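(* Let $(U(t),V(t))_{t\in[0,T]}$ be the $V_h\times V_h$-valued solution of the interior penalty discontinuous Galerkin semi-discrete scheme $$dU=V\,dt,\qquad dV=\Delta_hU\,dt-P_hf(U)\,dt+P_hg(U)\,dW(t).$$ Define the discrete energy $$\widehat H(U,V)=\frac12\langle V,V\rangle-\frac12\langle\Delta_hU,U\rangle+\int_a^bP_h\widetilde f(U)\,dx.$$ Then for every $t\in[0,T]$, $$\mathbb E\big[\widehat H(U(t),V(t))\big]=\mathbb E\big[\widehat H(U(0),V(0))\big]+\frac12\,\mathbb E\left[\int_0^t\mathrm{Tr}\Big(P_hg(U(s))\,Q\,\big(P_hg(U(s))\big)^*\Big)\,ds\right].$$
   Context: The scheme is a spatial discretization of the stochastic wave equation $du=v\,dt$, $dv=\Delta u\,dt-f(u)\,dt+g(u)\,dW(t)$ on $(a,b)\times(0,T]$ with homogeneous Dirichlet boundary condition and deterministic real-valued initial data. Let $\mathscr H=L^2([a,b];\mathbb R)$ with inner product $\langle\cdot,\cdot\rangle$. $W(t)=\sum_{k\ge1}\sqrt{q_k}\,e_k\,\beta_k(t)$ is an $\mathscr H$-valued $Q$-Wiener process on a filtered probability space $(\Omega,\mathcal F,\{\mathcal F_t\},\mathbb P)$ with a normal filtration. Here $Q$ is symmetric, positive definite and of finite trace, with eigenpairs $(q_k,e_k)$, $\{e_k\}$ orthonormal, and $\beta_k$ independent real standard Brownian motions. Let $\mathscr H_0=Q^{1/2}(\mathscr H)$ and let $\mathscr L_2^0$ be the space of Hilbert-Schmidt operators from $\mathscr H_0$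 to $\mathscr H$. The maps $f:\mathscr H\to\mathscr H$ and $g:\mathscr H\to\mathscr L_2^0$ are globally Lipschitz. The map $f$ acts pointwise through a scalar function, also denoted $f$, with antiderivative $\widetilde f$, i.e. $f=\partial\widetilde f/\partial u$. The expression $P_hg(U)\,Q\,(P_hg(U))^*$ means $(P_hg(U)Q^{1/2})(P_hg(U)Q^{1/2})^*$. Discretization: $M$ is a positive integer, $h=(b-a)/M$, $x_i=a+ih$, $I_i=(x_i,x_{i+1})$. With $\mathcal P^k$ the polynomials of degree at most $k$ (fixed $k\ge1$), $$V_h=\{u\in L^2([a,b]):\ u|_{I_i}\in\mathcal P^k\ \text{for all } i=0,\dots,M-1,\ u(a)=u(b)=0\}.$$ $P_h:L^2([a,b])\to V_h$ is the ($L^2$-orthogonal) projection. The initial values $U(0),V(0)\in V_h$ are deterministic. Write $u(x_i^\pm)$ for one-sided limits. For $1\le i\le M-1$ define the jump $[\![u(x_i)]\!]=u(x_i^-)-u(x_i^+)$ and the average $\{u(x_i)\}=\frac12(u(x_i^-)+u(x_i^+))$. At the endpoints, $[\![u(x_0)]\!]=-u(x_0^+)$, $\{u(x_0)\}=u(x_0^+)$, $[\![u(x_M)]\!]=u(x_M^-)$, $\{u(x_M)\}=u(x_M^-)$. With $\nabla$ the elementwise derivative in $x$ and $\sigma>0$ the interior penalty parameter (taken sufficiently large for coercivity of $-B_h$), $$B_h(u,\xi)=-\sum_{i=0}^{M-1}\int_{x_i}^{x_{i+1}}\nabla u\,\nabla\xi\,dx+\sum_{i=0}^M\{\nabla u(x_i)\}[\![\xi(x_i)]\!]+\sum_{i=0}^M\{\nabla\xi(x_i)\}[\![u(x_i)]\!]-\sum_{i=0}^M\frac\sigma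 h[\![u(x_i)]\!][\![\xi(x_i)]\!].$$ The linear operator $\Delta_h:V_h\to V_h$ is defined by $\langle\Delta_hU,\xi\rangle=B_h(U,\xi)$ for all $\xi\in V_h$. *)

theory Defs
  imports "HOL-Probability.Probability" "HOL-Computational_Algebra.Polynomial"
begin

section \<open>The Hilbert space \<open>L\<^sup>2([a,b])\<close>\<close>

text \<open>Elements of \<open>L\<^sup>2([a,b])\<close> are represented by functions; two functions denote the same element
  iff they agree almost everywhere on \<open>[a,b]\<close>, which is \<open>L2_eq\<close>. Accordingly, all equations
  between elements and all linearity requirements on operators are stated up to \<open>L2_eq\<close>.\<close>

abbreviation dom_measure :: "real \<Rightarrow> real \<Rightarrow> real measure" where
  "dom_measure a b \<equiv> restrict_space lborel {a..b}"

definition L2 :: "real \<Rightarrow> real \<Rightarrow> (real \<Rightarrow> real) set" where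
  "L2 a b = {u \<in> borel_measurable (dom_measure a b). integrable (dom_measure a b) (\<lambda>x. (u x)\<^sup>2)}"

definition L2_eq :: "real \<Rightarrow> real \<Rightarrow> (real \<Rightarrow> real) \<Rightarrow> (real \<Rightarrow> real) \<Rightarrow> bool" where
  "L2_eq a b u v \<longleftrightarrow> (AE x in dom_measure a b. u x = v x)"

definition L2_inner :: "real \<Rightarrow> real \<Rightarrow> (real \<Rightarrow> real) \<Rightarrow> (real \<Rightarrow> real) \<Rightarrow> real" where
  "L2_inner a b u v = (\<integral>x. u x * v x \<partial>dom_measure a b)"

definition L2_norm :: "real \<Rightarrow> real \<Rightarrow> (real \<Rightarrow> real) \<Rightarrow> real" where
  "L2_norm a b u = sqrt (L2_inner a b u u)"

text \<open>The Borel \<open>\<sigma>\<close>-algebra generated by the norm-open subsets of \<open>L\<^sup>2([a,b])\<close>.\<close>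

definition L2_borel :: "real \<Rightarrow> real \<Rightarrow> (real \<Rightarrow> real) measure" where
  "L2_borel a b = sigma (L2 a b)
     {S. S \<subseteq> L2 a b \<and>
         (\<forall>u\<in>S. \<exists>r>0. \<forall>v\<in>L2 a b. L2_norm a b (\<lambda>x. u x - v x) < r \<longrightarrow> v \<in> S)}"

text \<open>The vector-valued integral \<open>w = \<integral>\<^sub>0\<^sup>t X(s) ds\<close> in \<open>L\<^sup>2([a,b])\<close>, in the sense of Pettis. It is only
  applied to norm-continuous \<open>X\<close>, where it agrees with the Bochner and the Riemann integral.\<close>

definition L2_has_integral ::
  "real \<Rightarrow> real \<Rightarrow> real \<Rightarrow> (real \<Rightarrow> real \<Rightarrow> real) \<Rightarrow> (real \<Rightarrow> real) \<Rightarrow> bool" where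
  "L2_has_integral a b t X w \<longleftrightarrow>
     w \<in> L2 a b \<and> (\<forall>s\<in>{0..t}. X s \<in> L2 a b) \<and>
     (\<forall>\<xi>\<in>L2 a b. set_integrable lborel {0..t} (\<lambda>s. L2_inner a b (X s) \<xi>) \<and>
        L2_inner a b w \<xi> = (LINT s:{0..t}|lborel. L2_inner a b (X s) \<xi>))"


section \<open>Operators on \<open>L\<^sup>2([a,b])\<close>\<close>

definition L2_bounded_linear ::
  "real \<Rightarrow> real \<Rightarrow> ((real \<Rightarrow> real) \<Rightarrow> (real \<Rightarrow> real)) \<Rightarrow> bool" where
  "L2_bounded_linear a b A \<longleftrightarrow>
     (\<forall>u\<in>L2 a b. A u \<in> L2 a b) \<and>
     (\<forall>u\<in>L2 a b. \<forall>v\<in>L2 a b. \<forall>c d.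
        L2_eq a b (A (\<lambda>x. c * u x + d * v x)) (\<lambda>x. c * A u x + d * A v x)) \<and>
     (\<exists>C. \<forall>u\<in>L2 a b. L2_norm a b (A u) \<le> C * L2_norm a b u)"

definition L2_symmetric ::
  "real \<Rightarrow> real \<Rightarrow> ((real \<Rightarrow> real) \<Rightarrow> (real \<Rightarrow> real)) \<Rightarrow> bool" where
  "L2_symmetric a b A \<longleftrightarrow>
     (\<forall>u\<in>L2 a b. \<forall>v\<in>L2 a b. L2_inner a b (A u) v = L2_inner a b u (A v))"

definition L2_positive_definite ::
  "real \<Rightarrow> real \<Rightarrow> ((real \<Rightarrow> real) \<Rightarrow> (real \<Rightarrow> real)) \<Rightarrow> bool" where
  "L2_positive_definite a b A \<longleftrightarrow>
     (\<forall>u\<in>L2 a b. \<not> L2_eq a b u (\<lambda>x. 0) \<longrightarrow> L2_inner a b (A u) u > 0)"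

text \<open>The Hilbert space adjoint, in the style of the library constant \<open>adjoint\<close>; for bounded
  linear \<open>A\<close> it is determined up to \<open>L2_eq\<close>.\<close>

definition L2_adjoint ::
  "real \<Rightarrow> real \<Rightarrow> ((real \<Rightarrow> real) \<Rightarrow> (real \<Rightarrow> real)) \<Rightarrow> (real \<Rightarrow> real) \<Rightarrow> (real \<Rightarrow> real)" where
  "L2_adjoint a b A =
     (SOME B. (\<forall>v\<in>L2 a b. B v \<in> L2 a b) \<and>
        (\<forall>u\<in>L2 a b. \<forall>v\<in>L2 a b. L2_inner a b (A u) v = L2_inner a b u (B v)))"

definition L2_orthonormal_basis :: "real \<Rightarrow> real \<Rightarrow> (nat \<Rightarrow> real \<Rightarrow> real) \<Rightarrow> bool" where
  "L2_orthonormal_basis a b e \<longleftrightarrow>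
     (\<forall>k. e k \<in> L2 a b) \<and>
     (\<forall>j k. L2_inner a b (e j) (e k) = (if j = k then 1 else 0)) \<and>
     (\<forall>u\<in>L2 a b. (\<forall>k. L2_inner a b u (e k) = 0) \<longrightarrow> L2_eq a b u (\<lambda>x. 0))"

text \<open>Used with an orthonormal basis \<open>e\<close>; for trace class \<open>A\<close> the value does not depend on it.\<close>

definition L2_trace ::
  "real \<Rightarrow> real \<Rightarrow> (nat \<Rightarrow> real \<Rightarrow> real) \<Rightarrow> ((real \<Rightarrow> real) \<Rightarrow> (real \<Rightarrow> real)) \<Rightarrow> real" where
  "L2_trace a b e A = (\<Sum>k. L2_inner a b (A (e k)) (e k))"

text \<open>\<open>Q\<close> is symmetric, positive definite and of finite trace, with eigenpairs \<open>(q k, e k)\<close>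
  (indexed from 0) whose eigenfunctions form an orthonormal basis.\<close>

definition covariance_operator ::
  "real \<Rightarrow> real \<Rightarrow> ((real \<Rightarrow> real) \<Rightarrow> (real \<Rightarrow> real)) \<Rightarrow> (nat \<Rightarrow> real) \<Rightarrow> (nat \<Rightarrow> real \<Rightarrow> real) \<Rightarrow> bool"
where
  "covariance_operator a b Q q e \<longleftrightarrow>
     L2_bounded_linear a b Q \<and> L2_symmetric a b Q \<and> L2_positive_definite a b Q \<and>
     L2_orthonormal_basis a b e \<and>
     (\<forall>k. L2_eq a b (Q (e k)) (\<lambda>x. q k * e k x)) \<and>
     summable (\<lambda>k. L2_inner a b (Q (e k)) (e k))"

text \<open>\<open>R\<close> is the square root \<open>Q\<^sup>1\<^sup>/\<^sup>2\<close>: the (up to \<open>L2_eq\<close> unique) bounded, symmetric, nonnegative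
  operator with \<open>R (R u) = Q u\<close>.\<close>

definition L2_sqrt_operator ::
  "real \<Rightarrow> real \<Rightarrow> ((real \<Rightarrow> real) \<Rightarrow> (real \<Rightarrow> real)) \<Rightarrow> ((real \<Rightarrow> real) \<Rightarrow> (real \<Rightarrow> real)) \<Rightarrow> bool" where
  "L2_sqrt_operator a b Q R \<longleftrightarrow>
     L2_bounded_linear a b R \<and> L2_symmetric a b R \<and>
     (\<forall>u\<in>L2 a b. L2_inner a b (R u) u \<ge> 0) \<and>
     (\<forall>u\<in>L2 a b. L2_eq a b (R (R u)) (Q u))"

definition H0 :: "real \<Rightarrow> real \<Rightarrow> ((real \<Rightarrow> real) \<Rightarrow> (real \<Rightarrow> real)) \<Rightarrow> (real \<Rightarrow> real) set" where
  "H0 a b R = {v \<in> L2 a b. \<exists>u\<in>L2 a b. L2_eq a b v (R u)}"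

text \<open>The squared Hilbert-Schmidt norm of an operator from \<open>H0\<close> to \<open>L\<^sup>2([a,b])\<close>. The space \<open>H0\<close>
  carries the norm \<open>\<parallel>v\<parallel>\<^sub>0 = \<parallel>Q\<^sup>-\<^sup>1\<^sup>/\<^sup>2 v\<parallel>\<close>, for which the functions \<open>sqrt (q k) * e k\<close> form an
  orthonormal basis.\<close>

definition HS0_norm_sq ::
  "real \<Rightarrow> real \<Rightarrow> (nat \<Rightarrow> real) \<Rightarrow> (nat \<Rightarrow> real \<Rightarrow> real) \<Rightarrow> ((real \<Rightarrow> real) \<Rightarrow> (real \<Rightarrow> real)) \<Rightarrow> ennreal"
where
  "HS0_norm_sq a b q e A = (\<Sum>k. ennreal ((L2_norm a b (A (\<lambda>x. sqrt (q k) * e k x)))\<^sup>2))"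

text \<open>The Hilbert-Schmidt operators from \<open>H0\<close> to \<open>L\<^sup>2([a,b])\<close>; the third clause is boundedness with
  respect to \<open>\<parallel>v\<parallel>\<^sub>0 = \<parallel>u\<parallel>\<close> for \<open>v = R u\<close>.\<close>

definition L20 ::
  "real \<Rightarrow> real \<Rightarrow> ((real \<Rightarrow> real) \<Rightarrow> (real \<Rightarrow> real)) \<Rightarrow> (nat \<Rightarrow> real) \<Rightarrow> (nat \<Rightarrow> real \<Rightarrow> real) \<Rightarrow>
     ((real \<Rightarrow> real) \<Rightarrow> (real \<Rightarrow> real)) set" where
  "L20 a b R q e = {A.
     (\<forall>v\<in>H0 a b R. A v \<in> L2 a b) \<and>
     (\<forall>v\<in>H0 a b R. \<forall>w\<in>H0 a b R. \<forall>c d.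
        L2_eq a b (A (\<lambda>x. c * v x + d * w x)) (\<lambda>x. c * A v x + d * A w x)) \<and>
     (\<exists>C. \<forall>v\<in>L2 a b. \<forall>u\<in>L2 a b. L2_eq a b v (R u) \<longrightarrow> L2_norm a b (A v) \<le> C * L2_norm a b u) \<and>
     HS0_norm_sq a b q e A < \<infinity>}"


section \<open>The \<open>Q\<close>-Wiener process and the stochastic integral\<close>

definition normal_filtration :: "'w measure \<Rightarrow> (real \<Rightarrow> 'w measure) \<Rightarrow> real \<Rightarrow> bool" where
  "normal_filtration P F T \<longleftrightarrow>
     (\<forall>t\<in>{0..T}. subalgebra P (F t)) \<and>
     (\<forall>s\<in>{0..T}. \<forall>t\<in>{0..T}. s \<le> t \<longrightarrow> sets (F s) \<subseteq> sets (F t)) \<and>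
     null_sets P \<subseteq> sets (F 0) \<and>
     (\<forall>t\<in>{0..<T}. sets (F t) = (\<Inter>s\<in>{t<..T}. sets (F s)))"

text \<open>\<open>\<beta>\<close> is a sequence of independent real standard Brownian motions with respect to the
  filtration \<open>F\<close>. The last clause says that the increments after time \<open>s\<close> of the whole sequence are
  independent of the past up to time \<open>s\<close>.\<close>

definition independent_brownian_motions ::
  "'w measure \<Rightarrow> (real \<Rightarrow> 'w measure) \<Rightarrow> real \<Rightarrow> (nat \<Rightarrow> real \<Rightarrow> 'w \<Rightarrow> real) \<Rightarrow> bool" where
  "independent_brownian_motions P F T \<beta> \<longleftrightarrow>
     (\<forall>k. \<forall>t\<in>{0..T}. \<beta> k t \<in> borel_measurable (F t)) \<and>
     (\<forall>k. AE \<omega> in P. \<beta> k 0 \<omega> = 0) \<and>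
     (\<forall>k. AE \<omega> in P. continuous_on {0..T} (\<lambda>t. \<beta> k t \<omega>)) \<and>
     (\<forall>k s t. 0 \<le> s \<longrightarrow> s < t \<longrightarrow> t \<le> T \<longrightarrow>
        distributed P lborel (\<lambda>\<omega>. \<beta> k t \<omega> - \<beta> k s \<omega>)
          (\<lambda>x. ennreal (normal_density 0 (sqrt (t - s)) x))) \<and>
     prob_space.indep_vars P (\<lambda>_. Pi\<^sub>M {0..T} (\<lambda>_. borel)) (\<lambda>k \<omega>. \<lambda>t\<in>{0..T}. \<beta> k t \<omega>) UNIV \<and>
     (\<forall>s t. 0 \<le> s \<longrightarrow> s < t \<longrightarrow> t \<le> T \<longrightarrow>
        prob_space.indep_set P (sets (F s))
          (sets (vimage_algebra (space P) (\<lambda>\<omega> k. \<beta> k t \<omega> - \<beta> k s \<omega>) (Pi\<^sub>M UNIV (\<lambda>_. borel)))))"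

text \<open>The \<open>L\<^sup>2([a,b])\<close>-valued process \<open>W(t) = \<Sum>k. sqrt (q k) * \<beta> k t * e k\<close>, the series converging in
  mean square, with almost surely continuous paths.\<close>

definition Q_wiener_process ::
  "'w measure \<Rightarrow> (real \<Rightarrow> 'w measure) \<Rightarrow> real \<Rightarrow> real \<Rightarrow> real \<Rightarrow> (nat \<Rightarrow> real) \<Rightarrow> (nat \<Rightarrow> real \<Rightarrow> real) \<Rightarrow>
     (nat \<Rightarrow> real \<Rightarrow> 'w \<Rightarrow> real) \<Rightarrow> (real \<Rightarrow> 'w \<Rightarrow> real \<Rightarrow> real) \<Rightarrow> bool" where
  "Q_wiener_process P F T a b q e \<beta> W \<longleftrightarrow>
     independent_brownian_motions P F T \<beta> \<and>
     (\<forall>t\<in>{0..T}. W t \<in> F t \<rightarrow>\<^sub>M L2_borel a b) \<and>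
     (\<forall>t\<in>{0..T}.
        (\<lambda>n. \<integral>\<^sup>+\<omega>. ennreal ((L2_norm a b
               (\<lambda>x. W t \<omega> x - (\<Sum>k<n. sqrt (q k) * \<beta> k t \<omega> * e k x)))\<^sup>2) \<partial>P) \<longlonglongrightarrow> 0) \<and>
     (AE \<omega> in P. \<forall>t\<in>{0..T}.
        ((\<lambda>s. L2_norm a b (\<lambda>x. W s \<omega> x - W t \<omega> x)) \<longlongrightarrow> 0) (at t within {0..T}))"

definition predictable_sigma :: "'w measure \<Rightarrow> (real \<Rightarrow> 'w measure) \<Rightarrow> real \<Rightarrow> (real \<times> 'w) measure" where
  "predictable_sigma P F T = sigma ({0..T} \<times> space P)
     ({{s<..t} \<times> A | s t A. 0 \<le> s \<and> s \<le> t \<and> t \<le> T \<and> A \<in> sets (F s)} \<union>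
      {{0} \<times> A | A. A \<in> sets (F 0)})"

text \<open>Elementary operator-valued processes \<open>\<Sum>j<n. \<Phi> j * indicator {\<tau> j<..\<tau> (j + 1)}\<close>, where each \<open>\<Phi> j\<close>
  is \<open>F (\<tau> j)\<close>-measurable and takes finitely many values in the bounded operators.\<close>

definition elementary_process ::
  "'w measure \<Rightarrow> (real \<Rightarrow> 'w measure) \<Rightarrow> real \<Rightarrow> real \<Rightarrow> real \<Rightarrow> nat \<Rightarrow> (nat \<Rightarrow> real) \<Rightarrow>
     (nat \<Rightarrow> 'w \<Rightarrow> (real \<Rightarrow> real) \<Rightarrow> (real \<Rightarrow> real)) \<Rightarrow> bool" where
  "elementary_process P F T a b n \<tau> \<Phi> \<longleftrightarrow>
     \<tau> 0 = 0 \<and> \<tau> n = T \<and> (\<forall>j<n. \<tau> j < \<tau> (Suc j)) \<and>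
     (\<forall>j<n. finite (\<Phi> j ` space P) \<and>
        (\<forall>\<omega>\<in>space P. L2_bounded_linear a b (\<Phi> j \<omega>)) \<and>
        (\<forall>B. {\<omega> \<in> space P. \<Phi> j \<omega> = B} \<in> sets (F (\<tau> j))))"

definition elementary_value ::
  "nat \<Rightarrow> (nat \<Rightarrow> real) \<Rightarrow> (nat \<Rightarrow> 'w \<Rightarrow> (real \<Rightarrow> real) \<Rightarrow> (real \<Rightarrow> real)) \<Rightarrow>
     real \<Rightarrow> 'w \<Rightarrow> (real \<Rightarrow> real) \<Rightarrow> (real \<Rightarrow> real)" where
  "elementary_value n \<tau> \<Phi> s \<omega> v = (\<lambda>x. \<Sum>j<n. indicator {\<tau> j<..\<tau> (Suc j)} s * \<Phi> j \<omega> v x)"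

definition elementary_integral ::
  "(real \<Rightarrow> 'w \<Rightarrow> real \<Rightarrow> real) \<Rightarrow> nat \<Rightarrow> (nat \<Rightarrow> real) \<Rightarrow>
     (nat \<Rightarrow> 'w \<Rightarrow> (real \<Rightarrow> real) \<Rightarrow> (real \<Rightarrow> real)) \<Rightarrow> real \<Rightarrow> 'w \<Rightarrow> real \<Rightarrow> real" where
  "elementary_integral W n \<tau> \<Phi> t \<omega> =
     (\<lambda>x. \<Sum>j<n. \<Phi> j \<omega> (\<lambda>y. W (min t (\<tau> (Suc j))) \<omega> y - W (min t (\<tau> j)) \<omega> y) x)"

text \<open>\<open>I t\<close> is (a version of) the Ito integral \<open>\<integral>\<^sub>0\<^sup>t \<Psi>(s) dW(s)\<close> for \<open>t \<in> [0,T]\<close>: the process \<open>\<Psi>\<close> is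
  predictable with values in the Hilbert-Schmidt operators \<open>L20\<close>, it is the limit of elementary
  processes in \<open>L\<^sup>2([0,T] \<times> \<Omega>; L20)\<close>, and \<open>I t\<close> is the mean square limit of their integrals.
  Measurability into the separable space \<open>L20\<close> is stated through the values on the orthonormal
  basis of \<open>H0\<close>.\<close>

definition is_stochastic_integral ::
  "'w measure \<Rightarrow> (real \<Rightarrow> 'w measure) \<Rightarrow> real \<Rightarrow> real \<Rightarrow> real \<Rightarrow>
     ((real \<Rightarrow> real) \<Rightarrow> (real \<Rightarrow> real)) \<Rightarrow> (nat \<Rightarrow> real) \<Rightarrow> (nat \<Rightarrow> real \<Rightarrow> real) \<Rightarrow>
     (real \<Rightarrow> 'w \<Rightarrow> real \<Rightarrow> real) \<Rightarrow>
     (real \<Rightarrow> 'w \<Rightarrow> (real \<Rightarrow> real) \<Rightarrow> (real \<Rightarrow> real)) \<Rightarrow> (real \<Rightarrow> 'w \<Rightarrow> real \<Rightarrow> real) \<Rightarrow> bool" where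
  "is_stochastic_integral P F T a b R q e W \<Psi> I \<longleftrightarrow>
     (\<forall>s\<in>{0..T}. \<forall>\<omega>\<in>space P. \<Psi> s \<omega> \<in> L20 a b R q e) \<and>
     (\<forall>k. (\<lambda>(s, \<omega>). \<Psi> s \<omega> (\<lambda>x. sqrt (q k) * e k x)) \<in> predictable_sigma P F T \<rightarrow>\<^sub>M L2_borel a b) \<and>
     (\<forall>t\<in>{0..T}. I t \<in> F t \<rightarrow>\<^sub>M L2_borel a b) \<and>
     (\<exists>n \<tau> \<Phi>.
        (\<forall>m. elementary_process P F T a b (n m) (\<tau> m) (\<Phi> m)) \<and>
        (\<lambda>m. \<integral>\<^sup>+\<omega>. (\<integral>\<^sup>+s. HS0_norm_sq a b q e
                (\<lambda>v x. elementary_value (n m) (\<tau> m) (\<Phi> m) s \<omega> v x - \<Psi> s \<omega> v x)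
              * indicator {0..T} s \<partial>lborel) \<partial>P) \<longlonglongrightarrow> 0 \<and>
        (\<forall>t\<in>{0..T}.
           (\<lambda>m. \<integral>\<^sup>+\<omega>. ennreal ((L2_norm a b
                  (\<lambda>x. elementary_integral W (n m) (\<tau> m) (\<Phi> m) t \<omega> x - I t \<omega> x))\<^sup>2) \<partial>P) \<longlonglongrightarrow> 0))"


section \<open>The interior penalty discontinuous Galerkin discretization\<close>

definition mesh_size :: "real \<Rightarrow> real \<Rightarrow> nat \<Rightarrow> real" where
  "mesh_size a b M = (b - a) / real M"

definition node :: "real \<Rightarrow> real \<Rightarrow> nat \<Rightarrow> nat \<Rightarrow> real" where
  "node a b M i = a + real i * mesh_size a b M"

text \<open>The elements are polynomials on the open cells. Hence the conditions at \<open>a\<close> and \<open>b\<close> fix point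
  values only and do not constrain the one-sided limits there; the homogeneous Dirichlet condition
  is imposed weakly, through the boundary jump and penalty terms of \<open>B_h\<close>.\<close>

definition V_h :: "real \<Rightarrow> real \<Rightarrow> nat \<Rightarrow> nat \<Rightarrow> (real \<Rightarrow> real) set" where
  "V_h a b M k = {u \<in> L2 a b.
     (\<forall>i<M. \<exists>p::real poly. degree p \<le> k \<and>
        (\<forall>x\<in>{node a b M i<..<node a b M (Suc i)}. u x = poly p x)) \<and>
     u a = 0 \<and> u b = 0}"

text \<open>The \<open>L\<^sup>2\<close>-orthogonal projection onto \<open>V_h\<close>, determined up to \<open>L2_eq\<close>.\<close>

definition P_h :: "real \<Rightarrow> real \<Rightarrow> nat \<Rightarrow> nat \<Rightarrow> (real \<Rightarrow> real) \<Rightarrow> (real \<Rightarrow> real)" where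
  "P_h a b M k u =
     (SOME w. w \<in> V_h a b M k \<and> (\<forall>\<xi>\<in>V_h a b M k. L2_inner a b (\<lambda>x. u x - w x) \<xi> = 0))"

definition jump :: "real \<Rightarrow> real \<Rightarrow> nat \<Rightarrow> (real \<Rightarrow> real) \<Rightarrow> nat \<Rightarrow> real" where
  "jump a b M u i =
     (if i = 0 then - Lim (at_right (node a b M i)) u
      else if i = M then Lim (at_left (node a b M i)) u
      else Lim (at_left (node a b M i)) u - Lim (at_right (node a b M i)) u)"

definition average :: "real \<Rightarrow> real \<Rightarrow> nat \<Rightarrow> (real \<Rightarrow> real) \<Rightarrow> nat \<Rightarrow> real" where
  "average a b M u i =
     (if i = 0 then Lim (at_right (node a b M i)) u
      else if i = M then Lim (at_left (node a b M i)) u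
      else (Lim (at_left (node a b M i)) u + Lim (at_right (node a b M i)) u) / 2)"

text \<open>On the open cells \<open>deriv u\<close> is the elementwise derivative of \<open>u\<close>; its values at the nodes are
  irrelevant.\<close>

definition B_h :: "real \<Rightarrow> real \<Rightarrow> nat \<Rightarrow> real \<Rightarrow> (real \<Rightarrow> real) \<Rightarrow> (real \<Rightarrow> real) \<Rightarrow> real" where
  "B_h a b M \<sigma> u \<xi> =
     - (\<Sum>i<M. LINT x:{node a b M i<..<node a b M (Suc i)}|lborel. deriv u x * deriv \<xi> x)
     + (\<Sum>i\<le>M. average a b M (deriv u) i * jump a b M \<xi> i)
     + (\<Sum>i\<le>M. average a b M (deriv \<xi>) i * jump a b M u i)
     - (\<Sum>i\<le>M. \<sigma> / mesh_size a b M * jump a b M u i * jump a b M \<xi> i)"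

text \<open>On the finite-dimensional space \<open>V_h\<close> all norms are equivalent, so the choice of norm is
  immaterial for coercivity.\<close>

definition B_h_coercive :: "real \<Rightarrow> real \<Rightarrow> nat \<Rightarrow> nat \<Rightarrow> real \<Rightarrow> bool" where
  "B_h_coercive a b M k \<sigma> \<longleftrightarrow>
     (\<exists>c>0. \<forall>u\<in>V_h a b M k. - B_h a b M \<sigma> u u \<ge> c * (L2_norm a b u)\<^sup>2)"

definition Delta_h ::
  "real \<Rightarrow> real \<Rightarrow> nat \<Rightarrow> nat \<Rightarrow> real \<Rightarrow> (real \<Rightarrow> real) \<Rightarrow> (real \<Rightarrow> real)" where
  "Delta_h a b M k \<sigma> u =
     (SOME w. w \<in> V_h a b M k \<and> (\<forall>\<xi>\<in>V_h a b M k. L2_inner a b w \<xi> = B_h a b M \<sigma> u \<xi>))"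

definition discrete_energy ::
  "real \<Rightarrow> real \<Rightarrow> nat \<Rightarrow> nat \<Rightarrow> real \<Rightarrow> (real \<Rightarrow> real) \<Rightarrow> (real \<Rightarrow> real) \<Rightarrow> (real \<Rightarrow> real) \<Rightarrow> real" where
  "discrete_energy a b M k \<sigma> ft u v =
     1/2 * L2_inner a b v v - 1/2 * L2_inner a b (Delta_h a b M k \<sigma> u) u
     + (\<integral>x. P_h a b M k (\<lambda>y. ft (u y)) x \<partial>dom_measure a b)"

text \<open>Continuity is required of every path: this is a choice of version, and it makes time integrals
  along the paths measurable in \<open>\<omega>\<close> without assuming \<open>P\<close> to be complete.\<close>

definition V_h_process ::
  "'w measure \<Rightarrow> (real \<Rightarrow> 'w measure) \<Rightarrow> real \<Rightarrow> real \<Rightarrow> real \<Rightarrow> nat \<Rightarrow> nat \<Rightarrow>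
     (real \<Rightarrow> 'w \<Rightarrow> real \<Rightarrow> real) \<Rightarrow> bool" where
  "V_h_process P F T a b M k X \<longleftrightarrow>
     (\<forall>t\<in>{0..T}. \<forall>\<omega>\<in>space P. X t \<omega> \<in> V_h a b M k) \<and>
     (\<forall>t\<in>{0..T}. X t \<in> F t \<rightarrow>\<^sub>M L2_borel a b) \<and>
     (\<forall>\<omega>\<in>space P. \<forall>t\<in>{0..T}.
        ((\<lambda>s. L2_norm a b (\<lambda>x. X s \<omega> x - X t \<omega> x)) \<longlongrightarrow> 0) (at t within {0..T}))"

text \<open>\<open>(U, V)\<close> solves \<open>dU = V dt\<close>, \<open>dV = \<Delta>\<^sub>h U dt - P\<^sub>h f(U) dt + P\<^sub>h g(U) dW\<close> on \<open>[0,T]\<close>, in integrated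
  form, with deterministic initial values \<open>u0, v0 \<in> V_h\<close>.\<close>

definition ipdg_solution ::
  "'w measure \<Rightarrow> (real \<Rightarrow> 'w measure) \<Rightarrow> real \<Rightarrow> real \<Rightarrow> real \<Rightarrow> nat \<Rightarrow> nat \<Rightarrow> real \<Rightarrow>
     ((real \<Rightarrow> real) \<Rightarrow> (real \<Rightarrow> real)) \<Rightarrow> (nat \<Rightarrow> real) \<Rightarrow> (nat \<Rightarrow> real \<Rightarrow> real) \<Rightarrow>
     (real \<Rightarrow> 'w \<Rightarrow> real \<Rightarrow> real) \<Rightarrow>
     (real \<Rightarrow> real) \<Rightarrow> ((real \<Rightarrow> real) \<Rightarrow> (real \<Rightarrow> real) \<Rightarrow> (real \<Rightarrow> real)) \<Rightarrow>
     (real \<Rightarrow> real) \<Rightarrow> (real \<Rightarrow> real) \<Rightarrow>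
     (real \<Rightarrow> 'w \<Rightarrow> real \<Rightarrow> real) \<Rightarrow> (real \<Rightarrow> 'w \<Rightarrow> real \<Rightarrow> real) \<Rightarrow> bool" where
  "ipdg_solution P F T a b M k \<sigma> R q e W f g u0 v0 U V \<longleftrightarrow>
     V_h_process P F T a b M k U \<and> V_h_process P F T a b M k V \<and>
     (AE \<omega> in P. L2_eq a b (U 0 \<omega>) u0 \<and> L2_eq a b (V 0 \<omega>) v0) \<and>
     (\<forall>t\<in>{0..T}. AE \<omega> in P.
        L2_has_integral a b t (\<lambda>s. V s \<omega>) (\<lambda>x. U t \<omega> x - U 0 \<omega> x)) \<and>
     (\<exists>I. is_stochastic_integral P F T a b R q e W (\<lambda>s \<omega> v. P_h a b M k (g (U s \<omega>) v)) I \<and>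
        (\<forall>t\<in>{0..T}. AE \<omega> in P.
           L2_has_integral a b t
             (\<lambda>s x. Delta_h a b M k \<sigma> (U s \<omega>) x - P_h a b M k (\<lambda>y. f (U s \<omega> y)) x)
             (\<lambda>x. V t \<omega> x - V 0 \<omega> x - I t \<omega> x)))"


section \<open>Assumptions on the coefficients\<close>

definition lipschitz_nemytskii :: "real \<Rightarrow> real \<Rightarrow> (real \<Rightarrow> real) \<Rightarrow> bool" where
  "lipschitz_nemytskii a b f \<longleftrightarrow>
     (\<forall>u\<in>L2 a b. (\<lambda>x. f (u x)) \<in> L2 a b) \<and>
     (\<exists>C. \<forall>u\<in>L2 a b. \<forall>v\<in>L2 a b.
        L2_norm a b (\<lambda>x. f (u x) - f (v x)) \<le> C * L2_norm a b (\<lambda>x. u x - v x))"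

definition lipschitz_diffusion ::
  "real \<Rightarrow> real \<Rightarrow> ((real \<Rightarrow> real) \<Rightarrow> (real \<Rightarrow> real)) \<Rightarrow> (nat \<Rightarrow> real) \<Rightarrow> (nat \<Rightarrow> real \<Rightarrow> real) \<Rightarrow>
     ((real \<Rightarrow> real) \<Rightarrow> (real \<Rightarrow> real) \<Rightarrow> (real \<Rightarrow> real)) \<Rightarrow> bool" where
  "lipschitz_diffusion a b R q e g \<longleftrightarrow>
     (\<forall>u\<in>L2 a b. g u \<in> L20 a b R q e) \<and>
     (\<exists>C. \<forall>u\<in>L2 a b. \<forall>v\<in>L2 a b.
        HS0_norm_sq a b q e (\<lambda>w x. g u w x - g v w x)
          \<le> ennreal ((C * L2_norm a b (\<lambda>x. u x - v x))\<^sup>2))"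

end

theory Submission
  imports Defs
begin

text \<open>
  Ito's formula is not needed. Let \<open>V\<^sub>i\<close> be the coordinates of \<open>V\<close> in an orthonormal basis of
  \<open>V_h\<close>, \<open>b\<^sub>i\<close> those of the drift \<open>\<Delta>\<^sub>h U - P\<^sub>h f(U)\<close>, and
  \<open>J\<^sub>i(t) = V\<^sub>i(t) - V\<^sub>i(0) - \<integral>\<^sub>0\<^sup>t b\<^sub>i ds\<close>, a version of the \<open>i\<close>-th coordinate of the stochastic
  integral. Since \<open>V - J\<close> and \<open>U\<close> are continuously differentiable in time, ordinary calculus along each
  path turns the energy increment into
  \<open>\<Sum>\<^sub>i \<integral>\<^sub>0\<^sup>t b\<^sub>i(s) (J\<^sub>i(t) - J\<^sub>i(s)) ds + V\<^sub>i(0) J\<^sub>i(t) + J\<^sub>i(t)\<^sup>2 / 2\<close>: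
  the potential part of the energy cancels \<open>\<Sum>\<^sub>i \<integral>\<^sub>0\<^sup>t b\<^sub>i V\<^sub>i ds\<close>. The first two terms have mean zero by the
  martingale property, and the Ito isometry identifies the last one with half the integral of the
  trace. The integrability needed for Fubini follows from Gronwall's inequality for
  \<open>(\<Sum>\<^sub>i \<bar>U\<^sub>i\<bar> + \<bar>V\<^sub>i\<bar>)\<^sup>2\<close> along each path, with only the second moments of \<open>J\<^sub>i\<close> as input.
\<close>

section \<open>The Hilbert space \<open>L\<^sup>2([a,b])\<close>\<close>

text \<open>The stochastic integral is known only as a mean square limit at each fixed time, with
  null sets depending on the time, and continuity of its paths is not given. Hence \<open>Jc\<close>
  is built from the continuous processes \<open>U\<close> and \<open>V\<close>, and \<open>I\<close>
  is consulted only at single times: for second moments, and for orthogonality of its increments to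
  the past. The drift is square integrable only jointly in time and probability, so this
  orthogonality is applied at almost every \<open>s\<close> and integrated by Fubini.

  The Hilbert-Schmidt norm is a series over the basis of \<open>H0\<close>. Paired with a fixed
  \<open>\<phi>\<close>, an integrand becomes a scalar sequence, and both sides of the isometry are
  squared L2 norms: one over \<open>P\<close>, one over counting measure times Lebesgue measure
  times \<open>P\<close>. A single convergence lemma carries both to the limit. Summed over the
  basis of \<open>V_h\<close>, the second norm becomes the trace, by Parseval and an exchange of
  nonnegative series.

  Elements of L2 are functions, not classes. Operators given by choice, or linear only up to null
  sets, therefore need congruence for \<open>L2_eq\<close>; pairing with a test function leads back
  to equalities of real numbers.\<close>

lemma finite_measure_dom: "finite_measure (dom_measure a b)"
proof
  show "emeasure (dom_measure a b) (space (dom_measure a b)) \<noteq> \<infinity>"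
    by (cases "a \<le> b") (simp_all add: emeasure_restrict_space space_restrict_space)
qed

lemma L2_measurable: "u \<in> L2 a b \<Longrightarrow> u \<in> borel_measurable (dom_measure a b)"
  by (simp add: L2_def)

lemma L2_square_integrable: "u \<in> L2 a b \<Longrightarrow> integrable (dom_measure a b) (\<lambda>x. (u x)\<^sup>2)"
  by (simp add: L2_def)

lemma abs_mult_le_squares: "\<bar>x * y\<bar> \<le> x\<^sup>2 + (y::real)\<^sup>2"
proof -
  have "2 * \<bar>x * y\<bar> \<le> x\<^sup>2 + y\<^sup>2"
    using sum_squares_bound[of "\<bar>x\<bar>" "\<bar>y\<bar>"] by (simp add: mult.assoc abs_mult)
  then show ?thesis using abs_ge_zero[of "x * y"] by linarith
qed

lemma L2_mult_integrable:
  assumes "u \<in> L2 a b" "v \<in> L2 a b"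
  shows "integrable (dom_measure a b) (\<lambda>x. u x * v x)"
proof (rule Bochner_Integration.integrable_bound)
  show "integrable (dom_measure a b) (\<lambda>x. (u x)\<^sup>2 + (v x)\<^sup>2)"
    using assms by (simp add: L2_square_integrable)
  show "(\<lambda>x. u x * v x) \<in> borel_measurable (dom_measure a b)"
    using assms[THEN L2_measurable] by measurable
  show "AE x in dom_measure a b. norm (u x * v x) \<le> norm ((u x)\<^sup>2 + (v x)\<^sup>2)"
    using abs_mult_le_squares by (auto simp: abs_of_nonneg)
qed

lemma L2_lincomb:
  assumes "u \<in> L2 a b" "v \<in> L2 a b"
  shows "(\<lambda>x. c * u x + d * v x) \<in> L2 a b"
proof -
  have "(\<lambda>x. c * u x + d * v x) \<in> borel_measurable (dom_measure a b)"
    using assms[THEN L2_measurable] by measurable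
  moreover have "integrable (dom_measure a b) (\<lambda>x. (c\<^sup>2 * (u x)\<^sup>2 + 2 * c * d * (u x * v x)) + d\<^sup>2 * (v x)\<^sup>2)"
    using assms by (intro Bochner_Integration.integrable_add integrable_mult_right L2_mult_integrable L2_square_integrable)
  moreover have "(c * u x + d * v x)\<^sup>2 = (c\<^sup>2 * (u x)\<^sup>2 + 2 * c * d * (u x * v x)) + d\<^sup>2 * (v x)\<^sup>2" for x
    by (simp add: power2_eq_square algebra_simps)
  ultimately show ?thesis by (simp add: L2_def)
qed

lemma L2_bounded:
  assumes "u \<in> borel_measurable (dom_measure a b)" "\<And>x. x \<in> {a..b} \<Longrightarrow> \<bar>u x\<bar> \<le> K"
  shows "u \<in> L2 a b"
proof -
  interpret finite_measure "dom_measure a b" by (rule finite_measure_dom)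
  have "integrable (dom_measure a b) (\<lambda>x. (u x)\<^sup>2)"
  proof (rule integrable_const_bound[where B="K\<^sup>2"])
    show "AE x in dom_measure a b. norm ((u x)\<^sup>2) \<le> K\<^sup>2"
    proof (rule AE_I2)
      fix x assume "x \<in> space (dom_measure a b)"
      then have "\<bar>u x\<bar> \<le> K" using assms(2) by (simp add: space_restrict_space)
      then show "norm ((u x)\<^sup>2) \<le> K\<^sup>2" using power_mono[of "\<bar>u x\<bar>" K 2] by simp
    qed
    show "(\<lambda>x. (u x)\<^sup>2) \<in> borel_measurable (dom_measure a b)" using assms(1) by measurable
  qed
  then show ?thesis using assms(1) by (simp add: L2_def)
qed

lemma L2_const [simp]: "(\<lambda>x. c) \<in> L2 a b"
  by (rule L2_bounded[where K="\<bar>c\<bar>"]) auto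

lemma L2_cmult: "u \<in> L2 a b \<Longrightarrow> (\<lambda>x. c * u x) \<in> L2 a b"
  using L2_lincomb[of u a b u c 0] by simp

lemma L2_add: "u \<in> L2 a b \<Longrightarrow> v \<in> L2 a b \<Longrightarrow> (\<lambda>x. u x + v x) \<in> L2 a b"
  using L2_lincomb[of u a b v 1 1] by simp

lemma L2_diff: "u \<in> L2 a b \<Longrightarrow> v \<in> L2 a b \<Longrightarrow> (\<lambda>x. u x - v x) \<in> L2 a b"
  using L2_lincomb[of u a b v 1 "-1"] by simp

lemma L2_sum: "(\<And>i. i \<in> S \<Longrightarrow> u i \<in> L2 a b) \<Longrightarrow> (\<lambda>x. \<Sum>i\<in>S. u i x) \<in> L2 a b"
  by (induction S rule: infinite_finite_induct) (simp_all add: L2_add)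

lemma L2_integrable: "u \<in> L2 a b \<Longrightarrow> integrable (dom_measure a b) u"
  using L2_mult_integrable[of u a b "\<lambda>x. 1"] by simp

lemma L2_inner_commute: "L2_inner a b u v = L2_inner a b v u"
  by (simp add: L2_inner_def mult.commute)

lemma L2_inner_lincomb_left:
  assumes "u \<in> L2 a b" "v \<in> L2 a b" "w \<in> L2 a b"
  shows "L2_inner a b (\<lambda>x. c * u x + d * v x) w = c * L2_inner a b u w + d * L2_inner a b v w"
proof -
  have "(\<lambda>x. (c * u x + d * v x) * w x) = (\<lambda>x. c * (u x * w x) + d * (v x * w x))"
    by (auto simp: algebra_simps)
  then show ?thesis
    using assms by (simp add: L2_inner_def L2_mult_integrable)
qed

lemma L2_inner_zero_left [simp]: "L2_inner a b (\<lambda>x. 0) v = 0"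
  by (simp add: L2_inner_def)

lemma L2_inner_zero_right [simp]: "L2_inner a b v (\<lambda>x. 0) = 0"
  by (simp add: L2_inner_def)

lemma L2_inner_cmult_left: "L2_inner a b (\<lambda>x. c * u x) w = c * L2_inner a b u w"
  by (simp add: L2_inner_def mult.assoc)

lemma L2_inner_cmult_right: "L2_inner a b w (\<lambda>x. c * u x) = c * L2_inner a b w u"
  by (simp add: L2_inner_commute[of _ _ w] L2_inner_cmult_left)

lemma L2_inner_add_left:
  "u \<in> L2 a b \<Longrightarrow> v \<in> L2 a b \<Longrightarrow> w \<in> L2 a b \<Longrightarrow>
   L2_inner a b (\<lambda>x. u x + v x) w = L2_inner a b u w + L2_inner a b v w"
  using L2_inner_lincomb_left[of u a b v w 1 1] by simp

lemma L2_inner_diff_left: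
  "u \<in> L2 a b \<Longrightarrow> v \<in> L2 a b \<Longrightarrow> w \<in> L2 a b \<Longrightarrow>
   L2_inner a b (\<lambda>x. u x - v x) w = L2_inner a b u w - L2_inner a b v w"
  using L2_inner_lincomb_left[of u a b v w 1 "-1"] by simp

lemma L2_inner_sum_left:
  assumes "\<And>i. i \<in> S \<Longrightarrow> u i \<in> L2 a b" "w \<in> L2 a b"
  shows "L2_inner a b (\<lambda>x. \<Sum>i\<in>S. u i x) w = (\<Sum>i\<in>S. L2_inner a b (u i) w)"
  using assms(1)
  by (induction S rule: infinite_finite_induct) (simp_all add: L2_inner_add_left L2_sum assms(2))

lemma L2_inner_add_right:
  "u \<in> L2 a b \<Longrightarrow> v \<in> L2 a b \<Longrightarrow> w \<in> L2 a b \<Longrightarrow>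
   L2_inner a b w (\<lambda>x. u x + v x) = L2_inner a b w u + L2_inner a b w v"
  by (simp add: L2_inner_commute[of _ _ w] L2_inner_add_left)

lemma L2_inner_diff_right:
  "u \<in> L2 a b \<Longrightarrow> v \<in> L2 a b \<Longrightarrow> w \<in> L2 a b \<Longrightarrow>
   L2_inner a b w (\<lambda>x. u x - v x) = L2_inner a b w u - L2_inner a b w v"
  by (simp add: L2_inner_commute[of _ _ w] L2_inner_diff_left)

lemma L2_inner_self_nonneg: "0 \<le> L2_inner a b u u"
  by (simp add: L2_inner_def)

lemma L2_norm_sq: "(L2_norm a b u)\<^sup>2 = L2_inner a b u u"
  by (simp add: L2_norm_def L2_inner_self_nonneg)

lemma L2_norm_nonneg [simp]: "0 \<le> L2_norm a b u"
  by (simp add: L2_norm_def L2_inner_self_nonneg)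

lemma L2_norm_cmult: "L2_norm a b (\<lambda>x. c * u x) = \<bar>c\<bar> * L2_norm a b u"
  by (simp add: L2_norm_def L2_inner_cmult_left L2_inner_cmult_right real_sqrt_mult flip: mult.assoc)

lemma L2_norm_minus_commute: "L2_norm a b (\<lambda>x. u x - v x) = L2_norm a b (\<lambda>x. v x - u x)"
  by (simp add: L2_norm_def L2_inner_def algebra_simps)

lemma L2_eq_refl [simp]: "L2_eq a b u u"
  by (simp add: L2_eq_def)

lemma L2_eq_sym: "L2_eq a b u v \<Longrightarrow> L2_eq a b v u"
  by (auto simp: L2_eq_def eq_commute)

lemma L2_eq_trans: "L2_eq a b u v \<Longrightarrow> L2_eq a b v w \<Longrightarrow> L2_eq a b u w"
  unfolding L2_eq_def by (erule (1) eventually_elim2) simp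

lemma L2_eq_cmult: "L2_eq a b u v \<Longrightarrow> L2_eq a b (\<lambda>x. c * u x) (\<lambda>x. c * v x)"
  unfolding L2_eq_def by (erule eventually_mono) simp

lemma L2_eq_add: "L2_eq a b u v \<Longrightarrow> L2_eq a b u' v' \<Longrightarrow> L2_eq a b (\<lambda>x. u x + u' x) (\<lambda>x. v x + v' x)"
  unfolding L2_eq_def by (erule (1) eventually_elim2) simp

lemma L2_inner_cong:
  assumes "L2_eq a b u u'" "L2_eq a b v v'" "u \<in> L2 a b" "u' \<in> L2 a b" "v \<in> L2 a b" "v' \<in> L2 a b"
  shows "L2_inner a b u v = L2_inner a b u' v'"
  unfolding L2_inner_def
proof (rule integral_cong_AE)
  show "AE x in dom_measure a b. u x * v x = u' x * v' x"
    using assms(1,2) unfolding L2_eq_def by eventually_elim simp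
qed (use assms(3-6)[THEN L2_measurable] in measurable)

lemma L2_norm_cong:
  "L2_eq a b u v \<Longrightarrow> u \<in> L2 a b \<Longrightarrow> v \<in> L2 a b \<Longrightarrow> L2_norm a b u = L2_norm a b v"
  unfolding L2_norm_def using L2_inner_cong[of a b u v u v] by simp

lemma L2_inner_self_eq_0:
  assumes "u \<in> L2 a b"
  shows "L2_inner a b u u = 0 \<longleftrightarrow> L2_eq a b u (\<lambda>x. 0)"
proof -
  have "L2_inner a b u u = 0 \<longleftrightarrow> (AE x in dom_measure a b. u x * u x = 0)"
    unfolding L2_inner_def
    by (rule integral_nonneg_eq_0_iff_AE) (use L2_mult_integrable[OF assms assms] in auto)
  then show ?thesis by (simp add: L2_eq_def)
qed

lemma L2_norm_eq_0: "u \<in> L2 a b \<Longrightarrow> L2_norm a b u = 0 \<longleftrightarrow> L2_eq a b u (\<lambda>x. 0)"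
  by (simp add: L2_inner_self_eq_0[symmetric] L2_norm_def)

lemma L2_eq_iff_diff: "L2_eq a b u v \<longleftrightarrow> L2_eq a b (\<lambda>x. u x - v x) (\<lambda>x. 0)"
  by (simp add: L2_eq_def)

lemma L2_inner_CS:
  assumes "u \<in> L2 a b" "v \<in> L2 a b"
  shows "\<bar>L2_inner a b u v\<bar> \<le> L2_norm a b u * L2_norm a b v"
proof -
  \<comment> \<open>The main case cancels the product of the two norms, so vanishing norms come
    first: they make one argument zero almost everywhere.\<close>
  have zero: "L2_inner a b u v = 0" if "L2_norm a b u = 0" "u \<in> L2 a b" "v \<in> L2 a b" for u v
  proof -
    have "L2_eq a b u (\<lambda>x. 0)" using that by (simp add: L2_norm_eq_0)
    then show ?thesis using L2_inner_cong[of a b u "\<lambda>x. 0" v v] that by simp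
  qed
  have le: "L2_inner a b u v \<le> L2_norm a b u * L2_norm a b v" if uv: "u \<in> L2 a b" "v \<in> L2 a b" for u v
  proof (cases "L2_norm a b u = 0 \<or> L2_norm a b v = 0")
    case True
    then show ?thesis using zero[of u v] zero[of v u] uv by (auto simp: L2_inner_commute)
  next
    case False
    define s where "s = L2_norm a b u"
    define t where "t = L2_norm a b v"
    have pos: "s > 0" "t > 0" using False unfolding s_def t_def
      by (metis L2_norm_nonneg less_eq_real_def)+
    \<comment> \<open>With s and t the norms of \<open>u\<close> and \<open>v\<close>, the squared
      norm of t u - s v is 2 s t (s t - <u,v>); each vector is weighted by the norm of the other
      instead of being normalized.\<close>
    have "0 \<le> L2_inner a b (\<lambda>x. t * u x + (- s) * v x) (\<lambda>x. t * u x + (- s) * v x)"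
      by (rule L2_inner_self_nonneg)
    also have "\<dots> = t * (t * s\<^sup>2) - 2 * (s * t) * L2_inner a b u v + s * (s * t\<^sup>2)"
    proof -
      define z where "z = (\<lambda>x. t * u x + (- s) * v x)"
      have z: "z \<in> L2 a b" using uv by (simp only: z_def L2_lincomb)
      have "L2_inner a b u z = t * s\<^sup>2 - s * L2_inner a b u v"
        using L2_inner_lincomb_left[OF uv uv(1), of t "- s"]
        unfolding z_def[symmetric] L2_inner_commute[of a b z u] L2_inner_commute[of a b v u]
        by (simp add: s_def L2_norm_sq)
      moreover have "L2_inner a b v z = t * L2_inner a b u v - s * t\<^sup>2"
        using L2_inner_lincomb_left[OF uv uv(2), of t "- s"]
        unfolding z_def[symmetric] L2_inner_commute[of a b z v]
        by (simp add: t_def L2_norm_sq)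
      moreover have "L2_inner a b z z = t * L2_inner a b u z - s * L2_inner a b v z"
        using L2_inner_lincomb_left[OF uv z, of t "- s"] unfolding z_def[symmetric] by simp
      ultimately have "L2_inner a b z z = t * (t * s\<^sup>2 - s * L2_inner a b u v) - s * (t * L2_inner a b u v - s * t\<^sup>2)"
        by simp
      then show ?thesis unfolding z_def[symmetric] by (simp add: algebra_simps)
    qed
    finally have "(s * t) * L2_inner a b u v \<le> (s * t) * (s * t)"
      by (simp add: power2_eq_square algebra_simps)
    then show ?thesis using pos unfolding s_def[symmetric] t_def[symmetric]
      by (simp add: mult_le_cancel_left_pos)
  qed
  have "- L2_inner a b u v \<le> L2_norm a b u * L2_norm a b v"
    using le[OF L2_cmult[OF assms(1), of "-1"] assms(2)]
    by (simp add: L2_inner_cmult_left[of a b "-1" u, simplified] L2_norm_cmult[of a b "-1" u, simplified])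
  then show ?thesis using le[OF assms] by linarith
qed

lemma L2_norm_add_le:
  assumes "u \<in> L2 a b" "v \<in> L2 a b"
  shows "L2_norm a b (\<lambda>x. u x + v x) \<le> L2_norm a b u + L2_norm a b v"
proof (rule power2_le_imp_le)
  have "(L2_norm a b (\<lambda>x. u x + v x))\<^sup>2 = (L2_norm a b u)\<^sup>2 + 2 * L2_inner a b u v + (L2_norm a b v)\<^sup>2"
    using assms by (simp add: L2_norm_sq L2_inner_add_left L2_inner_add_right L2_add L2_inner_commute[of a b v u])
  also have "\<dots> \<le> (L2_norm a b u + L2_norm a b v)\<^sup>2"
    using L2_inner_CS[OF assms] by (simp add: power2_sum)
  finally show "(L2_norm a b (\<lambda>x. u x + v x))\<^sup>2 \<le> (L2_norm a b u + L2_norm a b v)\<^sup>2" .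
qed simp

lemma L2_norm_triangle:
  assumes "u \<in> L2 a b" "v \<in> L2 a b" "w \<in> L2 a b"
  shows "L2_norm a b (\<lambda>x. u x - w x) \<le> L2_norm a b (\<lambda>x. u x - v x) + L2_norm a b (\<lambda>x. v x - w x)"
  using L2_norm_add_le[of "\<lambda>x. u x - v x" a b "\<lambda>x. v x - w x"] assms by (simp add: L2_diff)

lemma L2_norm_reverse_triangle:
  assumes "u \<in> L2 a b" "v \<in> L2 a b"
  shows "\<bar>L2_norm a b u - L2_norm a b v\<bar> \<le> L2_norm a b (\<lambda>x. u x - v x)"
  using L2_norm_triangle[of u a b v "\<lambda>x. 0"] L2_norm_triangle[of v a b u "\<lambda>x. 0"] assms
    L2_norm_minus_commute[of a b u v] by simp

section \<open>Borel measurability of functionals on L2\<close>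

lemma space_L2_borel [simp]: "space (L2_borel a b) = L2 a b"
  unfolding L2_borel_def by (rule space_measure_of) auto

text \<open>Preimages of open sets are norm-open, hence generators of \<open>L2_borel\<close>. The
  Lipschitz corollary covers pairings and the norm; the potential energy, whose modulus of
  continuity depends on the point, needs this form.\<close>

lemma measurable_L2_borel_continuous:
  fixes \<Gamma> :: "(real \<Rightarrow> real) \<Rightarrow> real"
  assumes "\<And>u \<epsilon>. u \<in> L2 a b \<Longrightarrow> \<epsilon> > 0 \<Longrightarrow>
    \<exists>r>0. \<forall>v\<in>L2 a b. L2_norm a b (\<lambda>x. u x - v x) < r \<longrightarrow> \<bar>\<Gamma> u - \<Gamma> v\<bar> < \<epsilon>"
  shows "\<Gamma> \<in> borel_measurable (L2_borel a b)"
proof (rule borel_measurableI)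
  fix S :: "real set" assume S: "open S"
  let ?A = "{S. S \<subseteq> L2 a b \<and>
         (\<forall>u\<in>S. \<exists>r>0. \<forall>v\<in>L2 a b. L2_norm a b (\<lambda>x. u x - v x) < r \<longrightarrow> v \<in> S)}"
  have "\<Gamma> -` S \<inter> L2 a b \<in> ?A"
  proof (intro CollectI conjI ballI)
    fix u assume u: "u \<in> \<Gamma> -` S \<inter> L2 a b"
    then obtain \<epsilon> where \<epsilon>: "\<epsilon> > 0" "\<And>y. dist y (\<Gamma> u) < \<epsilon> \<Longrightarrow> y \<in> S"
      using S by (auto simp: open_dist)
    with assms[of u \<epsilon>] u obtain r where "r > 0"
      "\<forall>v\<in>L2 a b. L2_norm a b (\<lambda>x. u x - v x) < r \<longrightarrow> \<bar>\<Gamma> u - \<Gamma> v\<bar> < \<epsilon>" by auto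
    with \<epsilon> show "\<exists>r>0. \<forall>v\<in>L2 a b. L2_norm a b (\<lambda>x. u x - v x) < r \<longrightarrow> v \<in> \<Gamma> -` S \<inter> L2 a b"
      by (intro exI[of _ r]) (auto simp: dist_real_def abs_minus_commute)
  qed auto
  then show "\<Gamma> -` S \<inter> space (L2_borel a b) \<in> sets (L2_borel a b)"
    unfolding space_L2_borel unfolding L2_borel_def by (subst sets_measure_of) auto
qed

lemma measurable_L2_borel_lipschitz:
  fixes \<Gamma> :: "(real \<Rightarrow> real) \<Rightarrow> real"
  assumes "\<And>u v. u \<in> L2 a b \<Longrightarrow> v \<in> L2 a b \<Longrightarrow> \<bar>\<Gamma> u - \<Gamma> v\<bar> \<le> C * L2_norm a b (\<lambda>x. u x - v x)"
  shows "\<Gamma> \<in> borel_measurable (L2_borel a b)"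
proof (rule measurable_L2_borel_continuous)
  fix u and \<epsilon> :: real assume u: "u \<in> L2 a b" and \<epsilon>: "\<epsilon> > 0"
  \<comment> \<open>\<open>C\<close> may be zero or negative; the radius divides by a positive
    majorant.\<close>
  define D where "D = max C 1"
  have D: "D > 0" "C \<le> D" by (auto simp: D_def)
  show "\<exists>r>0. \<forall>v\<in>L2 a b. L2_norm a b (\<lambda>x. u x - v x) < r \<longrightarrow> \<bar>\<Gamma> u - \<Gamma> v\<bar> < \<epsilon>"
  proof (intro exI[of _ "\<epsilon> / D"] conjI ballI impI)
    fix v assume v: "v \<in> L2 a b" "L2_norm a b (\<lambda>x. u x - v x) < \<epsilon> / D"
    have "\<bar>\<Gamma> u - \<Gamma> v\<bar> \<le> C * L2_norm a b (\<lambda>x. u x - v x)" using assms u v by auto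
    also have "\<dots> \<le> D * L2_norm a b (\<lambda>x. u x - v x)" using D by (intro mult_right_mono) auto
    also have "\<dots> < \<epsilon>" using v(2) D by (simp add: field_simps)
    finally show "\<bar>\<Gamma> u - \<Gamma> v\<bar> < \<epsilon>" .
  qed (use \<epsilon> D in auto)
qed

lemma measurable_L2_inner: 
  assumes "w \<in> L2 a b"
  shows "(\<lambda>u. L2_inner a b u w) \<in> borel_measurable (L2_borel a b)"
proof (rule measurable_L2_borel_lipschitz)
  fix u v assume "u \<in> L2 a b" "v \<in> L2 a b"
  then show "\<bar>L2_inner a b u w - L2_inner a b v w\<bar> \<le> L2_norm a b w * L2_norm a b (\<lambda>x. u x - v x)"
    using L2_inner_CS[of "\<lambda>x. u x - v x" a b w] assms
    by (simp add: L2_inner_diff_left L2_diff mult.commute)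
qed

lemma measurable_L2_norm: "L2_norm a b \<in> borel_measurable (L2_borel a b)"
  by (rule measurable_L2_borel_lipschitz[where C=1]) (simp add: L2_norm_reverse_triangle)

section \<open>Completeness along rapidly converging sequences\<close>

lemma L2_nn_integral: "u \<in> L2 a b \<Longrightarrow> (\<integral>\<^sup>+x. ennreal ((u x)\<^sup>2) \<partial>dom_measure a b) = ennreal ((L2_norm a b u)\<^sup>2)"
  by (subst nn_integral_eq_integral[OF L2_square_integrable])
    (simp_all add: L2_norm_sq, simp add: L2_inner_def power2_eq_square)

lemma L2_I_nn_integral:
  assumes "u \<in> borel_measurable (dom_measure a b)" "(\<integral>\<^sup>+x. ennreal ((u x)\<^sup>2) \<partial>dom_measure a b) \<le> ennreal C"
  shows "u \<in> L2 a b"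
proof -
  have "integrable (dom_measure a b) (\<lambda>x. (u x)\<^sup>2)"
    using assms by (intro integrableI_nonneg) (auto intro: le_less_trans)
  then show ?thesis using assms by (simp add: L2_def)
qed

lemma L2_norm_zero [simp]: "L2_norm a b (\<lambda>x. 0) = 0"
  by (simp add: L2_norm_def)

text \<open>The increments have summable norms and the measure is finite, so their absolute values
  have a finite sum almost everywhere, which yields a pointwise limit. Fatou's lemma then turns the
  tail bounds into convergence in norm.\<close>

lemma L2_complete_rapid:
  assumes x: "\<And>n. x n \<in> L2 a b"
    and d: "\<And>n. L2_norm a b (\<lambda>t. x (Suc n) t - x n t) \<le> (1/2)^n"
  shows "\<exists>w\<in>L2 a b. (\<lambda>n. L2_norm a b (\<lambda>t. x n t - w t)) \<longlonglongrightarrow> 0"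
proof -
  let ?M = "dom_measure a b"
  have [measurable]: "x n \<in> borel_measurable ?M" for n by (rule L2_measurable[OF x])
  \<comment> \<open>The induction closes only with the exact remainder of the geometric series; the
    simpler bound \<open>tail'\<close> is read off afterwards.\<close>
  have tail: "L2_norm a b (\<lambda>t. x (m + j) t - x m t) \<le> 2 * (1/2)^m - 2 * (1/2)^(m + j)" for m j
  proof (induction j)
    case (Suc j)
    have "L2_norm a b (\<lambda>t. x (m + Suc j) t - x m t)
      \<le> L2_norm a b (\<lambda>t. x (Suc (m + j)) t - x (m + j) t) + L2_norm a b (\<lambda>t. x (m + j) t - x m t)"
      using L2_norm_triangle[OF x[of "Suc (m + j)"] x[of "m + j"] x[of m]] by simp
    also have "\<dots> \<le> 2 * (1/2)^m - 2 * (1/2)^(m + Suc j)" using Suc d[of "m + j"] by simp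
    finally show ?case .
  qed simp
  have tail': "L2_norm a b (\<lambda>t. x (m + j) t - x m t) \<le> 2 * (1/2)^m" for m j
    using tail[of m j] by (smt (verit) zero_le_power zero_le_divide_1_iff)
  \<comment> \<open>\<open>K\<close> is the factor in passing from an L2 bound to an L1 bound by
    Cauchy-Schwarz against the constant 1.\<close>
  define K where "K = L2_norm a b (\<lambda>x. 1)"
  have int1: "(\<integral>\<^sup>+t. ennreal \<bar>x (Suc n) t - x n t\<bar> \<partial>?M) \<le> ennreal (K * (1/2)^n)" for n
  proof -
    let ?d = "\<lambda>t. \<bar>x (Suc n) t - x n t\<bar>"
    have dL: "?d \<in> L2 a b" using L2_diff[OF x x, of "Suc n" n] by (simp add: L2_def)
    have "(\<integral>\<^sup>+t. ennreal (?d t) \<partial>?M) = ennreal (L2_inner a b ?d (\<lambda>x. 1))"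
      using L2_mult_integrable[OF dL L2_const[of 1]]
      by (subst nn_integral_eq_integral) (simp_all add: L2_inner_def)
    also have "L2_inner a b ?d (\<lambda>x. 1) \<le> L2_norm a b ?d * K"
      using L2_inner_CS[OF dL L2_const[of 1]] by (simp add: K_def)
    also have "L2_norm a b ?d = L2_norm a b (\<lambda>t. x (Suc n) t - x n t)"
      by (simp add: L2_norm_def L2_inner_def)
    also have "\<dots> * K \<le> K * (1/2)^n"
      using d[of n] by (simp add: K_def mult.commute mult_left_mono)
    finally show ?thesis by (simp add: ennreal_leI)
  qed
  have "(\<integral>\<^sup>+t. (\<Sum>n. ennreal \<bar>x (Suc n) t - x n t\<bar>) \<partial>?M) = (\<Sum>n. \<integral>\<^sup>+t. ennreal \<bar>x (Suc n) t - x n t\<bar> \<partial>?M)"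
    by (intro nn_integral_suminf) simp
  also have "\<dots> \<le> (\<Sum>n. ennreal (K * (1/2)^n))"
    by (intro suminf_le int1 summableI)
  also have "\<dots> = ennreal (\<Sum>n. K * (1/2)^n)"
    by (intro suminf_ennreal2) (auto simp: K_def intro!: summable_mult summable_geometric)
  finally have "(\<integral>\<^sup>+t. (\<Sum>n. ennreal \<bar>x (Suc n) t - x n t\<bar>) \<partial>?M) \<noteq> \<infinity>"
    by (auto simp: top_unique)
  then have "AE t in ?M. (\<Sum>n. ennreal \<bar>x (Suc n) t - x n t\<bar>) \<noteq> \<infinity>"
    by (intro nn_integral_PInf_AE) auto
  then have conv: "AE t in ?M. convergent (\<lambda>n. x n t)"
  proof eventually_elim
    case (elim t)
    then have "summable (\<lambda>n. \<bar>x (Suc n) t - x n t\<bar>)"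
      by (intro summable_suminf_not_top) auto
    then have "summable (\<lambda>n. x (Suc n) t - x n t)" by (rule summable_rabs_cancel)
    then have "(\<lambda>N. (\<Sum>n<N. x (Suc n) t - x n t) + x 0 t) \<longlonglongrightarrow> (\<Sum>n. x (Suc n) t - x n t) + x 0 t"
      by (intro tendsto_add summable_LIMSEQ tendsto_const)
    then have "(\<lambda>N. x N t) \<longlonglongrightarrow> (\<Sum>n. x (Suc n) t - x n t) + x 0 t"
      using sum_lessThan_telescope[of "\<lambda>n. x n t"] by simp
    then show ?case by (rule convergentI)
  qed
  \<comment> \<open>Where the sequence diverges \<open>lim\<close> is some fixed unspecified value,
    and the function remains measurable.\<close>
  define w where "w t = lim (\<lambda>n. x n t)" for t
  have wm [measurable]: "w \<in> borel_measurable ?M" unfolding w_def by measurable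
  have fatou: "(\<integral>\<^sup>+t. ennreal ((x m t - w t)\<^sup>2) \<partial>?M) \<le> ennreal ((2 * (1/2)^m)\<^sup>2)" for m
  proof -
    have "(\<integral>\<^sup>+t. ennreal ((x m t - w t)\<^sup>2) \<partial>?M) = (\<integral>\<^sup>+t. liminf (\<lambda>j. ennreal ((x (m + j) t - x m t)\<^sup>2)) \<partial>?M)"
    proof (rule nn_integral_cong_AE, use conv in eventually_elim)
      fix t assume "convergent (\<lambda>n. x n t)"
      then have "(\<lambda>n. x n t) \<longlonglongrightarrow> w t" unfolding w_def by (simp add: convergent_LIMSEQ_iff)
      then have "(\<lambda>j. x (j + m) t) \<longlonglongrightarrow> w t" by (rule LIMSEQ_ignore_initial_segment)
      then have "(\<lambda>j. ennreal ((x (m + j) t - x m t)\<^sup>2)) \<longlonglongrightarrow> ennreal ((w t - x m t)\<^sup>2)"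
        by (intro tendsto_intros) (simp add: add.commute)
      from lim_imp_Liminf[OF _ this] show "ennreal ((x m t - w t)\<^sup>2) = liminf (\<lambda>j. ennreal ((x (m + j) t - x m t)\<^sup>2))"
        by (simp add: power2_commute)
    qed
    also have "\<dots> \<le> liminf (\<lambda>j. \<integral>\<^sup>+t. ennreal ((x (m + j) t - x m t)\<^sup>2) \<partial>?M)"
      by (intro nn_integral_liminf) measurable
    also have "\<dots> \<le> limsup (\<lambda>j. \<integral>\<^sup>+t. ennreal ((x (m + j) t - x m t)\<^sup>2) \<partial>?M)"
      by (intro Liminf_le_Limsup) simp
    also have "\<dots> \<le> ennreal ((2 * (1/2)^m)\<^sup>2)"
      unfolding L2_nn_integral[OF L2_diff[OF x x]]
      by (intro Limsup_bounded always_eventually allI ennreal_leI power_mono tail') simp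
    finally show ?thesis .
  qed
  have diffL: "(\<lambda>t. x m t - w t) \<in> L2 a b" for m
    by (rule L2_I_nn_integral[OF _ fatou]) measurable
  have wL: "w \<in> L2 a b" using L2_diff[OF x[of 0] diffL[of 0]] by simp
  have "L2_norm a b (\<lambda>t. x m t - w t) \<le> 2 * (1/2)^m" for m
  proof (rule power2_le_imp_le)
    show "(L2_norm a b (\<lambda>t. x m t - w t))\<^sup>2 \<le> (2 * (1/2)^m)\<^sup>2"
      using fatou[of m] unfolding L2_nn_integral[OF diffL] by (simp del: power_mult_distrib)
  qed simp
  moreover have "(\<lambda>m. 2 * (1/2::real)^m) \<longlonglongrightarrow> 2 * 0"
    by (rule tendsto_mult_left) (rule LIMSEQ_power_zero, simp)
  ultimately have "(\<lambda>n. L2_norm a b (\<lambda>t. x n t - w t)) \<longlonglongrightarrow> 0"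
    by (auto intro: Lim_null_comparison[where g="\<lambda>m. 2 * (1/2::real)^m"])
  then show ?thesis using wL by blast
qed

subsection \<open>Orthonormal systems, Riesz representation and traces\<close>

text \<open>The index set lets one notion serve the finite bases of \<open>V_h\<close> and the
  eigenbasis of \<open>Q\<close>.\<close>

definition L2_orthonormal :: "real \<Rightarrow> real \<Rightarrow> nat set \<Rightarrow> (nat \<Rightarrow> real \<Rightarrow> real) \<Rightarrow> bool" where
  "L2_orthonormal a b J e \<longleftrightarrow> (\<forall>j\<in>J. e j \<in> L2 a b) \<and>
     (\<forall>j\<in>J. \<forall>k\<in>J. L2_inner a b (e j) (e k) = (if j = k then 1 else 0))"

lemma orthonormal_basis_imp_orthonormal:
  "L2_orthonormal_basis a b e \<Longrightarrow> L2_orthonormal a b UNIV e"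
  by (simp add: L2_orthonormal_basis_def L2_orthonormal_def)

lemma L2_orthonormal_subset: "L2_orthonormal a b J e \<Longrightarrow> S \<subseteq> J \<Longrightarrow> L2_orthonormal a b S e"
  unfolding L2_orthonormal_def by blast

lemma orthonormal_sum_mem: "L2_orthonormal a b S e \<Longrightarrow> (\<lambda>x. \<Sum>k\<in>S. c k * e k x) \<in> L2 a b"
  by (auto simp: L2_orthonormal_def intro!: L2_sum L2_cmult)

lemma orthonormal_inner_sum:
  assumes "L2_orthonormal a b S e" "u \<in> L2 a b"
  shows "L2_inner a b (\<lambda>x. \<Sum>k\<in>S. c k * e k x) u = (\<Sum>k\<in>S. c k * L2_inner a b u (e k))"
  using assms unfolding L2_orthonormal_def
  by (subst L2_inner_sum_left) (auto intro!: L2_cmult sum.cong simp: L2_inner_cmult_left L2_inner_commute[of a b u])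

lemma orthonormal_coeff:
  assumes "L2_orthonormal a b J e" "S \<subseteq> J" "finite S" "j \<in> J"
  shows "L2_inner a b (\<lambda>x. \<Sum>k\<in>S. c k * e k x) (e j) = (if j \<in> S then c j else 0)"
proof -
  have "e j \<in> L2 a b" using assms by (auto simp: L2_orthonormal_def)
  then have "L2_inner a b (\<lambda>x. \<Sum>k\<in>S. c k * e k x) (e j) = (\<Sum>k\<in>S. c k * L2_inner a b (e j) (e k))"
    using assms L2_orthonormal_subset by (intro orthonormal_inner_sum) auto
  also have "\<dots> = (\<Sum>k\<in>S. if k = j then c k else 0)"
    using assms by (intro sum.cong) (auto simp: L2_orthonormal_def subset_eq)
  finally show ?thesis using assms(3) by simp
qed

lemma orthonormal_norm_sum:
  assumes "L2_orthonormal a b S e" "finite S"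
  shows "L2_inner a b (\<lambda>x. \<Sum>k\<in>S. c k * e k x) (\<lambda>x. \<Sum>k\<in>S. c k * e k x) = (\<Sum>k\<in>S. (c k)\<^sup>2)"
  using assms
  by (simp add: orthonormal_inner_sum orthonormal_sum_mem orthonormal_coeff[OF assms(1)] power2_eq_square)

lemma orthonormal_residual:
  assumes "L2_orthonormal a b S e" "finite S" "u \<in> L2 a b"
  shows "(L2_norm a b (\<lambda>x. u x - (\<Sum>k\<in>S. L2_inner a b u (e k) * e k x)))\<^sup>2
    = (L2_norm a b u)\<^sup>2 - (\<Sum>k\<in>S. (L2_inner a b u (e k))\<^sup>2)"
proof -
  define p where "p = (\<lambda>x. \<Sum>k\<in>S. L2_inner a b u (e k) * e k x)"
  have p: "p \<in> L2 a b" unfolding p_def by (rule orthonormal_sum_mem[OF assms(1)])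
  have pp: "L2_inner a b p p = (\<Sum>k\<in>S. (L2_inner a b u (e k))\<^sup>2)"
    unfolding p_def by (rule orthonormal_norm_sum[OF assms(1,2)])
  have pu: "L2_inner a b p u = (\<Sum>k\<in>S. (L2_inner a b u (e k))\<^sup>2)"
    unfolding p_def by (subst orthonormal_inner_sum[OF assms(1,3)]) (simp add: power2_eq_square)
  show ?thesis
    unfolding L2_norm_sq fun_cong[OF p_def, symmetric]
    using assms p by (simp add: L2_inner_diff_left L2_inner_diff_right L2_diff pp pu L2_inner_commute[of a b u p])
qed

lemma orthonormal_bessel:
  assumes "L2_orthonormal a b S e" "finite S" "u \<in> L2 a b"
  shows "(\<Sum>k\<in>S. (L2_inner a b u (e k))\<^sup>2) \<le> (L2_norm a b u)\<^sup>2"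
  using orthonormal_residual[OF assms] by (smt (verit) zero_le_power2)

text \<open>Riesz--Fischer: a subsequence of the partial sums converges fast enough for
  the almost-everywhere limit to exist.\<close>

lemma orthonormal_series:
  assumes on: "L2_orthonormal a b UNIV e" and c: "summable (\<lambda>k. (c k)\<^sup>2)"
  shows "\<exists>w\<in>L2 a b. (\<forall>k. L2_inner a b w (e k) = c k) \<and> L2_inner a b w w = (\<Sum>k. (c k)\<^sup>2)"
proof -
  define s where "s n = (\<lambda>x. \<Sum>k<n. c k * e k x)" for n :: nat
  have onS: "L2_orthonormal a b S e" for S using on by (rule L2_orthonormal_subset) simp
  have s: "s n \<in> L2 a b" for n unfolding s_def by (rule orthonormal_sum_mem[OF onS])
  have sdiff: "(L2_norm a b (\<lambda>x. s m x - s n x))\<^sup>2 = (\<Sum>k\<in>{n..<m}. (c k)\<^sup>2)" if "n \<le> m" for m n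
  proof -
    have "s m x - s n x = (\<Sum>k\<in>{n..<m}. c k * e k x)" for x
      using that sum_diff_nat_ivl[of 0 n m "\<lambda>k. c k * e k x"] by (simp add: s_def atLeast0LessThan)
    then show ?thesis by (simp add: L2_norm_sq orthonormal_norm_sum[OF onS])
  qed
  have "\<exists>N. \<forall>m\<ge>N. \<forall>n. norm (\<Sum>k\<in>{m..<n}. (c k)\<^sup>2) < ((1/2)^i)\<^sup>2" for i
    using c unfolding summable_Cauchy by (meson zero_less_power half_gt_zero zero_less_one)
  then obtain N where N: "\<And>i m n. m \<ge> N i \<Longrightarrow> norm (\<Sum>k\<in>{m..<n}. (c k)\<^sup>2) < ((1/2)^i)\<^sup>2" by metis
  \<comment> \<open>The partial sums of \<open>N\<close> make \<open>r\<close> monotone with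
    \<open>r n\<close> at least \<open>N n\<close>; the extra summand \<open>n\<close> makes it tend
    to infinity.\<close>
  define r where "r n = n + (\<Sum>i\<le>n. N i)" for n
  have rmono: "r n \<le> r (Suc n)" for n by (simp add: r_def)
  have rge: "r n \<ge> N n" for n
    using member_le_sum[of n "{..n}" N] by (simp add: r_def trans_le_add2)
  have rn: "r n \<ge> n" for n by (simp add: r_def)
  have "L2_norm a b (\<lambda>x. s (r (Suc n)) x - s (r n) x) \<le> (1/2)^n" for n
  proof (rule power2_le_imp_le)
    show "(L2_norm a b (\<lambda>x. s (r (Suc n)) x - s (r n) x))\<^sup>2 \<le> ((1/2)^n)\<^sup>2"
      unfolding sdiff[OF rmono] using N[OF rge[of n], of "r (Suc n)"] by simp
  qed simp
  from L2_complete_rapid[of "\<lambda>n. s (r n)", OF s this]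
  obtain w where w: "w \<in> L2 a b" "(\<lambda>n. L2_norm a b (\<lambda>t. s (r n) t - w t)) \<longlonglongrightarrow> 0" by auto
  have inner_lim: "(\<lambda>n. L2_inner a b (s (r n)) v) \<longlonglongrightarrow> L2_inner a b w v" if v: "v \<in> L2 a b" for v
  proof -
    have "(\<lambda>n. L2_inner a b (s (r n)) v - L2_inner a b w v) \<longlonglongrightarrow> 0"
    proof (rule Lim_null_comparison)
      show "\<forall>\<^sub>F n in sequentially. norm (L2_inner a b (s (r n)) v - L2_inner a b w v)
          \<le> L2_norm a b (\<lambda>t. s (r n) t - w t) * L2_norm a b v"
        using L2_inner_CS[OF L2_diff[OF s w(1)] v] by (simp add: L2_inner_diff_left s w(1) v)
      show "(\<lambda>n. L2_norm a b (\<lambda>t. s (r n) t - w t) * L2_norm a b v) \<longlonglongrightarrow> 0"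
        using tendsto_mult_right[OF w(2)] by simp
    qed
    then show ?thesis by (simp add: LIM_zero_iff)
  qed
  have "L2_inner a b w (e k) = c k" for k
  proof (rule LIMSEQ_unique)
    show "(\<lambda>n. L2_inner a b (s (r n)) (e k)) \<longlonglongrightarrow> L2_inner a b w (e k)"
      using on by (intro inner_lim) (simp add: L2_orthonormal_def)
    have "L2_inner a b (s (r n)) (e k) = c k" if "n > k" for n
      using orthonormal_coeff[OF on, of "{..<r n}" k c] rn[of n] that by (simp add: s_def)
    then show "(\<lambda>n. L2_inner a b (s (r n)) (e k)) \<longlonglongrightarrow> c k"
      by (intro tendsto_eventually eventually_sequentiallyI[of "Suc k"]) simp
  qed
  moreover from this have swn: "L2_inner a b (s n) w = (\<Sum>k<n. (c k)\<^sup>2)" for n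
    unfolding s_def by (subst orthonormal_inner_sum[OF onS w(1)]) (simp add: power2_eq_square)
  have "L2_inner a b w w = (\<Sum>k. (c k)\<^sup>2)"
  proof (rule LIMSEQ_unique[OF inner_lim[OF w(1)]])
    have "filterlim r at_top sequentially"
      using rn by (auto intro: filterlim_at_top_mono[OF filterlim_ident])
    from filterlim_compose[OF summable_LIMSEQ[OF c] this]
    show "(\<lambda>n. L2_inner a b (s (r n)) w) \<longlonglongrightarrow> (\<Sum>k. (c k)\<^sup>2)" by (simp add: swn)
  qed
  ultimately show ?thesis using w(1) by blast
qed

text \<open>Riesz-Fischer gives some \<open>w\<close> with the coefficients of \<open>u\<close>
  whose norm is known from them; completeness of the basis forces \<open>u\<close> and
  \<open>w\<close> to agree almost everywhere.\<close>

lemma L2_parseval: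
  assumes "L2_orthonormal_basis a b e" "u \<in> L2 a b"
  shows "(\<lambda>k. (L2_inner a b u (e k))\<^sup>2) sums (L2_norm a b u)\<^sup>2"
proof -
  have on: "L2_orthonormal a b S e" for S
    using orthonormal_basis_imp_orthonormal[OF assms(1)] by (rule L2_orthonormal_subset) simp
  have sm: "summable (\<lambda>k. (L2_inner a b u (e k))\<^sup>2)"
    using orthonormal_bessel[OF on _ assms(2)] by (intro bounded_imp_summable[where B="(L2_norm a b u)\<^sup>2"]) auto
  from orthonormal_series[OF on this] obtain w where w: "w \<in> L2 a b"
    "\<And>k. L2_inner a b w (e k) = L2_inner a b u (e k)"
    "L2_inner a b w w = (\<Sum>k. (L2_inner a b u (e k))\<^sup>2)" by auto
  have "\<forall>k. L2_inner a b (\<lambda>x. u x - w x) (e k) = 0"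
    using on[of UNIV] by (simp add: L2_inner_diff_left assms(2) w L2_orthonormal_def)
  then have "L2_eq a b (\<lambda>x. u x - w x) (\<lambda>x. 0)"
    using assms w(1) unfolding L2_orthonormal_basis_def by (simp add: L2_diff)
  then have "L2_eq a b u w" by (simp add: L2_eq_iff_diff[of a b u])
  then have "(L2_norm a b u)\<^sup>2 = (\<Sum>k. (L2_inner a b u (e k))\<^sup>2)"
    using L2_norm_cong[of a b u w] assms(2) w by (simp add: L2_norm_sq[symmetric])
  then show ?thesis using sm by (simp add: sums_iff)
qed

lemma L2_fourier_tendsto:
  assumes "L2_orthonormal_basis a b e" "u \<in> L2 a b"
  shows "(\<lambda>n. L2_norm a b (\<lambda>x. u x - (\<Sum>k<n. L2_inner a b u (e k) * e k x))) \<longlonglongrightarrow> 0"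
proof -
  have on: "L2_orthonormal a b S e" for S
    using orthonormal_basis_imp_orthonormal[OF assms(1)] by (rule L2_orthonormal_subset) simp
  have "(\<lambda>n. (L2_norm a b u)\<^sup>2 - (\<Sum>k<n. (L2_inner a b u (e k))\<^sup>2)) \<longlonglongrightarrow> (L2_norm a b u)\<^sup>2 - (L2_norm a b u)\<^sup>2"
    using L2_parseval[OF assms] unfolding sums_def by (intro tendsto_intros)
  then have "(\<lambda>n. sqrt ((L2_norm a b (\<lambda>x. u x - (\<Sum>k<n. L2_inner a b u (e k) * e k x)))\<^sup>2)) \<longlonglongrightarrow> sqrt 0"
    unfolding orthonormal_residual[OF on finite_lessThan assms(2)] by (intro tendsto_intros) simp
  then show ?thesis by simp
qed

text \<open>Evaluating \<open>l\<close> on the partial sums built from its own coefficients bounds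
  S, the partial sum of their squares, by C times the square root of S. So the coefficients are
  square summable and Riesz-Fischer provides the candidate. The two functionals agree on finite
  combinations, hence everywhere by boundedness and convergence of the Fourier series.\<close>

lemma L2_riesz:
  assumes e: "L2_orthonormal_basis a b e"
    and lin: "\<And>u v c d. u \<in> L2 a b \<Longrightarrow> v \<in> L2 a b \<Longrightarrow> l (\<lambda>x. c * u x + d * v x) = c * l u + d * (l v :: real)"
    and bdd: "\<And>u. u \<in> L2 a b \<Longrightarrow> \<bar>l u\<bar> \<le> C * L2_norm a b u"
  shows "\<exists>w\<in>L2 a b. \<forall>u\<in>L2 a b. l u = L2_inner a b u w"
proof -
  have on: "L2_orthonormal a b S e" for S
    using orthonormal_basis_imp_orthonormal[OF e] by (rule L2_orthonormal_subset) simp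
  have eL: "e k \<in> L2 a b" for k using on[of UNIV] by (simp add: L2_orthonormal_def)
  have l0: "l (\<lambda>x. 0) = 0" using lin[of "\<lambda>x. 0" "\<lambda>x. 0" 0 0] by simp
  have lsum: "l (\<lambda>x. \<Sum>k<n. c k * e k x) = (\<Sum>k<n. c k * l (e k))" for n c
  proof (induction n)
    case (Suc n)
    then show ?case
      using lin[OF orthonormal_sum_mem[OF on[of "{..<n}"], of c] eL[of n], of 1 "c n"] by simp
  qed (simp add: l0)
  have ldiff: "l (\<lambda>x. u x - v x) = l u - l v" if "u \<in> L2 a b" "v \<in> L2 a b" for u v
    using lin[OF that, of 1 "-1"] by simp
  define c where "c k = l (e k)" for k
  have "(\<Sum>k<n. (c k)\<^sup>2) \<le> C\<^sup>2" for n
  proof -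
    let ?S = "\<Sum>k<n. (c k)\<^sup>2"
    have "?S = l (\<lambda>x. \<Sum>k<n. c k * e k x)" unfolding lsum by (simp add: c_def power2_eq_square)
    also have "\<dots> \<le> C * L2_norm a b (\<lambda>x. \<Sum>k<n. c k * e k x)"
      using bdd[OF orthonormal_sum_mem[OF on]] by (meson abs_le_D1)
    finally have "?S \<le> C * sqrt ?S" by (simp add: L2_norm_def orthonormal_norm_sum[OF on])
    then have le: "sqrt ?S * sqrt ?S \<le> C * sqrt ?S" by (simp add: sum_nonneg)
    have "sqrt ?S \<le> \<bar>C\<bar>"
    proof (cases "sqrt ?S = 0")
      case False
      then have "sqrt ?S > 0" using sum_nonneg[of "{..<n}" "\<lambda>k. (c k)\<^sup>2"] by simp
      with le have "sqrt ?S \<le> C" by (rule mult_right_le_imp_le)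
      then show ?thesis by linarith
    next
      case True
      then show ?thesis by (simp only: abs_ge_zero)
    qed
    then have "(sqrt ?S)\<^sup>2 \<le> \<bar>C\<bar>\<^sup>2" by (intro power_mono) (auto simp: sum_nonneg)
    then show ?thesis by (simp add: sum_nonneg)
  qed
  then have "(\<Sum>k\<le>n. (c k)\<^sup>2) \<le> C\<^sup>2" for n unfolding lessThan_Suc_atMost[symmetric] .
  then have "summable (\<lambda>k. (c k)\<^sup>2)" by (intro bounded_imp_summable[where B="C\<^sup>2"]) auto
  from orthonormal_series[OF on this] obtain w where w: "w \<in> L2 a b" "\<And>k. L2_inner a b w (e k) = c k" by auto
  have "l u = L2_inner a b u w" if u: "u \<in> L2 a b" for u
  proof (rule LIMSEQ_unique)
    let ?p = "\<lambda>n x. \<Sum>k<n. L2_inner a b u (e k) * e k x"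
    have p: "?p n \<in> L2 a b" for n by (rule orthonormal_sum_mem[OF on])
    have lp: "l (?p n) = L2_inner a b (?p n) w" for n
      unfolding lsum orthonormal_inner_sum[OF on w(1)] w(2) c_def ..
    have "(\<lambda>n. l (?p n) - l u) \<longlonglongrightarrow> 0"
    proof (rule Lim_null_comparison)
      show "\<forall>\<^sub>F n in sequentially. norm (l (?p n) - l u) \<le> C * L2_norm a b (\<lambda>x. u x - ?p n x)"
        using bdd[OF L2_diff[OF p u]] L2_norm_minus_commute[of a b u] by (simp add: ldiff p u)
      show "(\<lambda>n. C * L2_norm a b (\<lambda>x. u x - ?p n x)) \<longlonglongrightarrow> 0"
        using tendsto_mult_left[OF L2_fourier_tendsto[OF e u], of C] by simp
    qed
    then show "(\<lambda>n. l (?p n)) \<longlonglongrightarrow> l u" by (simp add: LIM_zero_iff)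
    have "(\<lambda>n. L2_inner a b (?p n) w - L2_inner a b u w) \<longlonglongrightarrow> 0"
    proof (rule Lim_null_comparison)
      show "\<forall>\<^sub>F n in sequentially. norm (L2_inner a b (?p n) w - L2_inner a b u w) \<le> L2_norm a b w * L2_norm a b (\<lambda>x. u x - ?p n x)"
        using L2_inner_CS[OF L2_diff[OF p u] w(1)]
        unfolding L2_norm_minus_commute[of a b u] L2_inner_diff_left[OF p u w(1), symmetric]
        by (simp add: mult.commute[of _ "L2_norm a b w"])
      show "(\<lambda>n. L2_norm a b w * L2_norm a b (\<lambda>x. u x - ?p n x)) \<longlonglongrightarrow> 0"
        using tendsto_mult_left[OF L2_fourier_tendsto[OF e u], of "L2_norm a b w"] by simp
    qed
    then show "(\<lambda>n. l (?p n)) \<longlonglongrightarrow> L2_inner a b u w" unfolding lp by (simp add: LIM_zero_iff)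
  qed
  then show ?thesis using w(1) by blast
qed

text \<open>\<open>L2_adjoint\<close> is a Hilbert choice; Riesz applied to u -> <A u, v> for every
  v shows that there is something to choose.\<close>

lemma L2_adjoint:
  assumes e: "L2_orthonormal_basis a b e" and A: "L2_bounded_linear a b A"
  shows "\<And>v. v \<in> L2 a b \<Longrightarrow> L2_adjoint a b A v \<in> L2 a b"
    and "\<And>u v. u \<in> L2 a b \<Longrightarrow> v \<in> L2 a b \<Longrightarrow> L2_inner a b (A u) v = L2_inner a b u (L2_adjoint a b A v)"
proof -
  from A obtain C where AL: "\<And>u. u \<in> L2 a b \<Longrightarrow> A u \<in> L2 a b"
    and lin: "\<And>u v c d. u \<in> L2 a b \<Longrightarrow> v \<in> L2 a b \<Longrightarrow>
        L2_eq a b (A (\<lambda>x. c * u x + d * v x)) (\<lambda>x. c * A u x + d * A v x)"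
    and C: "\<And>u. u \<in> L2 a b \<Longrightarrow> L2_norm a b (A u) \<le> C * L2_norm a b u"
    unfolding L2_bounded_linear_def by blast
  have "\<exists>w\<in>L2 a b. \<forall>u\<in>L2 a b. L2_inner a b (A u) v = L2_inner a b u w" if v: "v \<in> L2 a b" for v
  proof (rule L2_riesz[OF e])
    fix u u' :: "real \<Rightarrow> real" and c d assume u: "u \<in> L2 a b" "u' \<in> L2 a b"
    show "L2_inner a b (A (\<lambda>x. c * u x + d * u' x)) v = c * L2_inner a b (A u) v + d * L2_inner a b (A u') v"
      using L2_inner_cong[OF lin[OF u] L2_eq_refl, of c d v] u v
      by (simp add: AL L2_lincomb L2_inner_lincomb_left)
  next
    fix u assume u: "u \<in> L2 a b"
    have "\<bar>L2_inner a b (A u) v\<bar> \<le> L2_norm a b (A u) * L2_norm a b v"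
      by (rule L2_inner_CS[OF AL[OF u] v])
    also have "\<dots> \<le> (C * L2_norm a b u) * L2_norm a b v"
      by (intro mult_right_mono C u) simp
    finally show "\<bar>L2_inner a b (A u) v\<bar> \<le> (C * L2_norm a b v) * L2_norm a b u" by (simp add: ac_simps)
  qed
  then obtain B where "\<forall>v\<in>L2 a b. B v \<in> L2 a b \<and> (\<forall>u\<in>L2 a b. L2_inner a b (A u) v = L2_inner a b u (B v))"
    by metis
  then have "\<exists>B. (\<forall>v\<in>L2 a b. B v \<in> L2 a b) \<and> (\<forall>u\<in>L2 a b. \<forall>v\<in>L2 a b. L2_inner a b (A u) v = L2_inner a b u (B v))"
    by blast
  from someI_ex[OF this] show "\<And>v. v \<in> L2 a b \<Longrightarrow> L2_adjoint a b A v \<in> L2 a b"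
    and "\<And>u v. u \<in> L2 a b \<Longrightarrow> v \<in> L2 a b \<Longrightarrow> L2_inner a b (A u) v = L2_inner a b u (L2_adjoint a b A v)"
    unfolding L2_adjoint_def by blast+
qed

text \<open>The diagonal entries are the squared norms of the adjoint on \<open>e k\<close>.
  Parseval expands them into the double series of <A e_j, e_k>^2, and summing over k first gives the
  squared norms of A on the basis.\<close>

lemma L2_trace_adjoint:
  assumes e: "L2_orthonormal_basis a b e" and A: "L2_bounded_linear a b A"
    and sm: "summable (\<lambda>k. (L2_norm a b (A (e k)))\<^sup>2)"
  shows "L2_trace a b e (\<lambda>v. A (L2_adjoint a b A v)) = (\<Sum>k. (L2_norm a b (A (e k)))\<^sup>2)"
proof -
  let ?B = "L2_adjoint a b A"
  have eL: "e k \<in> L2 a b" for k using e by (simp add: L2_orthonormal_basis_def)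
  have AL: "\<And>u. u \<in> L2 a b \<Longrightarrow> A u \<in> L2 a b" using A by (simp add: L2_bounded_linear_def)
  note B = L2_adjoint[OF e A]
  have pars: "(\<Sum>k. ennreal ((L2_inner a b u (e k))\<^sup>2)) = ennreal ((L2_norm a b u)\<^sup>2)" if "u \<in> L2 a b" for u
    using L2_parseval[OF e that] by (intro suminf_ennreal_eq) auto
  have "(\<Sum>k. ennreal ((L2_norm a b (?B (e k)))\<^sup>2)) = (\<Sum>k. \<Sum>j. ennreal ((L2_inner a b (A (e j)) (e k))\<^sup>2))"
    by (simp add: pars[symmetric] B eL L2_inner_commute[of a b "?B _"])
  \<comment> \<open>One series is read as an integral over counting measure, so that the exchange of
    the two series is monotone convergence.\<close>
  also have "\<dots> = (\<integral>\<^sup>+k. (\<Sum>j. ennreal ((L2_inner a b (A (e j)) (e k))\<^sup>2)) \<partial>count_space UNIV)"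
    by (simp add: nn_integral_count_space_nat)
  also have "\<dots> = (\<Sum>j. \<integral>\<^sup>+k. ennreal ((L2_inner a b (A (e j)) (e k))\<^sup>2) \<partial>count_space UNIV)"
    by (intro nn_integral_suminf) simp
  also have "\<dots> = (\<Sum>j. ennreal ((L2_norm a b (A (e j)))\<^sup>2))"
    by (simp only: nn_integral_count_space_nat pars[OF AL[OF eL]])
  also have "\<dots> = ennreal (\<Sum>j. (L2_norm a b (A (e j)))\<^sup>2)"
    by (intro suminf_ennreal2 sm) simp
  finally have eq: "(\<Sum>k. ennreal ((L2_norm a b (?B (e k)))\<^sup>2)) = ennreal (\<Sum>j. (L2_norm a b (A (e j)))\<^sup>2)" .
  \<comment> \<open>Summability on the adjoint side is obtained from the identity in
    \<open>ennreal\<close>; without it the real \<open>suminf\<close> could be a junk value.\<close>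
  have sm': "summable (\<lambda>k. (L2_norm a b (?B (e k)))\<^sup>2)"
    by (intro summable_suminf_not_top) (simp_all add: eq)
  have "L2_inner a b (A (?B (e k))) (e k) = (L2_norm a b (?B (e k)))\<^sup>2" for k
    by (simp add: B eL L2_norm_sq)
  then have "L2_trace a b e (\<lambda>v. A (?B v)) = (\<Sum>k. (L2_norm a b (?B (e k)))\<^sup>2)"
    by (simp add: L2_trace_def)
  also have "\<dots> = (\<Sum>j. (L2_norm a b (A (e j)))\<^sup>2)"
  proof -
    have "ennreal (\<Sum>k. (L2_norm a b (?B (e k)))\<^sup>2) = ennreal (\<Sum>j. (L2_norm a b (A (e j)))\<^sup>2)"
      unfolding eq[symmetric] by (rule suminf_ennreal2[symmetric, OF _ sm']) simp
    then show ?thesis using suminf_nonneg[OF sm] suminf_nonneg[OF sm'] by (subst (asm) ennreal_inj) auto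
  qed
  finally show ?thesis .
qed

section \<open>The discontinuous Galerkin space\<close>

lemma L2_eq_sum:
  "finite S \<Longrightarrow> (\<And>i. i \<in> S \<Longrightarrow> L2_eq a b (u i) (v i)) \<Longrightarrow> L2_eq a b (\<lambda>x. \<Sum>i\<in>S. u i x) (\<lambda>x. \<Sum>i\<in>S. v i x)"
  by (induction S rule: finite_induct) (auto intro: L2_eq_add)

locale dg_mesh =
  fixes a b :: real and M k :: nat
  assumes ab: "a < b" and M: "1 \<le> M"
begin

abbreviation "nd \<equiv> node a b M"
abbreviation "cell i \<equiv> {nd i<..<nd (Suc i)}"
abbreviation "Vh \<equiv> V_h a b M k"
abbreviation "inn \<equiv> L2_inner a b"
abbreviation "nrm \<equiv> L2_norm a b"

lemma mesh_size_pos: "mesh_size a b M > 0"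
  using ab M by (simp add: mesh_size_def)

lemma node_0 [simp]: "nd 0 = a"
  by (simp add: node_def)

lemma node_M [simp]: "nd M = b"
  using M by (simp add: node_def mesh_size_def)

lemma node_le_iff [simp]: "nd i \<le> nd j \<longleftrightarrow> i \<le> j"
  using mesh_size_pos by (simp add: node_def)

lemma node_less_iff [simp]: "nd i < nd j \<longleftrightarrow> i < j"
  using mesh_size_pos by (simp add: node_def)

lemma node_bounds: "i \<le> M \<Longrightarrow> a \<le> nd i \<and> nd i \<le> b"
  using node_le_iff[of 0 i] node_le_iff[of i M] by (simp del: node_le_iff)

lemma cell_subset: "i < M \<Longrightarrow> cell i \<subseteq> {a<..<b}"
  using node_bounds[of i] node_bounds[of "Suc i"] by auto

lemma cell_unique: "x \<in> cell i \<Longrightarrow> x \<in> cell j \<Longrightarrow> i = j"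
proof (rule ccontr)
  assume *: "x \<in> cell i" "x \<in> cell j" "i \<noteq> j"
  then have "nd (Suc i) \<le> nd j \<or> nd (Suc j) \<le> nd i" unfolding node_le_iff by linarith
  with * show False by (auto simp del: node_le_iff)
qed

lemma infinite_cell: "infinite (cell i)"
  by (rule infinite_Ioo) simp

lemma node_or_cell:
  assumes "x \<in> {a..b}"
  shows "(\<exists>i\<le>M. x = nd i) \<or> (\<exists>i<M. x \<in> cell i)"
proof -
  define y where "y = (x - a) / mesh_size a b M"
  define i where "i = nat \<lfloor>y\<rfloor>"
  have xy: "x = a + y * mesh_size a b M" using mesh_size_pos by (simp add: y_def)
  have y0: "y \<ge> 0" using assms mesh_size_pos by (simp add: y_def)
  have iy: "real i \<le> y" "y < real i + 1" using y0 by (simp_all add: i_def)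
  have "y \<le> real M" using assms mesh_size_pos M by (simp add: y_def mesh_size_def field_simps)
  then have iM: "i \<le> M" using iy by linarith
  show ?thesis
  proof (cases "y = real i")
    case True
    then show ?thesis using iM xy by (auto simp: node_def)
  next
    case False
    then have "real i < y" using iy by simp
    moreover from this \<open>y \<le> real M\<close> have "i < M" by linarith
    ultimately show ?thesis using iy xy mesh_size_pos
      by (intro disjI2 exI[of _ i]) (auto simp: node_def)
  qed
qed

text \<open>The nodes form a null set, so for \<open>L2_eq\<close> only the values on the open cells
  count; the prescribed zeros at \<open>a\<close> and \<open>b\<close> are invisible.\<close>

lemma AE_cell: "AE x in dom_measure a b. \<exists>i<M. x \<in> cell i"
proof -
  have "nd ` {..M} \<in> null_sets lborel" by (intro finite_imp_null_set_lborel) simp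
  then have "AE x in lborel. x \<notin> nd ` {..M}" by (rule AE_not_in)
  then have "AE x in lborel. x \<in> {a..b} \<longrightarrow> (\<exists>i<M. x \<in> cell i)"
  proof eventually_elim
    case (elim x)
    then show ?case using node_or_cell[of x] by blast
  qed
  then show ?thesis by (subst AE_restrict_space_iff) auto
qed

lemma L2_eq_cellI: "(\<And>i x. i < M \<Longrightarrow> x \<in> cell i \<Longrightarrow> u x = v x) \<Longrightarrow> L2_eq a b u v"
  unfolding L2_eq_def using AE_cell by (rule eventually_mono) auto

lemma V_h_L2: "u \<in> Vh \<Longrightarrow> u \<in> L2 a b"
  by (simp add: V_h_def)

lemma V_h_lincomb: 
  assumes "u \<in> Vh" "v \<in> Vh" shows "(\<lambda>x. c * u x + d * v x) \<in> Vh"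
proof -
  have "\<exists>p. degree p \<le> k \<and> (\<forall>x\<in>cell i. c * u x + d * v x = poly p x)" if "i < M" for i
  proof -
    from assms that obtain p q where "degree p \<le> k" "\<forall>x\<in>cell i. u x = poly p x"
      "degree q \<le> k" "\<forall>x\<in>cell i. v x = poly q x" unfolding V_h_def by blast
    then show ?thesis
      by (intro exI[of _ "smult c p + smult d q"])
        (auto intro!: degree_add_le order_trans[OF degree_smult_le])
  qed
  then show ?thesis using assms by (auto simp: V_h_def L2_lincomb)
qed

lemma V_h_diff: "u \<in> Vh \<Longrightarrow> v \<in> Vh \<Longrightarrow> (\<lambda>x. u x - v x) \<in> Vh"
  using V_h_lincomb[of u v 1 "-1"] by simp

lemma V_h_cmult: "u \<in> Vh \<Longrightarrow> (\<lambda>x. c * u x) \<in> Vh"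
  using V_h_lincomb[of u u c 0] by simp

lemma V_h_zero: "(\<lambda>x. 0) \<in> Vh"
  by (auto simp: V_h_def intro: exI[of _ 0])

lemma V_h_sum: "(\<And>i. i \<in> S \<Longrightarrow> u i \<in> Vh) \<Longrightarrow> (\<lambda>x. \<Sum>i\<in>S. u i x) \<in> Vh"
proof (induction S rule: infinite_finite_induct)
  case (insert i S)
  then show ?case using V_h_lincomb[of "u i" "\<lambda>x. \<Sum>i\<in>S. u i x" 1 1] by simp
qed (simp_all add: V_h_zero)

definition cell_poly :: "(real \<Rightarrow> real) \<Rightarrow> nat \<Rightarrow> real poly" where
  "cell_poly u i = (SOME p. degree p \<le> k \<and> (\<forall>x\<in>cell i. u x = poly p x))"

lemma cell_poly:
  assumes "u \<in> Vh" "i < M"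
  shows "degree (cell_poly u i) \<le> k" "\<And>x. x \<in> cell i \<Longrightarrow> u x = poly (cell_poly u i) x"
proof -
  have "\<exists>p. degree p \<le> k \<and> (\<forall>x\<in>cell i. u x = poly p x)"
    using assms by (auto simp: V_h_def)
  from someI_ex[OF this] show "degree (cell_poly u i) \<le> k" "\<And>x. x \<in> cell i \<Longrightarrow> u x = poly (cell_poly u i) x"
    unfolding cell_poly_def by blast+
qed

lemma cell_poly_unique:
  assumes "u \<in> Vh" "i < M" "\<And>x. x \<in> cell i \<Longrightarrow> u x = poly p x"
  shows "cell_poly u i = p"
proof (rule ccontr)
  assume "cell_poly u i \<noteq> p"
  then have "finite {x. poly (cell_poly u i - p) x = 0}" by (intro poly_roots_finite) simp
  moreover have "cell i \<subseteq> {x. poly (cell_poly u i - p) x = 0}"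
    using cell_poly(2)[OF assms(1,2)] assms(3) by auto
  ultimately show False using infinite_cell finite_subset by blast
qed

lemma cell_poly_lincomb:
  assumes "u \<in> Vh" "v \<in> Vh" "i < M"
  shows "cell_poly (\<lambda>x. c * u x + d * v x) i = smult c (cell_poly u i) + smult d (cell_poly v i)"
  using assms by (intro cell_poly_unique V_h_lincomb) (auto simp: cell_poly(2))

text \<open>Two different polynomials agree at finitely many points only, so functions equal almost
  everywhere would leave a cell of positive length null. Hence one-sided limits and derivatives, and
  with them \<open>B_h\<close>, depend only on the class of an element of
  \<open>V_h\<close>.\<close>

lemma cell_poly_cong:
  assumes "u \<in> Vh" "v \<in> Vh" "L2_eq a b u v" "i < M"
  shows "cell_poly u i = cell_poly v i"
proof (rule ccontr)
  assume ne: "cell_poly u i \<noteq> cell_poly v i"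
  define Z where "Z = {x. poly (cell_poly u i - cell_poly v i) x = 0}"
  have "finite Z" using ne unfolding Z_def by (intro poly_roots_finite) simp
  then have "AE x in lborel. x \<notin> Z" by (intro AE_not_in finite_imp_null_set_lborel)
  moreover have "AE x in lborel. x \<in> {a..b} \<longrightarrow> u x = v x"
    using assms(3) unfolding L2_eq_def by (subst (asm) AE_restrict_space_iff) auto
  ultimately have "AE x in lborel. x \<notin> cell i"
  proof eventually_elim
    case (elim x)
    then show ?case using cell_subset[OF assms(4)] cell_poly(2)[OF assms(1,4)] cell_poly(2)[OF assms(2,4)]
      by (force simp: Z_def)
  qed
  then have "emeasure lborel (cell i) = 0"
    by (subst (asm) AE_iff_measurable[of "cell i"]) auto
  moreover have "emeasure lborel (cell i) = ennreal (nd (Suc i) - nd i)" by simp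
  ultimately show False using node_less_iff[of i "Suc i"] by (simp del: node_less_iff add: ennreal_eq_0_iff)
qed

section \<open>A finite orthonormal basis of the discontinuous Galerkin space\<close>

definition mono_fun :: "nat \<times> nat \<Rightarrow> real \<Rightarrow> real" where
  "mono_fun s x = (if x \<in> cell (fst s) then x ^ snd s else 0)"

lemma mono_fun_V_h: "s \<in> {..<M} \<times> {..k} \<Longrightarrow> mono_fun s \<in> Vh"
proof -
  assume s: "s \<in> {..<M} \<times> {..k}"
  obtain i d where [simp]: "s = (i, d)" by (cases s)
  have i: "i < M" "d \<le> k" using s by auto
  have "mono_fun s \<in> L2 a b"
  proof (rule L2_bounded)
    show "mono_fun s \<in> borel_measurable (dom_measure a b)"
      unfolding mono_fun_def by (intro measurable_restrict_space1) (simp, measurable)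
    fix x assume "x \<in> {a..b}"
    then have "\<bar>x\<bar> \<le> \<bar>a\<bar> + \<bar>b\<bar>" by auto
    then have "\<bar>x\<bar> ^ d \<le> (\<bar>a\<bar> + \<bar>b\<bar>) ^ d" by (intro power_mono) auto
    then show "\<bar>mono_fun s x\<bar> \<le> (\<bar>a\<bar> + \<bar>b\<bar>) ^ d"
      by (auto simp: mono_fun_def power_abs)
  qed
  moreover have "\<exists>p. degree p \<le> k \<and> (\<forall>x\<in>cell j. mono_fun s x = poly p x)" if "j < M" for j
  proof (cases "j = i")
    case True
    then show ?thesis using i
      by (intro exI[of _ "monom 1 d"]) (auto simp: mono_fun_def poly_monom degree_monom_eq)
  next
    case False
    then show ?thesis using cell_unique
      by (intro exI[of _ 0]) (fastforce simp: mono_fun_def)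
  qed
  \<comment> \<open>Cutting off to the open cell supplies the point values at \<open>a\<close> and
    \<open>b\<close> that \<open>V_h\<close> prescribes.\<close>
  moreover have "mono_fun s a = 0" "mono_fun s b = 0"
    using cell_subset[OF i(1)] by (auto simp: mono_fun_def)
  ultimately show ?thesis by (simp add: V_h_def)
qed

lemma V_h_mono_fun_expansion:
  assumes "u \<in> Vh"
  shows "L2_eq a b u (\<lambda>x. \<Sum>s\<in>{..<M} \<times> {..k}. coeff (cell_poly u (fst s)) (snd s) * mono_fun s x)"
proof (rule L2_eq_cellI)
  fix i x assume i: "i < M" "x \<in> cell i"
  have "(\<Sum>s\<in>{..<M} \<times> {..k}. coeff (cell_poly u (fst s)) (snd s) * mono_fun s x)
    = (\<Sum>j<M. \<Sum>d\<le>k. coeff (cell_poly u j) d * mono_fun (j, d) x)"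
    by (simp add: sum.cartesian_product case_prod_unfold)
  also have "\<dots> = (\<Sum>j<M. if j = i then \<Sum>d\<le>k. coeff (cell_poly u i) d * x ^ d else 0)"
  proof (rule sum.cong[OF refl])
    fix j assume "j \<in> {..<M}"
    show "(\<Sum>d\<le>k. coeff (cell_poly u j) d * mono_fun (j, d) x) = (if j = i then \<Sum>d\<le>k. coeff (cell_poly u i) d * x ^ d else 0)"
    proof (cases "j = i")
      case False
      then have "x \<notin> cell j" using cell_unique i by blast
      then have "mono_fun (j, d) x = 0" for d by (simp only: mono_fun_def fst_conv if_False)
      with False show ?thesis by simp
    qed (use i in \<open>simp only: mono_fun_def\<close>, simp)
  qed
  also have "\<dots> = (\<Sum>d\<le>k. coeff (cell_poly u i) d * x ^ d)" using i by simp
  also have "\<dots> = poly (cell_poly u i) x" unfolding poly_altdef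
    using cell_poly(1)[OF assms i(1)]
    by (intro sum.mono_neutral_right) (auto simp: coeff_eq_0)
  also have "\<dots> = u x" using cell_poly(2)[OF assms i] by simp
  finally show "u x = (\<Sum>s\<in>{..<M} \<times> {..k}. coeff (cell_poly u (fst s)) (snd s) * mono_fun s x)" by simp
qed

text \<open>Vectors are absorbed one at a time. A vector whose residual has norm zero adds nothing,
  so \<open>S\<close> may be linearly dependent and \<open>N\<close> is left existential.\<close>

lemma gram_schmidt:
  assumes "finite S" "S \<subseteq> Vh"
  shows "\<exists>N \<phi>. L2_orthonormal a b {..<N} \<phi> \<and> (\<forall>i<N. \<phi> i \<in> Vh) \<and>
    (\<forall>w\<in>S. L2_eq a b w (\<lambda>x. \<Sum>i<N. inn w (\<phi> i) * \<phi> i x))"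
  using assms
proof (induction S rule: finite_induct)
  case empty
  show ?case by (intro exI[of _ "0::nat"]) (auto simp: L2_orthonormal_def)
next
  case (insert w S)
  then obtain N \<phi> where on: "L2_orthonormal a b {..<N} \<phi>" and V: "\<And>i. i < N \<Longrightarrow> \<phi> i \<in> Vh"
    and ex: "\<And>w. w \<in> S \<Longrightarrow> L2_eq a b w (\<lambda>x. \<Sum>i<N. inn w (\<phi> i) * \<phi> i x)" by auto
  define r where "r = (\<lambda>x. w x - (\<Sum>i<N. inn w (\<phi> i) * \<phi> i x))"
  have w: "w \<in> Vh" and wL: "w \<in> L2 a b" using insert V_h_L2 by auto
  have pV: "(\<lambda>x. \<Sum>i<N. inn w (\<phi> i) * \<phi> i x) \<in> Vh" by (intro V_h_sum V_h_cmult V) simp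
  have r: "r \<in> Vh" unfolding r_def by (intro V_h_diff w pV)
  show ?case
  proof (cases "nrm r = 0")
    case True
    then have "L2_eq a b r (\<lambda>x. 0)" using L2_norm_eq_0 V_h_L2[OF r] by blast
    then have "L2_eq a b w (\<lambda>x. \<Sum>i<N. inn w (\<phi> i) * \<phi> i x)"
      by (simp add: r_def L2_eq_iff_diff[of a b w])
    with on V ex show ?thesis by (intro exI[of _ N] exI[of _ \<phi>]) auto
  next
    case False
    have r\<phi>: "inn r (\<phi> i) = 0" if "i < N" for i
      using that wL V_h_L2[OF pV] V_h_L2[OF V] orthonormal_coeff[OF on, of "{..<N}" i]
      by (simp add: r_def L2_inner_diff_left)
    define \<psi> where "\<psi> = \<phi>(N := (\<lambda>x. (1 / nrm r) * r x))"
    have \<psi>N: "\<psi> N = (\<lambda>x. (1 / nrm r) * r x)" and \<psi>i: "\<And>i. i < N \<Longrightarrow> \<psi> i = \<phi> i"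
      by (auto simp: \<psi>_def)
    have V': "\<psi> i \<in> Vh" if "i < Suc N" for i
      using that V V_h_cmult[OF r] by (cases "i = N") (auto simp only: \<psi>N \<psi>i less_Suc_eq)
    have NN: "inn (\<psi> N) (\<psi> N) = 1"
      unfolding \<psi>N L2_inner_cmult_left L2_inner_cmult_right L2_norm_sq[symmetric]
      using False by (simp add: power2_eq_square)
    have Ni: "inn (\<psi> N) (\<psi> i) = 0" "inn (\<psi> i) (\<psi> N) = 0" if "i < N" for i
      using r\<phi>[OF that] by (simp_all only: \<psi>N \<psi>i[OF that] L2_inner_cmult_left L2_inner_cmult_right L2_inner_commute[of a b "\<phi> i" r] mult_zero_right)
    have on': "L2_orthonormal a b {..<Suc N} \<psi>"
      unfolding L2_orthonormal_def
    proof (intro conjI ballI)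
      fix i assume "i \<in> {..<Suc N}" then show "\<psi> i \<in> L2 a b" using V' V_h_L2 by auto
    next
      fix i j assume "i \<in> {..<Suc N}" "j \<in> {..<Suc N}"
      then show "inn (\<psi> i) (\<psi> j) = (if i = j then 1 else 0)"
        using NN Ni on by (auto simp: less_Suc_eq \<psi>i L2_orthonormal_def)
    qed
    \<comment> \<open>For \<open>w\<close> itself the new coefficient is the norm of the residual,
      which restores \<open>w\<close> exactly; for earlier vectors it has to vanish.\<close>
    have "L2_eq a b v (\<lambda>x. \<Sum>i<Suc N. inn v (\<psi> i) * \<psi> i x)" if v: "v \<in> insert w S" for v
    proof (cases "v = w")
      case True
      have "w = (\<lambda>x. r x + 1 * (\<Sum>i<N. inn w (\<phi> i) * \<phi> i x))" by (simp add: r_def)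
      then have "inn w r = (nrm r)\<^sup>2 + inn (\<lambda>x. \<Sum>i<N. inn w (\<phi> i) * \<phi> i x) r"
        using L2_inner_add_left[OF V_h_L2[OF r] V_h_L2[OF pV] V_h_L2[OF r]]
        by (simp add: L2_norm_sq)
      also have "inn (\<lambda>x. \<Sum>i<N. inn w (\<phi> i) * \<phi> i x) r = 0"
        by (subst orthonormal_inner_sum[OF on V_h_L2[OF r]]) (simp add: r\<phi>)
      finally have "inn w (\<psi> N) = nrm r" using False
        by (simp only: \<psi>N L2_inner_cmult_right) (simp add: power2_eq_square)
      then have "(\<Sum>i<Suc N. inn w (\<psi> i) * \<psi> i x) = w x" for x
        using False by (simp add: \<psi>i \<psi>N) (simp add: r_def)
      with True show ?thesis by simp
    next
      case False
      then have vS: "v \<in> S" using v by simp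
      have vL: "v \<in> L2 a b" using vS insert V_h_L2 by auto
      \<comment> \<open>An earlier \<open>v\<close> is a combination of the old basis vectors, to
        all of which the residual \<open>r\<close> is orthogonal.\<close>
      have "inn v r = inn (\<lambda>x. \<Sum>i<N. inn v (\<phi> i) * \<phi> i x) r"
        by (intro L2_inner_cong ex vS vL L2_eq_refl V_h_L2 r V_h_sum V_h_cmult V) auto
      also have "\<dots> = 0"
        by (subst orthonormal_inner_sum[OF on V_h_L2[OF r]]) (simp add: r\<phi>)
      finally have "inn v (\<psi> N) = 0" by (simp only: \<psi>N L2_inner_cmult_right)
      then show ?thesis using ex[OF vS] by (simp add: \<psi>i)
    qed
    then show ?thesis using on' V' by (intro exI[of _ "Suc N"] exI[of _ \<psi>]) auto
  qed
qed

text \<open>Gram-Schmidt is run on the truncated monomials, which span \<open>V_h\<close> up to null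
  sets; the expansion property extends linearly, since the coefficients of \<open>w\<close> are the
  same combination of those of the monomials.\<close>

lemma V_h_orthonormal_basis:
  "\<exists>N \<phi>. L2_orthonormal a b {..<N} \<phi> \<and> (\<forall>i<N. \<phi> i \<in> Vh) \<and>
    (\<forall>w\<in>Vh. L2_eq a b w (\<lambda>x. \<Sum>i<N. inn w (\<phi> i) * \<phi> i x))"
proof -
  let ?J = "{..<M} \<times> {..k}"
  obtain N \<phi> where on: "L2_orthonormal a b {..<N} \<phi>" and V: "\<And>i. i < N \<Longrightarrow> \<phi> i \<in> Vh"
    and ex: "\<And>s. s \<in> ?J \<Longrightarrow> L2_eq a b (mono_fun s) (\<lambda>x. \<Sum>i<N. inn (mono_fun s) (\<phi> i) * \<phi> i x)"
  proof -
    have "mono_fun ` ?J \<subseteq> Vh" using mono_fun_V_h by blast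
    from gram_schmidt[OF _ this] that show thesis by fast
  qed
  have "L2_eq a b w (\<lambda>x. \<Sum>i<N. inn w (\<phi> i) * \<phi> i x)" if w: "w \<in> Vh" for w
  proof -
    define c where "c s = coeff (cell_poly w (fst s)) (snd s)" for s
    note e1 = V_h_mono_fun_expansion[OF w, folded c_def]
    have mL: "mono_fun s \<in> L2 a b" if "s \<in> ?J" for s using mono_fun_V_h[OF that] by (rule V_h_L2)
    have e2: "L2_eq a b (\<lambda>x. \<Sum>s\<in>?J. c s * mono_fun s x) (\<lambda>x. \<Sum>s\<in>?J. c s * (\<Sum>i<N. inn (mono_fun s) (\<phi> i) * \<phi> i x))"
      by (intro L2_eq_sum L2_eq_cmult ex) auto
    have "inn w (\<phi> i) = (\<Sum>s\<in>?J. c s * inn (mono_fun s) (\<phi> i))" if "i < N" for i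
    proof -
      have "inn w (\<phi> i) = inn (\<lambda>x. \<Sum>s\<in>?J. c s * mono_fun s x) (\<phi> i)"
        using e1 by (intro L2_inner_cong) (auto intro!: V_h_L2 w V that L2_sum L2_cmult mL)
      also have "\<dots> = (\<Sum>s\<in>?J. c s * inn (mono_fun s) (\<phi> i))"
        using V_h_L2[OF V[OF that]] by (subst L2_inner_sum_left) (auto intro!: L2_cmult mL simp: L2_inner_cmult_left)
      finally show ?thesis .
    qed
    then have "(\<Sum>i<N. inn w (\<phi> i) * \<phi> i x) = (\<Sum>s\<in>?J. c s * (\<Sum>i<N. inn (mono_fun s) (\<phi> i) * \<phi> i x))" for x
      by (simp add: sum_distrib_right sum_distrib_left mult.assoc) (rule sum.swap)
    then show ?thesis using L2_eq_trans[OF e1 e2] by simp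
  qed
  with on V show ?thesis by (intro exI[of _ N] exI[of _ \<phi>]) blast
qed

end

section \<open>Coordinates and the orthogonal projection\<close>

locale dg_basis = dg_mesh +
  fixes N :: nat and \<phi> :: "nat \<Rightarrow> real \<Rightarrow> real"
  assumes \<phi>_on: "L2_orthonormal a b {..<N} \<phi>" and \<phi>_V: "\<And>i. i < N \<Longrightarrow> \<phi> i \<in> Vh"
    and \<phi>_exp: "\<And>w. w \<in> Vh \<Longrightarrow> L2_eq a b w (\<lambda>x. \<Sum>i<N. inn w (\<phi> i) * \<phi> i x)"
begin

lemma \<phi>_L2: "i < N \<Longrightarrow> \<phi> i \<in> L2 a b"
  by (simp add: V_h_L2 \<phi>_V)

lemma sum_\<phi>_V: "(\<lambda>x. \<Sum>i<N. c i * \<phi> i x) \<in> Vh"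
  by (intro V_h_sum V_h_cmult \<phi>_V) simp

lemma \<phi>_norm [simp]: "i < N \<Longrightarrow> nrm (\<phi> i) = 1"
  using \<phi>_on by (simp add: L2_norm_def L2_orthonormal_def)

lemma V_h_inner:
  assumes "u \<in> L2 a b" "v \<in> Vh"
  shows "inn u v = (\<Sum>i<N. inn u (\<phi> i) * inn v (\<phi> i))"
proof -
  have "inn v u = inn (\<lambda>x. \<Sum>i<N. inn v (\<phi> i) * \<phi> i x) u"
    by (rule L2_inner_cong[OF \<phi>_exp[OF assms(2)] L2_eq_refl V_h_L2[OF assms(2)] V_h_L2[OF sum_\<phi>_V] assms(1) assms(1)])
  also have "\<dots> = (\<Sum>i<N. inn v (\<phi> i) * inn u (\<phi> i))"
    by (rule orthonormal_inner_sum[OF \<phi>_on assms(1)])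
  finally show ?thesis by (simp add: mult.commute L2_inner_commute[of a b u v])
qed

lemma V_h_norm_sq: "u \<in> Vh \<Longrightarrow> (nrm u)\<^sup>2 = (\<Sum>i<N. (inn u (\<phi> i))\<^sup>2)"
  unfolding L2_norm_sq by (subst V_h_inner) (simp_all add: V_h_L2 power2_eq_square)

lemma V_h_eqI:
  assumes "u \<in> Vh" "v \<in> Vh" "\<And>\<xi>. \<xi> \<in> Vh \<Longrightarrow> inn u \<xi> = inn v \<xi>"
  shows "L2_eq a b u v"
proof -
  have d: "(\<lambda>x. u x - v x) \<in> Vh" by (intro V_h_diff assms)
  have "inn (\<lambda>x. u x - v x) (\<lambda>x. u x - v x) = 0"
    using assms d by (subst L2_inner_diff_left) (auto intro: V_h_L2)
  then show ?thesis using L2_inner_self_eq_0 V_h_L2[OF d] L2_eq_iff_diff by blast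
qed

text \<open>The expansion of \<open>\<xi>\<close> holds only almost everywhere, hence the congruence
  hypothesis. It is applied to \<open>B_h\<close>, which sees one-sided limits and derivatives
  rather than integrals alone.\<close>

lemma V_h_functional:
  assumes lin: "\<And>\<xi> \<eta> c d. \<xi> \<in> Vh \<Longrightarrow> \<eta> \<in> Vh \<Longrightarrow> l (\<lambda>x. c * \<xi> x + d * \<eta> x) = c * l \<xi> + d * (l \<eta> :: real)"
    and cong: "\<And>\<xi> \<eta>. \<xi> \<in> Vh \<Longrightarrow> \<eta> \<in> Vh \<Longrightarrow> L2_eq a b \<xi> \<eta> \<Longrightarrow> l \<xi> = l \<eta>"
    and \<xi>: "\<xi> \<in> Vh"
  shows "l \<xi> = (\<Sum>i<N. inn \<xi> (\<phi> i) * l (\<phi> i))"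
proof -
  have l0: "l (\<lambda>x. 0) = 0" using lin[OF V_h_zero V_h_zero, of 0 0] by simp
  have "n \<le> N \<Longrightarrow> l (\<lambda>x. \<Sum>i<n. c i * \<phi> i x) = (\<Sum>i<n. c i * l (\<phi> i))" for n c
  proof (induction n)
    case (Suc n)
    have "(\<lambda>x. \<Sum>i<n. c i * \<phi> i x) \<in> Vh" using Suc.prems by (intro V_h_sum V_h_cmult \<phi>_V) auto
    from lin[OF this \<phi>_V[of n], of 1 "c n"] Suc show ?case by simp
  qed (simp add: l0)
  from this[of N] cong[OF \<xi> sum_\<phi>_V \<phi>_exp[OF \<xi>]] show ?thesis by simp
qed

text \<open>The Fourier sum over the basis of \<open>V_h\<close> is a witness for the choice in the
  definition.\<close>

lemma P_h:
  assumes "u \<in> L2 a b"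
  shows "P_h a b M k u \<in> Vh" "\<And>\<xi>. \<xi> \<in> Vh \<Longrightarrow> inn (P_h a b M k u) \<xi> = inn u \<xi>"
proof -
  define w where "w = (\<lambda>x. \<Sum>i<N. inn u (\<phi> i) * \<phi> i x)"
  have w: "w \<in> Vh" unfolding w_def by (rule sum_\<phi>_V)
  have "inn (\<lambda>x. u x - w x) \<xi> = 0" if \<xi>: "\<xi> \<in> Vh" for \<xi>
  proof -
    have "inn w \<xi> = inn u \<xi>" unfolding w_def
      using \<xi> by (simp add: orthonormal_inner_sum[OF \<phi>_on] V_h_L2 V_h_inner[OF assms \<xi>])
    then show ?thesis using assms w \<xi> by (simp add: L2_inner_diff_left V_h_L2)
  qed
  with w have "\<exists>w. w \<in> Vh \<and> (\<forall>\<xi>\<in>Vh. inn (\<lambda>x. u x - w x) \<xi> = 0)" by blast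
  from someI_ex[OF this, folded P_h_def] 
  have *: "P_h a b M k u \<in> Vh" "\<And>\<xi>. \<xi> \<in> Vh \<Longrightarrow> inn (\<lambda>x. u x - P_h a b M k u x) \<xi> = 0" by blast+
  then show "P_h a b M k u \<in> Vh" by simp
  show "inn (P_h a b M k u) \<xi> = inn u \<xi>" if "\<xi> \<in> Vh" for \<xi>
    using *(2)[OF that] *(1) assms that by (simp add: L2_inner_diff_left V_h_L2)
qed

lemma P_h_lincomb:
  assumes "u \<in> L2 a b" "v \<in> L2 a b"
  shows "L2_eq a b (P_h a b M k (\<lambda>x. c * u x + d * v x)) (\<lambda>x. c * P_h a b M k u x + d * P_h a b M k v x)"
  using assms
  by (intro V_h_eqI V_h_lincomb P_h L2_lincomb)
    (simp_all add: P_h L2_lincomb L2_inner_lincomb_left V_h_L2)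

lemma P_h_cong:
  assumes "u \<in> L2 a b" "v \<in> L2 a b" "L2_eq a b u v"
  shows "L2_eq a b (P_h a b M k u) (P_h a b M k v)"
  using assms
  by (intro V_h_eqI P_h) (auto simp: P_h V_h_L2 intro!: L2_inner_cong)

lemma P_h_norm_le:
  assumes "u \<in> L2 a b"
  shows "nrm (P_h a b M k u) \<le> nrm u"
proof -
  let ?p = "P_h a b M k u"
  have "nrm ?p * nrm ?p = inn u ?p"
    using P_h[OF assms] by (simp add: L2_norm_sq flip: power2_eq_square)
  also have "\<dots> \<le> nrm u * nrm ?p"
    using L2_inner_CS[OF assms V_h_L2[OF P_h(1)[OF assms]]] by linarith
  finally have *: "nrm ?p * nrm ?p \<le> nrm u * nrm ?p" .
  show ?thesis
  proof (cases "nrm ?p = 0")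
    case False
    then have "nrm ?p > 0" using L2_norm_nonneg[of a b ?p] by linarith
    with * show ?thesis by (rule mult_right_le_imp_le)
  qed simp
qed

text \<open>The constant 1 violates the boundary values of \<open>V_h\<close>, but the indicator of
  the open interval satisfies them and equals it almost everywhere. Testing the projection against
  it shows that the projected potential energy may be computed with \<open>ft\<close>
  itself.\<close>

lemma integral_P_h:
  assumes "u \<in> L2 a b"
  shows "(\<integral>x. P_h a b M k u x \<partial>dom_measure a b) = (\<integral>x. u x \<partial>dom_measure a b)"
proof -
  define one where "one = (\<lambda>x. if x \<in> {a<..<b} then 1 else 0 :: real)"
  have oneL: "one \<in> L2 a b"
  proof (rule L2_bounded[where K=1])
    show "one \<in> borel_measurable (dom_measure a b)"
      unfolding one_def by (intro measurable_restrict_space1) (simp, measurable)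
  qed (simp add: one_def)
  have one: "one \<in> Vh"
  proof -
    have "\<forall>x\<in>cell i. one x = poly 1 x" if "i < M" for i
      using cell_subset[OF that] unfolding one_def by (auto simp del: greaterThanLessThan_iff)
    then have "\<exists>p. degree p \<le> k \<and> (\<forall>x\<in>cell i. one x = poly p x)" if "i < M" for i
      using that by (intro exI[of _ 1]) auto
    then show ?thesis using oneL by (simp add: V_h_def) (simp add: one_def)
  qed
  have eq: "L2_eq a b one (\<lambda>x. 1)"
  proof (rule L2_eq_cellI)
    fix i x assume "i < M" "x \<in> cell i"
    then have "x \<in> {a<..<b}" using cell_subset by blast
    then show "one x = 1" by (simp add: one_def)
  qed
  have "(\<integral>x. v x \<partial>dom_measure a b) = inn v one" if "v \<in> L2 a b" for v
    using L2_inner_cong[OF L2_eq_refl eq that that oneL L2_const] by (simp add: L2_inner_def)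
  then show ?thesis using assms P_h[OF assms] one by (simp add: V_h_L2)
qed

end

section \<open>The interior penalty form\<close>

lemma Lim_at_right_eq:
  fixes f g :: "real \<Rightarrow> real"
  assumes "c < d" "\<And>x. x \<in> {c<..<d} \<Longrightarrow> f x = g x" "isCont g c"
  shows "Lim (at_right c) f = g c"
proof (rule tendsto_Lim)
  have "(g \<longlongrightarrow> g c) (at_right c)" using assms(3) by (simp add: isCont_def filterlim_at_split)
  moreover have "\<forall>\<^sub>F x in at_right c. f x = g x"
    using assms by (intro eventually_at_rightI[of c d]) auto
  ultimately show "(f \<longlongrightarrow> g c) (at_right c)" by (simp cong: tendsto_cong)
qed simp

lemma Lim_at_left_eq:
  fixes f g :: "real \<Rightarrow> real"
  assumes "c < d" "\<And>x. x \<in> {c<..<d} \<Longrightarrow> f x = g x" "isCont g d"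
  shows "Lim (at_left d) f = g d"
proof (rule tendsto_Lim)
  have "(g \<longlongrightarrow> g d) (at_left d)" using assms(3) by (simp add: isCont_def filterlim_at_split)
  moreover have "\<forall>\<^sub>F x in at_left d. f x = g x"
    using assms by (intro eventually_at_leftI[of c d]) auto
  ultimately show "(f \<longlongrightarrow> g d) (at_left d)" by (simp cong: tendsto_cong)
qed simp

lemma B_h_commute: "B_h a b M \<sigma> u \<xi> = B_h a b M \<sigma> \<xi> u"
  unfolding B_h_def
  by (simp add: mult.commute mult.left_commute)

section \<open>The interior penalty form in terms of cell polynomials\<close>

context dg_mesh
begin

definition jump_poly :: "(nat \<Rightarrow> real poly) \<Rightarrow> nat \<Rightarrow> real" where
  "jump_poly p i = (if i = 0 then - poly (p 0) (nd 0) else if i = M then poly (p (M - 1)) (nd M)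
     else poly (p (i - 1)) (nd i) - poly (p i) (nd i))"

definition average_poly :: "(nat \<Rightarrow> real poly) \<Rightarrow> nat \<Rightarrow> real" where
  "average_poly p i = (if i = 0 then poly (p 0) (nd 0) else if i = M then poly (p (M - 1)) (nd M)
     else (poly (p (i - 1)) (nd i) + poly (p i) (nd i)) / 2)"

text \<open>\<open>B_h\<close> contains \<open>Lim\<close> and \<open>deriv\<close>, which behave
  linearly only where limits and derivatives exist. In terms of the cell polynomials they are
  evaluations and \<open>pderiv\<close>, and bilinearity becomes algebra.\<close>

definition B_poly :: "real \<Rightarrow> (nat \<Rightarrow> real poly) \<Rightarrow> (nat \<Rightarrow> real poly) \<Rightarrow> real" where
  "B_poly \<sigma> p q =
     - (\<Sum>i<M. LINT x:cell i|lborel. poly (pderiv (p i)) x * poly (pderiv (q i)) x)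
     + (\<Sum>i\<le>M. average_poly (\<lambda>i. pderiv (p i)) i * jump_poly q i)
     + (\<Sum>i\<le>M. average_poly (\<lambda>i. pderiv (q i)) i * jump_poly p i)
     - (\<Sum>i\<le>M. \<sigma> / mesh_size a b M * jump_poly p i * jump_poly q i)"

lemma Lim_right_cell:
  assumes "\<And>i x. i < M \<Longrightarrow> x \<in> cell i \<Longrightarrow> f x = poly (p i) x" "i < M"
  shows "Lim (at_right (nd i)) f = poly (p i) (nd i)"
  using assms by (intro Lim_at_right_eq[where d="nd (Suc i)"]) auto

lemma Lim_left_cell:
  assumes "\<And>i x. i < M \<Longrightarrow> x \<in> cell i \<Longrightarrow> f x = poly (p i) x" "i < M"
  shows "Lim (at_left (nd (Suc i))) f = poly (p i) (nd (Suc i))"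
  using assms by (intro Lim_at_left_eq[where c="nd i"]) auto

lemma jump_eq:
  assumes "\<And>i x. i < M \<Longrightarrow> x \<in> cell i \<Longrightarrow> f x = poly (p i) x" "i \<le> M"
  shows "jump a b M f i = jump_poly p i"
proof -
  have R: "i < M \<Longrightarrow> Lim (at_right (nd i)) f = poly (p i) (nd i)"
    using assms(1) by (rule Lim_right_cell)
  \<comment> \<open>The left limit at node \<open>i\<close> lives in cell \<open>i - 1\<close>,
    which exists for positive \<open>i\<close> only; the right limit lives in cell \<open>i\<close>
    and needs \<open>i < M\<close>.\<close>
  have L: "0 < i \<Longrightarrow> Lim (at_left (nd i)) f = poly (p (i - 1)) (nd i)"
    using Lim_left_cell[of f p "i - 1", OF assms(1)] assms(2) by simp
  show ?thesis using R L assms(2) M unfolding jump_def jump_poly_def by (auto simp del: node_0 node_M)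
qed

lemma average_eq:
  assumes "\<And>i x. i < M \<Longrightarrow> x \<in> cell i \<Longrightarrow> f x = poly (p i) x" "i \<le> M"
  shows "average a b M f i = average_poly p i"
proof -
  have R: "i < M \<Longrightarrow> Lim (at_right (nd i)) f = poly (p i) (nd i)"
    using assms(1) by (rule Lim_right_cell)
  have L: "0 < i \<Longrightarrow> Lim (at_left (nd i)) f = poly (p (i - 1)) (nd i)"
    using Lim_left_cell[of f p "i - 1", OF assms(1)] assms(2) by simp
  show ?thesis using R L assms(2) M unfolding average_def average_poly_def by (auto simp del: node_0 node_M)
qed

lemma deriv_cell:
  assumes "u \<in> Vh" "i < M" "x \<in> cell i"
  shows "deriv u x = poly (pderiv (cell_poly u i)) x"
proof (rule DERIV_imp_deriv)
  show "(u has_real_derivative poly (pderiv (cell_poly u i)) x) (at x)"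
    by (rule has_field_derivative_transform_within_open[OF poly_DERIV _ assms(3)])
      (use cell_poly(2)[OF assms(1,2)] in auto)
qed

lemma B_h_eq:
  assumes "u \<in> Vh" "v \<in> Vh"
  shows "B_h a b M \<sigma> u v = B_poly \<sigma> (cell_poly u) (cell_poly v)"
proof -
  have J: "jump a b M w i = jump_poly (cell_poly w) i" if "i \<le> M" "w \<in> Vh" for w i
    using that by (intro jump_eq cell_poly(2)) auto
  have A: "average a b M (deriv w) i = average_poly (\<lambda>i. pderiv (cell_poly w i)) i" if "i \<le> M" "w \<in> Vh" for w i
    using that by (intro average_eq deriv_cell) auto
  have I: "(LINT x:cell i|lborel. deriv u x * deriv v x) =
      (LINT x:cell i|lborel. poly (pderiv (cell_poly u i)) x * poly (pderiv (cell_poly v i)) x)" if "i < M" for i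
    using that assms by (intro set_lebesgue_integral_cong) (auto simp: deriv_cell)
  show ?thesis unfolding B_h_def B_poly_def
    using assms by (intro arg_cong2[of _ _ _ _ "(+)"] arg_cong2[of _ _ _ _ "(-)"] arg_cong[of _ _ uminus] sum.cong)
      (auto simp: J A I)
qed

lemma jump_poly_lincomb:
  "jump_poly (\<lambda>i. smult c (p i) + smult d (q i)) i = c * jump_poly p i + d * jump_poly q i"
  by (simp add: jump_poly_def algebra_simps)

lemma average_poly_lincomb:
  "average_poly (\<lambda>i. smult c (p i) + smult d (q i)) i = c * average_poly p i + d * average_poly q i"
  by (simp add: average_poly_def algebra_simps add_divide_distrib)

lemma set_integrable_poly_cell: "set_integrable lborel (cell i) (poly p)"
proof (rule set_integrable_subset[of _ "{nd i..nd (Suc i)}"])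
  show "set_integrable lborel {nd i..nd (Suc i)} (poly p)"
    by (intro borel_integrable_atLeastAtMost') (intro continuous_intros)
qed auto

lemma B_poly_lincomb:
  "B_poly \<sigma> p (\<lambda>i. smult c (q i) + smult d (r i)) = c * B_poly \<sigma> p q + d * B_poly \<sigma> p r"
proof -
  have I: "(LINT x:cell i|lborel. poly (pderiv (p i)) x * poly (pderiv (smult c (q i) + smult d (r i))) x)
    = c * (LINT x:cell i|lborel. poly (pderiv (p i)) x * poly (pderiv (q i)) x)
    + d * (LINT x:cell i|lborel. poly (pderiv (p i)) x * poly (pderiv (r i)) x)" for i
  proof -
    have int: "set_integrable lborel (cell i) (\<lambda>x. e * (poly (pderiv (p i)) x * poly (pderiv s) x))" for s e
    proof -
      have "poly (smult e (pderiv (p i) * pderiv s)) = (\<lambda>x. e * (poly (pderiv (p i)) x * poly (pderiv s) x))"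
        by auto
      then show ?thesis using set_integrable_poly_cell[of i "smult e (pderiv (p i) * pderiv s)"] by (simp only:)
    qed
    have "poly (pderiv (p i)) x * poly (pderiv (smult c (q i) + smult d (r i))) x
      = c * (poly (pderiv (p i)) x * poly (pderiv (q i)) x) + d * (poly (pderiv (p i)) x * poly (pderiv (r i)) x)" for x
      by (simp add: pderiv_add pderiv_smult algebra_simps)
    then show ?thesis by (simp only: set_integral_add(2)[OF int int] set_integral_mult_right)
  qed
  show ?thesis
    unfolding B_poly_def I
    unfolding jump_poly_lincomb pderiv_add pderiv_smult average_poly_lincomb
    by (simp add: algebra_simps sum.distrib sum_distrib_left)
qed

lemma B_h_lincomb_right:
  assumes "u \<in> Vh" "v \<in> Vh" "w \<in> Vh"
  shows "B_h a b M \<sigma> u (\<lambda>x. c * v x + d * w x) = c * B_h a b M \<sigma> u v + d * B_h a b M \<sigma> u w"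
proof -
  \<comment> \<open>\<open>B_poly\<close> reads the polynomials of the cells below \<open>M\<close>
    only; beyond them \<open>cell_poly\<close> is an arbitrary choice and need not be
    linear.\<close>
  have cong: "B_poly \<sigma> p q = B_poly \<sigma> p q'" if "\<And>i. i < M \<Longrightarrow> q i = q' i" for p q q'
  proof -
    have "jump_poly q i = jump_poly q' i" "average_poly (\<lambda>i. pderiv (q i)) i = average_poly (\<lambda>i. pderiv (q' i)) i"
      if "i \<le> M" for i
      using that \<open>\<And>i. i < M \<Longrightarrow> q i = q' i\<close> M by (auto simp: jump_poly_def average_poly_def)
    then show ?thesis using that by (simp add: B_poly_def)
  qed
  have "B_poly \<sigma> (cell_poly u) (cell_poly (\<lambda>x. c * v x + d * w x))
      = B_poly \<sigma> (cell_poly u) (\<lambda>i. smult c (cell_poly v i) + smult d (cell_poly w i))"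
    by (rule cong) (rule cell_poly_lincomb[OF assms(2,3)])
  then show ?thesis using assms by (simp add: B_h_eq V_h_lincomb B_poly_lincomb)
qed

lemma B_h_cong_right:
  assumes "u \<in> Vh" "v \<in> Vh" "w \<in> Vh" "L2_eq a b v w"
  shows "B_h a b M \<sigma> u v = B_h a b M \<sigma> u w"
proof -
  have eq: "cell_poly v i = cell_poly w i" if "i < M" for i
    using cell_poly_cong assms that by blast
  then have "jump_poly (cell_poly v) i = jump_poly (cell_poly w) i"
    "average_poly (\<lambda>i. pderiv (cell_poly v i)) i = average_poly (\<lambda>i. pderiv (cell_poly w i)) i" if "i \<le> M" for i
    using that M by (auto simp: jump_poly_def average_poly_def)
  then show ?thesis using assms eq by (simp add: B_h_eq B_poly_def)
qed

text \<open>Each cell polynomial is bounded on the closed cell, and the values at the finitely many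
  nodes are added separately because they are unrelated to the polynomials.\<close>

lemma V_h_bounded:
  assumes "u \<in> Vh" shows "\<exists>K. \<forall>x\<in>{a..b}. \<bar>u x\<bar> \<le> K"
proof -
  have "\<exists>K. \<forall>x\<in>cell i. \<bar>u x\<bar> \<le> K" if "i < M" for i
  proof -
    have "compact (poly (cell_poly u i) ` {nd i..nd (Suc i)})"
      by (intro compact_continuous_image continuous_intros compact_Icc)
    then obtain K where "\<forall>y\<in>poly (cell_poly u i) ` {nd i..nd (Suc i)}. norm y \<le> K"
      using compact_imp_bounded bounded_iff by meson
    then show ?thesis using cell_poly(2)[OF assms that] by (intro exI[of _ K]) auto
  qed
  then obtain K where K: "\<And>i x. i < M \<Longrightarrow> x \<in> cell i \<Longrightarrow> \<bar>u x\<bar> \<le> K i" by metis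
  define C where "C = (\<Sum>i<M. \<bar>K i\<bar>) + (\<Sum>i\<le>M. \<bar>u (nd i)\<bar>)"
  have "\<bar>u x\<bar> \<le> C" if x: "x \<in> {a..b}" for x
    using node_or_cell[OF x]
  proof
    assume "\<exists>i\<le>M. x = nd i"
    then obtain i where i: "i \<le> M" "x = nd i" by auto
    then have "\<bar>u x\<bar> \<le> (\<Sum>i\<le>M. \<bar>u (nd i)\<bar>)"
      using member_le_sum[of i "{..M}" "\<lambda>i. \<bar>u (nd i)\<bar>"] by simp
    also have "\<dots> \<le> C" by (simp add: C_def sum_nonneg)
    finally show ?thesis .
  next
    assume "\<exists>i<M. x \<in> cell i"
    then obtain i where i: "i < M" "x \<in> cell i" by auto
    then have "\<bar>u x\<bar> \<le> \<bar>K i\<bar>" using K[OF i] by linarith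
    also have "\<dots> \<le> (\<Sum>i<M. \<bar>K i\<bar>)"
      using member_le_sum[of i "{..<M}" "\<lambda>i. \<bar>K i\<bar>"] i by simp
    also have "\<dots> \<le> C" by (simp add: C_def sum_nonneg)
    finally show ?thesis .
  qed
  then show ?thesis by blast
qed

text \<open>\<open>ft\<close> may grow quadratically, so \<open>ft(u)\<close> can fail to be square
  integrable for general \<open>u\<close> in L2. For bounded \<open>u\<close> it is in L2, and
  \<open>P_h\<close> applied to it is meaningful.\<close>

lemma continuous_V_h_L2:
  fixes f :: "real \<Rightarrow> real"
  assumes "u \<in> Vh" "continuous_on UNIV f"
  shows "(\<lambda>x. f (u x)) \<in> L2 a b"
proof -
  obtain K where K: "\<forall>x\<in>{a..b}. \<bar>u x\<bar> \<le> K" using V_h_bounded[OF assms(1)] by auto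
  have "compact (f ` {-K..K})"
    by (intro compact_continuous_image compact_Icc continuous_on_subset[OF assms(2)]) auto
  then obtain C where C: "\<forall>y\<in>f ` {-K..K}. norm y \<le> C"
    using compact_imp_bounded bounded_iff by meson
  show ?thesis
  proof (rule L2_bounded)
    show "(\<lambda>x. f (u x)) \<in> borel_measurable (dom_measure a b)"
      using borel_measurable_continuous_onI[OF assms(2)] L2_measurable[OF V_h_L2[OF assms(1)]]
      by measurable
    fix x assume "x \<in> {a..b}"
    then have "\<bar>u x\<bar> \<le> K" using K by blast
    then have "u x \<in> {-K..K}" by auto
    then show "\<bar>f (u x)\<bar> \<le> C" using C by (metis imageI real_norm_def)
  qed
qed

end

section \<open>The discrete Laplacian\<close>

context dg_basis
begin

text \<open>The combination of the basis with coefficients \<open>B_h u (\<phi> i)\<close> is a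
  witness for the choice in the definition: linearity and congruence of \<open>B_h\<close> in its
  second argument carry the identity from the basis to all test functions.\<close>

lemma Delta_h:
  assumes "u \<in> Vh"
  shows "Delta_h a b M k \<sigma> u \<in> Vh" "\<And>\<xi>. \<xi> \<in> Vh \<Longrightarrow> inn (Delta_h a b M k \<sigma> u) \<xi> = B_h a b M \<sigma> u \<xi>"
proof -
  define w where "w = (\<lambda>x. \<Sum>i<N. B_h a b M \<sigma> u (\<phi> i) * \<phi> i x)"
  have w: "w \<in> Vh" unfolding w_def by (rule sum_\<phi>_V)
  have "inn w \<xi> = B_h a b M \<sigma> u \<xi>" if \<xi>: "\<xi> \<in> Vh" for \<xi>
  proof -
    have "B_h a b M \<sigma> u \<xi> = (\<Sum>i<N. inn \<xi> (\<phi> i) * B_h a b M \<sigma> u (\<phi> i))"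
      by (rule V_h_functional[OF B_h_lincomb_right[OF assms] B_h_cong_right[OF assms] \<xi>])
    then show ?thesis
      unfolding w_def orthonormal_inner_sum[OF \<phi>_on V_h_L2[OF \<xi>]] by (simp add: mult.commute)
  qed
  with w have "\<exists>w. w \<in> Vh \<and> (\<forall>\<xi>\<in>Vh. inn w \<xi> = B_h a b M \<sigma> u \<xi>)" by blast
  from someI_ex[OF this, folded Delta_h_def]
  show "Delta_h a b M k \<sigma> u \<in> Vh" "\<And>\<xi>. \<xi> \<in> Vh \<Longrightarrow> inn (Delta_h a b M k \<sigma> u) \<xi> = B_h a b M \<sigma> u \<xi>"
    by blast+
qed

lemma B_h_coordinates:
  assumes "u \<in> Vh" "v \<in> Vh"
  shows "B_h a b M \<sigma> u v = (\<Sum>i<N. \<Sum>j<N. inn u (\<phi> i) * inn v (\<phi> j) * B_h a b M \<sigma> (\<phi> i) (\<phi> j))"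
proof -
  have "B_h a b M \<sigma> u v = (\<Sum>j<N. inn v (\<phi> j) * B_h a b M \<sigma> u (\<phi> j))"
    by (rule V_h_functional[OF B_h_lincomb_right[OF assms(1)] B_h_cong_right[OF assms(1)] assms(2)])
  moreover have "B_h a b M \<sigma> u (\<phi> j) = (\<Sum>i<N. inn u (\<phi> i) * B_h a b M \<sigma> (\<phi> i) (\<phi> j))" if "j < N" for j
    unfolding B_h_commute[of a b M \<sigma> _ "\<phi> j"]
    by (rule V_h_functional[OF B_h_lincomb_right[OF \<phi>_V[OF that]] B_h_cong_right[OF \<phi>_V[OF that]] assms(1)])
  then have "inn v (\<phi> j) * B_h a b M \<sigma> u (\<phi> j) =
      (\<Sum>i<N. inn u (\<phi> i) * inn v (\<phi> j) * B_h a b M \<sigma> (\<phi> i) (\<phi> j))" if "j < N" for j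
    using that B_h_commute[of a b M \<sigma> "\<phi> j"] by (simp add: sum_distrib_left ac_simps)
  ultimately show ?thesis by (subst sum.swap) simp
qed

end

section \<open>The stochastic integral\<close>

subsection \<open>Mean square convergence\<close>

lemma integral_CS:
  fixes f g :: "'a \<Rightarrow> real"
  assumes [measurable]: "f \<in> borel_measurable M" "g \<in> borel_measurable M"
    and f: "integrable M (\<lambda>x. (f x)\<^sup>2)" and g: "integrable M (\<lambda>x. (g x)\<^sup>2)"
  shows "integrable M (\<lambda>x. f x * g x)"
    and "\<bar>\<integral>x. f x * g x \<partial>M\<bar> \<le> sqrt (\<integral>x. (f x)\<^sup>2 \<partial>M) * sqrt (\<integral>x. (g x)\<^sup>2 \<partial>M)"
proof -
  show int: "integrable M (\<lambda>x. f x * g x)"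
  proof (rule Bochner_Integration.integrable_bound)
    show "integrable M (\<lambda>x. (f x)\<^sup>2 + (g x)\<^sup>2)" using f g by simp
    show "AE x in M. norm (f x * g x) \<le> norm ((f x)\<^sup>2 + (g x)\<^sup>2)"
      using abs_mult_le_squares by (auto simp: abs_of_nonneg)
  qed measurable
  have sq: "(\<integral>\<^sup>+x. (ennreal \<bar>h x\<bar>)\<^sup>2 \<partial>M) = ennreal (\<integral>x. (h x)\<^sup>2 \<partial>M)"
    if "integrable M (\<lambda>x. (h x)\<^sup>2)" for h :: "'a \<Rightarrow> real"
    using that by (subst nn_integral_eq_integral[symmetric]) (auto simp: ennreal_power)
  have "(\<integral>\<^sup>+x. ennreal \<bar>f x\<bar> * ennreal \<bar>g x\<bar> \<partial>M)\<^sup>2 \<le> (\<integral>\<^sup>+x. (ennreal \<bar>f x\<bar>)\<^sup>2 \<partial>M) * (\<integral>\<^sup>+x. (ennreal \<bar>g x\<bar>)\<^sup>2 \<partial>M)"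
    by (rule Cauchy_Schwarz_nn_integral) measurable
  also have "(\<integral>\<^sup>+x. ennreal \<bar>f x\<bar> * ennreal \<bar>g x\<bar> \<partial>M) = ennreal (\<integral>x. \<bar>f x * g x\<bar> \<partial>M)"
    using integrable_abs[OF int] by (subst nn_integral_eq_integral[symmetric]) (auto simp: abs_mult ennreal_mult)
  finally have "ennreal ((\<integral>x. \<bar>f x * g x\<bar> \<partial>M)\<^sup>2) \<le> ennreal ((\<integral>x. (f x)\<^sup>2 \<partial>M) * (\<integral>x. (g x)\<^sup>2 \<partial>M))"
    unfolding sq[OF f] sq[OF g] by (simp only: ennreal_power ennreal_mult integral_nonneg_AE zero_le_power2 abs_ge_zero AE_I2 Bochner_Integration.integral_nonneg)
  then have "(\<integral>x. \<bar>f x * g x\<bar> \<partial>M)\<^sup>2 \<le> (\<integral>x. (f x)\<^sup>2 \<partial>M) * (\<integral>x. (g x)\<^sup>2 \<partial>M)"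
    by (subst (asm) ennreal_le_iff) auto
  then have "(\<integral>x. \<bar>f x * g x\<bar> \<partial>M) \<le> sqrt (\<integral>x. (f x)\<^sup>2 \<partial>M) * sqrt (\<integral>x. (g x)\<^sup>2 \<partial>M)"
    by (simp add: real_le_rsqrt flip: real_sqrt_mult)
  then show "\<bar>\<integral>x. f x * g x \<partial>M\<bar> \<le> sqrt (\<integral>x. (f x)\<^sup>2 \<partial>M) * sqrt (\<integral>x. (g x)\<^sup>2 \<partial>M)"
    using integral_abs_bound[of M "\<lambda>x. f x * g x"] by linarith
qed

lemma integrable_square_add:
  fixes f g :: "'a \<Rightarrow> real"
  assumes [measurable]: "f \<in> borel_measurable M" "g \<in> borel_measurable M"
    and f: "integrable M (\<lambda>x. (f x)\<^sup>2)" and g: "integrable M (\<lambda>x. (g x)\<^sup>2)"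
  shows "integrable M (\<lambda>x. (f x + g x)\<^sup>2)"
proof -
  have "integrable M (\<lambda>x. (f x)\<^sup>2 + 2 * (f x * g x) + (g x)\<^sup>2)"
    using f g integral_CS(1)[of f M g] by simp
  then show ?thesis by (simp add: power2_sum mult.assoc algebra_simps)
qed

text \<open>Used for the truncation of the noise and the approximation by elementary processes, both
  over \<open>P\<close>, and for the integrands over a product measure. The distance is an
  \<open>ennreal\<close> integral, as in the definition of the stochastic integral; square
  integrability of the limit follows from a single \<open>X n\<close> at finite distance.\<close>

lemma L2_convergence:
  fixes X :: "nat \<Rightarrow> 'a \<Rightarrow> real"
  assumes [measurable]: "\<And>n. X n \<in> borel_measurable M" "Y \<in> borel_measurable M"
    and X: "\<And>n. integrable M (\<lambda>x. (X n x)\<^sup>2)"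
    and lim: "(\<lambda>n. \<integral>\<^sup>+x. ennreal ((X n x - Y x)\<^sup>2) \<partial>M) \<longlonglongrightarrow> 0"
  shows "integrable M (\<lambda>x. (Y x)\<^sup>2)"
    and "(\<lambda>n. \<integral>x. (X n x)\<^sup>2 \<partial>M) \<longlonglongrightarrow> (\<integral>x. (Y x)\<^sup>2 \<partial>M)"
    and "\<And>Z. Z \<in> borel_measurable M \<Longrightarrow> integrable M (\<lambda>x. (Z x)\<^sup>2) \<Longrightarrow>
      (\<lambda>n. \<integral>x. Z x * X n x \<partial>M) \<longlonglongrightarrow> (\<integral>x. Z x * Y x \<partial>M)"
proof -
  have "\<forall>\<^sub>F n in sequentially. (\<integral>\<^sup>+x. ennreal ((X n x - Y x)\<^sup>2) \<partial>M) < 1"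
    using lim by (rule order_tendstoD) simp
  then obtain n where "(\<integral>\<^sup>+x. ennreal ((X n x - Y x)\<^sup>2) \<partial>M) < 1"
    by (auto simp: eventually_sequentially)
  then have D0: "integrable M (\<lambda>x. (X n x - Y x)\<^sup>2)"
    by (intro integrableI_nonneg) (auto intro: less_trans)
  have "integrable M (\<lambda>x. (X n x + - (X n x - Y x))\<^sup>2)"
    using X D0 by (intro integrable_square_add) (simp_all add: power2_commute)
  then show Y: "integrable M (\<lambda>x. (Y x)\<^sup>2)" by simp
  have D: "integrable M (\<lambda>x. (X n x - Y x)\<^sup>2)" for n
    using integrable_square_add[of "X n" M "\<lambda>x. - Y x"] X Y by simp
  define d where "d n = (\<integral>x. (X n x - Y x)\<^sup>2 \<partial>M)" for n
  have "(\<lambda>n. ennreal (d n)) \<longlonglongrightarrow> ennreal 0"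
    using lim unfolding d_def by (simp add: nn_integral_eq_integral[OF D])
  then have d: "d \<longlonglongrightarrow> 0" by (subst (asm) tendsto_ennreal_iff) (auto simp: d_def)
  have main: "(\<lambda>n. \<integral>x. Z x * (X n x - Y x) \<partial>M) \<longlonglongrightarrow> 0"
    if [measurable]: "Z \<in> borel_measurable M" and Z: "integrable M (\<lambda>x. (Z x)\<^sup>2)" for Z
  proof (rule Lim_null_comparison)
    show "\<forall>\<^sub>F n in sequentially. norm (\<integral>x. Z x * (X n x - Y x) \<partial>M) \<le> sqrt (\<integral>x. (Z x)\<^sup>2 \<partial>M) * sqrt (d n)"
      using integral_CS(2)[of Z M "\<lambda>x. X _ x - Y x"] Z D by (simp add: d_def)
    have "(\<lambda>n. sqrt (\<integral>x. (Z x)\<^sup>2 \<partial>M) * sqrt (d n)) \<longlonglongrightarrow> sqrt (\<integral>x. (Z x)\<^sup>2 \<partial>M) * sqrt 0"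
      by (intro tendsto_mult_left tendsto_real_sqrt d)
    then show "(\<lambda>n. sqrt (\<integral>x. (Z x)\<^sup>2 \<partial>M) * sqrt (d n)) \<longlonglongrightarrow> 0" by simp
  qed
  show "(\<lambda>n. \<integral>x. Z x * X n x \<partial>M) \<longlonglongrightarrow> (\<integral>x. Z x * Y x \<partial>M)"
    if [measurable]: "Z \<in> borel_measurable M" and Z: "integrable M (\<lambda>x. (Z x)\<^sup>2)" for Z
  proof (rule LIM_zero_cancel)
    have "(\<integral>x. Z x * X n x \<partial>M) - (\<integral>x. Z x * Y x \<partial>M) = (\<integral>x. Z x * (X n x - Y x) \<partial>M)" for n
      using integral_CS(1)[of Z M "X n"] integral_CS(1)[of Z M Y] Z X Y
      by (simp add: right_diff_distrib)
    then show "(\<lambda>n. (\<integral>x. Z x * X n x \<partial>M) - (\<integral>x. Z x * Y x \<partial>M)) \<longlonglongrightarrow> 0"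
      using main[OF that] by simp
  qed
  show "(\<lambda>n. \<integral>x. (X n x)\<^sup>2 \<partial>M) \<longlonglongrightarrow> (\<integral>x. (Y x)\<^sup>2 \<partial>M)"
  proof (rule LIM_zero_cancel)
    have "(\<integral>x. (X n x)\<^sup>2 \<partial>M) - (\<integral>x. (Y x)\<^sup>2 \<partial>M) = d n + 2 * (\<integral>x. Y x * (X n x - Y x) \<partial>M)" for n
    proof -
      have "(\<integral>x. (X n x)\<^sup>2 \<partial>M) = (\<integral>x. (X n x - Y x)\<^sup>2 + 2 * (Y x * (X n x - Y x)) + (Y x)\<^sup>2 \<partial>M)"
        by (intro Bochner_Integration.integral_cong) (auto simp: power2_eq_square algebra_simps)
      then show ?thesis
        using D[of n] Y integral_CS(1)[of Y M "\<lambda>x. X n x - Y x"] by (simp add: d_def)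
    qed
    moreover have "(\<lambda>n. d n + 2 * (\<integral>x. Y x * (X n x - Y x) \<partial>M)) \<longlonglongrightarrow> 0 + 2 * 0"
      by (intro tendsto_add tendsto_mult_left d main Y) measurable
    ultimately show "(\<lambda>n. (\<integral>x. (X n x)\<^sup>2 \<partial>M) - (\<integral>x. (Y x)\<^sup>2 \<partial>M)) \<longlonglongrightarrow> 0" by simp
  qed
qed

subsection \<open>Brownian increments and simple integrands\<close>

locale Q_wiener = prob_space P for P :: "'w measure" +
  fixes F :: "real \<Rightarrow> 'w measure" and T a b :: real
    and q :: "nat \<Rightarrow> real" and e :: "nat \<Rightarrow> real \<Rightarrow> real"
    and \<beta> :: "nat \<Rightarrow> real \<Rightarrow> 'w \<Rightarrow> real" and W :: "real \<Rightarrow> 'w \<Rightarrow> real \<Rightarrow> real"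
  assumes T: "0 < T" and filt: "normal_filtration P F T"
    and wiener: "Q_wiener_process P F T a b q e \<beta> W"
    and e_on: "L2_orthonormal a b UNIV e"
begin

lemma F_subalgebra: "t \<in> {0..T} \<Longrightarrow> subalgebra P (F t)"
  using filt by (simp add: normal_filtration_def)

lemma measurable_F: "t \<in> {0..T} \<Longrightarrow> X \<in> measurable (F t) N \<Longrightarrow> X \<in> measurable P N"
  using measurable_from_subalg F_subalgebra by blast

lemma space_F: "t \<in> {0..T} \<Longrightarrow> space (F t) = space P"
  using F_subalgebra by (simp add: subalgebra_def)

lemma measurable_F_mono:
  assumes "s \<in> {0..T}" "t \<in> {0..T}" "s \<le> t" "X \<in> measurable (F s) N"
  shows "X \<in> measurable (F t) N"
proof (rule measurable_from_subalg[OF _ assms(4)])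
  show "subalgebra (F t) (F s)"
    using assms filt space_F by (auto simp: subalgebra_def normal_filtration_def)
qed

lemma \<beta>_measurable: "t \<in> {0..T} \<Longrightarrow> \<beta> k t \<in> borel_measurable (F t)"
  using wiener by (simp add: Q_wiener_process_def independent_brownian_motions_def)

lemma \<beta>_measurable_P: "t \<in> {0..T} \<Longrightarrow> \<beta> k t \<in> borel_measurable P"
  using \<beta>_measurable measurable_F by blast

lemma W_measurable: "t \<in> {0..T} \<Longrightarrow> W t \<in> F t \<rightarrow>\<^sub>M L2_borel a b"
  using wiener by (simp add: Q_wiener_process_def)

lemma W_L2: "t \<in> {0..T} \<Longrightarrow> \<omega> \<in> space P \<Longrightarrow> W t \<omega> \<in> L2 a b"
  using W_measurable[THEN measurable_space] space_F by simp

lemma e_L2: "e k \<in> L2 a b"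
  using e_on by (simp add: L2_orthonormal_def)

lemma increment_distributed:
  "0 \<le> s \<Longrightarrow> s < t \<Longrightarrow> t \<le> T \<Longrightarrow>
   distributed P lborel (\<lambda>\<omega>. \<beta> k t \<omega> - \<beta> k s \<omega>) (\<lambda>x. ennreal (normal_density 0 (sqrt (t - s)) x))"
  using wiener by (simp add: Q_wiener_process_def independent_brownian_motions_def)

lemma increment_moments:
  assumes "0 \<le> s" "s < t" "t \<le> T"
  shows "integrable P (\<lambda>\<omega>. \<beta> k t \<omega> - \<beta> k s \<omega>)" "expectation (\<lambda>\<omega>. \<beta> k t \<omega> - \<beta> k s \<omega>) = 0"
    "integrable P (\<lambda>\<omega>. (\<beta> k t \<omega> - \<beta> k s \<omega>)\<^sup>2)" "expectation (\<lambda>\<omega>. (\<beta> k t \<omega> - \<beta> k s \<omega>)\<^sup>2) = t - s"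
proof -
  note D = increment_distributed[OF assms, of k]
  have pos: "0 < sqrt (t - s)" using assms by simp
  show "integrable P (\<lambda>\<omega>. \<beta> k t \<omega> - \<beta> k s \<omega>)"
    using integrable_normal_moment_nz_1[OF pos, of 0]
    by (intro distributed_integrable_var[OF D]) auto
  show m: "expectation (\<lambda>\<omega>. \<beta> k t \<omega> - \<beta> k s \<omega>) = 0"
    by (rule normal_distributed_expectation[OF pos D])
  show "integrable P (\<lambda>\<omega>. (\<beta> k t \<omega> - \<beta> k s \<omega>)\<^sup>2)"
    using distributed_integrable[OF D, of "\<lambda>x. x\<^sup>2"] integrable_normal_moment[OF pos, of 0 2] by simp
  show "expectation (\<lambda>\<omega>. (\<beta> k t \<omega> - \<beta> k s \<omega>)\<^sup>2) = t - s"
    using normal_distributed_variance[OF pos D] assms by (simp add: m)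
qed

text \<open>The filtration clause concerns the increments of the whole sequence, so \<open>G\<close>
  may combine several Brownian motions. This covers products of two increments, for which
  independence of each of them from the past would not suffice.\<close>

lemma increment_indep:
  assumes st: "0 \<le> s" "s < t" "t \<le> T" and X: "X \<in> borel_measurable (F s)"
    and G: "G \<in> borel_measurable (Pi\<^sub>M UNIV (\<lambda>_::nat. borel :: real measure))"
  shows "indep_var borel X borel (\<lambda>\<omega>. G (\<lambda>k. \<beta> k t \<omega> - \<beta> k s \<omega>))"
proof -
  let ?D = "\<lambda>\<omega> k. \<beta> k t \<omega> - \<beta> k s \<omega>"
  let ?V = "vimage_algebra (space P) ?D (Pi\<^sub>M UNIV (\<lambda>_::nat. borel :: real measure))"
  have s: "s \<in> {0..T}" and t: "t \<in> {0..T}" using st by auto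
  have ind: "indep_set (sets (F s)) (sets ?V)"
    using wiener st by (simp add: Q_wiener_process_def independent_brownian_motions_def)
  have DV: "?D \<in> measurable ?V (Pi\<^sub>M UNIV (\<lambda>_. borel))"
    by (rule measurable_vimage_algebra1) (auto simp: space_PiM)
  have GV: "(\<lambda>\<omega>. G (?D \<omega>)) \<in> borel_measurable ?V"
    by (rule measurable_compose[OF DV G])
  have DP: "?D \<in> measurable P (Pi\<^sub>M UNIV (\<lambda>_. borel))"
  proof (rule measurable_PiM_single')
    fix k show "(\<lambda>\<omega>. \<beta> k t \<omega> - \<beta> k s \<omega>) \<in> borel_measurable P"
      using \<beta>_measurable_P[OF t] \<beta>_measurable_P[OF s] by measurable
  qed (auto)
  show ?thesis unfolding indep_var_eq
  proof (intro conjI)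
    show "X \<in> borel_measurable P" by (rule measurable_F[OF s X])
    show "(\<lambda>\<omega>. G (?D \<omega>)) \<in> borel_measurable P" by (rule measurable_compose[OF DP G])
    have A: "sigma_sets (space P) {X -` A \<inter> space P |A. A \<in> sets borel} \<subseteq> sets (F s)"
      using sets.sigma_sets_subset[of "{X -` A \<inter> space P |A. A \<in> sets borel}" "F s"] measurable_sets[OF X]
      by (auto simp: space_F[OF s])
    have B: "sigma_sets (space P) {(\<lambda>\<omega>. G (?D \<omega>)) -` A \<inter> space P |A. A \<in> sets borel} \<subseteq> sets ?V"
      using sets.sigma_sets_subset[of "{(\<lambda>\<omega>. G (?D \<omega>)) -` A \<inter> space P |A. A \<in> sets borel}" ?V] measurable_sets[OF GV]
      by auto
    show "indep_set (sigma_sets (space P) {X -` A \<inter> space P |A. A \<in> sets borel})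
       (sigma_sets (space P) {(\<lambda>\<omega>. G (?D \<omega>)) -` A \<inter> space P |A. A \<in> sets borel})"
      using ind A B unfolding indep_sets2_eq by (meson subset_iff subset_trans)
  qed
qed

lemma increment_mean:
  assumes st: "0 \<le> s" "s \<le> t" "t \<le> T" and X: "X \<in> borel_measurable (F s)" "integrable P X"
  shows "integrable P (\<lambda>\<omega>. X \<omega> * (\<beta> k t \<omega> - \<beta> k s \<omega>))"
    "expectation (\<lambda>\<omega>. X \<omega> * (\<beta> k t \<omega> - \<beta> k s \<omega>)) = 0"
proof -
  have "integrable P (\<lambda>\<omega>. X \<omega> * (\<beta> k t \<omega> - \<beta> k s \<omega>)) \<and> expectation (\<lambda>\<omega>. X \<omega> * (\<beta> k t \<omega> - \<beta> k s \<omega>)) = 0"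
  proof (cases "s = t")
    case False
    then have st': "0 \<le> s" "s < t" "t \<le> T" using st by auto
    have ind: "indep_var borel X borel (\<lambda>\<omega>. \<beta> k t \<omega> - \<beta> k s \<omega>)"
      using increment_indep[OF st' X(1), of "\<lambda>x. x k"] by simp
    show ?thesis
      using indep_var_lebesgue_integral[OF ind X(2) increment_moments(1)[OF st']]
        indep_var_integrable[OF ind X(2) increment_moments(1)[OF st']] increment_moments(2)[OF st'] by simp
  qed simp
  then show "integrable P (\<lambda>\<omega>. X \<omega> * (\<beta> k t \<omega> - \<beta> k s \<omega>))"
    "expectation (\<lambda>\<omega>. X \<omega> * (\<beta> k t \<omega> - \<beta> k s \<omega>)) = 0" by auto
qed

text \<open>Independence is assumed for whole paths; an increment is a measurable function of two
  path values and inherits it.\<close>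

lemma increment_orthogonal:
  assumes st: "0 \<le> s" "s < t" "t \<le> T" and jk: "j \<noteq> k"
  shows "integrable P (\<lambda>\<omega>. (\<beta> j t \<omega> - \<beta> j s \<omega>) * (\<beta> k t \<omega> - \<beta> k s \<omega>))"
    "expectation (\<lambda>\<omega>. (\<beta> j t \<omega> - \<beta> j s \<omega>) * (\<beta> k t \<omega> - \<beta> k s \<omega>)) = 0"
proof -
  have s: "s \<in> {0..T}" and t: "t \<in> {0..T}" using st by auto
  have "indep_vars (\<lambda>_. Pi\<^sub>M {0..T} (\<lambda>_. borel)) (\<lambda>k \<omega>. \<lambda>t\<in>{0..T}. \<beta> k t \<omega>) UNIV"
    using wiener by (simp add: Q_wiener_process_def independent_brownian_motions_def)
  then have "indep_vars (\<lambda>_. Pi\<^sub>M {0..T} (\<lambda>_. borel)) (\<lambda>k \<omega>. \<lambda>t\<in>{0..T}. \<beta> k t \<omega>) {j, k}"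
    by (rule indep_vars_subset) simp
  then have "indep_vars (\<lambda>_. borel) (\<lambda>k \<omega>. (\<lambda>t\<in>{0..T}. \<beta> k t \<omega>) t - (\<lambda>t\<in>{0..T}. \<beta> k t \<omega>) s) {j, k}"
    by (rule indep_vars_compose2[where Y="\<lambda>_ x. x t - x s"])
      (intro borel_measurable_diff measurable_component_singleton s t)
  then have ind: "indep_vars (\<lambda>_. borel) (\<lambda>k \<omega>. \<beta> k t \<omega> - \<beta> k s \<omega>) {j, k}"
    using s t by simp
  show "integrable P (\<lambda>\<omega>. (\<beta> j t \<omega> - \<beta> j s \<omega>) * (\<beta> k t \<omega> - \<beta> k s \<omega>))"
    using indep_vars_integrable[OF _ ind] increment_moments(1)[OF st] jk by simp
  show "expectation (\<lambda>\<omega>. (\<beta> j t \<omega> - \<beta> j s \<omega>) * (\<beta> k t \<omega> - \<beta> k s \<omega>)) = 0"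
    using indep_vars_lebesgue_integral[OF _ ind] increment_moments[OF st] jk by simp
qed

text \<open>This is the conditional covariance matrix of the increments given \<open>F s\<close>,
  written with a test variable \<open>X\<close> instead of conditional expectations.\<close>

lemma increment_product:
  assumes st: "0 \<le> s" "s \<le> t" "t \<le> T" and X: "X \<in> borel_measurable (F s)" "integrable P X"
  shows "integrable P (\<lambda>\<omega>. X \<omega> * ((\<beta> j t \<omega> - \<beta> j s \<omega>) * (\<beta> k t \<omega> - \<beta> k s \<omega>)))"
    "expectation (\<lambda>\<omega>. X \<omega> * ((\<beta> j t \<omega> - \<beta> j s \<omega>) * (\<beta> k t \<omega> - \<beta> k s \<omega>)))
      = (if j = k then (t - s) * expectation X else 0)"
proof -
  let ?D = "\<lambda>\<omega>. (\<beta> j t \<omega> - \<beta> j s \<omega>) * (\<beta> k t \<omega> - \<beta> k s \<omega>)"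
  have "integrable P (\<lambda>\<omega>. X \<omega> * ?D \<omega>) \<and> expectation (\<lambda>\<omega>. X \<omega> * ?D \<omega>) = (if j = k then (t - s) * expectation X else 0)"
  proof (cases "s = t")
    case False
    then have st': "0 \<le> s" "s < t" "t \<le> T" using st by auto
    have ind: "indep_var borel X borel ?D"
      using increment_indep[OF st' X(1), of "\<lambda>x. x j * x k"] by simp
    have "integrable P ?D \<and> expectation ?D = (if j = k then t - s else 0)"
      using increment_moments(3,4)[OF st', of k] increment_orthogonal[OF st', of j k]
      by (cases "j = k") (auto simp: power2_eq_square)
    then show ?thesis
      using indep_var_lebesgue_integral[OF ind X(2)] indep_var_integrable[OF ind X(2)] by auto
  qed simp
  then show "integrable P (\<lambda>\<omega>. X \<omega> * ((\<beta> j t \<omega> - \<beta> j s \<omega>) * (\<beta> k t \<omega> - \<beta> k s \<omega>)))"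
    "expectation (\<lambda>\<omega>. X \<omega> * ((\<beta> j t \<omega> - \<beta> j s \<omega>) * (\<beta> k t \<omega> - \<beta> k s \<omega>)))
      = (if j = k then (t - s) * expectation X else 0)" by auto
qed

lemma integrable_mult_bounded:
  fixes X c :: "'w \<Rightarrow> real"
  assumes "integrable P X" "c \<in> borel_measurable P" "\<And>\<omega>. \<omega> \<in> space P \<Longrightarrow> \<bar>c \<omega>\<bar> \<le> C"
  shows "integrable P (\<lambda>\<omega>. c \<omega> * X \<omega>)"
proof (rule Bochner_Integration.integrable_bound)
  show "integrable P (\<lambda>\<omega>. C * X \<omega>)" using assms by simp
  show "(\<lambda>\<omega>. c \<omega> * X \<omega>) \<in> borel_measurable P" using assms by measurable
  show "AE \<omega> in P. norm (c \<omega> * X \<omega>) \<le> norm (C * X \<omega>)"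
    using assms(3) by (intro AE_I2) (force simp: abs_mult intro!: mult_right_mono)
qed

end

text \<open>The scalar case of an elementary process: \<open>c j k\<close> is the integrand of the
  k-th Brownian motion on the j-th interval, bounded and known at its left endpoint.\<close>

locale simple_integrand = Q_wiener P F T a b q e \<beta> W
  for P :: "'w measure" and F T a b q e \<beta> W +
  fixes n :: nat and \<tau> :: "nat \<Rightarrow> real" and c :: "nat \<Rightarrow> nat \<Rightarrow> 'w \<Rightarrow> real"
  assumes \<tau>_0: "\<tau> 0 = 0" and \<tau>_n: "\<tau> n = T" and \<tau>_less: "\<And>j. j < n \<Longrightarrow> \<tau> j < \<tau> (Suc j)"
    and c_meas: "\<And>j k. j < n \<Longrightarrow> c j k \<in> borel_measurable (F (\<tau> j))"
    and c_bounded: "\<And>j k. j < n \<Longrightarrow> \<exists>C. \<forall>\<omega>\<in>space P. \<bar>c j k \<omega>\<bar> \<le> C"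
begin

lemma \<tau>_mono: "i \<le> j \<Longrightarrow> j \<le> n \<Longrightarrow> \<tau> i \<le> \<tau> j"
proof (induction j)
  case (Suc j)
  then show ?case using \<tau>_less[of j] by (cases "i = Suc j") auto
qed simp

lemma \<tau>_range: "j \<le> n \<Longrightarrow> 0 \<le> \<tau> j \<and> \<tau> j \<le> T"
  using \<tau>_mono[of 0 j] \<tau>_mono[of j n] \<tau>_0 \<tau>_n by simp

definition D :: "real \<Rightarrow> nat \<Rightarrow> nat \<Rightarrow> 'w \<Rightarrow> real" where
  "D t j k \<omega> = \<beta> k (min t (\<tau> (Suc j))) \<omega> - \<beta> k (min t (\<tau> j)) \<omega>"

definition len :: "real \<Rightarrow> nat \<Rightarrow> real" where
  "len t j = min t (\<tau> (Suc j)) - min t (\<tau> j)"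

text \<open>Only the first \<open>K\<close> Brownian motions enter, so that every moment is a finite
  sum; \<open>K\<close> tends to infinity in \<open>S_tendsto_J\<close>.\<close>

definition S :: "nat \<Rightarrow> real \<Rightarrow> 'w \<Rightarrow> real" where
  "S K t \<omega> = (\<Sum>(j, k)\<in>{..<n} \<times> {..<K}. c j k \<omega> * D t j k \<omega>)"

lemma c_meas_P: "j < n \<Longrightarrow> c j k \<in> borel_measurable P"
  using measurable_F[OF _ c_meas[of j k]] \<tau>_range[of j] by simp

lemma c_integrable: 
  assumes "j < n" shows "integrable P (\<lambda>\<omega>. c j k \<omega> * c j m \<omega>)"
proof -
  obtain C C' where "\<forall>\<omega>\<in>space P. \<bar>c j k \<omega>\<bar> \<le> C" "\<forall>\<omega>\<in>space P. \<bar>c j m \<omega>\<bar> \<le> C'"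
    using c_bounded assms by meson
  then show ?thesis using c_meas_P[OF assms]
    by (intro integrable_mult_bounded[where C=C] integrable_const_bound[where B=C']) auto
qed

lemma D_moments:
  assumes t: "t \<in> {0..T}" and j: "j < n"
    and X: "\<tau> j \<le> t \<Longrightarrow> X \<in> borel_measurable (F (\<tau> j))" "integrable P X"
  shows "integrable P (\<lambda>\<omega>. X \<omega> * D t j k \<omega>)" "expectation (\<lambda>\<omega>. X \<omega> * D t j k \<omega>) = 0"
    "integrable P (\<lambda>\<omega>. X \<omega> * (D t j k \<omega> * D t j m \<omega>))"
    "expectation (\<lambda>\<omega>. X \<omega> * (D t j k \<omega> * D t j m \<omega>)) = (if k = m then len t j * expectation X else 0)"
proof -
  have r: "0 \<le> \<tau> j" "\<tau> j < \<tau> (Suc j)" "\<tau> (Suc j) \<le> T"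
    using \<tau>_range[of j] \<tau>_range[of "Suc j"] \<tau>_less[OF j] j by auto
  have "integrable P (\<lambda>\<omega>. X \<omega> * D t j k \<omega>) \<and> expectation (\<lambda>\<omega>. X \<omega> * D t j k \<omega>) = 0 \<and>
    integrable P (\<lambda>\<omega>. X \<omega> * (D t j k \<omega> * D t j m \<omega>)) \<and>
    expectation (\<lambda>\<omega>. X \<omega> * (D t j k \<omega> * D t j m \<omega>)) = (if k = m then len t j * expectation X else 0)"
  proof (cases "\<tau> j \<le> t")
    case True
    then have m: "min t (\<tau> j) = \<tau> j" "\<tau> j \<le> min t (\<tau> (Suc j))" "min t (\<tau> (Suc j)) \<le> T" using r t by auto
    show ?thesis
      using increment_mean[OF r(1) m(2,3) X(1)[OF True] X(2), of k]
        increment_product[OF r(1) m(2,3) X(1)[OF True] X(2), of k m]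
      by (simp only: D_def len_def m(1))
  next
    \<comment> \<open>The whole interval lies beyond \<open>t\<close>, so increment and length both
      vanish.\<close>
    case False
    then have "D t j k = (\<lambda>\<omega>. 0)" "len t j = 0" for k using r by (auto simp: D_def len_def min_def)
    then show ?thesis by simp
  qed
  then show "integrable P (\<lambda>\<omega>. X \<omega> * D t j k \<omega>)" "expectation (\<lambda>\<omega>. X \<omega> * D t j k \<omega>) = 0"
    "integrable P (\<lambda>\<omega>. X \<omega> * (D t j k \<omega> * D t j m \<omega>))"
    "expectation (\<lambda>\<omega>. X \<omega> * (D t j k \<omega> * D t j m \<omega>)) = (if k = m then len t j * expectation X else 0)"
    by auto
qed

lemma D_measurable:
  assumes "t \<in> {0..T}" "j < n" "Suc j \<le> l" "l \<le> n"
  shows "D t j k \<in> borel_measurable (F (\<tau> l))"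
proof -
  have r: "0 \<le> \<tau> j" "\<tau> j < \<tau> (Suc j)" "\<tau> (Suc j) \<le> \<tau> l" "\<tau> l \<le> T"
    using \<tau>_range[of j] \<tau>_range[of l] \<tau>_less[of j] \<tau>_mono[of "Suc j" l] assms by auto
  have "\<beta> k (min t (\<tau> (Suc j))) \<in> borel_measurable (F (\<tau> l))" "\<beta> k (min t (\<tau> j)) \<in> borel_measurable (F (\<tau> l))"
    using r assms(1) by (intro measurable_F_mono[OF _ _ _ \<beta>_measurable]; auto simp: min_def)+
  then show ?thesis unfolding D_def by measurable
qed

lemma D_measurable_P: "t \<in> {0..T} \<Longrightarrow> j < n \<Longrightarrow> D t j k \<in> borel_measurable P"
  using measurable_F[OF _ D_measurable[of t j n k]] \<tau>_range[of n] by simp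

lemma S_measurable [measurable]: "t \<in> {0..T} \<Longrightarrow> S K t \<in> borel_measurable P"
  unfolding S_def using D_measurable_P c_meas_P by (intro borel_measurable_sum) (auto simp: case_prod_unfold)

text \<open>On a common interval the conditional covariance decides. On different intervals the
  earlier summand and both coefficients are known at the start of the later interval, whose
  increment has mean zero. The order of \<open>j\<close> and \<open>l\<close> is arranged by
  symmetry in \<open>S_isometry\<close>.\<close>

lemma S_product:
  assumes t: "t \<in> {0..T}" and jl: "j < n" "l < n" "j \<le> l"
  shows "integrable P (\<lambda>\<omega>. (c j k \<omega> * D t j k \<omega>) * (c l m \<omega> * D t l m \<omega>))"
    "expectation (\<lambda>\<omega>. (c j k \<omega> * D t j k \<omega>) * (c l m \<omega> * D t l m \<omega>))
      = (if (j, k) = (l, m) then len t j * expectation (\<lambda>\<omega>. (c j k \<omega>)\<^sup>2) else 0)"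
proof -
  have "integrable P (\<lambda>\<omega>. (c j k \<omega> * D t j k \<omega>) * (c l m \<omega> * D t l m \<omega>)) \<and>
    expectation (\<lambda>\<omega>. (c j k \<omega> * D t j k \<omega>) * (c l m \<omega> * D t l m \<omega>))
      = (if (j, k) = (l, m) then len t j * expectation (\<lambda>\<omega>. (c j k \<omega>)\<^sup>2) else 0)"
  proof (cases "j = l")
    case True
    have X: "(\<lambda>\<omega>. c j k \<omega> * c j m \<omega>) \<in> borel_measurable (F (\<tau> j))"
      using c_meas[OF jl(1)] by measurable
    show ?thesis
      using D_moments(3,4)[OF t jl(1) X c_integrable[OF jl(1)], of k m] True
      by (auto simp: ac_simps power2_eq_square)
  next
    case False
    then have sl: "Suc j \<le> l" using jl by simp
    obtain C C' where C: "\<forall>\<omega>\<in>space P. \<bar>c j k \<omega>\<bar> \<le> C" "\<forall>\<omega>\<in>space P. \<bar>c l m \<omega>\<bar> \<le> C'"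
      using c_bounded jl by meson
    \<comment> \<open>Everything except the later increment, all of it known at
      \<open>\<tau> l\<close>.\<close>
    define X where "X \<omega> = c l m \<omega> * (c j k \<omega> * D t j k \<omega>)" for \<omega>
    have r: "\<tau> j \<in> {0..T}" "\<tau> l \<in> {0..T}" "\<tau> j \<le> \<tau> l"
      using \<tau>_range[of j] \<tau>_range[of l] \<tau>_mono[of j l] jl by auto
    have [measurable]: "c j k \<in> borel_measurable (F (\<tau> l))" "c l m \<in> borel_measurable (F (\<tau> l))"
      "D t j k \<in> borel_measurable (F (\<tau> l))"
      using measurable_F_mono[OF r c_meas[OF jl(1)]] c_meas[OF jl(2)] D_measurable[OF t jl(1) sl] jl by auto
    have X: "X \<in> borel_measurable (F (\<tau> l))" unfolding X_def by measurable
    have "integrable P (\<lambda>\<omega>. 1 * D t j k \<omega>)" by (rule D_moments(1)[OF t jl(1)]) auto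
    then have "integrable P X" unfolding X_def
      using C c_meas_P[OF jl(1)] c_meas_P[OF jl(2)] by (intro integrable_mult_bounded[of _ _ C'] integrable_mult_bounded[of _ _ C]) auto
    from D_moments(1,2)[OF t jl(2) X this, of m] show ?thesis
      using False by (simp add: X_def ac_simps)
  qed
  then show "integrable P (\<lambda>\<omega>. (c j k \<omega> * D t j k \<omega>) * (c l m \<omega> * D t l m \<omega>))"
    "expectation (\<lambda>\<omega>. (c j k \<omega> * D t j k \<omega>) * (c l m \<omega> * D t l m \<omega>))
      = (if (j, k) = (l, m) then len t j * expectation (\<lambda>\<omega>. (c j k \<omega>)\<^sup>2) else 0)" by blast+
qed

lemma S_isometry:
  assumes t: "t \<in> {0..T}"
  shows "integrable P (\<lambda>\<omega>. (S K t \<omega>)\<^sup>2)"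
    "expectation (\<lambda>\<omega>. (S K t \<omega>)\<^sup>2) = (\<Sum>j<n. \<Sum>k<K. len t j * expectation (\<lambda>\<omega>. (c j k \<omega>)\<^sup>2))"
proof -
  let ?I = "{..<n} \<times> {..<K}"
  let ?t = "\<lambda>p \<omega>. c (fst p) (snd p) \<omega> * D t (fst p) (snd p) \<omega>"
  let ?v = "\<lambda>p. len t (fst p) * expectation (\<lambda>\<omega>. (c (fst p) (snd p) \<omega>)\<^sup>2)"
  have prod: "integrable P (\<lambda>\<omega>. ?t p \<omega> * ?t r \<omega>) \<and> expectation (\<lambda>\<omega>. ?t p \<omega> * ?t r \<omega>) = (if p = r then ?v p else 0)"
    if "p \<in> ?I" "r \<in> ?I" for p r
  proof (cases "fst p \<le> fst r")
    case True
    then show ?thesis using S_product[OF t, of "fst p" "fst r" "snd p" "snd r"] that by (auto simp: prod_eq_iff)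
  next
    case False
    then show ?thesis using S_product[OF t, of "fst r" "fst p" "snd r" "snd p"] that
      by (auto simp: prod_eq_iff mult.commute[of "?t p _"])
  qed
  have sq: "(S K t \<omega>)\<^sup>2 = (\<Sum>p\<in>?I. \<Sum>r\<in>?I. ?t p \<omega> * ?t r \<omega>)" for \<omega>
    by (simp add: S_def power2_eq_square sum_product case_prod_unfold)
  have int: "integrable P (\<lambda>\<omega>. \<Sum>r\<in>?I. ?t p \<omega> * ?t r \<omega>)" if "p \<in> ?I" for p
    by (rule Bochner_Integration.integrable_sum) (rule conjunct1[OF prod[OF that]])
  show "integrable P (\<lambda>\<omega>. (S K t \<omega>)\<^sup>2)"
    unfolding sq by (rule Bochner_Integration.integrable_sum) (rule int)
  have "expectation (\<lambda>\<omega>. (S K t \<omega>)\<^sup>2) = (\<Sum>p\<in>?I. expectation (\<lambda>\<omega>. \<Sum>r\<in>?I. ?t p \<omega> * ?t r \<omega>))"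
    unfolding sq by (rule Bochner_Integration.integral_sum) (rule int)
  also have "\<dots> = (\<Sum>p\<in>?I. \<Sum>r\<in>?I. expectation (\<lambda>\<omega>. ?t p \<omega> * ?t r \<omega>))"
    by (rule sum.cong[OF refl], rule Bochner_Integration.integral_sum, rule conjunct1[OF prod])
  also have "\<dots> = (\<Sum>p\<in>?I. \<Sum>r\<in>?I. if p = r then ?v p else 0)"
    by (rule sum.cong[OF refl], rule sum.cong[OF refl], rule conjunct2[OF prod])
  also have "\<dots> = (\<Sum>p\<in>?I. ?v p)" by (intro sum.cong) auto
  finally show "expectation (\<lambda>\<omega>. (S K t \<omega>)\<^sup>2) = (\<Sum>j<n. \<Sum>k<K. len t j * expectation (\<lambda>\<omega>. (c j k \<omega>)\<^sup>2))"
    by (simp add: sum.cartesian_product case_prod_unfold)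
qed

lemma S_martingale:
  assumes st: "0 \<le> s" "s \<le> t" "t \<le> T" and X: "X \<in> borel_measurable (F s)" "integrable P X"
  shows "expectation (\<lambda>\<omega>. X \<omega> * (S K t \<omega> - S K s \<omega>)) = 0"
proof -
  have summand: "integrable P (\<lambda>\<omega>. X \<omega> * (c j k \<omega> * (D t j k \<omega> - D s j k \<omega>))) \<and>
      expectation (\<lambda>\<omega>. X \<omega> * (c j k \<omega> * (D t j k \<omega> - D s j k \<omega>))) = 0" if j: "j < n" for j k
  proof -
    \<comment> \<open>Clamping the partition to [s, t] rewrites the difference of the two stopped
      increments as one Brownian increment. If \<open>\<tau> j\<close> is at most \<open>t\<close>,
      it starts at \<open>r j\<close>, which is at least \<open>s\<close> and
      \<open>\<tau> j\<close>, so both \<open>X\<close> and the coefficient are known there;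
      otherwise both ends coincide.\<close>
    define r where "r i = max s (min t (\<tau> i))" for i
    have D: "D t j k \<omega> - D s j k \<omega> = \<beta> k (r (Suc j)) \<omega> - \<beta> k (r j) \<omega>" for \<omega>
      using st by (auto simp: D_def r_def min_def max_def)
    have \<tau>: "0 \<le> \<tau> j" "\<tau> j < \<tau> (Suc j)" "\<tau> (Suc j) \<le> T"
      using \<tau>_range[of j] \<tau>_range[of "Suc j"] \<tau>_less[OF j] j by auto
    obtain C where C: "\<And>\<omega>. \<omega> \<in> space P \<Longrightarrow> \<bar>c j k \<omega>\<bar> \<le> C" using c_bounded[OF j] by meson
    have int: "integrable P (\<lambda>\<omega>. c j k \<omega> * X \<omega>)"
      by (rule integrable_mult_bounded[OF X(2) c_meas_P[OF j] C])
    show ?thesis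
    proof (cases "\<tau> j \<le> t")
      case True
      then have r: "0 \<le> r j" "r j \<le> r (Suc j)" "r (Suc j) \<le> T" "s \<le> r j" "\<tau> j \<le> r j"
        using \<tau> st by (auto simp: r_def min_def max_def)
      have [measurable]: "X \<in> borel_measurable (F (r j))" "c j k \<in> borel_measurable (F (r j))"
        using r st \<tau> by (auto intro!: measurable_F_mono[OF _ _ _ X(1)] measurable_F_mono[OF _ _ _ c_meas[OF j]])
      have "(\<lambda>\<omega>. c j k \<omega> * X \<omega>) \<in> borel_measurable (F (r j))" by measurable
      from increment_mean[OF r(1-3) this int, of k] show ?thesis unfolding D by (simp add: ac_simps)
    next
      case False
      then have "r (Suc j) = r j" using \<tau> by (auto simp: r_def)
      then show ?thesis unfolding D by simp
    qed
  qed
  have eq: "X \<omega> * (S K t \<omega> - S K s \<omega>) = (\<Sum>(j, k)\<in>{..<n} \<times> {..<K}. X \<omega> * (c j k \<omega> * (D t j k \<omega> - D s j k \<omega>)))" for \<omega>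
    by (simp add: S_def sum_distrib_left right_diff_distrib case_prod_unfold flip: sum_subtractf)
  show ?thesis unfolding eq using summand
    by (subst Bochner_Integration.integral_sum) (auto simp: case_prod_unfold intro!: sum.neutral)
qed

end

subsection \<open>Elementary integrands\<close>

text \<open>Operators are linear only up to \<open>L2_eq\<close>; after pairing with
  \<open>\<phi>\<close> linearity is an equality of real numbers.\<close>

lemma bounded_linear_functional:
  assumes B: "L2_bounded_linear a b B" and \<phi>: "\<phi> \<in> L2 a b"
  shows "\<And>u v c d. u \<in> L2 a b \<Longrightarrow> v \<in> L2 a b \<Longrightarrow>
      L2_inner a b (B (\<lambda>x. c * u x + d * v x)) \<phi> = c * L2_inner a b (B u) \<phi> + d * L2_inner a b (B v) \<phi>"
    and "\<exists>C\<ge>0. \<forall>u\<in>L2 a b. \<bar>L2_inner a b (B u) \<phi>\<bar> \<le> C * L2_norm a b u"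
proof -
  from B obtain C where BL: "\<And>u. u \<in> L2 a b \<Longrightarrow> B u \<in> L2 a b"
    and lin: "\<And>u v c d. u \<in> L2 a b \<Longrightarrow> v \<in> L2 a b \<Longrightarrow>
        L2_eq a b (B (\<lambda>x. c * u x + d * v x)) (\<lambda>x. c * B u x + d * B v x)"
    and C: "\<And>u. u \<in> L2 a b \<Longrightarrow> L2_norm a b (B u) \<le> C * L2_norm a b u"
    unfolding L2_bounded_linear_def by blast
  show "L2_inner a b (B (\<lambda>x. c * u x + d * v x)) \<phi> = c * L2_inner a b (B u) \<phi> + d * L2_inner a b (B v) \<phi>"
    if u: "u \<in> L2 a b" "v \<in> L2 a b" for u v c d
    using L2_inner_cong[OF lin[OF u] L2_eq_refl, of c d \<phi>] u \<phi>
    by (simp add: BL L2_lincomb L2_inner_lincomb_left)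
  show "\<exists>C\<ge>0. \<forall>u\<in>L2 a b. \<bar>L2_inner a b (B u) \<phi>\<bar> \<le> C * L2_norm a b u"
  proof (intro exI[of _ "\<bar>C\<bar> * L2_norm a b \<phi>"] conjI ballI)
    fix u assume u: "u \<in> L2 a b"
    have "\<bar>L2_inner a b (B u) \<phi>\<bar> \<le> L2_norm a b (B u) * L2_norm a b \<phi>"
      by (rule L2_inner_CS[OF BL[OF u] \<phi>])
    also have "\<dots> \<le> (\<bar>C\<bar> * L2_norm a b u) * L2_norm a b \<phi>"
      using C[OF u] by (intro mult_right_mono order_trans[OF C[OF u]]) auto
    finally show "\<bar>L2_inner a b (B u) \<phi>\<bar> \<le> (\<bar>C\<bar> * L2_norm a b \<phi>) * L2_norm a b u" by (simp add: ac_simps)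
  qed simp
qed

lemma linear_functional_sum:
  assumes lin: "\<And>u v c d. u \<in> L2 a b \<Longrightarrow> v \<in> L2 a b \<Longrightarrow> l (\<lambda>x. c * u x + d * v x) = c * l u + d * (l v :: real)"
    and g: "\<And>k. g k \<in> L2 a b"
  shows "l (\<lambda>x. \<Sum>k<(n::nat). c k * g k x) = (\<Sum>k<n. c k * l (g k))"
proof (induction n)
  case 0
  show ?case using lin[of "\<lambda>x. 0" "\<lambda>x. 0" 0 0] by simp
next
  case (Suc n)
  have "(\<lambda>x. \<Sum>k<n. c k * g k x) \<in> L2 a b" by (intro L2_sum L2_cmult g)
  from lin[OF this g[of n], of 1 "c n"] Suc show ?case by simp
qed

text \<open>Operators carry no sigma-algebra here. Finitely many values with measurable level sets
  allow an argument by cases on the value.\<close>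

lemma finite_valued_measurable:
  fixes h :: "'b \<Rightarrow> 'a \<Rightarrow> real"
  assumes fin: "finite (Y ` space M)" and Y: "\<And>B. {\<omega> \<in> space M. Y \<omega> = B} \<in> sets M"
    and h: "\<And>B. B \<in> Y ` space M \<Longrightarrow> h B \<in> borel_measurable M"
  shows "(\<lambda>\<omega>. h (Y \<omega>) \<omega>) \<in> borel_measurable M"
proof -
  have "(\<lambda>\<omega>. \<Sum>B\<in>Y ` space M. indicator {\<omega> \<in> space M. Y \<omega> = B} \<omega> * h B \<omega>) \<in> borel_measurable M"
    using Y h by (intro borel_measurable_sum borel_measurable_times borel_measurable_indicator) auto
  moreover have "(\<Sum>B\<in>Y ` space M. indicator {\<omega> \<in> space M. Y \<omega> = B} \<omega> * h B \<omega>) = h (Y \<omega>) \<omega>"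
    if "\<omega> \<in> space M" for \<omega>
  proof -
    have "(\<Sum>B\<in>Y ` space M. indicator {\<omega> \<in> space M. Y \<omega> = B} \<omega> * h B \<omega>)
      = (\<Sum>B\<in>Y ` space M. if B = Y \<omega> then h B \<omega> else 0)"
      using that by (intro sum.cong) (auto simp: indicator_def)
    then show ?thesis using fin that by simp
  qed
  ultimately show ?thesis by (simp cong: measurable_cong)
qed

lemma tendsto_0_le_ennreal:
  fixes f g :: "nat \<Rightarrow> ennreal"
  assumes "g \<longlonglongrightarrow> 0" "\<And>n. f n \<le> g n"
  shows "f \<longlonglongrightarrow> 0"
  by (rule tendsto_sandwich[OF _ _ tendsto_const assms(1)]) (use assms(2) in auto)

section \<open>Truncation of the Wiener series\<close>

context Q_wiener
begin

sublocale lborel_P: pair_sigma_finite lborel P ..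

abbreviation "bas k \<equiv> (\<lambda>x. sqrt (q k) * e k x)"

lemma bas_L2: "bas k \<in> L2 a b"
  by (intro L2_cmult e_L2)

definition trunc_err :: "nat \<Rightarrow> real \<Rightarrow> 'w \<Rightarrow> real" where
  "trunc_err K r \<omega> = L2_norm a b (\<lambda>x. W r \<omega> x - (\<Sum>k<K. sqrt (q k) * \<beta> k r \<omega> * e k x))"

text \<open>Expanding the square leaves the norm of \<open>W\<close>, its pairings with
  \<open>e k\<close> and the Brownian motions, each of which is measurable.\<close>

lemma trunc_err_measurable:
  assumes r: "r \<in> {0..T}"
  shows "(\<lambda>\<omega>. (trunc_err K r \<omega>)\<^sup>2) \<in> borel_measurable P"
proof -
  have on: "L2_orthonormal a b {..<K} e" using e_on by (rule L2_orthonormal_subset) simp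
  have WP: "W r \<in> P \<rightarrow>\<^sub>M L2_borel a b" using measurable_F[OF r W_measurable[OF r]] .
  have [measurable]: "(\<lambda>\<omega>. L2_norm a b (W r \<omega>)) \<in> borel_measurable P"
    "\<And>k. (\<lambda>\<omega>. L2_inner a b (W r \<omega>) (e k)) \<in> borel_measurable P" "\<And>k. \<beta> k r \<in> borel_measurable P"
    using measurable_compose[OF WP measurable_L2_norm] measurable_compose[OF WP measurable_L2_inner[OF e_L2]]
      \<beta>_measurable_P[OF r] by auto
  have "(trunc_err K r \<omega>)\<^sup>2 = (L2_norm a b (W r \<omega>))\<^sup>2
      - 2 * (\<Sum>k<K. (sqrt (q k) * \<beta> k r \<omega>) * L2_inner a b (W r \<omega>) (e k))
      + (\<Sum>k<K. (sqrt (q k) * \<beta> k r \<omega>)\<^sup>2)" if \<omega>: "\<omega> \<in> space P" for \<omega>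
  proof -
    define p where "p = (\<lambda>x. \<Sum>k<K. (sqrt (q k) * \<beta> k r \<omega>) * e k x)"
    have p: "p \<in> L2 a b" unfolding p_def by (rule orthonormal_sum_mem[OF on])
    have w: "W r \<omega> \<in> L2 a b" by (rule W_L2[OF r \<omega>])
    have "L2_inner a b p p = (\<Sum>k<K. (sqrt (q k) * \<beta> k r \<omega>)\<^sup>2)"
      unfolding p_def by (rule orthonormal_norm_sum[OF on]) simp
    moreover have "L2_inner a b p (W r \<omega>) = (\<Sum>k<K. (sqrt (q k) * \<beta> k r \<omega>) * L2_inner a b (W r \<omega>) (e k))"
      unfolding p_def by (rule orthonormal_inner_sum[OF on w])
    ultimately show ?thesis
      unfolding trunc_err_def fun_cong[OF p_def, symmetric] L2_norm_sq
      using p w by (simp add: L2_inner_diff_left L2_inner_diff_right L2_diff L2_inner_commute[of a b "W r \<omega>" p])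
  qed
  then show ?thesis by (simp cong: measurable_cong)
qed

lemma trunc_err_tendsto:
  "r \<in> {0..T} \<Longrightarrow> (\<lambda>K. \<integral>\<^sup>+\<omega>. ennreal ((trunc_err K r \<omega>)\<^sup>2) \<partial>P) \<longlonglongrightarrow> 0"
  using wiener by (simp add: Q_wiener_process_def trunc_err_def)

end

section \<open>Elementary integrals paired with a test function\<close>

locale elementary_integrand = Q_wiener P F T a b q e \<beta> W
  for P :: "'w measure" and F T a b q e \<beta> W +
  fixes n :: nat and \<tau> :: "nat \<Rightarrow> real" and \<Phi> :: "nat \<Rightarrow> 'w \<Rightarrow> (real \<Rightarrow> real) \<Rightarrow> (real \<Rightarrow> real)"
    and \<phi> :: "real \<Rightarrow> real"
  assumes elem: "elementary_process P F T a b n \<tau> \<Phi>" and \<phi>: "\<phi> \<in> L2 a b"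
begin

text \<open>Since W is the sum of \<open>\<beta> k\<close> times \<open>bas k\<close>, this is the
  scalar integrand that the paired operator puts on the k-th Brownian motion.\<close>

definition coef :: "nat \<Rightarrow> nat \<Rightarrow> 'w \<Rightarrow> real" where
  "coef j k \<omega> = L2_inner a b (\<Phi> j \<omega> (bas k)) \<phi>"

lemma \<Phi>_bl: "j < n \<Longrightarrow> \<omega> \<in> space P \<Longrightarrow> L2_bounded_linear a b (\<Phi> j \<omega>)"
  using elem by (simp add: elementary_process_def)

lemma \<Phi>_L2: "j < n \<Longrightarrow> \<omega> \<in> space P \<Longrightarrow> u \<in> L2 a b \<Longrightarrow> \<Phi> j \<omega> u \<in> L2 a b"
  using \<Phi>_bl by (simp add: L2_bounded_linear_def)

lemma \<Phi>_finite: "j < n \<Longrightarrow> finite (\<Phi> j ` space P)"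
  using elem by (simp add: elementary_process_def)

lemma \<Phi>_sets: "j < n \<Longrightarrow> {\<omega> \<in> space P. \<Phi> j \<omega> = B} \<in> sets (F (\<tau> j))"
  using elem by (simp add: elementary_process_def)

lemma elem_\<tau>_range: "j \<le> n \<Longrightarrow> \<tau> j \<in> {0..T}"
proof -
  have *: "\<tau> 0 = 0" "\<tau> n = T" "\<And>j. j < n \<Longrightarrow> \<tau> j < \<tau> (Suc j)"
    using elem by (auto simp: elementary_process_def)
  have mono: "i \<le> j \<Longrightarrow> j \<le> n \<Longrightarrow> \<tau> i \<le> \<tau> j" for i j
  proof (induction j)
    case (Suc j)
    then show ?case using *(3)[of j] by (cases "i = Suc j") auto
  qed simp
  show "j \<le> n \<Longrightarrow> \<tau> j \<in> {0..T}" using mono[of 0 j] mono[of j n] *(1,2) by simp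
qed

sublocale simple_integrand P F T a b q e \<beta> W n \<tau> coef
proof
  show "\<tau> 0 = 0" "\<tau> n = T" "\<And>j. j < n \<Longrightarrow> \<tau> j < \<tau> (Suc j)"
    using elem by (auto simp: elementary_process_def)
  fix j k assume j: "j < n"
  have sp: "space (F (\<tau> j)) = space P" using space_F elem_\<tau>_range j by simp
  show "coef j k \<in> borel_measurable (F (\<tau> j))" unfolding coef_def
    using finite_valued_measurable[of "\<Phi> j" "F (\<tau> j)" "\<lambda>B \<omega>. L2_inner a b (B (bas k)) \<phi>"]
      \<Phi>_finite[OF j] \<Phi>_sets[OF j] by (simp add: sp)
  show "\<exists>C. \<forall>\<omega>\<in>space P. \<bar>coef j k \<omega>\<bar> \<le> C"
  proof -
    have "finite ((\<lambda>B. \<bar>L2_inner a b (B (bas k)) \<phi>\<bar>) ` (\<Phi> j ` space P))" using \<Phi>_finite[OF j] by simp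
    then show ?thesis
      by (intro exI[of _ "Max ((\<lambda>B. \<bar>L2_inner a b (B (bas k)) \<phi>\<bar>) ` (\<Phi> j ` space P))"])
        (auto simp: coef_def intro!: Max_ge)
  qed
qed

definition J :: "real \<Rightarrow> 'w \<Rightarrow> real" where
  "J t \<omega> = L2_inner a b (elementary_integral W n \<tau> \<Phi> t \<omega>) \<phi>"

lemma min_range: "t \<in> {0..T} \<Longrightarrow> j \<le> n \<Longrightarrow> min t (\<tau> j) \<in> {0..T}"
  using elem_\<tau>_range[of j] by auto

lemma elementary_integral_L2:
  "t \<in> {0..T} \<Longrightarrow> \<omega> \<in> space P \<Longrightarrow> elementary_integral W n \<tau> \<Phi> t \<omega> \<in> L2 a b"
  unfolding elementary_integral_def by (intro L2_sum \<Phi>_L2 L2_diff W_L2 min_range) auto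

lemma J_eq:
  assumes "t \<in> {0..T}" "\<omega> \<in> space P"
  shows "J t \<omega> = (\<Sum>j<n. L2_inner a b (\<Phi> j \<omega> (\<lambda>y. W (min t (\<tau> (Suc j))) \<omega> y - W (min t (\<tau> j)) \<omega> y)) \<phi>)"
  unfolding J_def elementary_integral_def
  using assms by (intro L2_inner_sum_left \<phi> \<Phi>_L2 L2_diff W_L2 min_range) auto

lemma J_measurable:
  assumes t: "t \<in> {0..T}"
  shows "J t \<in> borel_measurable P"
proof -
  have "(\<lambda>\<omega>. L2_inner a b (\<Phi> j \<omega> (\<lambda>y. W (min t (\<tau> (Suc j))) \<omega> y - W (min t (\<tau> j)) \<omega> y)) \<phi>) \<in> borel_measurable P"
    if j: "j < n" for j
  proof (rule finite_valued_measurable[where Y="\<Phi> j" and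
      h="\<lambda>B \<omega>. L2_inner a b (B (\<lambda>y. W (min t (\<tau> (Suc j))) \<omega> y - W (min t (\<tau> j)) \<omega> y)) \<phi>"])
    show "finite (\<Phi> j ` space P)" by (rule \<Phi>_finite[OF j])
    show "{\<omega> \<in> space P. \<Phi> j \<omega> = B} \<in> sets P" for B
      using \<Phi>_sets[OF j] F_subalgebra[OF elem_\<tau>_range[of j]] j by (auto simp: subalgebra_def)
  next
    fix B assume "B \<in> \<Phi> j ` space P"
    then have B: "L2_bounded_linear a b B" using \<Phi>_bl[OF j] by auto
    note fl = bounded_linear_functional[OF B \<phi>]
    obtain C where C: "\<And>u. u \<in> L2 a b \<Longrightarrow> \<bar>L2_inner a b (B u) \<phi>\<bar> \<le> C * L2_norm a b u" using fl(2) by blast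
    have diff: "L2_inner a b (B (\<lambda>x. u x - v x)) \<phi> = L2_inner a b (B u) \<phi> - L2_inner a b (B v) \<phi>"
      if "u \<in> L2 a b" "v \<in> L2 a b" for u v
      using fl(1)[OF that, of 1 "-1"] by simp
    have meas: "(\<lambda>u. L2_inner a b (B u) \<phi>) \<in> borel_measurable (L2_borel a b)"
    proof (rule measurable_L2_borel_lipschitz)
      fix u v assume uv: "u \<in> L2 a b" "v \<in> L2 a b"
      show "\<bar>L2_inner a b (B u) \<phi> - L2_inner a b (B v) \<phi>\<bar> \<le> C * L2_norm a b (\<lambda>x. u x - v x)"
        using C[OF L2_diff[OF uv]] by (simp add: diff uv)
    qed
    have "(\<lambda>\<omega>. L2_inner a b (B (W r \<omega>)) \<phi>) \<in> borel_measurable P" if "r \<in> {0..T}" for r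
      using measurable_compose[OF measurable_F[OF that W_measurable[OF that]] meas] .
    from this[OF min_range[OF t, of "Suc j"]] this[OF min_range[OF t, of j]]
    have "(\<lambda>\<omega>. L2_inner a b (B (W (min t (\<tau> (Suc j))) \<omega>)) \<phi> - L2_inner a b (B (W (min t (\<tau> j)) \<omega>)) \<phi>) \<in> borel_measurable P"
      using j by simp
    then show "(\<lambda>\<omega>. L2_inner a b (B (\<lambda>y. W (min t (\<tau> (Suc j))) \<omega> y - W (min t (\<tau> j)) \<omega> y)) \<phi>) \<in> borel_measurable P"
      using diff W_L2 min_range[OF t, of "Suc j"] min_range[OF t, of j] j by (simp cong: measurable_cong)
  qed
  then have "(\<lambda>\<omega>. \<Sum>j<n. L2_inner a b (\<Phi> j \<omega> (\<lambda>y. W (min t (\<tau> (Suc j))) \<omega> y - W (min t (\<tau> j)) \<omega> y)) \<phi>) \<in> borel_measurable P"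
    by (intro borel_measurable_sum) simp
  then show ?thesis using J_eq[OF t] by (simp cong: measurable_cong)
qed

text \<open>\<open>S K\<close> is \<open>J\<close> with the noise replaced by the first
  \<open>K\<close> terms of its series, so their difference is a paired operator applied to
  truncation errors at the interval ends. \<open>A\<close> is independent of \<open>K\<close> and
  \<open>\<omega>\<close> because each \<open>\<Phi> j\<close> takes finitely many values.\<close>

lemma J_approx:
  assumes t: "t \<in> {0..T}"
  shows "\<exists>A. \<forall>K. \<forall>\<omega>\<in>space P. (S K t \<omega> - J t \<omega>)\<^sup>2
    \<le> (\<Sum>j<n. A * (trunc_err K (min t (\<tau> (Suc j))) \<omega>)\<^sup>2 + A * (trunc_err K (min t (\<tau> j)) \<omega>)\<^sup>2)"
proof -
  have "\<exists>C\<ge>0. \<forall>\<omega>\<in>space P. \<forall>u\<in>L2 a b. \<bar>L2_inner a b (\<Phi> j \<omega> u) \<phi>\<bar> \<le> C * L2_norm a b u" if j: "j < n" for j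
  proof -
    have "\<forall>B\<in>\<Phi> j ` space P. \<exists>C\<ge>0. \<forall>u\<in>L2 a b. \<bar>L2_inner a b (B u) \<phi>\<bar> \<le> C * L2_norm a b u"
      using bounded_linear_functional(2)[OF \<Phi>_bl[OF j] \<phi>] by blast
    then obtain C where C: "\<And>B. B \<in> \<Phi> j ` space P \<Longrightarrow> 0 \<le> C B"
      "\<And>B u. B \<in> \<Phi> j ` space P \<Longrightarrow> u \<in> L2 a b \<Longrightarrow> \<bar>L2_inner a b (B u) \<phi>\<bar> \<le> C B * L2_norm a b u" by metis
    \<comment> \<open>Nonnegative bounds, one per value of \<open>\<Phi> j\<close>, are added up;
      the sum dominates each of them.\<close>
    show ?thesis
    proof (intro exI[of _ "\<Sum>B\<in>\<Phi> j ` space P. C B"] conjI ballI)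
      fix \<omega> u assume \<omega>: "\<omega> \<in> space P" and u: "u \<in> L2 a b"
      have "\<bar>L2_inner a b (\<Phi> j \<omega> u) \<phi>\<bar> \<le> C (\<Phi> j \<omega>) * L2_norm a b u" using C(2) \<omega> u by blast
      also have "\<dots> \<le> (\<Sum>B\<in>\<Phi> j ` space P. C B) * L2_norm a b u"
        using C(1) \<omega> \<Phi>_finite[OF j] by (intro mult_right_mono member_le_sum) auto
      finally show "\<bar>L2_inner a b (\<Phi> j \<omega> u) \<phi>\<bar> \<le> (\<Sum>B\<in>\<Phi> j ` space P. C B) * L2_norm a b u" .
    qed (use C(1) in \<open>auto intro: sum_nonneg\<close>)
  qed
  then obtain C where C0: "\<And>j. j < n \<Longrightarrow> 0 \<le> C j"
    and C: "\<And>j \<omega> u. j < n \<Longrightarrow> \<omega> \<in> space P \<Longrightarrow> u \<in> L2 a b \<Longrightarrow> \<bar>L2_inner a b (\<Phi> j \<omega> u) \<phi>\<bar> \<le> C j * L2_norm a b u"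
    by metis
  define C1 where "C1 = (\<Sum>j<n. C j)"
  have C1: "0 \<le> C1" "\<And>j. j < n \<Longrightarrow> C j \<le> C1"
    unfolding C1_def using C0 by (auto intro!: sum_nonneg member_le_sum)
  have one: "\<bar>(\<Sum>k<K. coef j k \<omega> * D t j k \<omega>) - L2_inner a b (\<Phi> j \<omega> (\<lambda>y. W r' \<omega> y - W r \<omega> y)) \<phi>\<bar>
      \<le> C1 * (trunc_err K r' \<omega> + trunc_err K r \<omega>)"
    if j: "j < n" and \<omega>: "\<omega> \<in> space P" and r: "r = min t (\<tau> j)" "r' = min t (\<tau> (Suc j))" for j K \<omega> r r'
  proof -
    note fl = bounded_linear_functional(1)[OF \<Phi>_bl[OF j \<omega>] \<phi>]
    have rr: "r \<in> {0..T}" "r' \<in> {0..T}" using min_range[OF t, of "Suc j"] min_range[OF t, of j] j by (auto simp: r)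
    define p where "p s = (\<lambda>x. \<Sum>k<K. sqrt (q k) * \<beta> k s \<omega> * e k x)" for s
    define w where "w = (\<lambda>y. W r' \<omega> y - W r \<omega> y)"
    define d where "d = (\<lambda>x. \<Sum>k<K. D t j k \<omega> * (sqrt (q k) * e k x))"
    have pL: "p s \<in> L2 a b" for s unfolding p_def by (intro L2_sum L2_cmult e_L2)
    have wL: "w \<in> L2 a b" unfolding w_def by (intro L2_diff W_L2 rr \<omega>)
    have dL: "d \<in> L2 a b" unfolding d_def by (intro L2_sum L2_cmult e_L2)
    have "L2_inner a b (\<Phi> j \<omega> d) \<phi> = (\<Sum>k<K. D t j k \<omega> * coef j k \<omega>)"
      unfolding d_def coef_def by (rule linear_functional_sum[OF fl bas_L2])
    then have "(\<Sum>k<K. coef j k \<omega> * D t j k \<omega>) - L2_inner a b (\<Phi> j \<omega> w) \<phi> = L2_inner a b (\<Phi> j \<omega> (\<lambda>x. 1 * d x + (-1) * w x)) \<phi>"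
      unfolding fl[OF dL wL] by (simp add: mult.commute)
    also have "\<bar>\<dots>\<bar> \<le> C j * L2_norm a b (\<lambda>x. 1 * d x + (-1) * w x)"
      by (rule C[OF j \<omega> L2_lincomb[OF dL wL]])
    also have "\<dots> \<le> C1 * L2_norm a b (\<lambda>x. 1 * d x + (-1) * w x)"
      using C1(2)[OF j] by (intro mult_right_mono) auto
    also have "L2_norm a b (\<lambda>x. 1 * d x + (-1) * w x) \<le> trunc_err K r' \<omega> + trunc_err K r \<omega>"
    proof -
      have "d x = p r' x - p r x" for x
        by (simp add: d_def p_def D_def r algebra_simps sum_subtractf)
      then have "L2_norm a b (\<lambda>x. 1 * d x + (-1) * w x) = L2_norm a b (\<lambda>x. (p r' x - W r' \<omega> x) + (W r \<omega> x - p r x))"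
        by (intro arg_cong[where f="L2_norm a b"]) (auto simp: w_def)
      also have "\<dots> \<le> L2_norm a b (\<lambda>x. p r' x - W r' \<omega> x) + L2_norm a b (\<lambda>x. W r \<omega> x - p r x)"
        by (intro L2_norm_add_le L2_diff pL W_L2 rr \<omega>)
      also have "\<dots> = trunc_err K r' \<omega> + trunc_err K r \<omega>"
        unfolding L2_norm_minus_commute[of a b "p r'"] by (simp add: trunc_err_def p_def)
      finally show ?thesis .
    qed
    finally show ?thesis using C1(1) by (simp add: w_def mult_left_mono)
  qed
  \<comment> \<open>The factor \<open>real n\<close> comes from Cauchy-Schwarz for the sum over the
    intervals, the 2 from splitting the square of a sum of two errors.\<close>
  define A where "A = 2 * C1\<^sup>2 * real n"
  have "(S K t \<omega> - J t \<omega>)\<^sup>2 \<le> (\<Sum>j<n. A * (trunc_err K (min t (\<tau> (Suc j))) \<omega>)\<^sup>2 + A * (trunc_err K (min t (\<tau> j)) \<omega>)\<^sup>2)"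
    if \<omega>: "\<omega> \<in> space P" for K \<omega>
  proof -
    let ?x = "\<lambda>j. (\<Sum>k<K. coef j k \<omega> * D t j k \<omega>) - L2_inner a b (\<Phi> j \<omega> (\<lambda>y. W (min t (\<tau> (Suc j))) \<omega> y - W (min t (\<tau> j)) \<omega> y)) \<phi>"
    let ?w' = "\<lambda>j. trunc_err K (min t (\<tau> (Suc j))) \<omega>" and ?w = "\<lambda>j. trunc_err K (min t (\<tau> j)) \<omega>"
    have "S K t \<omega> - J t \<omega> = (\<Sum>j<n. ?x j)"
      by (simp add: S_def J_eq[OF t \<omega>] sum_subtractf sum.cartesian_product[symmetric])
    then have "(S K t \<omega> - J t \<omega>)\<^sup>2 \<le> (\<Sum>j<n. (?x j)\<^sup>2) * real n"
      using sum_squared_le_sum_of_squares[of ?x "{..<n}"] by simp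
    also have "\<dots> \<le> (\<Sum>j<n. 2 * C1\<^sup>2 * ((?w' j)\<^sup>2 + (?w j)\<^sup>2)) * real n"
    proof (intro mult_right_mono sum_mono)
      fix j assume "j \<in> {..<n}"
      then have "\<bar>?x j\<bar> \<le> C1 * (?w' j + ?w j)" using one \<omega> by simp
      then have "\<bar>?x j\<bar>\<^sup>2 \<le> (C1 * (?w' j + ?w j))\<^sup>2" by (intro power_mono) auto
      also have "\<dots> = C1\<^sup>2 * (?w' j + ?w j)\<^sup>2" by (simp add: power_mult_distrib)
      also have "\<dots> \<le> C1\<^sup>2 * (2 * ((?w' j)\<^sup>2 + (?w j)\<^sup>2))"
        using sum_squares_bound[of "?w' j" "?w j"] by (intro mult_left_mono) (auto simp: power2_sum)
      finally show "(?x j)\<^sup>2 \<le> 2 * C1\<^sup>2 * ((?w' j)\<^sup>2 + (?w j)\<^sup>2)" by (simp only: power2_abs mult.assoc mult.left_commute)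
    qed simp
    also have "\<dots> = (\<Sum>j<n. A * (?w' j)\<^sup>2 + A * (?w j)\<^sup>2)"
      unfolding sum_distrib_right A_def by (intro sum.cong refl) (simp add: distrib_left distrib_right mult.commute mult.left_commute)
    finally show ?thesis .
  qed
  then show ?thesis by blast
qed

lemma S_tendsto_J:
  assumes t: "t \<in> {0..T}"
  shows "(\<lambda>K. \<integral>\<^sup>+\<omega>. ennreal ((S K t \<omega> - J t \<omega>)\<^sup>2) \<partial>P) \<longlonglongrightarrow> 0"
proof -
  obtain A0 where A0: "\<And>K \<omega>. \<omega> \<in> space P \<Longrightarrow> (S K t \<omega> - J t \<omega>)\<^sup>2
    \<le> (\<Sum>j<n. A0 * (trunc_err K (min t (\<tau> (Suc j))) \<omega>)\<^sup>2 + A0 * (trunc_err K (min t (\<tau> j)) \<omega>)\<^sup>2)"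
    using J_approx[OF t] by blast
  \<comment> \<open>\<open>J_approx\<close> says nothing about the sign of its constant; the
    absolute value can be moved into \<open>ennreal\<close>.\<close>
  define A where "A = \<bar>A0\<bar>"
  have A: "(S K t \<omega> - J t \<omega>)\<^sup>2
    \<le> (\<Sum>j<n. A * (trunc_err K (min t (\<tau> (Suc j))) \<omega>)\<^sup>2 + A * (trunc_err K (min t (\<tau> j)) \<omega>)\<^sup>2)"
    if "\<omega> \<in> space P" for K \<omega>
    using A0[OF that] by (rule order_trans) (auto simp: A_def intro!: sum_mono add_mono mult_right_mono)
  have r: "min t (\<tau> (Suc j)) \<in> {0..T}" "min t (\<tau> j) \<in> {0..T}" if "j < n" for j
    using min_range[OF t, of "Suc j"] min_range[OF t, of j] that by auto
  define I where "I K r = (\<integral>\<^sup>+\<omega>. ennreal ((trunc_err K r \<omega>)\<^sup>2) \<partial>P)" for K r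
  have le: "(\<integral>\<^sup>+\<omega>. ennreal ((S K t \<omega> - J t \<omega>)\<^sup>2) \<partial>P)
    \<le> (\<Sum>j<n. ennreal A * I K (min t (\<tau> (Suc j))) + ennreal A * I K (min t (\<tau> j)))" for K
  proof -
    have "(\<integral>\<^sup>+\<omega>. ennreal ((S K t \<omega> - J t \<omega>)\<^sup>2) \<partial>P)
      \<le> (\<integral>\<^sup>+\<omega>. (\<Sum>j<n. ennreal A * ennreal ((trunc_err K (min t (\<tau> (Suc j))) \<omega>)\<^sup>2) + ennreal A * ennreal ((trunc_err K (min t (\<tau> j)) \<omega>)\<^sup>2)) \<partial>P)"
    proof (rule nn_integral_mono)
      fix \<omega> assume "\<omega> \<in> space P"
      from ennreal_leI[OF A[OF this]] show "ennreal ((S K t \<omega> - J t \<omega>)\<^sup>2) \<le>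
        (\<Sum>j<n. ennreal A * ennreal ((trunc_err K (min t (\<tau> (Suc j))) \<omega>)\<^sup>2) + ennreal A * ennreal ((trunc_err K (min t (\<tau> j)) \<omega>)\<^sup>2))"
        by (simp add: A_def ennreal_mult ennreal_plus flip: sum_ennreal)
    qed
    also have "\<dots> = (\<Sum>j<n. ennreal A * I K (min t (\<tau> (Suc j))) + ennreal A * I K (min t (\<tau> j)))"
      unfolding I_def using trunc_err_measurable r
      by (subst nn_integral_sum) (auto intro!: sum.cong simp: nn_integral_add nn_integral_cmult)
    finally show ?thesis .
  qed
  have "(\<lambda>K. \<Sum>j<n. ennreal A * I K (min t (\<tau> (Suc j))) + ennreal A * I K (min t (\<tau> j))) \<longlonglongrightarrow> (\<Sum>j<n. ennreal A * 0 + ennreal A * 0)"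
    unfolding I_def using trunc_err_tendsto r
    by (intro tendsto_sum tendsto_add ennreal_tendsto_cmult) auto
  then show ?thesis
    using tendsto_0_le_ennreal[OF _ le] by simp
qed

lemmas J_limits = L2_convergence[OF S_measurable J_measurable S_isometry(1) S_tendsto_J]

lemma J_square_integrable: "t \<in> {0..T} \<Longrightarrow> integrable P (\<lambda>\<omega>. (J t \<omega>)\<^sup>2)"
  by (rule J_limits(1))

lemma J_isometry_sums:
  assumes t: "t \<in> {0..T}"
  shows "(\<lambda>k. \<Sum>j<n. len t j * expectation (\<lambda>\<omega>. (coef j k \<omega>)\<^sup>2)) sums expectation (\<lambda>\<omega>. (J t \<omega>)\<^sup>2)"
  using J_limits(2)[OF t t t t] unfolding S_isometry(2)[OF t] sums_def by (subst (asm) sum.swap)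

text \<open>The equality holds for each truncation \<open>S K\<close>, and pairing with the square
  integrable \<open>X\<close> passes to the limit in \<open>K\<close>.\<close>

lemma J_martingale:
  assumes st: "0 \<le> s" "s \<le> t" "t \<le> T" and X: "X \<in> borel_measurable (F s)" "integrable P (\<lambda>\<omega>. (X \<omega>)\<^sup>2)"
  shows "expectation (\<lambda>\<omega>. X \<omega> * J t \<omega>) = expectation (\<lambda>\<omega>. X \<omega> * J s \<omega>)"
proof -
  have s: "s \<in> {0..T}" and t: "t \<in> {0..T}" using st by auto
  have XP: "X \<in> borel_measurable P" by (rule measurable_F[OF s X(1)])
  have XI: "integrable P X" by (rule square_integrable_imp_integrable[OF XP X(2)])
  have "expectation (\<lambda>\<omega>. X \<omega> * S K t \<omega>) = expectation (\<lambda>\<omega>. X \<omega> * S K s \<omega>)" for K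
    using S_martingale[OF st X(1) XI, of K] integral_CS(1)[OF XP S_measurable[OF t] X(2) S_isometry(1)[OF t]]
      integral_CS(1)[OF XP S_measurable[OF s] X(2) S_isometry(1)[OF s]]
    by (simp add: right_diff_distrib)
  then show ?thesis
    using LIMSEQ_unique[OF J_limits(3)[OF t t t t XP X(2)]] J_limits(3)[OF s s s s XP X(2)] by simp
qed

end

text \<open>No measurability of \<open>f\<close> is assumed: the integral of a non-measurable function is the
  supremum over the simple functions below it.\<close>

lemma nn_integral_cmult_le:
  fixes c :: real
  shows "(\<integral>\<^sup>+x. ennreal c * f x \<partial>M) \<le> ennreal c * (\<integral>\<^sup>+x. f x \<partial>M)"
proof (cases "c \<le> 0")
  case False
  then have c: "ennreal (1 / c) * ennreal c = 1" "ennreal c * ennreal (1 / c) = 1"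
    by (simp_all flip: ennreal_mult)
  show ?thesis unfolding nn_integral_def[of M "\<lambda>x. ennreal c * f x"]
  proof (rule SUP_least)
    fix g assume g: "g \<in> {g. simple_function M g \<and> g \<le> (\<lambda>x. ennreal c * f x)}"
    then have g': "g x \<le> ennreal c * f x" and sg: "simple_function M g" for x by (auto simp: le_fun_def)
    have "ennreal (1 / c) * g x \<le> f x" for x
      using mult_left_mono[OF g'[of x], of "ennreal (1 / c)"] by (simp add: c flip: mult.assoc)
    then have "(\<integral>\<^sup>+x. ennreal (1 / c) * g x \<partial>M) \<le> (\<integral>\<^sup>+x. f x \<partial>M)" by (intro nn_integral_mono)
    moreover have "integral\<^sup>S M g = (\<integral>\<^sup>+x. ennreal c * (ennreal (1 / c) * g x) \<partial>M)"
      using sg by (simp add: nn_integral_eq_simple_integral c flip: mult.assoc)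
    moreover have "\<dots> = ennreal c * (\<integral>\<^sup>+x. ennreal (1 / c) * g x \<partial>M)"
      using borel_measurable_simple_function[OF sg] by (intro nn_integral_cmult) measurable
    ultimately show "integral\<^sup>S M g \<le> ennreal c * (\<integral>\<^sup>+x. f x \<partial>M)" by (simp add: mult_left_mono)
  qed
qed (simp add: ennreal_neg)

section \<open>Isometry for elementary integrands\<close>

context elementary_integrand
begin

definition integrand :: "nat \<Rightarrow> real \<Rightarrow> 'w \<Rightarrow> real" where
  "integrand k s \<omega> = (\<Sum>j<n. indicator {\<tau> j<..\<tau> (Suc j)} s * coef j k \<omega>)"

lemma integrand_eq:
  assumes "\<omega> \<in> space P"
  shows "L2_inner a b (elementary_value n \<tau> \<Phi> s \<omega> (bas k)) \<phi> = integrand k s \<omega>"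
  unfolding elementary_value_def integrand_def coef_def
  using assms by (subst L2_inner_sum_left) (auto intro!: L2_cmult \<Phi>_L2 bas_L2 \<phi> sum.cong simp: L2_inner_cmult_left)

lemma elementary_value_L2: "\<omega> \<in> space P \<Longrightarrow> elementary_value n \<tau> \<Phi> s \<omega> (bas k) \<in> L2 a b"
  unfolding elementary_value_def by (intro L2_sum L2_cmult \<Phi>_L2 bas_L2) auto

lemma integrand_measurable: "(\<lambda>(s, \<omega>). integrand k s \<omega>) \<in> borel_measurable (lborel \<Otimes>\<^sub>M P)"
  unfolding integrand_def case_prod_unfold
proof (intro borel_measurable_sum borel_measurable_times)
  fix j assume "j \<in> {..<n}"
  then have [measurable]: "coef j k \<in> borel_measurable P" using c_meas_P by simp
  show "(\<lambda>z. indicator {\<tau> j<..\<tau> (Suc j)} (fst z) :: real) \<in> borel_measurable (lborel \<Otimes>\<^sub>M P)" by measurable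
  show "(\<lambda>z. coef j k (snd z)) \<in> borel_measurable (lborel \<Otimes>\<^sub>M P)" by measurable
qed

text \<open>The time intervals are disjoint, so mixed products vanish; cutting at \<open>t\<close>
  leaves intervals of length \<open>len t j\<close>.\<close>

lemma integrand_square:
  assumes "t \<in> {0..T}"
  shows "(indicator {0..t} s * integrand k s \<omega>)\<^sup>2
    = (\<Sum>j<n. indicator {min t (\<tau> j)<..min t (\<tau> (Suc j))} s * (coef j k \<omega>)\<^sup>2)"
proof -
  let ?i = "\<lambda>j. indicator {\<tau> j<..\<tau> (Suc j)} s :: real"
  have disj: "?i j * ?i l = (if j = l then ?i j else 0)" if "j < n" "l < n" for j l
  proof -
    have "\<tau> (Suc j) \<le> \<tau> l" if "j < l" using \<tau>_mono[of "Suc j" l] that \<open>l < n\<close> by simp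
    moreover have "\<tau> (Suc l) \<le> \<tau> j" if "l < j" using \<tau>_mono[of "Suc l" j] that \<open>j < n\<close> by simp
    ultimately show ?thesis by (cases j l rule: linorder_cases) (auto simp: indicator_def)
  qed
  have "(integrand k s \<omega>)\<^sup>2 = (\<Sum>j<n. \<Sum>l<n. (?i j * ?i l) * (coef j k \<omega> * coef l k \<omega>))"
    unfolding integrand_def power2_eq_square sum_product
    by (intro sum.cong refl) (simp only: mult.assoc mult.left_commute)
  also have "\<dots> = (\<Sum>j<n. \<Sum>l<n. if j = l then ?i j * (coef j k \<omega>)\<^sup>2 else 0)"
    by (intro sum.cong refl) (auto simp: disj power2_eq_square)
  also have "\<dots> = (\<Sum>j<n. ?i j * (coef j k \<omega>)\<^sup>2)" by (intro sum.cong refl) simp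
  finally have "integrand k s \<omega> ^ 2 = (\<Sum>j<n. ?i j * (coef j k \<omega>)\<^sup>2)" .
  then have "(indicator {0..t} s * integrand k s \<omega>)\<^sup>2 = (\<Sum>j<n. indicator {0..t} s * (?i j * (coef j k \<omega>)\<^sup>2))"
    by (cases "s \<in> {0..t}") simp_all
  also have "\<dots> = (\<Sum>j<n. indicator {min t (\<tau> j)<..min t (\<tau> (Suc j))} s * (coef j k \<omega>)\<^sup>2)"
  proof (intro sum.cong refl)
    fix j assume "j \<in> {..<n}"
    then have "0 \<le> \<tau> j" using \<tau>_range[of j] by simp
    then have "s \<in> {0..t} \<and> s \<in> {\<tau> j<..\<tau> (Suc j)} \<longleftrightarrow> s \<in> {min t (\<tau> j)<..min t (\<tau> (Suc j))}"
      by (auto simp: min_def)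
    then show "indicator {0..t} s * (?i j * (coef j k \<omega>)\<^sup>2) = indicator {min t (\<tau> j)<..min t (\<tau> (Suc j))} s * (coef j k \<omega>)\<^sup>2"
      by (cases "s \<in> {min t (\<tau> j)<..min t (\<tau> (Suc j))}"; cases "s \<in> {0..t}"; cases "s \<in> {\<tau> j<..\<tau> (Suc j)}")
        (simp_all only: indicator_simps simp_thms mult_1 mult_zero_left mult_zero_right)
  qed
  finally show ?thesis .
qed

lemma len_nonneg: "j < n \<Longrightarrow> 0 \<le> len t j"
  using \<tau>_less[of j] by (auto simp: len_def)

lemma integrand_nn_integral:
  assumes t: "t \<in> {0..T}"
  shows "(\<integral>\<^sup>+(s, \<omega>). ennreal ((indicator {0..t} s * integrand k s \<omega>)\<^sup>2) \<partial>(lborel \<Otimes>\<^sub>M P))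
    = ennreal (\<Sum>j<n. len t j * expectation (\<lambda>\<omega>. (coef j k \<omega>)\<^sup>2))"
proof -
  let ?I = "\<lambda>j. {min t (\<tau> j)<..min t (\<tau> (Suc j))}"
  have cm: "coef j k \<in> borel_measurable P" if "j < n" for j using c_meas_P that by simp
  note len0 = len_nonneg[of _ t]
  have e0: "0 \<le> expectation (\<lambda>\<omega>. (coef j k \<omega>)\<^sup>2)" for j by simp
  have "(\<integral>\<^sup>+(s, \<omega>). ennreal ((indicator {0..t} s * integrand k s \<omega>)\<^sup>2) \<partial>(lborel \<Otimes>\<^sub>M P))
    = (\<integral>\<^sup>+z. (\<Sum>j<n. indicator (?I j) (fst z) * ennreal ((coef j k (snd z))\<^sup>2)) \<partial>(lborel \<Otimes>\<^sub>M P))"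
    by (intro nn_integral_cong)
      (simp add: case_prod_unfold integrand_square[OF t] sum_ennreal[symmetric] ennreal_mult ennreal_indicator
        del: sum_ennreal)
  also have "\<dots> = (\<Sum>j<n. \<integral>\<^sup>+z. indicator (?I j) (fst z) * ennreal ((coef j k (snd z))\<^sup>2) \<partial>(lborel \<Otimes>\<^sub>M P))"
    using cm by (intro nn_integral_sum) auto
  also have "\<dots> = (\<Sum>j<n. ennreal (len t j * expectation (\<lambda>\<omega>. (coef j k \<omega>)\<^sup>2)))"
  proof (intro sum.cong refl)
    fix j assume "j \<in> {..<n}"
    then have j: "j < n" by simp
    have [measurable]: "coef j k \<in> borel_measurable P" by (rule cm[OF j])
    have "(\<integral>\<^sup>+z. indicator (?I j) (fst z) * ennreal ((coef j k (snd z))\<^sup>2) \<partial>(lborel \<Otimes>\<^sub>M P))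
      = (\<integral>\<^sup>+s. \<integral>\<^sup>+\<omega>. indicator (?I j) s * ennreal ((coef j k \<omega>)\<^sup>2) \<partial>P \<partial>lborel)"
      by (subst nn_integral_fst[symmetric]) auto
    also have "\<dots> = (\<integral>\<^sup>+s. indicator (?I j) s * ennreal (expectation (\<lambda>\<omega>. (coef j k \<omega>)\<^sup>2)) \<partial>lborel)"
      using c_integrable[OF j, of k k]
      by (simp add: nn_integral_cmult nn_integral_eq_integral power2_eq_square)
    also have "\<dots> = emeasure lborel (?I j) * ennreal (expectation (\<lambda>\<omega>. (coef j k \<omega>)\<^sup>2))"
      by (simp add: nn_integral_multc)
    also have "emeasure lborel (?I j) = ennreal (len t j)"
      using len0[OF j] by (simp add: len_def)
    finally show "(\<integral>\<^sup>+z. indicator (?I j) (fst z) * ennreal ((coef j k (snd z))\<^sup>2) \<partial>(lborel \<Otimes>\<^sub>M P))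
      = ennreal (len t j * expectation (\<lambda>\<omega>. (coef j k \<omega>)\<^sup>2))"
      using len0[OF j] e0 by (simp add: ennreal_mult)
  qed
  also have "\<dots> = ennreal (\<Sum>j<n. len t j * expectation (\<lambda>\<omega>. (coef j k \<omega>)\<^sup>2))"
    using len0 by (intro sum_ennreal) (auto intro!: mult_nonneg_nonneg)
  finally show ?thesis .
qed

text \<open>The left side is arranged as a series over \<open>k\<close> of integrals over time and
  probability, so that it can be read as a squared norm over one product measure.\<close>

lemma J_isometry:
  assumes t: "t \<in> {0..T}"
  shows "(\<Sum>k. \<integral>\<^sup>+(s, \<omega>). ennreal ((indicator {0..t} s * integrand k s \<omega>)\<^sup>2) \<partial>(lborel \<Otimes>\<^sub>M P))
    = ennreal (expectation (\<lambda>\<omega>. (J t \<omega>)\<^sup>2))"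
  unfolding integrand_nn_integral[OF t]
  by (intro suminf_ennreal_eq J_isometry_sums[OF t]) (auto intro!: sum_nonneg mult_nonneg_nonneg len_nonneg)

end

subsection \<open>Isometry and martingale property\<close>

lemma nn_integral_count_space_pair:
  assumes "sigma_finite_measure N" "\<And>k. (\<lambda>z. f (k, z)) \<in> borel_measurable N"
  shows "(\<integral>\<^sup>+p. f p \<partial>(count_space (UNIV :: nat set) \<Otimes>\<^sub>M N)) = (\<Sum>k. \<integral>\<^sup>+z. f (k, z) \<partial>N)"
proof -
  have "f \<in> borel_measurable (count_space UNIV \<Otimes>\<^sub>M N)"
    using assms(2) by (intro measurable_pair_measure_countable1) auto
  from sigma_finite_measure.nn_integral_fst[OF assms(1) this, symmetric]
  show ?thesis by (simp add: nn_integral_count_space_nat)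
qed

context Q_wiener
begin

text \<open>The generators of the predictable sigma-algebra are rectangles of a Borel set and an
  event, so predictability is stronger than joint measurability. The indicator extends the function
  by zero beyond [0, T].\<close>

lemma predictable_measurable:
  fixes f :: "real \<times> 'w \<Rightarrow> real"
  assumes f: "f \<in> borel_measurable (predictable_sigma P F T)"
  shows "(\<lambda>z. indicator {0..T} (fst z) * f z) \<in> borel_measurable (lborel \<Otimes>\<^sub>M P)"
proof -
  let ?\<Omega> = "{0..T} \<times> space P"
  let ?G = "{{s<..t} \<times> A | s t A. 0 \<le> s \<and> s \<le> t \<and> t \<le> T \<and> A \<in> sets (F s)} \<union>
      {{0} \<times> A | A. A \<in> sets (F 0)}"
  have FP: "A \<in> sets P" if "A \<in> sets (F s)" "s \<in> {0..T}" for A s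
    using F_subalgebra[OF that(2)] that(1) by (auto simp: subalgebra_def)
  have \<Omega>: "?\<Omega> \<inter> space (lborel \<Otimes>\<^sub>M P) \<in> sets (lborel \<Otimes>\<^sub>M P)"
    by (intro sets.Int sets.top pair_measureI) auto
  have G: "A \<in> sets (lborel \<Otimes>\<^sub>M P)" "A \<subseteq> ?\<Omega>" if "A \<in> ?G" for A
  proof -
    have "\<exists>B C. A = B \<times> C \<and> B \<in> sets lborel \<and> B \<subseteq> {0..T} \<and> C \<in> sets P"
      using that
    proof
      assume "A \<in> {{s<..t} \<times> A | s t A. 0 \<le> s \<and> s \<le> t \<and> t \<le> T \<and> A \<in> sets (F s)}"
      then obtain s t C where "A = {s<..t} \<times> C" "0 \<le> s" "s \<le> t" "t \<le> T" "C \<in> sets (F s)" by blast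
      then show ?thesis using FP[of C s] by (intro exI[of _ "{s<..t}"] exI[of _ C]) auto
    next
      assume "A \<in> {{0} \<times> A | A. A \<in> sets (F 0)}"
      then obtain C where "A = {0} \<times> C" "C \<in> sets (F 0)" by blast
      then show ?thesis using FP[of C 0] T by (intro exI[of _ "{0}"] exI[of _ C]) auto
    qed
    then obtain B C where "A = B \<times> C" "B \<in> sets lborel" "B \<subseteq> {0..T}" "C \<in> sets P" by blast
    then have "A \<in> sets (lborel \<Otimes>\<^sub>M P) \<and> A \<subseteq> ?\<Omega>"
      using sets.sets_into_space[of C P] by (auto intro!: pair_measureI)
    then show "A \<in> sets (lborel \<Otimes>\<^sub>M P)" "A \<subseteq> ?\<Omega>" by auto
  qed
  have "(\<lambda>z. z) \<in> restrict_space (lborel \<Otimes>\<^sub>M P) ?\<Omega> \<rightarrow>\<^sub>M predictable_sigma P F T"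
    unfolding predictable_sigma_def
  proof (rule measurable_measure_of)
    show "?G \<subseteq> Pow ?\<Omega>" by (rule subsetI) (rule PowI, erule G(2))
    show "(\<lambda>z. z) \<in> space (restrict_space (lborel \<Otimes>\<^sub>M P) ?\<Omega>) \<rightarrow> ?\<Omega>" by (auto simp: space_restrict_space)
    fix A assume A: "A \<in> ?G"
    have "A = (\<lambda>z. z) -` A \<inter> space (restrict_space (lborel \<Otimes>\<^sub>M P) ?\<Omega>)"
      using G(2)[OF A] sets.sets_into_space[OF G(1)[OF A]] by (auto simp: space_restrict_space)
    moreover have "A \<in> sets (restrict_space (lborel \<Otimes>\<^sub>M P) ?\<Omega>)"
      unfolding sets_restrict_space_iff[OF \<Omega>] using G[OF A] by simp
    ultimately show "(\<lambda>z. z) -` A \<inter> space (restrict_space (lborel \<Otimes>\<^sub>M P) ?\<Omega>) \<in> sets (restrict_space (lborel \<Otimes>\<^sub>M P) ?\<Omega>)"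
      by simp
  qed
  from measurable_compose[OF this f] have "(\<lambda>z. indicator ?\<Omega> z *\<^sub>R f z) \<in> borel_measurable (lborel \<Otimes>\<^sub>M P)"
    by (subst borel_measurable_restrict_space_iff[OF \<Omega>, symmetric]) simp
  moreover have "indicator ?\<Omega> z *\<^sub>R f z = indicator {0..T} (fst z) * f z" if "z \<in> space (lborel \<Otimes>\<^sub>M P)" for z
    using that by (auto simp: space_pair_measure indicator_def)
  ultimately show ?thesis by (subst measurable_cong[symmetric])
qed

end

locale stoch_integral = Q_wiener P F T a b q e \<beta> W
  for P :: "'w measure" and F T a b q e \<beta> W +
  fixes R :: "(real \<Rightarrow> real) \<Rightarrow> (real \<Rightarrow> real)" and \<Psi> :: "real \<Rightarrow> 'w \<Rightarrow> (real \<Rightarrow> real) \<Rightarrow> (real \<Rightarrow> real)"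
    and I :: "real \<Rightarrow> 'w \<Rightarrow> real \<Rightarrow> real" and \<phi> :: "real \<Rightarrow> real"
  assumes si: "is_stochastic_integral P F T a b R q e W \<Psi> I" and \<phi>L: "\<phi> \<in> L2 a b"
begin

definition \<psi> :: "nat \<Rightarrow> real \<Rightarrow> 'w \<Rightarrow> real" where
  "\<psi> k s \<omega> = L2_inner a b (\<Psi> s \<omega> (bas k)) \<phi>"

lemma \<Psi>_predictable: "(\<lambda>(s, \<omega>). \<Psi> s \<omega> (bas k)) \<in> predictable_sigma P F T \<rightarrow>\<^sub>M L2_borel a b"
  using si by (simp add: is_stochastic_integral_def)

lemma space_predictable: "space (predictable_sigma P F T) = {0..T} \<times> space P"
proof -
  have "A \<subseteq> space P" if "A \<in> sets (F s)" "s \<in> {0..T}" for A s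
    using sets.sets_into_space[OF that(1)] space_F[OF that(2)] by simp
  then show ?thesis unfolding predictable_sigma_def using T
    by (intro space_measure_of) (auto, (meson atLeastAtMost_iff order.trans subsetD less_imp_le order_refl)+)
qed

lemma \<Psi>_L2: "s \<in> {0..T} \<Longrightarrow> \<omega> \<in> space P \<Longrightarrow> \<Psi> s \<omega> (bas k) \<in> L2 a b"
  using measurable_space[OF \<Psi>_predictable, of "(s, \<omega>)" k] by (simp add: space_predictable)

lemma \<psi>_measurable: "t \<le> T \<Longrightarrow> (\<lambda>(s, \<omega>). indicator {0..t} s * \<psi> k s \<omega>) \<in> borel_measurable (lborel \<Otimes>\<^sub>M P)"
proof -
  assume t: "t \<le> T"
  have "(\<lambda>(s, \<omega>). \<psi> k s \<omega>) \<in> borel_measurable (predictable_sigma P F T)"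
    using measurable_compose[OF \<Psi>_predictable measurable_L2_inner[OF \<phi>L]] by (simp add: \<psi>_def case_prod_unfold)
  from predictable_measurable[OF this]
  have "(\<lambda>z. indicator {0..t} (fst z) * (indicator {0..T} (fst z) * (case z of (s, \<omega>) \<Rightarrow> \<psi> k s \<omega>))) \<in> borel_measurable (lborel \<Otimes>\<^sub>M P)"
    by measurable
  moreover have "indicator {0..t} (fst z) * (indicator {0..T} (fst z) * (case z of (s, \<omega>) \<Rightarrow> \<psi> k s \<omega>))
    = (case z of (s, \<omega>) \<Rightarrow> indicator {0..t} s * \<psi> k s \<omega>)" for z
    using t by (auto simp: indicator_def split: prod.splits)
  ultimately show ?thesis by simp
qed

lemma I_measurable: "t \<in> {0..T} \<Longrightarrow> (\<lambda>\<omega>. L2_inner a b (I t \<omega>) \<phi>) \<in> borel_measurable P"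
proof -
  assume t: "t \<in> {0..T}"
  have "I t \<in> F t \<rightarrow>\<^sub>M L2_borel a b" using si t by (simp add: is_stochastic_integral_def)
  from measurable_compose[OF measurable_F[OF t this] measurable_L2_inner[OF \<phi>L]]
  show ?thesis .
qed

lemma I_L2: "t \<in> {0..T} \<Longrightarrow> \<omega> \<in> space P \<Longrightarrow> I t \<omega> \<in> L2 a b"
proof -
  assume t: "t \<in> {0..T}" "\<omega> \<in> space P"
  have "I t \<in> F t \<rightarrow>\<^sub>M L2_borel a b" using si t by (simp add: is_stochastic_integral_def)
  from measurable_space[OF this] t show ?thesis by (simp add: space_F)
qed

text \<open>All three properties hold for the elementary approximations. Their integrals converge
  after pairing by Cauchy-Schwarz; their scalar integrands converge because the series of squared
  differences is at most the squared norm of \<open>\<phi>\<close> times the squared Hilbert-Schmidt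
  distance.\<close>

lemma isometry_martingale:
  shows "\<And>t. t \<in> {0..T} \<Longrightarrow> integrable P (\<lambda>\<omega>. (L2_inner a b (I t \<omega>) \<phi>)\<^sup>2)"
    and "\<And>t. t \<in> {0..T} \<Longrightarrow> ennreal (expectation (\<lambda>\<omega>. (L2_inner a b (I t \<omega>) \<phi>)\<^sup>2))
      = (\<Sum>k. \<integral>\<^sup>+(s, \<omega>). ennreal ((indicator {0..t} s * \<psi> k s \<omega>)\<^sup>2) \<partial>(lborel \<Otimes>\<^sub>M P))"
    and "\<And>s t X. 0 \<le> s \<Longrightarrow> s \<le> t \<Longrightarrow> t \<le> T \<Longrightarrow> X \<in> borel_measurable (F s) \<Longrightarrow> integrable P (\<lambda>\<omega>. (X \<omega>)\<^sup>2) \<Longrightarrow>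
      expectation (\<lambda>\<omega>. X \<omega> * L2_inner a b (I t \<omega>) \<phi>) = expectation (\<lambda>\<omega>. X \<omega> * L2_inner a b (I s \<omega>) \<phi>)"
proof -
  from si obtain n \<tau> \<Phi> where el: "\<And>m. elementary_process P F T a b (n m) (\<tau> m) (\<Phi> m)"
    and HS: "(\<lambda>m. \<integral>\<^sup>+\<omega>. (\<integral>\<^sup>+s. HS0_norm_sq a b q e
                (\<lambda>v x. elementary_value (n m) (\<tau> m) (\<Phi> m) s \<omega> v x - \<Psi> s \<omega> v x)
              * indicator {0..T} s \<partial>lborel) \<partial>P) \<longlonglongrightarrow> 0"
    and Jlim: "\<And>t. t \<in> {0..T} \<Longrightarrow> (\<lambda>m. \<integral>\<^sup>+\<omega>. ennreal ((L2_norm a b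
                  (\<lambda>x. elementary_integral W (n m) (\<tau> m) (\<Phi> m) t \<omega> x - I t \<omega> x))\<^sup>2) \<partial>P) \<longlonglongrightarrow> 0"
    unfolding is_stochastic_integral_def by blast
  interpret E: elementary_integrand P F T a b q e \<beta> W "n m" "\<tau> m" "\<Phi> m" \<phi> for m
    by unfold_locales (rule el, rule \<phi>L)
  let ?N = "(L2_norm a b \<phi>)\<^sup>2"
  have CS: "ennreal ((L2_inner a b u \<phi>)\<^sup>2) \<le> ennreal ?N * ennreal ((L2_norm a b u)\<^sup>2)" if "u \<in> L2 a b" for u
  proof -
    have "\<bar>L2_inner a b u \<phi>\<bar>\<^sup>2 \<le> (L2_norm a b u * L2_norm a b \<phi>)\<^sup>2"
      by (intro power_mono L2_inner_CS that \<phi>L) simp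
    then show ?thesis by (simp add: power_mult_distrib mult.commute flip: ennreal_mult)
  qed
  have Jconv: "(\<lambda>m. \<integral>\<^sup>+\<omega>. ennreal ((E.J m t \<omega> - L2_inner a b (I t \<omega>) \<phi>)\<^sup>2) \<partial>P) \<longlonglongrightarrow> 0" if t: "t \<in> {0..T}" for t
  proof (rule tendsto_0_le_ennreal)
    let ?d = "\<lambda>m \<omega> x. elementary_integral W (n m) (\<tau> m) (\<Phi> m) t \<omega> x - I t \<omega> x"
    let ?G = "\<lambda>m. \<integral>\<^sup>+\<omega>. ennreal ((L2_norm a b (?d m \<omega>))\<^sup>2) \<partial>P"
    show "(\<lambda>m. ennreal ?N * ?G m) \<longlonglongrightarrow> 0"
      using ennreal_tendsto_cmult[OF _ Jlim[OF t], of "ennreal ?N"] by simp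
    fix m
    have WI: "elementary_integral W (n m) (\<tau> m) (\<Phi> m) t \<omega> \<in> L2 a b" "I t \<omega> \<in> L2 a b" if "\<omega> \<in> space P" for \<omega>
      using E.elementary_integral_L2[OF t that] I_L2[OF t that] by auto
    have "(\<integral>\<^sup>+\<omega>. ennreal ((E.J m t \<omega> - L2_inner a b (I t \<omega>) \<phi>)\<^sup>2) \<partial>P)
      \<le> (\<integral>\<^sup>+\<omega>. ennreal ?N * ennreal ((L2_norm a b (?d m \<omega>))\<^sup>2) \<partial>P)"
      using CS[OF L2_diff[OF WI]] by (intro nn_integral_mono) (simp add: E.J_def L2_inner_diff_left WI \<phi>L)
    also have "\<dots> \<le> ennreal ?N * ?G m"
      by (rule nn_integral_cmult_le)
    finally show "(\<integral>\<^sup>+\<omega>. ennreal ((E.J m t \<omega> - L2_inner a b (I t \<omega>) \<phi>)\<^sup>2) \<partial>P) \<le> ennreal ?N * ?G m" .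
  qed
  have Jm: "E.J m t \<in> borel_measurable P" if "t \<in> {0..T}" for m t by (rule E.J_measurable[OF that])
  note lim = L2_convergence[OF Jm I_measurable E.J_square_integrable Jconv]
  show int: "integrable P (\<lambda>\<omega>. (L2_inner a b (I t \<omega>) \<phi>)\<^sup>2)" if t: "t \<in> {0..T}" for t
    by (rule lim(1)[OF t t t t])
  show "expectation (\<lambda>\<omega>. X \<omega> * L2_inner a b (I t \<omega>) \<phi>) = expectation (\<lambda>\<omega>. X \<omega> * L2_inner a b (I s \<omega>) \<phi>)"
    if st: "0 \<le> s" "s \<le> t" "t \<le> T" and X: "X \<in> borel_measurable (F s)" "integrable P (\<lambda>\<omega>. (X \<omega>)\<^sup>2)" for s t X
  proof -
    have s: "s \<in> {0..T}" and t: "t \<in> {0..T}" using st by auto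
    have XP: "X \<in> borel_measurable P" by (rule measurable_F[OF s X(1)])
    show ?thesis
      using LIMSEQ_unique[OF lim(3)[OF t t t t XP X(2)]] lim(3)[OF s s s s XP X(2)] E.J_martingale[OF st X] by simp
  qed
  show "ennreal (expectation (\<lambda>\<omega>. (L2_inner a b (I t \<omega>) \<phi>)\<^sup>2))
      = (\<Sum>k. \<integral>\<^sup>+(s, \<omega>). ennreal ((indicator {0..t} s * \<psi> k s \<omega>)\<^sup>2) \<partial>(lborel \<Otimes>\<^sub>M P))" if t: "t \<in> {0..T}" for t
  proof -
    let ?L = "lborel \<Otimes>\<^sub>M P"
    \<comment> \<open>Counting measure for the index of the Brownian motion makes the whole sequence
      of scalar integrands one function, to which \<open>L2_convergence\<close> applies.\<close>
    let ?B = "count_space (UNIV :: nat set) \<Otimes>\<^sub>M ?L"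
    define X where "X m = (\<lambda>(k, s, \<omega>). indicator {0..t} s * E.integrand m k s \<omega>)" for m
    define Y where "Y = (\<lambda>(k, s, \<omega>). indicator {0..t} s * \<psi> k s \<omega>)"
    have sf: "sigma_finite_measure ?L" by (rule lborel_P.sigma_finite_measure_axioms)
    have im: "(\<lambda>z. E.integrand m k (fst z) (snd z)) \<in> borel_measurable ?L" for m k
      using E.integrand_measurable[of m k] by (simp add: case_prod_unfold)
    have Xm: "(\<lambda>z. X m (k, z)) \<in> borel_measurable ?L" for m k
      unfolding X_def using im by (simp add: case_prod_unfold) 
    have Ym: "(\<lambda>z. Y (k, z)) \<in> borel_measurable ?L" for k
      unfolding Y_def using \<psi>_measurable[of t k] t by (simp add: case_prod_unfold)
    have XB: "X m \<in> borel_measurable ?B" for m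
      using Xm by (intro measurable_pair_measure_countable1) auto
    have YB: "Y \<in> borel_measurable ?B"
      using Ym by (intro measurable_pair_measure_countable1) auto
    have Xsq: "(\<integral>\<^sup>+p. ennreal ((X m p)\<^sup>2) \<partial>?B) = ennreal (expectation (\<lambda>\<omega>. (E.J m t \<omega>)\<^sup>2))" for m
      unfolding E.J_isometry[OF t, symmetric] using Xm
      by (subst nn_integral_count_space_pair[OF sf]) (auto simp: X_def case_prod_unfold)
    have Xint: "integrable ?B (\<lambda>p. (X m p)\<^sup>2)" for m
      using XB by (intro integrableI_nonneg) (auto simp: Xsq)
    have Xval: "(\<integral>p. (X m p)\<^sup>2 \<partial>?B) = expectation (\<lambda>\<omega>. (E.J m t \<omega>)\<^sup>2)" for m
      using Xsq[of m] nn_integral_eq_integral[OF Xint[of m]] by (simp add: integral_nonneg_AE)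
    have conv: "(\<lambda>m. \<integral>\<^sup>+p. ennreal ((X m p - Y p)\<^sup>2) \<partial>?B) \<longlonglongrightarrow> 0"
    proof (rule tendsto_0_le_ennreal)
      let ?H = "\<lambda>m \<omega> s. HS0_norm_sq a b q e (\<lambda>v x. elementary_value (n m) (\<tau> m) (\<Phi> m) s \<omega> v x - \<Psi> s \<omega> v x)
              * indicator {0..T} s"
      show "(\<lambda>m. ennreal ?N * (\<integral>\<^sup>+\<omega>. (\<integral>\<^sup>+s. ?H m \<omega> s \<partial>lborel) \<partial>P)) \<longlonglongrightarrow> 0"
        using ennreal_tendsto_cmult[OF _ HS, of "ennreal ?N"] by simp
      fix m
      define d where "d k z = ennreal ((X m (k, z) - Y (k, z))\<^sup>2)" for k z
      have dm [measurable]: "d k \<in> borel_measurable ?L" for k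
        unfolding d_def using Xm Ym by measurable
      have "(\<integral>\<^sup>+p. ennreal ((X m p - Y p)\<^sup>2) \<partial>?B) = (\<Sum>k. \<integral>\<^sup>+z. d k z \<partial>?L)"
        unfolding d_def using Xm Ym by (subst nn_integral_count_space_pair[OF sf]) auto
      also have "\<dots> = (\<integral>\<^sup>+z. (\<Sum>k. d k z) \<partial>?L)" by (intro nn_integral_suminf[symmetric]) measurable
      \<comment> \<open>Tonelli in the order of \<open>is_stochastic_integral\<close>: time inside,
        probability outside.\<close>
      also have "\<dots> = (\<integral>\<^sup>+\<omega>. \<integral>\<^sup>+s. (\<Sum>k. d k (s, \<omega>)) \<partial>lborel \<partial>P)"
        by (rule lborel_P.nn_integral_snd[symmetric]) measurable
      also have "\<dots> \<le> (\<integral>\<^sup>+\<omega>. \<integral>\<^sup>+s. ennreal ?N * ?H m \<omega> s \<partial>lborel \<partial>P)"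
      proof (intro nn_integral_mono)
        fix s \<omega> assume \<omega>: "\<omega> \<in> space P"
        let ?D = "\<lambda>k x. elementary_value (n m) (\<tau> m) (\<Phi> m) s \<omega> (bas k) x - \<Psi> s \<omega> (bas k) x"
        have "d k (s, \<omega>) \<le> ennreal ?N * ennreal ((L2_norm a b (?D k))\<^sup>2)" if s: "s \<in> {0..T}" for k
        proof -
          have L: "elementary_value (n m) (\<tau> m) (\<Phi> m) s \<omega> (bas k) \<in> L2 a b" "\<Psi> s \<omega> (bas k) \<in> L2 a b"
            using E.elementary_value_L2[OF \<omega>] \<Psi>_L2[OF s \<omega>] by auto
          have "L2_inner a b (?D k) \<phi> = E.integrand m k s \<omega> - \<psi> k s \<omega>"
            using L \<phi>L by (simp add: L2_inner_diff_left E.integrand_eq[OF \<omega>] \<psi>_def)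
          then have "d k (s, \<omega>) \<le> ennreal ((L2_inner a b (?D k) \<phi>)\<^sup>2)"
            by (auto simp: d_def X_def Y_def indicator_def)
          also have "\<dots> \<le> ennreal ?N * ennreal ((L2_norm a b (?D k))\<^sup>2)" by (rule CS[OF L2_diff[OF L]])
          finally show ?thesis .
        qed
        note le = this
        show "(\<Sum>k. d k (s, \<omega>)) \<le> ennreal ?N * ?H m \<omega> s"
        proof (cases "s \<in> {0..T}")
          case True
          have "(\<Sum>k. d k (s, \<omega>)) \<le> (\<Sum>k. ennreal ?N * ennreal ((L2_norm a b (?D k))\<^sup>2))"
            by (rule suminf_le[OF le[OF True]]) auto
          also have "\<dots> = ennreal ?N * ?H m \<omega> s"
            unfolding HS0_norm_sq_def ennreal_suminf_cmult using True by simp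
          finally show ?thesis .
        next
          case False
          then have "d k (s, \<omega>) = 0" for k using t by (auto simp: d_def X_def Y_def indicator_def)
          then show ?thesis by simp
        qed
      qed
      also have "\<dots> \<le> ennreal ?N * (\<integral>\<^sup>+\<omega>. (\<integral>\<^sup>+s. ?H m \<omega> s \<partial>lborel) \<partial>P)"
        by (intro order_trans[OF nn_integral_mono[OF nn_integral_cmult_le] nn_integral_cmult_le])
      finally show "(\<integral>\<^sup>+p. ennreal ((X m p - Y p)\<^sup>2) \<partial>?B) \<le> ennreal ?N * (\<integral>\<^sup>+\<omega>. (\<integral>\<^sup>+s. ?H m \<omega> s \<partial>lborel) \<partial>P)" .
    qed
    note XY = L2_convergence[OF XB YB Xint conv]
    \<comment> \<open>For each elementary process the two squared norms coincide by
      \<open>Xval\<close>, so one real sequence has both limits.\<close>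
    have "expectation (\<lambda>\<omega>. (L2_inner a b (I t \<omega>) \<phi>)\<^sup>2) = (\<integral>p. (Y p)\<^sup>2 \<partial>?B)"
      using LIMSEQ_unique[OF lim(2)[OF t t t t]] XY(2) unfolding Xval by simp
    then have "ennreal (expectation (\<lambda>\<omega>. (L2_inner a b (I t \<omega>) \<phi>)\<^sup>2)) = (\<integral>\<^sup>+p. ennreal ((Y p)\<^sup>2) \<partial>?B)"
      by (simp add: nn_integral_eq_integral[OF XY(1)])
    also have "\<dots> = (\<Sum>k. \<integral>\<^sup>+z. ennreal ((Y (k, z))\<^sup>2) \<partial>?L)"
      using Ym by (subst nn_integral_count_space_pair[OF sf]) auto
    finally show ?thesis by (simp add: Y_def case_prod_unfold)
  qed
qed

end

section \<open>Pathwise calculus\<close>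

text \<open>Rounding time down to a grid of step 1/(n+1) gives a process assembled from countably
  many random variables, hence jointly measurable; continuity of the paths gives pointwise
  convergence.\<close>

lemma continuous_process_measurable:
  fixes X :: "real \<Rightarrow> 'a \<Rightarrow> real"
  assumes X: "\<And>t. X t \<in> borel_measurable P" and cont: "\<And>\<omega>. \<omega> \<in> space P \<Longrightarrow> continuous_on UNIV (\<lambda>t. X t \<omega>)"
  shows "(\<lambda>z. X (fst z) (snd z)) \<in> borel_measurable (lborel \<Otimes>\<^sub>M P)"
proof (rule borel_measurable_LIMSEQ_metric)
  define r where "r n t = real_of_int \<lfloor>real (Suc n) * t\<rfloor> / real (Suc n)" for n t
  show "(\<lambda>z. X (r n (fst z)) (snd z)) \<in> borel_measurable (lborel \<Otimes>\<^sub>M P)" for n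
    unfolding r_def
  proof (rule measurable_compose_countable[where f="\<lambda>i z. X (real_of_int i / real (Suc n)) (snd z)" and g="\<lambda>z. \<lfloor>real (Suc n) * fst z\<rfloor>"])
    show "(\<lambda>z. X (real_of_int i / real (Suc n)) (snd z)) \<in> borel_measurable (lborel \<Otimes>\<^sub>M P)" for i
      using measurable_compose[OF measurable_snd X] .
    show "(\<lambda>z. \<lfloor>real (Suc n) * fst z\<rfloor>) \<in> lborel \<Otimes>\<^sub>M P \<rightarrow>\<^sub>M count_space UNIV" by measurable
  qed
  fix z :: "real \<times> 'a" assume z: "z \<in> space (lborel \<Otimes>\<^sub>M P)"
  have "(\<lambda>n. r n (fst z)) \<longlonglongrightarrow> fst z"
  proof (rule LIM_zero_cancel, rule Lim_null_comparison)
    show "\<forall>\<^sub>F n in sequentially. norm (r n (fst z) - fst z) \<le> 1 / real (Suc n)"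
    proof (rule always_eventually, rule allI)
      fix n
      have "\<bar>real_of_int \<lfloor>real (Suc n) * fst z\<rfloor> - real (Suc n) * fst z\<bar> \<le> 1" by linarith
      moreover have "r n (fst z) - fst z = (real_of_int \<lfloor>real (Suc n) * fst z\<rfloor> - real (Suc n) * fst z) / real (Suc n)"
        unfolding r_def by (simp add: diff_divide_distrib del: of_nat_Suc)
      ultimately show "norm (r n (fst z) - fst z) \<le> 1 / real (Suc n)"
        by (simp add: abs_divide divide_right_mono del: of_nat_Suc)
    qed
    show "(\<lambda>n. 1 / real (Suc n)) \<longlonglongrightarrow> 0" by (rule LIMSEQ_Suc[OF lim_1_over_n])
  qed
  moreover have "isCont (\<lambda>t. X t (snd z)) (fst z)"
    using cont[of "snd z"] z by (simp add: space_pair_measure mem_Times_iff continuous_on_eq_continuous_at)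
  ultimately show "(\<lambda>n. X (r n (fst z)) (snd z)) \<longlonglongrightarrow> X (fst z) (snd z)"
    by (rule isCont_tendsto_compose[rotated])
qed

text \<open>Rational times contribute countably many null sets; off their union continuity forces
  the path to vanish at every time.\<close>

lemma AE_all_times:
  fixes G :: "real \<Rightarrow> 'a \<Rightarrow> real"
  assumes T: "0 < T" and cont: "\<And>\<omega>. \<omega> \<in> space P \<Longrightarrow> continuous_on {0..T} (\<lambda>t. G t \<omega>)"
    and AE: "\<And>t. t \<in> {0..T} \<Longrightarrow> AE \<omega> in P. G t \<omega> = 0"
  shows "AE \<omega> in P. \<forall>t\<in>{0..T}. G t \<omega> = 0"
proof -
  let ?D = "{0<..<T} \<inter> \<rat>"
  have "countable ?D" using countable_rat by (rule countable_subset[rotated]) auto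
  then have "AE \<omega> in P. \<forall>t\<in>?D. G t \<omega> = 0"
    using AE by (subst AE_ball_countable) auto
  moreover have "AE \<omega> in P. \<omega> \<in> space P" by simp
  ultimately show ?thesis
  proof eventually_elim
    case (elim \<omega>)
    have "closure ?D = {0..T}"
      using T by (subst closure_open_Int_superset) (auto simp: Rats_closure_real)
    then show ?case
      using continuous_constant_on_closure[of ?D "\<lambda>t. G t \<omega>" 0] cont[OF elim(2)] elim(1) by auto
  qed
qed

lemma integral_deriv_interior:
  fixes f :: "real \<Rightarrow> real"
  assumes "continuous_on {0..T} f" "0 < x" "x < T"
  shows "((\<lambda>u. integral {0..u} f) has_real_derivative f x) (at x)"
  using integral_has_real_derivative[OF assms(1), of x] assms(2,3)
  by (simp add: at_within_Icc_at)

lemma continuous_on_integral: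
  fixes f :: "real \<Rightarrow> real"
  assumes "continuous_on {0..T} f"
  shows "continuous_on {0..T} (\<lambda>u. integral {0..u} f)"
  using assms by (intro indefinite_integral_continuous_1 integrable_continuous_real)

lemma abs_integral_le:
  fixes h :: "real \<Rightarrow> real"
  assumes "continuous_on {0..t} h"
  shows "\<bar>integral {0..t} h\<bar> \<le> integral {0..t} (\<lambda>s. \<bar>h s\<bar>)"
  using integral_norm_bound_integral[of h "{0..t}" "\<lambda>s. \<bar>h s\<bar>"] assms
  by (simp add: integrable_continuous_real continuous_intros)

text \<open>Only the time integral of \<open>Y\<close> is bounded, in terms of the time integral of
  \<open>m\<close>: in the application \<open>m\<close> contains the squares of \<open>Jc\<close>,
  whose moments are controlled at each time but not uniformly along a path.\<close>

lemma gronwall_integral: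
  fixes Y m :: "real \<Rightarrow> real"
  assumes T: "0 \<le> T" and Y: "continuous_on {0..T} Y" and m: "continuous_on {0..T} m"
    and m0: "\<And>t. t \<in> {0..T} \<Longrightarrow> 0 \<le> m t" and C: "0 \<le> C"
    and le: "\<And>t. t \<in> {0..T} \<Longrightarrow> Y t \<le> m t + C * integral {0..t} Y"
  shows "integral {0..T} Y \<le> exp (C * T) * integral {0..T} m"
proof -
  \<comment> \<open>The integrating factor turns the hypothesis into w' <= (exp(-C t) - 1) m, which
    is at most 0 since \<open>m\<close> and \<open>C\<close> are nonnegative.\<close>
  define w where "w t = exp (- C * t) * integral {0..t} Y - integral {0..t} m" for t
  have "w T \<le> w 0"
  proof (rule DERIV_nonpos_imp_decreasing_open[OF T])
    fix t assume t: "0 < t" "t < T"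
    note d = integral_deriv_interior[OF Y t] integral_deriv_interior[OF m t]
    have "(w has_real_derivative (exp (- C * t) * (Y t - C * integral {0..t} Y) - m t)) (at t)"
      unfolding w_def by (rule derivative_eq_intros d refl | simp add: algebra_simps)+
    moreover have "exp (- C * t) * (Y t - C * integral {0..t} Y) \<le> 1 * m t"
    proof (rule order_trans)
      show "exp (- C * t) * (Y t - C * integral {0..t} Y) \<le> exp (- C * t) * m t"
        using le[of t] t by (intro mult_left_mono) auto
      show "exp (- C * t) * m t \<le> 1 * m t" using m0[of t] t C by (intro mult_right_mono) auto
    qed
    ultimately show "\<exists>y. (w has_real_derivative y) (at t) \<and> y \<le> 0" by (intro exI conjI) auto
  next
    show "continuous_on {0..T} w" unfolding w_def
      by (intro continuous_intros continuous_on_integral Y m)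
  qed
  then have "exp (- C * T) * integral {0..T} Y \<le> integral {0..T} m" by (simp add: w_def)
  then have "exp (C * T) * (exp (- C * T) * integral {0..T} Y) \<le> exp (C * T) * integral {0..T} m"
    by (intro mult_left_mono) auto
  then show ?thesis by (simp add: mult.assoc[symmetric] flip: exp_add)
qed

lemma square_of_primitive:
  fixes f :: "real \<Rightarrow> real"
  assumes t: "0 \<le> t" and f: "continuous_on {0..t} f"
  shows "(x + integral {0..t} f)\<^sup>2 = x\<^sup>2 + 2 * integral {0..t} (\<lambda>s. f s * (x + integral {0..s} f))"
proof -
  let ?B = "\<lambda>s. x + integral {0..s} f"
  have "((\<lambda>s. 2 * (f s * ?B s)) has_integral (?B t)\<^sup>2 - (?B 0)\<^sup>2) {0..t}"
  proof (rule fundamental_theorem_of_calculus[OF t])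
    fix s assume s: "s \<in> {0..t}"
    have "((\<lambda>s. (?B s)\<^sup>2) has_real_derivative 2 * (f s * ?B s)) (at s within {0..t})"
      by (rule derivative_eq_intros integral_has_real_derivative[OF f s] refl | simp)+
    then show "((\<lambda>s. (?B s)\<^sup>2) has_vector_derivative 2 * (f s * ?B s)) (at s within {0..t})"
      by (simp add: has_real_derivative_iff_has_vector_derivative)
  qed
  then have "integral {0..t} (\<lambda>s. 2 * (f s * ?B s)) = (?B t)\<^sup>2 - x\<^sup>2"
    by (subst integral_unique) auto
  then show ?thesis by simp
qed

text \<open>The pathwise substitute for the Ito formula: with \<open>J\<close> the martingale part of \<open>V\<close>,
  the term \<open>\<integral> f(s) (J(t) - J(s)) ds\<close> has mean zero.\<close>

lemma square_of_semimartingale_path: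
  fixes f J V :: "real \<Rightarrow> real"
  assumes t: "0 \<le> t" and f: "continuous_on {0..t} f" and V: "continuous_on {0..t} V"
    and J: "\<And>s. s \<in> {0..t} \<Longrightarrow> V s = x + integral {0..s} f + J s"
  shows "(V t)\<^sup>2 = x\<^sup>2 + 2 * integral {0..t} (\<lambda>s. f s * V s)
    + 2 * integral {0..t} (\<lambda>s. f s * (J t - J s)) + 2 * x * J t + (J t)\<^sup>2"
proof -
  let ?B = "\<lambda>s. x + integral {0..s} f"
  note ints = integrable_continuous_real
  have Bc: "continuous_on {0..t} ?B" by (intro continuous_intros continuous_on_integral f)
  have "continuous_on {0..t} (\<lambda>s. V s - ?B s)" by (intro continuous_intros V Bc)
  then have Jc: "continuous_on {0..t} J" by (rule continuous_on_eq) (simp add: J)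
  have fV: "integral {0..t} (\<lambda>s. f s * V s) = integral {0..t} (\<lambda>s. f s * ?B s) + integral {0..t} (\<lambda>s. f s * J s)"
  proof -
    have "integral {0..t} (\<lambda>s. f s * V s) = integral {0..t} (\<lambda>s. f s * ?B s + f s * J s)"
      by (intro integral_cong) (simp add: J algebra_simps)
    also have "\<dots> = integral {0..t} (\<lambda>s. f s * ?B s) + integral {0..t} (\<lambda>s. f s * J s)"
      by (intro Henstock_Kurzweil_Integration.integral_add ints continuous_intros f Bc Jc)
    finally show ?thesis .
  qed
  have fJ: "integral {0..t} (\<lambda>s. f s * (J t - J s)) = J t * integral {0..t} f - integral {0..t} (\<lambda>s. f s * J s)"
  proof -
    have "integral {0..t} (\<lambda>s. f s * (J t - J s)) = integral {0..t} (\<lambda>s. J t * f s - f s * J s)"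
      by (intro integral_cong) (simp add: algebra_simps)
    also have "\<dots> = integral {0..t} (\<lambda>s. J t * f s) - integral {0..t} (\<lambda>s. f s * J s)"
      by (intro Henstock_Kurzweil_Integration.integral_diff ints continuous_intros f Jc)
    finally show ?thesis by simp
  qed
  have "V t = ?B t + J t" using J[of t] t by simp
  then have "(V t)\<^sup>2 = (?B t)\<^sup>2 + 2 * ?B t * J t + (J t)\<^sup>2" by (simp add: power2_sum)
  then show ?thesis unfolding square_of_primitive[OF t f] fV fJ by (simp add: algebra_simps)
qed

text \<open>This disposes of the remainder in the chain rule for the potential energy along a path:
  it is dominated by a function vanishing to second order.\<close>

lemma has_derivative_zero_comparison:
  fixes r h :: "real \<Rightarrow> real"
  assumes "\<And>s. s \<in> S \<Longrightarrow> \<bar>r s\<bar> \<le> h s" and t: "t \<in> S" "h t = 0"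
    and h: "(h has_real_derivative 0) (at t within S)"
  shows "(r has_real_derivative 0) (at t within S)"
  unfolding has_field_derivative_iff
proof (rule Lim_null_comparison)
  have r0: "r t = 0" using assms(1)[OF t(1)] t(2) by simp
  show "\<forall>\<^sub>F y in at t within S. norm ((r y - r t) / (y - t)) \<le> \<bar>(h y - h t) / (y - t)\<bar>"
    unfolding eventually_at_filter
    by (rule always_eventually) (auto simp: r0 t(2) abs_divide intro!: divide_right_mono order_trans[OF assms(1) abs_ge_self])
  have "((\<lambda>y. (h y - h t) / (y - t)) \<longlongrightarrow> 0) (at t within S)"
    using h by (simp add: has_field_derivative_iff)
  then show "((\<lambda>y. \<bar>(h y - h t) / (y - t)\<bar>) \<longlongrightarrow> 0) (at t within S)" by (simp only: tendsto_rabs_zero_iff)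
qed

text \<open>The mean value theorem yields the slope at a point no farther from \<open>x\<close> than
  \<open>y\<close>; the Lipschitz bound there gives the constant \<open>L\<close>, and the optimal
  L/2 is not pursued.\<close>

lemma taylor_lipschitz:
  fixes f F :: "real \<Rightarrow> real"
  assumes F: "\<And>x. (F has_real_derivative f x) (at x)" and L: "\<And>x y. \<bar>f x - f y\<bar> \<le> L * \<bar>x - y\<bar>"
  shows "\<bar>F y - F x - f x * (y - x)\<bar> \<le> L * (y - x)\<^sup>2"
proof -
  have L0: "0 \<le> L" using L[of 1 0] by (simp add: order_trans[OF abs_ge_zero])
  obtain \<xi> where \<xi>: "F y - F x = f \<xi> * (y - x)" "\<bar>\<xi> - x\<bar> \<le> \<bar>y - x\<bar>"
  proof (cases x y rule: linorder_cases)
    case less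
    from MVT2[OF this F] obtain z where "x < z" "z < y" "F y - F x = (y - x) * f z" by auto
    then show thesis by (intro that[of z]) auto
  next
    case greater
    from MVT2[OF this F] obtain z where "y < z" "z < x" "F x - F y = (x - y) * f z" by auto
    then show thesis by (intro that[of z]) (auto simp: algebra_simps)
  qed (use that[of x] in auto)
  have "\<bar>F y - F x - f x * (y - x)\<bar> = \<bar>f \<xi> - f x\<bar> * \<bar>y - x\<bar>"
    unfolding \<xi>(1) by (simp add: left_diff_distrib[symmetric] abs_mult)
  also have "\<dots> \<le> (L * \<bar>y - x\<bar>) * \<bar>y - x\<bar>"
    using \<xi>(2) L0 by (intro mult_right_mono order_trans[OF L] mult_left_mono) auto
  finally show ?thesis by (simp add: power2_eq_square mult.assoc)
qed

lemma integral_square_le: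
  fixes f :: "real \<Rightarrow> real"
  assumes t: "0 \<le> t" and f: "continuous_on {0..t} f"
  shows "(integral {0..t} f)\<^sup>2 \<le> t * integral {0..t} (\<lambda>s. (f s)\<^sup>2)"
proof -
  let ?I = "integral {0..t} f" and ?Q = "integral {0..t} (\<lambda>s. (f s)\<^sup>2)"
  \<comment> \<open>Cauchy-Schwarz as a variance: with I the integral of f and Q that of f^2, the
    square of t f - I integrates to t (t Q - I^2).\<close>
  have "0 \<le> integral {0..t} (\<lambda>s. (t * f s - ?I)\<^sup>2)"
    by (rule integral_nonneg) (auto intro!: integrable_continuous_real continuous_intros f)
  also have "integral {0..t} (\<lambda>s. (t * f s - ?I)\<^sup>2) = integral {0..t} (\<lambda>s. (t\<^sup>2 * (f s)\<^sup>2 - (2 * t * ?I) * f s) + ?I\<^sup>2)"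
    by (intro integral_cong) (simp add: power2_eq_square algebra_simps)
  also have "\<dots> = (t\<^sup>2 * ?Q - (2 * t * ?I) * ?I) + t * ?I\<^sup>2"
    using t by (simp add: Henstock_Kurzweil_Integration.integral_add Henstock_Kurzweil_Integration.integral_diff
        integrable_continuous_real continuous_intros f)
  also have "\<dots> = t * (t * ?Q - ?I\<^sup>2)" by (simp add: power2_eq_square algebra_simps)
  finally have "0 \<le> t * (t * ?Q - ?I\<^sup>2)" .
  then show ?thesis using t by (cases "t = 0") (auto simp: zero_le_mult_iff)
qed

section \<open>Processes with continuous paths\<close>

context Q_wiener
begin

text \<open>Measurability is with respect to \<open>P\<close> at each time. Adaptedness is tracked
  separately, for the processes that are tested against martingale increments.\<close>

definition cont_process :: "(real \<Rightarrow> 'w \<Rightarrow> real) \<Rightarrow> bool" where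
  "cont_process Z \<longleftrightarrow> (\<forall>t\<in>{0..T}. Z t \<in> borel_measurable P) \<and>
     (\<forall>\<omega>\<in>space P. continuous_on {0..T} (\<lambda>t. Z t \<omega>))"

lemma cont_processD:
  "cont_process Z \<Longrightarrow> t \<in> {0..T} \<Longrightarrow> Z t \<in> borel_measurable P"
  "cont_process Z \<Longrightarrow> \<omega> \<in> space P \<Longrightarrow> continuous_on {0..T} (\<lambda>t. Z t \<omega>)"
  by (auto simp: cont_process_def)

lemma cont_process_on:
  "cont_process Z \<Longrightarrow> \<omega> \<in> space P \<Longrightarrow> t \<in> {0..T} \<Longrightarrow> continuous_on {0..t} (\<lambda>t. Z t \<omega>)"
  by (rule continuous_on_subset[OF cont_processD(2)]) auto

lemma cont_process_const: "cont_process (\<lambda>t \<omega>. c)"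
  by (simp add: cont_process_def)

lemma cont_process_initial: "cont_process Z \<Longrightarrow> cont_process (\<lambda>t. Z 0)"
  using T by (simp add: cont_process_def)

lemma cont_process_add: "cont_process Y \<Longrightarrow> cont_process Z \<Longrightarrow> cont_process (\<lambda>t \<omega>. Y t \<omega> + Z t \<omega>)"
  unfolding cont_process_def
  by (auto intro!: continuous_intros borel_measurable_add borel_measurable_diff borel_measurable_times borel_measurable_sum)

lemma cont_process_diff: "cont_process Y \<Longrightarrow> cont_process Z \<Longrightarrow> cont_process (\<lambda>t \<omega>. Y t \<omega> - Z t \<omega>)"
  unfolding cont_process_def
  by (auto intro!: continuous_intros borel_measurable_add borel_measurable_diff borel_measurable_times borel_measurable_sum)

lemma cont_process_mult: "cont_process Y \<Longrightarrow> cont_process Z \<Longrightarrow> cont_process (\<lambda>t \<omega>. Y t \<omega> * Z t \<omega>)"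
  unfolding cont_process_def
  by (auto intro!: continuous_intros borel_measurable_add borel_measurable_diff borel_measurable_times borel_measurable_sum)

lemma cont_process_abs: "cont_process Z \<Longrightarrow> cont_process (\<lambda>t \<omega>. \<bar>Z t \<omega>\<bar>)"
  unfolding cont_process_def
  by (auto intro!: continuous_intros borel_measurable_add borel_measurable_diff borel_measurable_times borel_measurable_sum)

lemma cont_process_power: "cont_process Z \<Longrightarrow> cont_process (\<lambda>t \<omega>. (Z t \<omega>)\<^sup>2)"
  unfolding cont_process_def
  by (auto intro!: continuous_intros borel_measurable_add borel_measurable_diff borel_measurable_times borel_measurable_sum)

lemma cont_process_sum: "(\<And>i. i \<in> A \<Longrightarrow> cont_process (Z i)) \<Longrightarrow> cont_process (\<lambda>t \<omega>. \<Sum>i\<in>A. Z i t \<omega>)"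
  unfolding cont_process_def
  by (auto intro!: continuous_intros borel_measurable_add borel_measurable_diff borel_measurable_times borel_measurable_sum)

lemma cont_process_joint:
  assumes Z: "cont_process Z" and t: "t \<in> {0..T}"
  shows "(\<lambda>z. indicator {0..t} (fst z) * Z (fst z) (snd z)) \<in> borel_measurable (lborel \<Otimes>\<^sub>M P)"
proof -
  \<comment> \<open>Clamping time to [0, T] extends the paths continuously to the whole line; on
    {0..t} nothing changes.\<close>
  define c where "c s = max 0 (min T s)" for s
  have c: "c s \<in> {0..T}" "s \<in> {0..T} \<Longrightarrow> c s = s" for s using T by (auto simp: c_def)
  have cont_c: "continuous_on UNIV c" unfolding c_def by (intro continuous_intros)
  have "(\<lambda>z. Z (c (fst z)) (snd z)) \<in> borel_measurable (lborel \<Otimes>\<^sub>M P)"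
  proof (rule continuous_process_measurable[where X="\<lambda>s. Z (c s)"])
    show "Z (c s) \<in> borel_measurable P" for s using cont_processD(1)[OF Z c(1)] .
    show "continuous_on UNIV (\<lambda>s. Z (c s) \<omega>)" if "\<omega> \<in> space P" for \<omega>
      by (rule continuous_on_compose2[OF cont_processD(2)[OF Z that] cont_c]) (use c(1) in auto)
  qed
  then have "(\<lambda>z. indicator {0..t} (fst z) * Z (c (fst z)) (snd z)) \<in> borel_measurable (lborel \<Otimes>\<^sub>M P)"
    by measurable
  moreover have "indicator {0..t} s * Z (c s) \<omega> = indicator {0..t} s * Z s \<omega>" for s \<omega>
    using t c(2)[of s] by (auto simp: indicator_def)
  ultimately show ?thesis by simp
qed

lemma cont_process_integral_eq:
  assumes Z: "cont_process Z" and t: "t \<in> {0..T}" and \<omega>: "\<omega> \<in> space P"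
  shows "integrable lborel (\<lambda>s. indicator {0..t} s * Z s \<omega>)"
    "integral {0..t} (\<lambda>s. Z s \<omega>) = (\<integral>s. indicator {0..t} s * Z s \<omega> \<partial>lborel)"
proof -
  have si: "set_integrable lborel {0..t} (\<lambda>s. Z s \<omega>)"
    by (intro borel_integrable_atLeastAtMost' cont_process_on[OF Z \<omega> t])
  then show "integrable lborel (\<lambda>s. indicator {0..t} s * Z s \<omega>)" by (simp add: set_integrable_def)
  show "integral {0..t} (\<lambda>s. Z s \<omega>) = (\<integral>s. indicator {0..t} s * Z s \<omega> \<partial>lborel)"
    using set_borel_integral_eq_integral(2)[OF si] by (simp add: set_lebesgue_integral_def)
qed

lemma cont_process_integral:
  assumes Z: "cont_process Z"
  shows "cont_process (\<lambda>t \<omega>. integral {0..t} (\<lambda>s. Z s \<omega>))"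
  unfolding cont_process_def
proof (intro conjI ballI)
  fix t assume t: "t \<in> {0..T}"
  have "(\<lambda>\<omega>. \<integral>s. indicator {0..t} s * Z s \<omega> \<partial>lborel) \<in> borel_measurable P"
    using cont_process_joint[OF Z t] 
    by (intro lborel.borel_measurable_lebesgue_integral) (drule measurable_pair_swap, simp add: case_prod_unfold)
  then show "(\<lambda>\<omega>. integral {0..t} (\<lambda>s. Z s \<omega>)) \<in> borel_measurable P"
    using cont_process_integral_eq(2)[OF Z t] by (simp cong: measurable_cong)
next
  fix \<omega> assume "\<omega> \<in> space P"
  then show "continuous_on {0..T} (\<lambda>t. integral {0..t} (\<lambda>s. Z s \<omega>))"
    by (intro continuous_on_integral cont_processD[OF Z])
qed

lemmas cont_process_intros = cont_process_const cont_process_add cont_process_diff cont_process_mult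
  cont_process_abs cont_process_power cont_process_sum cont_process_integral

text \<open>Tonelli in both orders: the first serves bounds that hold along a path, the second
  bounds on moments at each time.\<close>

lemma cont_process_nn_integral:
  assumes Z: "cont_process Z" and t: "t \<in> {0..T}" and nn: "\<And>s \<omega>. 0 \<le> Z s \<omega>"
  shows "(\<integral>\<^sup>+z. ennreal (indicator {0..t} (fst z) * Z (fst z) (snd z)) \<partial>(lborel \<Otimes>\<^sub>M P))
      = (\<integral>\<^sup>+\<omega>. ennreal (integral {0..t} (\<lambda>s. Z s \<omega>)) \<partial>P)"
    and "(\<integral>\<^sup>+z. ennreal (indicator {0..t} (fst z) * Z (fst z) (snd z)) \<partial>(lborel \<Otimes>\<^sub>M P))
      = (\<integral>\<^sup>+s. indicator {0..t} s * (\<integral>\<^sup>+\<omega>. ennreal (Z s \<omega>) \<partial>P) \<partial>lborel)"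
proof -
  let ?h = "\<lambda>z. ennreal (indicator {0..t} (fst z) * Z (fst z) (snd z))"
  have m: "?h \<in> borel_measurable (lborel \<Otimes>\<^sub>M P)" using cont_process_joint[OF Z t] by measurable
  have "(\<integral>\<^sup>+z. ?h z \<partial>(lborel \<Otimes>\<^sub>M P)) = (\<integral>\<^sup>+\<omega>. \<integral>\<^sup>+s. ?h (s, \<omega>) \<partial>lborel \<partial>P)"
    by (rule lborel_P.nn_integral_snd[OF m, symmetric])
  also have "\<dots> = (\<integral>\<^sup>+\<omega>. ennreal (integral {0..t} (\<lambda>s. Z s \<omega>)) \<partial>P)"
  proof (rule nn_integral_cong)
    fix \<omega> assume \<omega>: "\<omega> \<in> space P"
    show "(\<integral>\<^sup>+s. ?h (s, \<omega>) \<partial>lborel) = ennreal (integral {0..t} (\<lambda>s. Z s \<omega>))"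
      unfolding cont_process_integral_eq(2)[OF Z t \<omega>] using cont_process_integral_eq(1)[OF Z t \<omega>] nn
      by (subst nn_integral_eq_integral) auto
  qed
  finally show "(\<integral>\<^sup>+z. ?h z \<partial>(lborel \<Otimes>\<^sub>M P)) = (\<integral>\<^sup>+\<omega>. ennreal (integral {0..t} (\<lambda>s. Z s \<omega>)) \<partial>P)" .
  have "(\<integral>\<^sup>+z. ?h z \<partial>(lborel \<Otimes>\<^sub>M P)) = (\<integral>\<^sup>+s. \<integral>\<^sup>+\<omega>. ?h (s, \<omega>) \<partial>P \<partial>lborel)"
    by (rule nn_integral_fst[OF m, symmetric])
  also have "\<dots> = (\<integral>\<^sup>+s. indicator {0..t} s * (\<integral>\<^sup>+\<omega>. ennreal (Z s \<omega>) \<partial>P) \<partial>lborel)"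
    by (intro nn_integral_cong) (auto simp: indicator_def)
  finally show "(\<integral>\<^sup>+z. ?h z \<partial>(lborel \<Otimes>\<^sub>M P)) = (\<integral>\<^sup>+s. indicator {0..t} s * (\<integral>\<^sup>+\<omega>. ennreal (Z s \<omega>) \<partial>P) \<partial>lborel)" .
qed

end

section \<open>The semi-discrete scheme\<close>

locale ipdg = dg_basis a b M k N \<phi> + Q_wiener P F T a b q e \<beta> W
  for a b :: real and M k N :: nat and \<phi> :: "nat \<Rightarrow> real \<Rightarrow> real"
    and P :: "'w measure" and F T q e \<beta> W +
  fixes \<sigma> :: real and Q R :: "(real \<Rightarrow> real) \<Rightarrow> (real \<Rightarrow> real)"
    and f ft :: "real \<Rightarrow> real" and g :: "(real \<Rightarrow> real) \<Rightarrow> (real \<Rightarrow> real) \<Rightarrow> (real \<Rightarrow> real)"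
    and u0 v0 :: "real \<Rightarrow> real" and U V I :: "real \<Rightarrow> 'w \<Rightarrow> real \<Rightarrow> real"
  assumes cov: "covariance_operator a b Q q e" and sqrtR: "L2_sqrt_operator a b Q R"
    and f_nem: "lipschitz_nemytskii a b f" and ft: "\<And>x. (ft has_real_derivative f x) (at x)"
    and g_lip: "lipschitz_diffusion a b R q e g"
    and u0: "u0 \<in> V_h a b M k" and v0: "v0 \<in> V_h a b M k"
    and U: "V_h_process P F T a b M k U" and V: "V_h_process P F T a b M k V"
    and init: "AE \<omega> in P. L2_eq a b (U 0 \<omega>) u0 \<and> L2_eq a b (V 0 \<omega>) v0"
    and eqU: "\<And>t. t \<in> {0..T} \<Longrightarrow> AE \<omega> in P. L2_has_integral a b t (\<lambda>s. V s \<omega>) (\<lambda>x. U t \<omega> x - U 0 \<omega> x)"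
    and si: "is_stochastic_integral P F T a b R q e W (\<lambda>s \<omega> v. P_h a b M k (g (U s \<omega>) v)) I"
    and eqV: "\<And>t. t \<in> {0..T} \<Longrightarrow> AE \<omega> in P. L2_has_integral a b t
             (\<lambda>s x. Delta_h a b M k \<sigma> (U s \<omega>) x - P_h a b M k (\<lambda>y. f (U s \<omega> y)) x)
             (\<lambda>x. V t \<omega> x - V 0 \<omega> x - I t \<omega> x)"
begin

lemma process_V_h:
  "V_h_process P F T a b M k X \<Longrightarrow> t \<in> {0..T} \<Longrightarrow> \<omega> \<in> space P \<Longrightarrow> X t \<omega> \<in> Vh"
  by (simp add: V_h_process_def)

lemma process_measurable:
  assumes "V_h_process P F T a b M k X" "\<Gamma> \<in> borel_measurable (L2_borel a b)" "t \<in> {0..T}"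
  shows "(\<lambda>\<omega>. \<Gamma> (X t \<omega>)) \<in> borel_measurable (F t)"
  using assms measurable_compose[of "X t" "F t" "L2_borel a b" \<Gamma>] by (simp add: V_h_process_def)

lemma lipschitz_process:
  fixes \<Gamma> :: "(real \<Rightarrow> real) \<Rightarrow> real"
  assumes X: "V_h_process P F T a b M k X"
    and \<Gamma>: "\<And>u v. u \<in> L2 a b \<Longrightarrow> v \<in> L2 a b \<Longrightarrow> \<bar>\<Gamma> u - \<Gamma> v\<bar> \<le> C * nrm (\<lambda>x. u x - v x)"
  shows "cont_process (\<lambda>t \<omega>. \<Gamma> (X t \<omega>))" "\<And>t. t \<in> {0..T} \<Longrightarrow> (\<lambda>\<omega>. \<Gamma> (X t \<omega>)) \<in> borel_measurable (F t)"
proof -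
  show F: "(\<lambda>\<omega>. \<Gamma> (X t \<omega>)) \<in> borel_measurable (F t)" if "t \<in> {0..T}" for t
    using process_measurable[OF X measurable_L2_borel_lipschitz[OF \<Gamma>] that] .
  have "continuous_on {0..T} (\<lambda>t. \<Gamma> (X t \<omega>))" if \<omega>: "\<omega> \<in> space P" for \<omega>
    unfolding continuous_on_def
  proof
    fix t assume t: "t \<in> {0..T}"
    have lim: "((\<lambda>s. nrm (\<lambda>x. X s \<omega> x - X t \<omega> x)) \<longlongrightarrow> 0) (at t within {0..T})"
      using X \<omega> t by (simp add: V_h_process_def)
    have "((\<lambda>s. \<Gamma> (X s \<omega>) - \<Gamma> (X t \<omega>)) \<longlongrightarrow> 0) (at t within {0..T})"
    proof (rule Lim_null_comparison)
      show "\<forall>\<^sub>F s in at t within {0..T}. norm (\<Gamma> (X s \<omega>) - \<Gamma> (X t \<omega>)) \<le> C * nrm (\<lambda>x. X s \<omega> x - X t \<omega> x)"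
        unfolding eventually_at_filter
        using \<Gamma> process_V_h[OF X _ \<omega>] t by (intro always_eventually) (auto intro: V_h_L2)
      show "((\<lambda>s. C * nrm (\<lambda>x. X s \<omega> x - X t \<omega> x)) \<longlongrightarrow> 0) (at t within {0..T})"
        using tendsto_mult_left[OF lim, of C] by simp
    qed
    then show "((\<lambda>s. \<Gamma> (X s \<omega>)) \<longlongrightarrow> \<Gamma> (X t \<omega>)) (at t within {0..T})" by (simp add: LIM_zero_iff)
  qed
  then show "cont_process (\<lambda>t \<omega>. \<Gamma> (X t \<omega>))" unfolding cont_process_def by (intro conjI ballI measurable_F[OF _ F]) auto
qed

lemma norm_one_pos: "nrm (\<lambda>x. 1) > 0"
proof -
  have "(nrm (\<lambda>x. 1))\<^sup>2 = b - a"
    using ab by (simp add: L2_norm_sq L2_inner_def measure_restrict_space space_restrict_space)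
  then have "nrm (\<lambda>x. 1) \<noteq> 0" using ab by auto
  then show ?thesis using L2_norm_nonneg[of a b "\<lambda>x. 1"] by linarith
qed

text \<open>Testing the L2 bound on constant functions gives the pointwise bound, since a constant
  has norm its absolute value times the positive norm of 1.\<close>

lemma f_lipschitz: "\<exists>L\<ge>0. (\<forall>x y. \<bar>f x - f y\<bar> \<le> L * \<bar>x - y\<bar>) \<and>
  (\<forall>u\<in>L2 a b. \<forall>v\<in>L2 a b. nrm (\<lambda>x. f (u x) - f (v x)) \<le> L * nrm (\<lambda>x. u x - v x))"
proof -
  obtain C where C: "\<And>u v. u \<in> L2 a b \<Longrightarrow> v \<in> L2 a b \<Longrightarrow> nrm (\<lambda>x. f (u x) - f (v x)) \<le> C * nrm (\<lambda>x. u x - v x)"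
    using f_nem unfolding lipschitz_nemytskii_def by blast
  have c: "nrm (\<lambda>x. c) = \<bar>c\<bar> * nrm (\<lambda>x. 1)" for c using L2_norm_cmult[of a b c "\<lambda>x. 1"] by simp
  have "\<bar>f x - f y\<bar> \<le> C * \<bar>x - y\<bar>" for x y
  proof -
    have "\<bar>f x - f y\<bar> * nrm (\<lambda>x. 1) \<le> (C * \<bar>x - y\<bar>) * nrm (\<lambda>x. 1)"
      using C[OF L2_const L2_const, of x y] unfolding c[of "f x - f y"] c[of "x - y"] by (simp add: mult.assoc)
    then show ?thesis using norm_one_pos by (simp add: mult_le_cancel_right)
  qed
  then show ?thesis using C
    by (intro exI[of _ "\<bar>C\<bar>"]) (auto intro: order_trans mult_right_mono[OF abs_ge_self] order_trans[OF _ mult_right_mono[OF abs_ge_self]])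
qed

lemma f_L2: "u \<in> L2 a b \<Longrightarrow> (\<lambda>x. f (u x)) \<in> L2 a b"
  using f_nem by (simp add: lipschitz_nemytskii_def)

lemma inner_\<phi>_le: "i < N \<Longrightarrow> u \<in> L2 a b \<Longrightarrow> \<bar>inn u (\<phi> i)\<bar> \<le> nrm u"
  using L2_inner_CS[of u a b "\<phi> i"] by (simp add: \<phi>_L2)

lemma f_inner_lipschitz: "\<exists>L\<ge>0. \<forall>i<N. \<forall>u\<in>L2 a b. \<forall>v\<in>L2 a b.
  \<bar>inn (\<lambda>x. f (u x)) (\<phi> i) - inn (\<lambda>x. f (v x)) (\<phi> i)\<bar> \<le> L * nrm (\<lambda>x. u x - v x)"
proof -
  obtain L where L: "L \<ge> 0" "\<And>u v. u \<in> L2 a b \<Longrightarrow> v \<in> L2 a b \<Longrightarrow> nrm (\<lambda>x. f (u x) - f (v x)) \<le> L * nrm (\<lambda>x. u x - v x)"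
    using f_lipschitz by blast
  have "\<bar>inn (\<lambda>x. f (u x)) (\<phi> i) - inn (\<lambda>x. f (v x)) (\<phi> i)\<bar> \<le> L * nrm (\<lambda>x. u x - v x)"
    if "i < N" "u \<in> L2 a b" "v \<in> L2 a b" for i u v
  proof -
    have "\<bar>inn (\<lambda>x. f (u x) - f (v x)) (\<phi> i)\<bar> \<le> nrm (\<lambda>x. f (u x) - f (v x))"
      using that by (intro inner_\<phi>_le L2_diff f_L2)
    also have "\<dots> \<le> L * nrm (\<lambda>x. u x - v x)" using L(2) that by blast
    finally show ?thesis using that by (simp add: L2_inner_diff_left f_L2 \<phi>_L2)
  qed
  then show ?thesis using L(1) by blast
qed

definition Uc :: "nat \<Rightarrow> real \<Rightarrow> 'w \<Rightarrow> real" where "Uc i t \<omega> = inn (U t \<omega>) (\<phi> i)"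
definition Vc :: "nat \<Rightarrow> real \<Rightarrow> 'w \<Rightarrow> real" where "Vc i t \<omega> = inn (V t \<omega>) (\<phi> i)"
definition fc :: "nat \<Rightarrow> real \<Rightarrow> 'w \<Rightarrow> real" where "fc i t \<omega> = inn (\<lambda>x. f (U t \<omega> x)) (\<phi> i)"
definition Bc :: "nat \<Rightarrow> nat \<Rightarrow> real" where "Bc i j = B_h a b M \<sigma> (\<phi> i) (\<phi> j)"
definition drift :: "nat \<Rightarrow> real \<Rightarrow> 'w \<Rightarrow> real" where
  "drift i t \<omega> = (\<Sum>j<N. Uc j t \<omega> * Bc j i) - fc i t \<omega>"
definition Jc :: "nat \<Rightarrow> real \<Rightarrow> 'w \<Rightarrow> real" where
  "Jc i t \<omega> = Vc i t \<omega> - Vc i 0 \<omega> - integral {0..t} (\<lambda>s. drift i s \<omega>)"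

lemma inner_process:
  assumes "V_h_process P F T a b M k X" "i < N"
  shows "cont_process (\<lambda>t \<omega>. inn (X t \<omega>) (\<phi> i))" "t \<in> {0..T} \<Longrightarrow> (\<lambda>\<omega>. inn (X t \<omega>) (\<phi> i)) \<in> borel_measurable (F t)"
proof -
  have lip: "\<bar>inn u (\<phi> i) - inn v (\<phi> i)\<bar> \<le> 1 * nrm (\<lambda>x. u x - v x)" if "u \<in> L2 a b" "v \<in> L2 a b" for u v
    using inner_\<phi>_le[OF assms(2) L2_diff[OF that]] that assms(2) by (simp add: L2_inner_diff_left \<phi>_L2)
  show "cont_process (\<lambda>t \<omega>. inn (X t \<omega>) (\<phi> i))" "t \<in> {0..T} \<Longrightarrow> (\<lambda>\<omega>. inn (X t \<omega>) (\<phi> i)) \<in> borel_measurable (F t)"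
    using lipschitz_process[OF assms(1), of "\<lambda>u. inn u (\<phi> i)", OF lip] by auto
qed

lemma Uc_process: "i < N \<Longrightarrow> cont_process (Uc i)" "i < N \<Longrightarrow> t \<in> {0..T} \<Longrightarrow> Uc i t \<in> borel_measurable (F t)"
  using inner_process[OF U, of i] unfolding Uc_def[abs_def] by auto

lemma Vc_process: "i < N \<Longrightarrow> cont_process (Vc i)" "i < N \<Longrightarrow> t \<in> {0..T} \<Longrightarrow> Vc i t \<in> borel_measurable (F t)"
  using inner_process[OF V, of i] unfolding Vc_def[abs_def] by auto

lemma fc_process: 
  assumes "i < N"
  shows "cont_process (fc i)" "t \<in> {0..T} \<Longrightarrow> fc i t \<in> borel_measurable (F t)"
proof -
  obtain L where L: "\<And>u v. u \<in> L2 a b \<Longrightarrow> v \<in> L2 a b \<Longrightarrow>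
      \<bar>inn (\<lambda>x. f (u x)) (\<phi> i) - inn (\<lambda>x. f (v x)) (\<phi> i)\<bar> \<le> L * nrm (\<lambda>x. u x - v x)"
    using f_inner_lipschitz assms by blast
  show "cont_process (fc i)" unfolding fc_def[abs_def]
    by (rule lipschitz_process(1)[OF U, where \<Gamma>="\<lambda>u. inn (\<lambda>x. f (u x)) (\<phi> i)"], erule (1) L)
  show "fc i t \<in> borel_measurable (F t)" if "t \<in> {0..T}" unfolding fc_def[abs_def]
    by (rule lipschitz_process(2)[OF U, where \<Gamma>="\<lambda>u. inn (\<lambda>x. f (u x)) (\<phi> i)"], erule (1) L, rule that)
qed

lemma drift_process: 
  assumes "i < N"
  shows "cont_process (drift i)" "t \<in> {0..T} \<Longrightarrow> drift i t \<in> borel_measurable (F t)"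
proof -
  show "cont_process (drift i)" unfolding drift_def[abs_def]
    by (intro cont_process_intros Uc_process fc_process assms) simp
  show "drift i t \<in> borel_measurable (F t)" if "t \<in> {0..T}"
    unfolding drift_def[abs_def] using fc_process(2)[OF assms that] Uc_process(2)[OF _ that]
    by (intro borel_measurable_diff borel_measurable_sum borel_measurable_times) auto
qed

lemma Jc_process: "i < N \<Longrightarrow> cont_process (Jc i)"
  unfolding Jc_def[abs_def]
  by (intro cont_process_intros cont_process_initial Vc_process drift_process)

lemma U_V_h: "t \<in> {0..T} \<Longrightarrow> \<omega> \<in> space P \<Longrightarrow> U t \<omega> \<in> Vh"
  by (rule process_V_h[OF U])

lemma V_V_h: "t \<in> {0..T} \<Longrightarrow> \<omega> \<in> space P \<Longrightarrow> V t \<omega> \<in> Vh"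
  by (rule process_V_h[OF V])

lemma drift_eq:
  assumes i: "i < N" and s: "s \<in> {0..T}" and \<omega>: "\<omega> \<in> space P"
  shows "inn (\<lambda>x. Delta_h a b M k \<sigma> (U s \<omega>) x - P_h a b M k (\<lambda>y. f (U s \<omega> y)) x) (\<phi> i) = drift i s \<omega>"
proof -
  have u: "U s \<omega> \<in> Vh" by (rule U_V_h[OF s \<omega>])
  have fL: "(\<lambda>y. f (U s \<omega> y)) \<in> L2 a b" by (rule f_L2[OF V_h_L2[OF u]])
  have "inn (Delta_h a b M k \<sigma> (U s \<omega>)) (\<phi> i) = B_h a b M \<sigma> (\<phi> i) (U s \<omega>)"
    using Delta_h(2)[OF u \<phi>_V[OF i]] by (simp add: B_h_commute[of a b M \<sigma> "U s \<omega>"])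
  also have "\<dots> = (\<Sum>j<N. inn (U s \<omega>) (\<phi> j) * B_h a b M \<sigma> (\<phi> i) (\<phi> j))"
    by (rule V_h_functional[OF B_h_lincomb_right[OF \<phi>_V[OF i]] B_h_cong_right[OF \<phi>_V[OF i]] u])
  also have "\<dots> = (\<Sum>j<N. Uc j s \<omega> * Bc j i)"
    by (simp add: Uc_def Bc_def B_h_commute[of a b M \<sigma> "\<phi> i"])
  finally show ?thesis
    using Delta_h(1)[OF u] P_h[OF fL] i by (simp add: L2_inner_diff_left V_h_L2 \<phi>_L2 \<phi>_V drift_def fc_def)
qed

text \<open>This is the integrated equation for \<open>V\<close> paired with
  \<open>\<phi> i\<close>; the vector-valued integral is defined weakly, so the pairing enters it
  directly.\<close>

lemma Jc_eq:
  assumes i: "i < N" and t: "t \<in> {0..T}"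
  shows "AE \<omega> in P. Jc i t \<omega> = inn (I t \<omega>) (\<phi> i)"
proof -
  interpret SI: stoch_integral P F T a b q e \<beta> W R "\<lambda>s \<omega> v. P_h a b M k (g (U s \<omega>) v)" I "\<phi> i"
    by unfold_locales (rule si, rule \<phi>_L2[OF i])
  have "AE \<omega> in P. \<omega> \<in> space P" by simp
  with eqV[OF t] show ?thesis
  proof eventually_elim
    case (elim \<omega>)
    let ?X = "\<lambda>s x. Delta_h a b M k \<sigma> (U s \<omega>) x - P_h a b M k (\<lambda>y. f (U s \<omega> y)) x"
    have 0: "0 \<in> {0..T}" using T by simp
    have sub: "s \<in> {0..t} \<Longrightarrow> s \<in> {0..T}" for s using t by auto
    have "inn (\<lambda>x. V t \<omega> x - V 0 \<omega> x - I t \<omega> x) (\<phi> i) = (LINT s:{0..t}|lborel. inn (?X s) (\<phi> i))"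
      using elim(1) \<phi>_L2[OF i] unfolding L2_has_integral_def by blast
    also have "\<dots> = (LINT s:{0..t}|lborel. drift i s \<omega>)"
      by (intro set_lebesgue_integral_cong) (auto simp: drift_eq[OF i sub elim(2)])
    also have "\<dots> = integral {0..t} (\<lambda>s. drift i s \<omega>)"
      using cont_process_integral_eq(2)[OF drift_process(1)[OF i] t elim(2)] by (simp add: set_lebesgue_integral_def)
    finally have "inn (\<lambda>x. V t \<omega> x - V 0 \<omega> x - I t \<omega> x) (\<phi> i) = integral {0..t} (\<lambda>s. drift i s \<omega>)" .
    moreover have "inn (\<lambda>x. V t \<omega> x - V 0 \<omega> x - I t \<omega> x) (\<phi> i) = Vc i t \<omega> - Vc i 0 \<omega> - inn (I t \<omega>) (\<phi> i)"
      using V_h_L2[OF V_V_h[OF t elim(2)]] V_h_L2[OF V_V_h[OF 0 elim(2)]] SI.I_L2[OF t elim(2)] \<phi>_L2[OF i]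
      by (simp add: L2_inner_diff_left L2_diff Vc_def)
    ultimately show ?case by (simp add: Jc_def)
  qed
qed

text \<open>The equation is given with an exceptional set for each time; continuity of the
  coordinates makes it common to all times, which differentiation along a path requires.\<close>

lemma U_eq: "AE \<omega> in P. \<forall>i\<in>{..<N}. \<forall>t\<in>{0..T}. Uc i t \<omega> = Uc i 0 \<omega> + integral {0..t} (\<lambda>s. Vc i s \<omega>)"
proof (subst AE_finite_all, simp, intro ballI)
  fix i assume "i \<in> {..<N}"
  then have i: "i < N" by simp
  let ?G = "\<lambda>t \<omega>. Uc i t \<omega> - Uc i 0 \<omega> - integral {0..t} (\<lambda>s. Vc i s \<omega>)"
  have G: "cont_process ?G"
    by (intro cont_process_intros cont_process_initial Uc_process Vc_process i)
  have G0: "AE \<omega> in P. ?G t \<omega> = 0" if t: "t \<in> {0..T}" for t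
  proof -
    have "AE \<omega> in P. \<omega> \<in> space P" by simp
    with eqU[OF t] show ?thesis
    proof eventually_elim
      case (elim \<omega>)
      have 0: "0 \<in> {0..T}" using T by simp
      have "inn (\<lambda>x. U t \<omega> x - U 0 \<omega> x) (\<phi> i) = (LINT s:{0..t}|lborel. inn (V s \<omega>) (\<phi> i))"
        using elim(1) \<phi>_L2[OF i] unfolding L2_has_integral_def by blast
      also have "\<dots> = integral {0..t} (\<lambda>s. Vc i s \<omega>)"
        using cont_process_integral_eq(2)[OF Vc_process(1)[OF i] t elim(2)]
        by (simp add: set_lebesgue_integral_def Vc_def)
      finally show ?case
        using V_h_L2[OF U_V_h[OF t elim(2)]] V_h_L2[OF U_V_h[OF 0 elim(2)]] \<phi>_L2[OF i]
        by (simp add: L2_inner_diff_left Uc_def)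
    qed
  qed
  have "AE \<omega> in P. \<forall>t\<in>{0..T}. ?G t \<omega> = 0"
    by (rule AE_all_times[OF T]) (erule cont_processD(2)[OF G], erule G0)
  then show "AE \<omega> in P. \<forall>t\<in>{0..T}. Uc i t \<omega> = Uc i 0 \<omega> + integral {0..t} (\<lambda>s. Vc i s \<omega>)"
  proof (rule eventually_mono, intro ballI)
    fix \<omega> t assume "\<forall>t\<in>{0..T}. ?G t \<omega> = 0" "t \<in> {0..T}"
    then have "?G t \<omega> = 0" by (rule bspec)
    then show "Uc i t \<omega> = Uc i 0 \<omega> + integral {0..t} (\<lambda>s. Vc i s \<omega>)" by linarith
  qed
qed

lemma V_eq: "Vc i t \<omega> = Vc i 0 \<omega> + integral {0..t} (\<lambda>s. drift i s \<omega>) + Jc i t \<omega>"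
  by (simp add: Jc_def)

lemma init_eq: "AE \<omega> in P. \<forall>i<N. Uc i 0 \<omega> = inn u0 (\<phi> i) \<and> Vc i 0 \<omega> = inn v0 (\<phi> i)"
proof -
  have "AE \<omega> in P. \<omega> \<in> space P" by simp
  with init show ?thesis
  proof eventually_elim
    case (elim \<omega>)
    have 0: "0 \<in> {0..T}" using T by simp
    show ?case using elim u0 v0 V_h_L2 U_V_h[OF 0 elim(2)] V_V_h[OF 0 elim(2)]
      by (auto simp: Uc_def Vc_def \<phi>_L2 intro!: L2_inner_cong)
  qed
qed

lemma norm_U_le:
  assumes "t \<in> {0..T}" "\<omega> \<in> space P"
  shows "nrm (U t \<omega>) \<le> (\<Sum>j<N. \<bar>Uc j t \<omega>\<bar>)"
proof -
  have "nrm (U t \<omega>) = L2_set (\<lambda>j. Uc j t \<omega>) {..<N}"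
    using V_h_norm_sq[OF U_V_h[OF assms]] by (simp add: L2_set_def Uc_def real_sqrt_unique)
  then show ?thesis using L2_set_le_sum_abs by simp
qed

lemma drift_bound: "\<exists>c\<ge>0. \<forall>i<N. \<forall>t\<in>{0..T}. \<forall>\<omega>\<in>space P. \<bar>drift i t \<omega>\<bar> \<le> c * (1 + (\<Sum>j<N. \<bar>Uc j t \<omega>\<bar>))"
proof -
  obtain L where L: "L \<ge> 0" "\<And>i u v. i < N \<Longrightarrow> u \<in> L2 a b \<Longrightarrow> v \<in> L2 a b \<Longrightarrow>
      \<bar>inn (\<lambda>x. f (u x)) (\<phi> i) - inn (\<lambda>x. f (v x)) (\<phi> i)\<bar> \<le> L * nrm (\<lambda>x. u x - v x)"
    using f_inner_lipschitz by blast
  \<comment> \<open>\<open>c1\<close> dominates every entry of the matrix of \<open>B_h\<close>,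
    \<open>c2\<close> the coordinates of the constant function f(0), and \<open>L\<close> the growth
    of \<open>f\<close> away from 0.\<close>
  define c1 where "c1 = (\<Sum>i<N. \<Sum>j<N. \<bar>Bc j i\<bar>)"
  define c2 where "c2 = nrm (\<lambda>x. f 0)"
  have B: "\<bar>Bc j i\<bar> \<le> c1" if "i < N" "j < N" for i j
  proof -
    have "\<bar>Bc j i\<bar> \<le> (\<Sum>j<N. \<bar>Bc j i\<bar>)" using that by (intro member_le_sum) auto
    also have "\<dots> \<le> c1" unfolding c1_def using that by (intro member_le_sum[of i "{..<N}" "\<lambda>i. \<Sum>j<N. \<bar>Bc j i\<bar>"]) (auto intro: sum_nonneg)
    finally show ?thesis .
  qed
  have c0: "0 \<le> c1" "0 \<le> c2" by (auto simp: c1_def c2_def intro!: sum_nonneg)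
  have "\<bar>drift i t \<omega>\<bar> \<le> (c1 + c2 + L) * (1 + (\<Sum>j<N. \<bar>Uc j t \<omega>\<bar>))"
    if i: "i < N" and t: "t \<in> {0..T}" "\<omega> \<in> space P" for i t \<omega>
  proof -
    let ?S = "\<Sum>j<N. \<bar>Uc j t \<omega>\<bar>"
    have S: "0 \<le> ?S" by (intro sum_nonneg) simp
    have u: "U t \<omega> \<in> L2 a b" using V_h_L2[OF U_V_h[OF t]] .
    have "\<bar>\<Sum>j<N. Uc j t \<omega> * Bc j i\<bar> \<le> (\<Sum>j<N. \<bar>Uc j t \<omega>\<bar> * c1)"
      using B[OF i] by (intro order_trans[OF sum_abs] sum_mono) (auto simp: abs_mult intro: mult_left_mono)
    then have 1: "\<bar>\<Sum>j<N. Uc j t \<omega> * Bc j i\<bar> \<le> c1 * ?S" by (simp add: sum_distrib_left mult.commute)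
    have "\<bar>fc i t \<omega> - inn (\<lambda>x. f 0) (\<phi> i)\<bar> \<le> L * nrm (U t \<omega>)"
      using L(2)[OF i u L2_const[of 0]] by (simp add: fc_def)
    also have "\<dots> \<le> L * ?S" by (rule mult_left_mono[OF norm_U_le[OF t] L(1)])
    finally have "\<bar>fc i t \<omega> - inn (\<lambda>x. f 0) (\<phi> i)\<bar> \<le> L * ?S" .
    moreover have "\<bar>inn (\<lambda>x. f 0) (\<phi> i)\<bar> \<le> c2" unfolding c2_def by (rule inner_\<phi>_le[OF i L2_const])
    ultimately have 2: "\<bar>fc i t \<omega>\<bar> \<le> c2 + L * ?S" by linarith
    have "\<bar>drift i t \<omega>\<bar> \<le> c1 * ?S + (c2 + L * ?S)" using 1 2 unfolding drift_def by linarith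
    also have "\<dots> \<le> (c1 + c2 + L) * (1 + ?S)"
      using S c0 L(1) by (simp add: algebra_simps)
    finally show ?thesis .
  qed
  then show ?thesis using c0 L(1) by (intro exI[of _ "c1 + c2 + L"]) auto
qed

end

section \<open>Joint integrability and Fubini\<close>

context Q_wiener
begin

lemma cont_process_integrable:
  assumes Z: "cont_process Z" and t: "t \<in> {0..T}" and nn: "\<And>s \<omega>. 0 \<le> Z s \<omega>"
    and bd: "\<And>s. s \<in> {0..t} \<Longrightarrow> (\<integral>\<^sup>+\<omega>. ennreal (Z s \<omega>) \<partial>P) \<le> ennreal C"
  shows "integrable (lborel \<Otimes>\<^sub>M P) (\<lambda>z. indicator {0..t} (fst z) * Z (fst z) (snd z))"
proof (rule integrableI_nonneg)
  show "(\<lambda>z. indicator {0..t} (fst z) * Z (fst z) (snd z)) \<in> borel_measurable (lborel \<Otimes>\<^sub>M P)"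
    by (rule cont_process_joint[OF Z t])
  have "(\<integral>\<^sup>+z. ennreal (indicator {0..t} (fst z) * Z (fst z) (snd z)) \<partial>(lborel \<Otimes>\<^sub>M P))
    \<le> (\<integral>\<^sup>+s. ennreal C * indicator {0..t} s \<partial>lborel)"
    unfolding cont_process_nn_integral(2)[OF Z t nn]
    by (intro nn_integral_mono) (auto simp: indicator_def bd)
  also have "\<dots> = ennreal C * ennreal t" using t by (subst nn_integral_cmult_indicator) auto
  also have "\<dots> < \<infinity>" by (simp add: ennreal_mult_less_top)
  finally show "(\<integral>\<^sup>+z. ennreal (indicator {0..t} (fst z) * Z (fst z) (snd z)) \<partial>(lborel \<Otimes>\<^sub>M P)) < \<infinity>" .
qed (auto simp: nn)

lemma cont_process_fubini:
  assumes Z: "cont_process Z" and t: "t \<in> {0..T}"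
    and int: "integrable (lborel \<Otimes>\<^sub>M P) (\<lambda>z. indicator {0..t} (fst z) * Z (fst z) (snd z))"
  shows "integrable P (\<lambda>\<omega>. integral {0..t} (\<lambda>s. Z s \<omega>))"
    and "expectation (\<lambda>\<omega>. integral {0..t} (\<lambda>s. Z s \<omega>)) = (\<integral>s. indicator {0..t} s * expectation (Z s) \<partial>lborel)"
proof -
  interpret PL: pair_sigma_finite P lborel ..
  have int': "integrable (P \<Otimes>\<^sub>M lborel) (\<lambda>(\<omega>, s). indicator {0..t} s * Z s \<omega>)"
    using lborel_P.integrable_product_swap[OF int] by simp
  show "integrable P (\<lambda>\<omega>. integral {0..t} (\<lambda>s. Z s \<omega>))"
    by (subst Bochner_Integration.integrable_cong[OF refl cont_process_integral_eq(2)[OF Z t]])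
      (use PL.integrable_fst'[OF int'] in simp_all)
  have "expectation (\<lambda>\<omega>. integral {0..t} (\<lambda>s. Z s \<omega>)) = (\<integral>\<omega>. \<integral>s. indicator {0..t} s * Z s \<omega> \<partial>lborel \<partial>P)"
    using cont_process_integral_eq(2)[OF Z t] by (intro Bochner_Integration.integral_cong) auto
  also have "\<dots> = (\<integral>s. \<integral>\<omega>. indicator {0..t} s * Z s \<omega> \<partial>P \<partial>lborel)"
    using int by (intro lborel_P.Fubini_integral) (simp add: case_prod_unfold)
  finally show "expectation (\<lambda>\<omega>. integral {0..t} (\<lambda>s. Z s \<omega>)) = (\<integral>s. indicator {0..t} s * expectation (Z s) \<partial>lborel)"
    by simp
qed

end

section \<open>Second moments and the vanishing of the martingale term\<close>

context ipdg
begin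

text \<open>The second moment that the isometry assigns to the i-th coordinate of the stochastic
  integral at time \<open>t\<close>. As an extended real series of integrals it is monotone in
  \<open>t\<close> and needs no prior integrability.\<close>

definition mass :: "nat \<Rightarrow> real \<Rightarrow> ennreal" where
  "mass i t = (\<Sum>l. \<integral>\<^sup>+z. ennreal ((indicator {0..t} (fst z) *
      inn (P_h a b M k (g (U (fst z) (snd z)) (bas l))) (\<phi> i))\<^sup>2) \<partial>(lborel \<Otimes>\<^sub>M P))"

lemma SI:
  assumes "i < N"
  shows "stoch_integral P F T a b q e \<beta> W R (\<lambda>s \<omega> v. P_h a b M k (g (U s \<omega>) v)) I (\<phi> i)"
  by unfold_locales (rule si, rule \<phi>_L2[OF assms])

lemma Jc_moments:
  assumes i: "i < N" and t: "t \<in> {0..T}"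
  shows "integrable P (\<lambda>\<omega>. (Jc i t \<omega>)\<^sup>2)" "ennreal (expectation (\<lambda>\<omega>. (Jc i t \<omega>)\<^sup>2)) = mass i t"
proof -
  interpret SI: stoch_integral P F T a b q e \<beta> W R "\<lambda>s \<omega> v. P_h a b M k (g (U s \<omega>) v)" I "\<phi> i"
    by (rule SI[OF i])
  have [measurable]: "Jc i t \<in> borel_measurable P" "(\<lambda>\<omega>. inn (I t \<omega>) (\<phi> i)) \<in> borel_measurable P"
    using cont_processD(1)[OF Jc_process[OF i] t] SI.I_measurable[OF t] by auto
  have eq: "AE \<omega> in P. (Jc i t \<omega>)\<^sup>2 = (inn (I t \<omega>) (\<phi> i))\<^sup>2"
    using Jc_eq[OF i t] by (rule eventually_mono) simp
  show "integrable P (\<lambda>\<omega>. (Jc i t \<omega>)\<^sup>2)"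
    by (subst integrable_cong_AE[OF _ _ eq]) (use SI.isometry_martingale(1)[OF t] in auto)
  have "expectation (\<lambda>\<omega>. (Jc i t \<omega>)\<^sup>2) = expectation (\<lambda>\<omega>. (inn (I t \<omega>) (\<phi> i))\<^sup>2)"
    by (rule integral_cong_AE[OF _ _ eq]) auto
  then show "ennreal (expectation (\<lambda>\<omega>. (Jc i t \<omega>)\<^sup>2)) = mass i t"
    using SI.isometry_martingale(2)[OF t] by (simp add: mass_def SI.\<psi>_def case_prod_unfold)
qed

lemma Jc_martingale:
  assumes i: "i < N" and st: "0 \<le> s" "s \<le> t" "t \<le> T"
    and X: "X \<in> borel_measurable (F s)" "integrable P (\<lambda>\<omega>. (X \<omega>)\<^sup>2)"
  shows "expectation (\<lambda>\<omega>. X \<omega> * Jc i t \<omega>) = expectation (\<lambda>\<omega>. X \<omega> * Jc i s \<omega>)"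
proof -
  interpret SI: stoch_integral P F T a b q e \<beta> W R "\<lambda>s \<omega> v. P_h a b M k (g (U s \<omega>) v)" I "\<phi> i"
    by (rule SI[OF i])
  have s: "s \<in> {0..T}" and t: "t \<in> {0..T}" using st by auto
  have [measurable]: "X \<in> borel_measurable P" by (rule measurable_F[OF s X(1)])
  have "expectation (\<lambda>\<omega>. X \<omega> * Jc i r \<omega>) = expectation (\<lambda>\<omega>. X \<omega> * inn (I r \<omega>) (\<phi> i))" if r: "r \<in> {0..T}" for r
  proof (rule integral_cong_AE)
    have [measurable]: "Jc i r \<in> borel_measurable P" "(\<lambda>\<omega>. inn (I r \<omega>) (\<phi> i)) \<in> borel_measurable P"
      using cont_processD(1)[OF Jc_process[OF i] r] SI.I_measurable[OF r] by auto
    show "(\<lambda>\<omega>. X \<omega> * Jc i r \<omega>) \<in> borel_measurable P" "(\<lambda>\<omega>. X \<omega> * inn (I r \<omega>) (\<phi> i)) \<in> borel_measurable P"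
      by measurable
    show "AE \<omega> in P. X \<omega> * Jc i r \<omega> = X \<omega> * inn (I r \<omega>) (\<phi> i)"
      using Jc_eq[OF i r] by (rule eventually_mono) simp
  qed
  then show ?thesis using SI.isometry_martingale(3)[OF st X] s t by simp
qed

lemma Jc_moment_mono:
  assumes i: "i < N" and t: "t \<in> {0..T}"
  shows "expectation (\<lambda>\<omega>. (Jc i t \<omega>)\<^sup>2) \<le> expectation (\<lambda>\<omega>. (Jc i T \<omega>)\<^sup>2)"
proof -
  have "mass i t \<le> mass i T" unfolding mass_def
    using t by (intro suminf_le nn_integral_mono ennreal_leI) (auto simp: indicator_def)
  then have "ennreal (expectation (\<lambda>\<omega>. (Jc i t \<omega>)\<^sup>2)) \<le> ennreal (expectation (\<lambda>\<omega>. (Jc i T \<omega>)\<^sup>2))"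
    using Jc_moments(2)[OF i t] Jc_moments(2)[OF i, of T] T by simp
  then show ?thesis by (subst (asm) ennreal_le_iff) auto
qed

text \<open>Absolute values allow the coordinate equations to be estimated one by one by the
  triangle inequality; squares are taken only afterwards.\<close>

definition size_UV :: "real \<Rightarrow> 'w \<Rightarrow> real" where
  "size_UV t \<omega> = (\<Sum>i<N. \<bar>Uc i t \<omega>\<bar> + \<bar>Vc i t \<omega>\<bar>)"

lemma size_UV_process: "cont_process size_UV"
  unfolding size_UV_def[abs_def] by (intro cont_process_intros Uc_process Vc_process) auto

lemma size_UV_nonneg: "0 \<le> size_UV t \<omega>"
  unfolding size_UV_def by (intro sum_nonneg) auto

lemma drift_bound': "\<exists>c\<ge>0. \<forall>i<N. \<forall>t\<in>{0..T}. \<forall>\<omega>\<in>space P. \<bar>drift i t \<omega>\<bar> \<le> c * (1 + size_UV t \<omega>)"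
proof -
  obtain c where c: "c \<ge> 0" "\<And>i t \<omega>. i < N \<Longrightarrow> t \<in> {0..T} \<Longrightarrow> \<omega> \<in> space P \<Longrightarrow> \<bar>drift i t \<omega>\<bar> \<le> c * (1 + (\<Sum>j<N. \<bar>Uc j t \<omega>\<bar>))"
    using drift_bound by blast
  have "c * (1 + (\<Sum>j<N. \<bar>Uc j t \<omega>\<bar>)) \<le> c * (1 + size_UV t \<omega>)" for t \<omega>
    unfolding size_UV_def using c(1) by (intro mult_left_mono add_left_mono sum_mono) auto
  then show ?thesis using c order_trans by blast
qed

lemma size_UV_bound:
  "\<exists>A\<ge>0. AE \<omega> in P. integral {0..T} (\<lambda>s. (size_UV s \<omega>)\<^sup>2)
    \<le> A + A * (\<Sum>i<N. integral {0..T} (\<lambda>s. (Jc i s \<omega>)\<^sup>2))"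
proof -
  obtain c where c0: "c \<ge> 0" and c: "\<And>i t \<omega>. i < N \<Longrightarrow> t \<in> {0..T} \<Longrightarrow> \<omega> \<in> space P \<Longrightarrow> \<bar>drift i t \<omega>\<bar> \<le> c * (1 + size_UV t \<omega>)"
    using drift_bound' by blast
  \<comment> \<open>\<open>K\<close> is the size of the initial data. In \<open>C\<close> the 1
    comes from the equation for \<open>U\<close> and \<open>N * c\<close> from the drifts, whose
    constant part puts \<open>N * c * T\<close> into \<open>K'\<close>. Squaring three summands
    gives the factor 3, Cauchy-Schwarz in time the \<open>T\<close> in \<open>D\<close>, and
    Cauchy-Schwarz over the coordinates the \<open>N\<close> in \<open>A\<close>;
    \<open>exp (D * T)\<close> is the Gronwall factor.\<close>
  define K where "K = (\<Sum>i<N. \<bar>inn u0 (\<phi> i)\<bar> + \<bar>inn v0 (\<phi> i)\<bar>)"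
  define C where "C = 1 + N * c"
  define K' where "K' = K + N * c * T"
  define D where "D = 3 * C\<^sup>2 * T"
  define A where "A = exp (D * T) * (3 * K'\<^sup>2 * T + 3 * N)"
  have nonneg: "0 \<le> K" "0 \<le> C" "0 \<le> K'" "0 \<le> D" using c0 T
    by (auto simp: K_def C_def K'_def D_def intro!: sum_nonneg add_nonneg_nonneg)
  have A0: "0 \<le> A" using T by (simp add: A_def)
  have "AE \<omega> in P. \<omega> \<in> space P" by simp
  with U_eq init_eq have "AE \<omega> in P. integral {0..T} (\<lambda>s. (size_UV s \<omega>)\<^sup>2)
    \<le> A + A * (\<Sum>i<N. integral {0..T} (\<lambda>s. (Jc i s \<omega>)\<^sup>2))"
  proof eventually_elim
    case (elim \<omega>)
    let ?y = "\<lambda>s. size_UV s \<omega>"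
    let ?m = "\<lambda>s. \<Sum>i<N. \<bar>Jc i s \<omega>\<bar>"
    let ?Q = "\<lambda>s. \<Sum>i<N. (Jc i s \<omega>)\<^sup>2"
    have cont: "continuous_on {0..t} (\<lambda>s. Z s \<omega>)" if "cont_process Z" "t \<in> {0..T}" for Z t
      by (rule cont_process_on[OF that(1) elim(3) that(2)])
    have 0: "0 \<in> {0..T}" and TT: "T \<in> {0..T}" using T by auto
    have le1: "?y t \<le> K' + ?m t + C * integral {0..t} ?y" if t: "t \<in> {0..T}" for t
    proof -
      note ints = integrable_continuous_real
      have cV: "continuous_on {0..t} (\<lambda>s. Vc i s \<omega>)" "continuous_on {0..t} (\<lambda>s. drift i s \<omega>)" if "i < N" for i
        using cont[OF Vc_process(1)[OF that] t] cont[OF drift_process(1)[OF that] t] by auto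
      have cy: "continuous_on {0..t} ?y" by (rule cont[OF size_UV_process t])
      have "?y t \<le> (\<Sum>i<N. (\<bar>inn u0 (\<phi> i)\<bar> + \<bar>inn v0 (\<phi> i)\<bar>) + \<bar>Jc i t \<omega>\<bar> + integral {0..t} (\<lambda>s. \<bar>Vc i s \<omega>\<bar> + \<bar>drift i s \<omega>\<bar>))"
        unfolding size_UV_def
      proof (rule sum_mono)
        fix i assume "i \<in> {..<N}"
        then have i: "i < N" by simp
        have "Uc i t \<omega> = inn u0 (\<phi> i) + integral {0..t} (\<lambda>s. Vc i s \<omega>)" using elim i t by auto
        moreover have "Vc i t \<omega> = inn v0 (\<phi> i) + integral {0..t} (\<lambda>s. drift i s \<omega>) + Jc i t \<omega>"
          using elim i V_eq[of i t \<omega>] by auto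
        moreover have "integral {0..t} (\<lambda>s. \<bar>Vc i s \<omega>\<bar> + \<bar>drift i s \<omega>\<bar>) = integral {0..t} (\<lambda>s. \<bar>Vc i s \<omega>\<bar>) + integral {0..t} (\<lambda>s. \<bar>drift i s \<omega>\<bar>)"
          by (intro Henstock_Kurzweil_Integration.integral_add ints continuous_on_rabs cV i)
        ultimately show "\<bar>Uc i t \<omega>\<bar> + \<bar>Vc i t \<omega>\<bar> \<le> (\<bar>inn u0 (\<phi> i)\<bar> + \<bar>inn v0 (\<phi> i)\<bar>) + \<bar>Jc i t \<omega>\<bar> + integral {0..t} (\<lambda>s. \<bar>Vc i s \<omega>\<bar> + \<bar>drift i s \<omega>\<bar>)"
          using abs_integral_le[OF cV(1)[OF i]] abs_integral_le[OF cV(2)[OF i]] by linarith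
      qed
      also have "\<dots> = K + ?m t + integral {0..t} (\<lambda>s. \<Sum>i<N. \<bar>Vc i s \<omega>\<bar> + \<bar>drift i s \<omega>\<bar>)"
      proof -
        have "integral {0..t} (\<lambda>s. \<Sum>i<N. \<bar>Vc i s \<omega>\<bar> + \<bar>drift i s \<omega>\<bar>) = (\<Sum>i<N. integral {0..t} (\<lambda>s. \<bar>Vc i s \<omega>\<bar> + \<bar>drift i s \<omega>\<bar>))"
          by (rule Henstock_Kurzweil_Integration.integral_sum) (auto intro!: ints continuous_intros cV)
        then show ?thesis by (simp add: sum.distrib K_def)
      qed
      also have "integral {0..t} (\<lambda>s. \<Sum>i<N. \<bar>Vc i s \<omega>\<bar> + \<bar>drift i s \<omega>\<bar>) \<le> integral {0..t} (\<lambda>s. N * c + C * ?y s)"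
      proof (rule integral_le)
        show "(\<lambda>s. \<Sum>i<N. \<bar>Vc i s \<omega>\<bar> + \<bar>drift i s \<omega>\<bar>) integrable_on {0..t}"
          by (auto intro!: ints continuous_intros cV)
        show "(\<lambda>s. N * c + C * ?y s) integrable_on {0..t}" by (auto intro!: ints continuous_intros cy)
        fix s assume s: "s \<in> {0..t}"
        then have sT: "s \<in> {0..T}" using t by auto
        have "(\<Sum>i<N. \<bar>drift i s \<omega>\<bar>) \<le> (\<Sum>i<N. c * (1 + ?y s))"
          using c[OF _ sT elim(3)] by (intro sum_mono) auto
        moreover have "(\<Sum>i<N. \<bar>Vc i s \<omega>\<bar>) \<le> ?y s" unfolding size_UV_def by (intro sum_mono) auto
        ultimately show "(\<Sum>i<N. \<bar>Vc i s \<omega>\<bar> + \<bar>drift i s \<omega>\<bar>) \<le> N * c + C * ?y s"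
          by (simp add: sum.distrib C_def algebra_simps)
      qed
      also have "integral {0..t} (\<lambda>s. N * c + C * ?y s) = N * c * t + C * integral {0..t} ?y"
        using t by (subst Henstock_Kurzweil_Integration.integral_add) (auto intro!: ints continuous_intros cy)
      also have "N * c * t \<le> N * c * T" using t c0 by (intro mult_left_mono) auto
      finally show ?thesis by (simp add: K'_def)
    qed
    \<comment> \<open>The linear bound is squared before Gronwall is applied, so that
      \<open>Jc\<close> enters through its square, whose expectation is finite.\<close>
    have le2: "(?y t)\<^sup>2 \<le> (3 * K'\<^sup>2 + 3 * N * ?Q t) + D * integral {0..t} (\<lambda>s. (?y s)\<^sup>2)" if t: "t \<in> {0..T}" for t
    proof -
      let ?i = "integral {0..t} ?y"
      have three: "(x + y + z)\<^sup>2 \<le> 3 * x\<^sup>2 + 3 * y\<^sup>2 + 3 * z\<^sup>2" for x y z :: real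
      proof -
        have "3 * x\<^sup>2 + 3 * y\<^sup>2 + 3 * z\<^sup>2 - (x + y + z)\<^sup>2 = (x - y)\<^sup>2 + (y - z)\<^sup>2 + (x - z)\<^sup>2"
          by (simp add: power2_eq_square algebra_simps)
        then show ?thesis by (smt (verit) zero_le_power2)
      qed
      have "(?y t)\<^sup>2 \<le> (K' + ?m t + C * ?i)\<^sup>2" by (intro power_mono le1 t size_UV_nonneg)
      also have "\<dots> \<le> 3 * K'\<^sup>2 + 3 * (?m t)\<^sup>2 + 3 * (C * ?i)\<^sup>2" by (rule three)
      also have "(?m t)\<^sup>2 \<le> N * ?Q t"
        using sum_squared_le_sum_of_squares[of "\<lambda>i. \<bar>Jc i t \<omega>\<bar>" "{..<N}"] by (simp add: mult.commute)
      also have "(C * ?i)\<^sup>2 \<le> C\<^sup>2 * (T * integral {0..t} (\<lambda>s. (?y s)\<^sup>2))"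
      proof -
        have "?i\<^sup>2 \<le> t * integral {0..t} (\<lambda>s. (?y s)\<^sup>2)"
          using t by (intro integral_square_le cont[OF size_UV_process t]) auto
        also have "\<dots> \<le> T * integral {0..t} (\<lambda>s. (?y s)\<^sup>2)"
          using t by (intro mult_right_mono integral_nonneg) (auto intro!: integrable_continuous_real continuous_intros cont[OF size_UV_process t])
        finally show ?thesis by (simp add: power_mult_distrib mult_left_mono)
      qed
      finally show ?thesis by (simp add: D_def mult.assoc)
    qed
    have "integral {0..T} (\<lambda>s. (?y s)\<^sup>2) \<le> exp (D * T) * integral {0..T} (\<lambda>s. 3 * K'\<^sup>2 + 3 * N * ?Q s)"
    proof (rule gronwall_integral[OF _ _ _ _ nonneg(4) le2])
      show "continuous_on {0..T} (\<lambda>s. (?y s)\<^sup>2)" by (intro continuous_intros cont[OF size_UV_process TT])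
      show "continuous_on {0..T} (\<lambda>s. 3 * K'\<^sup>2 + 3 * N * ?Q s)"
        by (auto intro!: continuous_intros cont[OF Jc_process TT])
      show "0 \<le> 3 * K'\<^sup>2 + 3 * N * ?Q s" for s by (intro add_nonneg_nonneg mult_nonneg_nonneg sum_nonneg) auto
    qed (use T in auto)
    also have "integral {0..T} (\<lambda>s. 3 * K'\<^sup>2 + 3 * N * ?Q s) = 3 * K'\<^sup>2 * T + 3 * N * (\<Sum>i<N. integral {0..T} (\<lambda>s. (Jc i s \<omega>)\<^sup>2))"
    proof -
      have "integral {0..T} ?Q = (\<Sum>i<N. integral {0..T} (\<lambda>s. (Jc i s \<omega>)\<^sup>2))"
        by (rule Henstock_Kurzweil_Integration.integral_sum) (auto intro!: integrable_continuous_real continuous_intros cont[OF Jc_process TT])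
      then show ?thesis using T
        by (subst Henstock_Kurzweil_Integration.integral_add) (auto intro!: integrable_continuous_real continuous_intros cont[OF Jc_process TT])
    qed
    also have "exp (D * T) * (3 * K'\<^sup>2 * T + 3 * N * (\<Sum>i<N. integral {0..T} (\<lambda>s. (Jc i s \<omega>)\<^sup>2)))
      \<le> A + A * (\<Sum>i<N. integral {0..T} (\<lambda>s. (Jc i s \<omega>)\<^sup>2))"
    proof -
      have S: "0 \<le> (\<Sum>i<N. integral {0..T} (\<lambda>s. (Jc i s \<omega>)\<^sup>2))"
        by (intro sum_nonneg integral_nonneg integrable_continuous_real continuous_intros cont[OF Jc_process TT]) auto
      have 1: "exp (D * T) * (3 * K'\<^sup>2 * T) \<le> A" using T by (simp add: A_def)
      have 2: "exp (D * T) * (3 * N) \<le> A" using T by (simp add: A_def)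
      show ?thesis using add_mono[OF 1 mult_right_mono[OF 2 S]] by (simp add: distrib_left mult.assoc)
    qed
    finally show ?case .
  qed
  then show ?thesis using A0 by blast
qed

lemma Jc_joint_integrable:
  assumes i: "i < N" and t: "t \<in> {0..T}"
  shows "integrable (lborel \<Otimes>\<^sub>M P) (\<lambda>z. indicator {0..t} (fst z) * (Jc i (fst z) (snd z))\<^sup>2)"
proof (rule cont_process_integrable[OF cont_process_power[OF Jc_process[OF i]] t])
  fix s assume "s \<in> {0..t}"
  then have s: "s \<in> {0..T}" using t by auto
  show "(\<integral>\<^sup>+\<omega>. ennreal ((Jc i s \<omega>)\<^sup>2) \<partial>P) \<le> ennreal (expectation (\<lambda>\<omega>. (Jc i T \<omega>)\<^sup>2))"
    by (subst nn_integral_eq_integral[OF Jc_moments(1)[OF i s]]) (auto intro: ennreal_leI Jc_moment_mono[OF i s])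
qed simp

text \<open>The pathwise bound is integrated over \<open>P\<close>, where its right side is
  integrable by the second moments of \<open>Jc\<close>; Tonelli turns this into joint
  integrability.\<close>

lemma size_UV_joint_integrable:
  assumes t: "t \<in> {0..T}"
  shows "integrable (lborel \<Otimes>\<^sub>M P) (\<lambda>z. indicator {0..t} (fst z) * (size_UV (fst z) (snd z))\<^sup>2)"
proof -
  have TT: "T \<in> {0..T}" using T by simp
  note Y = cont_process_power[OF size_UV_process]
  obtain A where A: "A \<ge> 0" "AE \<omega> in P. integral {0..T} (\<lambda>s. (size_UV s \<omega>)\<^sup>2)
    \<le> A + A * (\<Sum>i<N. integral {0..T} (\<lambda>s. (Jc i s \<omega>)\<^sup>2))" using size_UV_bound by blast
  have Ji: "integrable P (\<lambda>\<omega>. integral {0..T} (\<lambda>s. (Jc i s \<omega>)\<^sup>2))" if "i < N" for i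
    by (rule cont_process_fubini(1)[OF cont_process_power[OF Jc_process[OF that]] TT Jc_joint_integrable[OF that TT]])
  have RI: "integrable P (\<lambda>\<omega>. A + A * (\<Sum>i<N. integral {0..T} (\<lambda>s. (Jc i s \<omega>)\<^sup>2)))"
    using Ji by (intro Bochner_Integration.integrable_add integrable_mult_right Bochner_Integration.integrable_sum) auto
  have "(\<integral>\<^sup>+\<omega>. ennreal (integral {0..T} (\<lambda>s. (size_UV s \<omega>)\<^sup>2)) \<partial>P) < \<infinity>"
  proof (rule le_less_trans)
    show "(\<integral>\<^sup>+\<omega>. ennreal (integral {0..T} (\<lambda>s. (size_UV s \<omega>)\<^sup>2)) \<partial>P)
      \<le> (\<integral>\<^sup>+\<omega>. ennreal (A + A * (\<Sum>i<N. integral {0..T} (\<lambda>s. (Jc i s \<omega>)\<^sup>2))) \<partial>P)"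
      by (rule nn_integral_mono_AE, use A(2) in eventually_elim) (rule ennreal_leI)
    show "(\<integral>\<^sup>+\<omega>. ennreal (A + A * (\<Sum>i<N. integral {0..T} (\<lambda>s. (Jc i s \<omega>)\<^sup>2))) \<partial>P) < \<infinity>"
    proof (rule le_less_trans)
      show "(\<integral>\<^sup>+\<omega>. ennreal (A + A * (\<Sum>i<N. integral {0..T} (\<lambda>s. (Jc i s \<omega>)\<^sup>2))) \<partial>P)
        \<le> (\<integral>\<^sup>+\<omega>. ennreal (norm (A + A * (\<Sum>i<N. integral {0..T} (\<lambda>s. (Jc i s \<omega>)\<^sup>2)))) \<partial>P)"
        by (intro nn_integral_mono ennreal_leI) (simp add: abs_ge_self)
    qed (rule conjunct2[OF RI[unfolded integrable_iff_bounded]])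
  qed
  then have "integrable (lborel \<Otimes>\<^sub>M P) (\<lambda>z. indicator {0..T} (fst z) * (size_UV (fst z) (snd z))\<^sup>2)"
    using cont_process_joint[OF Y TT] by (intro integrableI_nonneg) (simp_all add: cont_process_nn_integral(1)[OF Y TT])
  then show ?thesis
  proof (rule Bochner_Integration.integrable_bound)
    show "(\<lambda>z. indicator {0..t} (fst z) * (size_UV (fst z) (snd z))\<^sup>2) \<in> borel_measurable (lborel \<Otimes>\<^sub>M P)"
      by (rule cont_process_joint[OF Y t])
    show "AE z in lborel \<Otimes>\<^sub>M P. norm (indicator {0..t} (fst z) * (size_UV (fst z) (snd z))\<^sup>2)
        \<le> norm (indicator {0..T} (fst z) * (size_UV (fst z) (snd z))\<^sup>2)"
      using t by (auto simp: indicator_def)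
  qed
qed

lemma drift_joint_integrable:
  assumes i: "i < N" and t: "t \<in> {0..T}"
  shows "integrable (lborel \<Otimes>\<^sub>M P) (\<lambda>z. indicator {0..t} (fst z) * (drift i (fst z) (snd z))\<^sup>2)"
proof -
  obtain c where c0: "c \<ge> 0" and c: "\<And>t \<omega>. t \<in> {0..T} \<Longrightarrow> \<omega> \<in> space P \<Longrightarrow> \<bar>drift i t \<omega>\<bar> \<le> c * (1 + size_UV t \<omega>)"
    using drift_bound' i by blast
  have one: "integrable (lborel \<Otimes>\<^sub>M P) (\<lambda>z. indicator {0..t} (fst z) * (1::real))"
    by (rule cont_process_integrable[where Z="\<lambda>s \<omega>. 1" and C=1, OF cont_process_const t]) (simp_all add: emeasure_space_1)
  show ?thesis
  proof (rule Bochner_Integration.integrable_bound)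
    show "integrable (lborel \<Otimes>\<^sub>M P) (\<lambda>z. 2 * c\<^sup>2 * (indicator {0..t} (fst z) * 1) + 2 * c\<^sup>2 * (indicator {0..t} (fst z) * (size_UV (fst z) (snd z))\<^sup>2))"
      by (intro Bochner_Integration.integrable_add integrable_mult_right one size_UV_joint_integrable t)
    show "(\<lambda>z. indicator {0..t} (fst z) * (drift i (fst z) (snd z))\<^sup>2) \<in> borel_measurable (lborel \<Otimes>\<^sub>M P)"
      by (rule cont_process_joint[OF cont_process_power[OF drift_process(1)[OF i]] t])
    show "AE z in lborel \<Otimes>\<^sub>M P. norm (indicator {0..t} (fst z) * (drift i (fst z) (snd z))\<^sup>2)
      \<le> norm (2 * c\<^sup>2 * (indicator {0..t} (fst z) * 1) + 2 * c\<^sup>2 * (indicator {0..t} (fst z) * (size_UV (fst z) (snd z))\<^sup>2))"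
    proof (rule AE_I2)
      fix z :: "real \<times> 'w" assume "z \<in> space (lborel \<Otimes>\<^sub>M P)"
      then have \<omega>: "snd z \<in> space P" by (auto simp: space_pair_measure)
      show "norm (indicator {0..t} (fst z) * (drift i (fst z) (snd z))\<^sup>2)
        \<le> norm (2 * c\<^sup>2 * (indicator {0..t} (fst z) * 1) + 2 * c\<^sup>2 * (indicator {0..t} (fst z) * (size_UV (fst z) (snd z))\<^sup>2))"
      proof (cases "fst z \<in> {0..t}")
        case True
        let ?y = "size_UV (fst z) (snd z)"
        have "\<bar>drift i (fst z) (snd z)\<bar>\<^sup>2 \<le> (c * (1 + ?y))\<^sup>2"
          using c[OF _ \<omega>, of "fst z"] True t by (intro power_mono) auto
        also have "\<dots> = c\<^sup>2 * (1 + ?y)\<^sup>2" by (simp add: power_mult_distrib)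
        also have "\<dots> \<le> c\<^sup>2 * (2 + 2 * ?y\<^sup>2)"
          using sum_squares_bound[of 1 ?y] by (intro mult_left_mono) (auto simp: power2_sum)
        finally show ?thesis using True by (simp add: algebra_simps)
      qed simp
    qed
  qed
qed

text \<open>At a fixed \<open>s\<close> the drift is known and the increment of \<open>Jc\<close>
  after \<open>s\<close> is orthogonal to it, so the expectation of the integrand vanishes before
  the time integral is taken. Joint integrability of the three squares justifies the
  exchange.\<close>

lemma martingale_term:
  assumes i: "i < N" and t: "t \<in> {0..T}"
  shows "integrable P (\<lambda>\<omega>. integral {0..t} (\<lambda>s. drift i s \<omega> * (Jc i t \<omega> - Jc i s \<omega>)))"
    "expectation (\<lambda>\<omega>. integral {0..t} (\<lambda>s. drift i s \<omega> * (Jc i t \<omega> - Jc i s \<omega>))) = 0"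
proof -
  define Z where "Z s \<omega> = drift i s \<omega> * (Jc i t \<omega> - Jc i s \<omega>)" for s \<omega>
  have Jt: "cont_process (\<lambda>s. Jc i t)"
    using cont_processD(1)[OF Jc_process[OF i] t] by (simp add: cont_process_def)
  have Z: "cont_process Z" unfolding Z_def[abs_def]
    by (intro cont_process_intros drift_process Jc_process Jt i)
  have Jtint: "integrable (lborel \<Otimes>\<^sub>M P) (\<lambda>z. indicator {0..t} (fst z) * (Jc i t (snd z))\<^sup>2)"
    by (rule cont_process_integrable[OF cont_process_power[OF Jt] t, of "expectation (\<lambda>\<omega>. (Jc i t \<omega>)\<^sup>2)"])
      (simp_all add: nn_integral_eq_integral[OF Jc_moments(1)[OF i t]])
  have int: "integrable (lborel \<Otimes>\<^sub>M P) (\<lambda>z. indicator {0..t} (fst z) * Z (fst z) (snd z))"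
  proof (rule Bochner_Integration.integrable_bound)
    show "integrable (lborel \<Otimes>\<^sub>M P) (\<lambda>z. indicator {0..t} (fst z) * (drift i (fst z) (snd z))\<^sup>2
        + (2 * (indicator {0..t} (fst z) * (Jc i t (snd z))\<^sup>2) + 2 * (indicator {0..t} (fst z) * (Jc i (fst z) (snd z))\<^sup>2)))"
      by (intro Bochner_Integration.integrable_add integrable_mult_right drift_joint_integrable Jtint Jc_joint_integrable i t)
    show "(\<lambda>z. indicator {0..t} (fst z) * Z (fst z) (snd z)) \<in> borel_measurable (lborel \<Otimes>\<^sub>M P)"
      by (rule cont_process_joint[OF Z t])
    have "\<bar>x * (y - w)\<bar> \<le> x\<^sup>2 + (2 * y\<^sup>2 + 2 * w\<^sup>2)" for x y w :: real
    proof -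
      have "\<bar>x * (y - w)\<bar> \<le> x\<^sup>2 + (y - w)\<^sup>2" by (rule abs_mult_le_squares)
      also have "(y - w)\<^sup>2 \<le> 2 * y\<^sup>2 + 2 * w\<^sup>2"
        using zero_le_power2[of "y + w"] by (simp add: power2_eq_square algebra_simps)
      finally show ?thesis by simp
    qed
    then show "AE z in lborel \<Otimes>\<^sub>M P. norm (indicator {0..t} (fst z) * Z (fst z) (snd z)) \<le>
        norm (indicator {0..t} (fst z) * (drift i (fst z) (snd z))\<^sup>2
        + (2 * (indicator {0..t} (fst z) * (Jc i t (snd z))\<^sup>2) + 2 * (indicator {0..t} (fst z) * (Jc i (fst z) (snd z))\<^sup>2)))"
      by (intro AE_I2) (auto simp: Z_def indicator_def intro: order_trans[OF _ abs_ge_self])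
  qed
  show "integrable P (\<lambda>\<omega>. integral {0..t} (\<lambda>s. drift i s \<omega> * (Jc i t \<omega> - Jc i s \<omega>)))"
    using cont_process_fubini(1)[OF Z t int] by (simp add: Z_def)
  \<comment> \<open>Joint integrability yields a square integrable drift at almost every time, which
    is enough under the time integral.\<close>
  have "AE s in lborel. integrable P (\<lambda>\<omega>. indicator {0..t} s * (drift i s \<omega>)\<^sup>2)"
    using lborel_P.AE_integrable_fst'[OF drift_joint_integrable[OF i t]] by simp
  then have "AE s in lborel. indicator {0..t} s * expectation (Z s) = 0"
  proof eventually_elim
    case (elim s)
    show ?case
    proof (cases "s \<in> {0..t}")
      case True
      then have sT: "s \<in> {0..T}" "0 \<le> s" "s \<le> t" "t \<le> T" using t by auto
      have d2: "integrable P (\<lambda>\<omega>. (drift i s \<omega>)\<^sup>2)" using elim True by simp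
      have m: "drift i s \<in> borel_measurable P" "Jc i s \<in> borel_measurable P" "Jc i t \<in> borel_measurable P"
        using cont_processD(1)[OF drift_process(1)[OF i] sT(1)] cont_processD(1)[OF Jc_process[OF i] sT(1)]
          cont_processD(1)[OF Jc_process[OF i] t] by auto
      have "expectation (Z s) = expectation (\<lambda>\<omega>. drift i s \<omega> * Jc i t \<omega>) - expectation (\<lambda>\<omega>. drift i s \<omega> * Jc i s \<omega>)"
        unfolding Z_def right_diff_distrib
        by (intro Bochner_Integration.integral_diff integral_CS(1) m d2 Jc_moments(1)[OF i] t sT)
      also have "\<dots> = 0"
        using Jc_martingale[OF i sT(2-4) drift_process(2)[OF i sT(1)] d2] by simp
      finally show ?thesis by simp
    qed simp
  qed
  then have "(\<integral>s. indicator {0..t} s * expectation (Z s) \<partial>lborel) = 0"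
    by (rule integral_eq_zero_AE)
  then have "expectation (\<lambda>\<omega>. integral {0..t} (\<lambda>s. Z s \<omega>)) = 0"
    using cont_process_fubini(2)[OF Z t int] by simp
  then show "expectation (\<lambda>\<omega>. integral {0..t} (\<lambda>s. drift i s \<omega> * (Jc i t \<omega> - Jc i s \<omega>))) = 0"
    by (simp only: Z_def)
qed

end

section \<open>The energy along a path and its expectation\<close>

context ipdg
begin

definition G :: "(real \<Rightarrow> real) \<Rightarrow> real" where
  "G u = (\<integral>x. ft (u x) \<partial>dom_measure a b)"

lemma ft_continuous: "continuous_on UNIV ft"
  using ft by (intro continuous_at_imp_continuous_on) (auto intro: DERIV_isCont)

lemma ft_integrable:
  assumes u: "u \<in> L2 a b"
  shows "integrable (dom_measure a b) (\<lambda>x. ft (u x))"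
proof -
  obtain L where L: "\<And>x y. \<bar>f x - f y\<bar> \<le> L * \<bar>x - y\<bar>" using f_lipschitz by blast
  show ?thesis
  proof (rule Bochner_Integration.integrable_bound)
    show "integrable (dom_measure a b) (\<lambda>x. \<bar>ft 0\<bar> + \<bar>f 0\<bar> * \<bar>u x\<bar> + L * (u x)\<^sup>2)"
      using L2_integrable[OF u] L2_integrable[OF L2_const, of a b "\<bar>ft 0\<bar>"] L2_square_integrable[OF u] by simp
    show "(\<lambda>x. ft (u x)) \<in> borel_measurable (dom_measure a b)"
      using borel_measurable_continuous_onI[OF ft_continuous] L2_measurable[OF u] by measurable
    have "\<bar>ft x\<bar> \<le> \<bar>ft 0\<bar> + \<bar>f 0\<bar> * \<bar>x\<bar> + L * x\<^sup>2" for x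
      using taylor_lipschitz[OF ft L, of x 0] by (simp add: abs_mult[symmetric])
    then show "AE x in dom_measure a b. norm (ft (u x)) \<le> norm (\<bar>ft 0\<bar> + \<bar>f 0\<bar> * \<bar>u x\<bar> + L * (u x)\<^sup>2)"
      by (intro AE_I2) (auto intro: order_trans[OF _ abs_ge_self])
  qed
qed

text \<open>The pointwise Taylor estimate is integrated over [a, b]: \<open>f(u)\<close> is the
  gradient of \<open>G\<close> in L2, with a quadratic remainder.\<close>

lemma G_taylor:
  assumes L: "\<And>x y. \<bar>f x - f y\<bar> \<le> L * \<bar>x - y\<bar>" and u: "u \<in> L2 a b" and v: "v \<in> L2 a b"
  shows "\<bar>G v - G u - inn (\<lambda>x. f (u x)) (\<lambda>x. v x - u x)\<bar> \<le> L * (nrm (\<lambda>x. v x - u x))\<^sup>2"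
proof -
  let ?r = "\<lambda>x. ft (v x) - ft (u x) - f (u x) * (v x - u x)"
  have fi: "integrable (dom_measure a b) (\<lambda>x. f (u x) * (v x - u x))"
    by (intro L2_mult_integrable f_L2 L2_diff u v)
  have d: "integrable (dom_measure a b) (\<lambda>x. (v x - u x)\<^sup>2)"
    by (rule L2_square_integrable[OF L2_diff[OF v u]])
  have "G v - G u - inn (\<lambda>x. f (u x)) (\<lambda>x. v x - u x) = (\<integral>x. ?r x \<partial>dom_measure a b)"
    unfolding G_def L2_inner_def using ft_integrable[OF u] ft_integrable[OF v] fi by simp
  also have "\<bar>\<dots>\<bar> \<le> (\<integral>x. \<bar>?r x\<bar> \<partial>dom_measure a b)" by (rule integral_abs_bound)
  also have "\<dots> \<le> (\<integral>x. L * (v x - u x)\<^sup>2 \<partial>dom_measure a b)"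
    using ft_integrable[OF u] ft_integrable[OF v] fi d taylor_lipschitz[OF ft L]
    by (intro integral_mono) auto
  also have "\<dots> = L * (nrm (\<lambda>x. v x - u x))\<^sup>2"
    unfolding L2_norm_sq L2_inner_def by (simp add: power2_eq_square)
  finally show ?thesis .
qed

lemma G_measurable: "G \<in> borel_measurable (L2_borel a b)"
proof (rule measurable_L2_borel_continuous)
  fix u and \<epsilon> :: real assume u: "u \<in> L2 a b" and \<epsilon>: "\<epsilon> > 0"
  obtain L where L0: "L \<ge> 0" and L: "\<And>x y. \<bar>f x - f y\<bar> \<le> L * \<bar>x - y\<bar>" using f_lipschitz by blast
  \<comment> \<open>Within distance 1 the squared distance is at most the distance, so the local
    slope is the norm of \<open>f(u)\<close> plus \<open>L\<close>; the added 1 makes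
    \<open>C\<close> positive.\<close>
  define C where "C = nrm (\<lambda>x. f (u x)) + L + 1"
  have C: "C > 0" using L0 L2_norm_nonneg[of a b "\<lambda>x. f (u x)"] unfolding C_def by linarith
  show "\<exists>r>0. \<forall>v\<in>L2 a b. nrm (\<lambda>x. u x - v x) < r \<longrightarrow> \<bar>G u - G v\<bar> < \<epsilon>"
  proof (intro exI[of _ "min 1 (\<epsilon> / C)"] conjI ballI impI)
    show "0 < min 1 (\<epsilon> / C)" using \<epsilon> C by simp
    fix v assume v: "v \<in> L2 a b" and lt: "nrm (\<lambda>x. u x - v x) < min 1 (\<epsilon> / C)"
    define d where "d = nrm (\<lambda>x. v x - u x)"
    have d: "0 \<le> d" "d < 1" "d * C < \<epsilon>" using lt C L2_norm_minus_commute[of a b u v]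
      by (auto simp: d_def pos_less_divide_eq)
    have "\<bar>inn (\<lambda>x. f (u x)) (\<lambda>x. v x - u x)\<bar> \<le> nrm (\<lambda>x. f (u x)) * d"
      unfolding d_def by (intro L2_inner_CS f_L2 L2_diff u v)
    then have "\<bar>G u - G v\<bar> \<le> nrm (\<lambda>x. f (u x)) * d + L * d\<^sup>2"
      using G_taylor[OF L u v] unfolding d_def by linarith
    also have "L * d\<^sup>2 \<le> L * d" using d L0 by (intro mult_left_mono) (auto simp: power2_eq_square mult_left_le)
    also have "nrm (\<lambda>x. f (u x)) * d + L * d \<le> d * C" using d by (simp add: C_def algebra_simps)
    also have "\<dots> < \<epsilon>" by (rule d(3))
    finally show "\<bar>G u - G v\<bar> < \<epsilon>" by simp
  qed
qed

text \<open>The energy without its kinetic part, with \<open>B_h(U,U)\<close> written in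
  coordinates.\<close>

definition pot :: "real \<Rightarrow> 'w \<Rightarrow> real" where
  "pot t \<omega> = G (U t \<omega>) - 1/2 * (\<Sum>i<N. \<Sum>j<N. Uc i t \<omega> * Uc j t \<omega> * Bc i j)"

lemma pot_measurable: 
  assumes t: "t \<in> {0..T}" shows "pot t \<in> borel_measurable P"
proof -
  have "(\<lambda>\<omega>. G (U t \<omega>)) \<in> borel_measurable P"
    by (rule measurable_F[OF t process_measurable[OF U G_measurable t]])
  moreover have "Uc i t \<in> borel_measurable P" if "i < N" for i
    by (rule cont_processD(1)[OF Uc_process(1)[OF that] t])
  ultimately show ?thesis unfolding pot_def[abs_def] by (intro borel_measurable_diff borel_measurable_times
      borel_measurable_sum borel_measurable_const) auto
qed

text \<open>\<open>U\<close> is differentiable in time with derivative \<open>V\<close>. The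
  gradient of the potential energy is \<open>f(U)\<close> minus the discrete Laplacian of
  \<open>U\<close>, that is, minus the drift, so the noise does not enter this part.\<close>

lemma pot_path:
  "AE \<omega> in P. \<forall>t\<in>{0..T}. pot t \<omega> = pot 0 \<omega> - integral {0..t} (\<lambda>s. \<Sum>i<N. drift i s \<omega> * Vc i s \<omega>)"
proof -
  obtain L where L: "\<And>x y. \<bar>f x - f y\<bar> \<le> L * \<bar>x - y\<bar>" using f_lipschitz by blast
  have "AE \<omega> in P. \<omega> \<in> space P" by simp
  with U_eq show ?thesis
  proof eventually_elim
    case (elim \<omega>)
    have dU: "((\<lambda>t. Uc i t \<omega>) has_real_derivative Vc i t \<omega>) (at t within {0..T})" if i: "i < N" and t: "t \<in> {0..T}" for i t
    proof (rule has_field_derivative_transform_within[OF _ zero_less_one t])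
      show "Uc i 0 \<omega> + integral {0..s} (\<lambda>s. Vc i s \<omega>) = Uc i s \<omega>" if "s \<in> {0..T}" for s
        by (rule sym, rule elim(1)[rule_format]) (use i that in auto)
      show "((\<lambda>s. Uc i 0 \<omega> + integral {0..s} (\<lambda>s. Vc i s \<omega>)) has_real_derivative Vc i t \<omega>) (at t within {0..T})"
        using DERIV_add[OF DERIV_const integral_has_real_derivative[OF cont_processD(2)[OF Vc_process(1)[OF i] elim(2)] t]]
        by simp
    qed
    have dG: "((\<lambda>t. G (U t \<omega>)) has_real_derivative (\<Sum>i<N. fc i t \<omega> * Vc i t \<omega>)) (at t within {0..T})" if t: "t \<in> {0..T}" for t
    proof -
      \<comment> \<open>\<open>l\<close> is the linearization of \<open>G\<close> at
        \<open>U t\<close>, and \<open>h\<close> the quadratic remainder bound in coordinates; each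
        square in \<open>h\<close> has derivative zero at \<open>t\<close>.\<close>
      define l where "l s = (\<Sum>i<N. fc i t \<omega> * (Uc i s \<omega> - Uc i t \<omega>))" for s
      define h where "h s = L * (\<Sum>i<N. (Uc i s \<omega> - Uc i t \<omega>)\<^sup>2)" for s
      have dl: "(l has_real_derivative (\<Sum>i<N. fc i t \<omega> * Vc i t \<omega>)) (at t within {0..T})"
      proof -
        have "((\<lambda>s. fc i t \<omega> * (Uc i s \<omega> - Uc i t \<omega>)) has_real_derivative fc i t \<omega> * Vc i t \<omega>) (at t within {0..T})" if "i < N" for i
          using DERIV_cmult[OF DERIV_diff[OF dU[OF that t] DERIV_const], of "fc i t \<omega>"] by simp
        then show ?thesis unfolding l_def by (intro DERIV_sum) auto
      qed
      have dh: "(h has_real_derivative 0) (at t within {0..T})"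
      proof -
        have "((\<lambda>s. (Uc i s \<omega> - Uc i t \<omega>)\<^sup>2) has_real_derivative 0) (at t within {0..T})" if "i < N" for i
          using dU[OF that t] by (auto intro!: derivative_eq_intros)
        then have "((\<lambda>s. \<Sum>i<N. (Uc i s \<omega> - Uc i t \<omega>)\<^sup>2) has_real_derivative (\<Sum>i<N. 0)) (at t within {0..T})"
          by (intro DERIV_sum) auto
        from DERIV_cmult[OF this, of L] show ?thesis unfolding h_def by simp
      qed
      have "((\<lambda>s. G (U s \<omega>) - G (U t \<omega>) - l s) has_real_derivative 0) (at t within {0..T})"
      proof (rule has_derivative_zero_comparison[OF _ t _ dh])
        fix s assume s: "s \<in> {0..T}"
        have Us: "U s \<omega> \<in> Vh" "U t \<omega> \<in> Vh" using U_V_h s t elim(2) by auto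
        have Ud: "(\<lambda>x. U s \<omega> x - U t \<omega> x) \<in> Vh" by (rule V_h_diff[OF Us])
        have c: "inn (\<lambda>x. U s \<omega> x - U t \<omega> x) (\<phi> i) = Uc i s \<omega> - Uc i t \<omega>" if "i < N" for i
          using Us that by (simp add: Uc_def L2_inner_diff_left V_h_L2 \<phi>_L2)
        have "inn (\<lambda>x. f (U t \<omega> x)) (\<lambda>x. U s \<omega> x - U t \<omega> x) = l s"
          unfolding V_h_inner[OF f_L2[OF V_h_L2[OF Us(2)]] Ud] l_def by (simp add: c fc_def)
        moreover have "(nrm (\<lambda>x. U s \<omega> x - U t \<omega> x))\<^sup>2 = (\<Sum>i<N. (Uc i s \<omega> - Uc i t \<omega>)\<^sup>2)"
          unfolding V_h_norm_sq[OF Ud] by (simp add: c)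
        ultimately show "\<bar>G (U s \<omega>) - G (U t \<omega>) - l s\<bar> \<le> h s"
          using G_taylor[OF L V_h_L2[OF Us(2)] V_h_L2[OF Us(1)]] by (simp add: h_def)
      qed (simp add: h_def)
      from DERIV_add[OF DERIV_add[OF this dl] DERIV_const[of "G (U t \<omega>)"]] show ?thesis by simp
    qed
    have dpot: "((\<lambda>t. pot t \<omega>) has_real_derivative - (\<Sum>i<N. drift i t \<omega> * Vc i t \<omega>)) (at t within {0..T})" if t: "t \<in> {0..T}" for t
    proof -
      have "((\<lambda>t. \<Sum>i<N. \<Sum>j<N. Uc i t \<omega> * Uc j t \<omega> * Bc i j) has_real_derivative
          (\<Sum>i<N. \<Sum>j<N. (Uc i t \<omega> * Vc j t \<omega> + Vc i t \<omega> * Uc j t \<omega>) * Bc i j)) (at t within {0..T})"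
        by (intro DERIV_sum DERIV_cmult_right DERIV_mult' dU t) auto
      moreover have "(\<Sum>i<N. \<Sum>j<N. (Uc i t \<omega> * Vc j t \<omega> + Vc i t \<omega> * Uc j t \<omega>) * Bc i j)
        = 2 * (\<Sum>i<N. Vc i t \<omega> * (\<Sum>j<N. Uc j t \<omega> * Bc j i))"
      proof -
        \<comment> \<open>Symmetry of the form makes both halves of the product rule equal, and the
          resulting 2 cancels the 1/2 in \<open>pot\<close>.\<close>
        have B: "Bc i j = Bc j i" for i j unfolding Bc_def by (rule B_h_commute)
        have "(\<Sum>i<N. \<Sum>j<N. Uc i t \<omega> * Vc j t \<omega> * Bc i j) = (\<Sum>i<N. Vc i t \<omega> * (\<Sum>j<N. Uc j t \<omega> * Bc j i))"
          by (subst sum.swap) (simp add: sum_distrib_left ac_simps)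
        moreover have "(\<Sum>i<N. \<Sum>j<N. Vc i t \<omega> * Uc j t \<omega> * Bc i j) = (\<Sum>i<N. Vc i t \<omega> * (\<Sum>j<N. Uc j t \<omega> * Bc j i))"
          unfolding sum_distrib_left by (intro sum.cong refl) (simp add: B mult.assoc)
        ultimately show ?thesis by (simp add: distrib_right sum.distrib)
      qed
      ultimately have "((\<lambda>t. \<Sum>i<N. \<Sum>j<N. Uc i t \<omega> * Uc j t \<omega> * Bc i j) has_real_derivative
          2 * (\<Sum>i<N. Vc i t \<omega> * (\<Sum>j<N. Uc j t \<omega> * Bc j i))) (at t within {0..T})" by simp
      from DERIV_diff[OF dG[OF t] DERIV_cmult[OF this, of "1/2"]]
      have "((\<lambda>t. pot t \<omega>) has_real_derivative (\<Sum>i<N. fc i t \<omega> * Vc i t \<omega>)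
          - (\<Sum>i<N. Vc i t \<omega> * (\<Sum>j<N. Uc j t \<omega> * Bc j i))) (at t within {0..T})"
        unfolding pot_def by simp
      moreover have "(\<Sum>i<N. fc i t \<omega> * Vc i t \<omega>) - (\<Sum>i<N. Vc i t \<omega> * (\<Sum>j<N. Uc j t \<omega> * Bc j i))
        = - (\<Sum>i<N. drift i t \<omega> * Vc i t \<omega>)"
        unfolding drift_def sum_negf[symmetric] sum_subtractf[symmetric]
        by (intro sum.cong refl) (simp add: algebra_simps)
      ultimately show ?thesis by simp
    qed
    show ?case
    proof
      fix t assume t: "t \<in> {0..T}"
      have "((\<lambda>s. - (\<Sum>i<N. drift i s \<omega> * Vc i s \<omega>)) has_integral (pot t \<omega> - pot 0 \<omega>)) {0..t}"
      proof (rule fundamental_theorem_of_calculus)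
        show "0 \<le> t" using t by simp
        fix s assume "s \<in> {0..t}"
        then have "s \<in> {0..T}" "{0..t} \<subseteq> {0..T}" using t by auto
        then show "((\<lambda>s. pot s \<omega>) has_vector_derivative - (\<Sum>i<N. drift i s \<omega> * Vc i s \<omega>)) (at s within {0..t})"
          using dpot has_field_derivative_subset unfolding has_real_derivative_iff_has_vector_derivative[symmetric] by blast
      qed
      then have "integral {0..t} (\<lambda>s. - (\<Sum>i<N. drift i s \<omega> * Vc i s \<omega>)) = pot t \<omega> - pot 0 \<omega>"
        by (rule integral_unique)
      then show "pot t \<omega> = pot 0 \<omega> - integral {0..t} (\<lambda>s. \<Sum>i<N. drift i s \<omega> * Vc i s \<omega>)" by simp
    qed
  qed
qed

abbreviation "energy t \<omega> \<equiv> discrete_energy a b M k \<sigma> ft (U t \<omega>) (V t \<omega>)"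

lemma energy_eq:
  assumes t: "t \<in> {0..T}" and \<omega>: "\<omega> \<in> space P"
  shows "energy t \<omega> = 1/2 * (\<Sum>i<N. (Vc i t \<omega>)\<^sup>2) + pot t \<omega>"
proof -
  have u: "U t \<omega> \<in> Vh" and v: "V t \<omega> \<in> Vh" using U_V_h V_V_h t \<omega> by auto
  have "inn (V t \<omega>) (V t \<omega>) = (\<Sum>i<N. (Vc i t \<omega>)\<^sup>2)"
    using V_h_norm_sq[OF v] by (simp add: L2_norm_sq Vc_def)
  moreover have "inn (Delta_h a b M k \<sigma> (U t \<omega>)) (U t \<omega>) = (\<Sum>i<N. \<Sum>j<N. Uc i t \<omega> * Uc j t \<omega> * Bc i j)"
    unfolding Delta_h(2)[OF u u] B_h_coordinates[OF u u] by (simp add: Uc_def Bc_def)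
  moreover have "(\<integral>x. P_h a b M k (\<lambda>y. ft (U t \<omega> y)) x \<partial>dom_measure a b) = G (U t \<omega>)"
    unfolding G_def by (rule integral_P_h[OF continuous_V_h_L2[OF u ft_continuous]])
  ultimately show ?thesis by (simp add: discrete_energy_def pot_def)
qed

lemma energy_measurable:
  assumes t: "t \<in> {0..T}" shows "energy t \<in> borel_measurable P"
proof -
  have "Vc i t \<in> borel_measurable P" if "i < N" for i
    by (rule cont_processD(1)[OF Vc_process(1)[OF that] t])
  then have "(\<lambda>\<omega>. 1/2 * (\<Sum>i<N. (Vc i t \<omega>)\<^sup>2) + pot t \<omega>) \<in> borel_measurable P"
    using pot_measurable[OF t] by (intro borel_measurable_add borel_measurable_times borel_measurable_sum
        borel_measurable_power borel_measurable_const) auto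
  then show ?thesis using energy_eq[OF t] by (simp cong: measurable_cong)
qed

text \<open>Initial values are prescribed only up to null sets in space and in probability, while
  the coordinates and \<open>G\<close> depend on the class alone; so the initial energy is almost
  surely constant.\<close>

lemma energy_initial: "\<exists>E0. AE \<omega> in P. energy 0 \<omega> = E0"
proof -
  have 0: "0 \<in> {0..T}" using T by simp
  have "AE \<omega> in P. \<omega> \<in> space P" by simp
  with init init_eq have "AE \<omega> in P. energy 0 \<omega> = 1/2 * (\<Sum>i<N. (inn v0 (\<phi> i))\<^sup>2) +
      (G u0 - 1/2 * (\<Sum>i<N. \<Sum>j<N. inn u0 (\<phi> i) * inn u0 (\<phi> j) * Bc i j))"
  proof eventually_elim
    case (elim \<omega>)
    have "G (U 0 \<omega>) = G u0" unfolding G_def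
    proof (rule integral_cong_AE)
      show "(\<lambda>x. ft (U 0 \<omega> x)) \<in> borel_measurable (dom_measure a b)" "(\<lambda>x. ft (u0 x)) \<in> borel_measurable (dom_measure a b)"
        using L2_measurable[OF continuous_V_h_L2[OF _ ft_continuous]] U_V_h[OF 0 elim(3)] u0 by auto
      show "AE x in dom_measure a b. ft (U 0 \<omega> x) = ft (u0 x)"
        using elim(1) unfolding L2_eq_def by (auto elim: eventually_mono)
    qed
    then show ?case using elim(2) by (simp add: energy_eq[OF 0 elim(3)] pot_def)
  qed
  then show ?thesis by blast
qed

lemma energy_path:
  assumes t: "t \<in> {0..T}"
  shows "AE \<omega> in P. energy t \<omega> = energy 0 \<omega> + (\<Sum>i<N. integral {0..t} (\<lambda>s. drift i s \<omega> * (Jc i t \<omega> - Jc i s \<omega>))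
    + inn v0 (\<phi> i) * Jc i t \<omega> + 1/2 * (Jc i t \<omega>)\<^sup>2)"
proof -
  have 0: "0 \<in> {0..T}" using T by simp
  have "AE \<omega> in P. \<omega> \<in> space P" by simp
  with pot_path init_eq show ?thesis
  proof eventually_elim
    case (elim \<omega>)
    have c: "continuous_on {0..t} (\<lambda>s. drift i s \<omega>)" "continuous_on {0..t} (\<lambda>s. Vc i s \<omega>)" if "i < N" for i
      using cont_process_on[OF _ elim(3) t] drift_process(1)[OF that] Vc_process(1)[OF that] by auto
    have "integral {0..t} (\<lambda>s. \<Sum>i<N. drift i s \<omega> * Vc i s \<omega>) = (\<Sum>i<N. integral {0..t} (\<lambda>s. drift i s \<omega> * Vc i s \<omega>))"
      by (rule Henstock_Kurzweil_Integration.integral_sum) (auto intro!: integrable_continuous_real continuous_intros c)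
    then have "energy t \<omega> - energy 0 \<omega> = (\<Sum>i<N. 1/2 * (Vc i t \<omega>)\<^sup>2 - 1/2 * (Vc i 0 \<omega>)\<^sup>2 - integral {0..t} (\<lambda>s. drift i s \<omega> * Vc i s \<omega>))"
      using elim(1)[rule_format, OF t] energy_eq[OF t elim(3)] energy_eq[OF 0 elim(3)]
      by (simp only: sum_subtractf sum_distrib_left)
    also have "\<dots> = (\<Sum>i<N. integral {0..t} (\<lambda>s. drift i s \<omega> * (Jc i t \<omega> - Jc i s \<omega>))
        + inn v0 (\<phi> i) * Jc i t \<omega> + 1/2 * (Jc i t \<omega>)\<^sup>2)"
    proof (intro sum.cong refl)
      fix i assume "i \<in> {..<N}"
      then have i: "i < N" by simp
      have "(Vc i t \<omega>)\<^sup>2 = (Vc i 0 \<omega>)\<^sup>2 + 2 * integral {0..t} (\<lambda>s. drift i s \<omega> * Vc i s \<omega>)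
        + 2 * integral {0..t} (\<lambda>s. drift i s \<omega> * (Jc i t \<omega> - Jc i s \<omega>)) + 2 * Vc i 0 \<omega> * Jc i t \<omega> + (Jc i t \<omega>)\<^sup>2"
        using t by (intro square_of_semimartingale_path[OF _ c[OF i]] V_eq) auto
      \<comment> \<open>The initial coordinate is replaced by the deterministic <v0,
        \<open>\<phi> i\<close>>, so the term linear in \<open>Jc\<close> is a constant multiple of
        it.\<close>
      then show "1/2 * (Vc i t \<omega>)\<^sup>2 - 1/2 * (Vc i 0 \<omega>)\<^sup>2 - integral {0..t} (\<lambda>s. drift i s \<omega> * Vc i s \<omega>)
        = integral {0..t} (\<lambda>s. drift i s \<omega> * (Jc i t \<omega> - Jc i s \<omega>)) + inn v0 (\<phi> i) * Jc i t \<omega> + 1/2 * (Jc i t \<omega>)\<^sup>2"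
        using elim(2) i by (simp add: field_simps)
    qed
    finally show ?case by simp
  qed
qed

lemma energy_expectation:
  assumes t: "t \<in> {0..T}"
  shows "integrable P (energy t)"
    "expectation (energy t) = expectation (energy 0) + 1/2 * (\<Sum>i<N. expectation (\<lambda>\<omega>. (Jc i t \<omega>)\<^sup>2))"
proof -
  have 0: "0 \<in> {0..T}" using T by simp
  obtain E0 where E0: "AE \<omega> in P. energy 0 \<omega> = E0" using energy_initial by blast
  have e0: "expectation (energy 0) = E0"
    using integral_cong_AE[OF energy_measurable[OF 0] borel_measurable_const E0] by (simp add: prob_space)
  define X where "X i \<omega> = integral {0..t} (\<lambda>s. drift i s \<omega> * (Jc i t \<omega> - Jc i s \<omega>)) + inn v0 (\<phi> i) * Jc i t \<omega> + 1/2 * (Jc i t \<omega>)\<^sup>2" for i \<omega>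
  have Jint: "integrable P (Jc i t)" if "i < N" for i
    by (rule square_integrable_imp_integrable[OF cont_processD(1)[OF Jc_process[OF that] t] Jc_moments(1)[OF that t]])
  have J0: "expectation (Jc i t) = 0" if "i < N" for i
  proof -
    \<comment> \<open>Testing the martingale property against the constant 1 compares
      \<open>Jc\<close> with its value at time 0.\<close>
    have "Jc i 0 = (\<lambda>\<omega>. 0)" by (auto simp: Jc_def)
    then show ?thesis using Jc_martingale[OF that, of 0 t "\<lambda>_. 1"] t by simp
  qed
  have Xint: "integrable P (X i)" if "i < N" for i
    using martingale_term(1)[OF that t] Jint[OF that] Jc_moments(1)[OF that t] unfolding X_def by simp
  have XE: "expectation (X i) = 1/2 * expectation (\<lambda>\<omega>. (Jc i t \<omega>)\<^sup>2)" if "i < N" for i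
    using martingale_term[OF that t] Jint[OF that] Jc_moments(1)[OF that t] J0[OF that] unfolding X_def by simp
  have RI: "integrable P (\<lambda>\<omega>. E0 + (\<Sum>i<N. X i \<omega>))"
    using Xint by (intro Bochner_Integration.integrable_add Bochner_Integration.integrable_sum) auto
  have eq: "AE \<omega> in P. energy t \<omega> = E0 + (\<Sum>i<N. X i \<omega>)"
    using energy_path[OF t] E0 by eventually_elim (simp add: X_def)
  show "integrable P (energy t)"
    by (rule integrable_cong_AE_imp[OF RI energy_measurable[OF t]]) (use eq in \<open>auto elim: eventually_mono\<close>)
  have "expectation (energy t) = expectation (\<lambda>\<omega>. E0 + (\<Sum>i<N. X i \<omega>))"
    by (rule integral_cong_AE[OF energy_measurable[OF t] borel_measurable_integrable[OF RI] eq])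
  also have "\<dots> = E0 + (\<Sum>i<N. expectation (X i))"
  proof -
    have "expectation (\<lambda>\<omega>. \<Sum>i<N. X i \<omega>) = (\<Sum>i<N. expectation (X i))"
      by (rule Bochner_Integration.integral_sum) (simp add: Xint)
    moreover have "integrable P (\<lambda>\<omega>. \<Sum>i<N. X i \<omega>)"
      by (rule Bochner_Integration.integrable_sum) (simp add: Xint)
    ultimately show ?thesis by (simp add: prob_space)
  qed
  also have "(\<Sum>i<N. expectation (X i)) = 1/2 * (\<Sum>i<N. expectation (\<lambda>\<omega>. (Jc i t \<omega>)\<^sup>2))"
    unfolding sum_distrib_left by (rule sum.cong) (simp_all only: XE lessThan_iff)
  finally show "expectation (energy t) = expectation (energy 0) + 1/2 * (\<Sum>i<N. expectation (\<lambda>\<omega>. (Jc i t \<omega>)\<^sup>2))"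
    by (simp add: e0)
qed

end

section \<open>The trace of the projected diffusion\<close>

context ipdg
begin

lemma e_basis: "L2_orthonormal_basis a b e"
  using cov by (simp add: covariance_operator_def)

lemma R_bounded_linear: "L2_bounded_linear a b R"
  using sqrtR by (simp add: L2_sqrt_operator_def)

lemma R_L2: "u \<in> L2 a b \<Longrightarrow> R u \<in> L2 a b"
  using R_bounded_linear by (simp add: L2_bounded_linear_def)

lemma R_lincomb: "u \<in> L2 a b \<Longrightarrow> v \<in> L2 a b \<Longrightarrow>
    L2_eq a b (R (\<lambda>x. c * u x + d * v x)) (\<lambda>x. c * R u x + d * R v x)"
  using R_bounded_linear by (simp add: L2_bounded_linear_def)

lemma Q_L2: "u \<in> L2 a b \<Longrightarrow> Q u \<in> L2 a b"
  using cov by (simp add: covariance_operator_def L2_bounded_linear_def)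

lemma q_pos: "q j > 0"
proof -
  have ee: "inn (e j) (e j) = 1" using e_on by (simp add: L2_orthonormal_def)
  then have "\<not> L2_eq a b (e j) (\<lambda>x. 0)" using L2_inner_self_eq_0[OF e_L2[of j]] by simp
  then have "inn (Q (e j)) (e j) > 0"
    using cov e_L2 by (simp add: covariance_operator_def L2_positive_definite_def)
  moreover have "inn (Q (e j)) (e j) = inn (\<lambda>x. q j * e j x) (e j)"
    using cov by (intro L2_inner_cong Q_L2 L2_cmult e_L2) (auto simp: covariance_operator_def)
  ultimately show ?thesis by (simp add: L2_inner_cmult_left ee)
qed

text \<open>With \<open>w = R e - sqrt q e\<close> one has \<open>R w = - sqrt q w\<close>, so nonnegativity of \<open>R\<close> forces \<open>w = 0\<close>.\<close>

lemma R_e: "L2_eq a b (R (e j)) (bas j)"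
proof -
  define s where "s = sqrt (q j)"
  have s: "s > 0" "s * s = q j" using q_pos[of j] by (auto simp: s_def)
  define w where "w = (\<lambda>x. 1 * R (e j) x + (- s) * e j x)"
  have w: "w \<in> L2 a b" unfolding w_def by (intro L2_lincomb R_L2 e_L2)
  have "L2_eq a b (R w) (\<lambda>x. 1 * R (R (e j)) x + (- s) * R (e j) x)"
    unfolding w_def by (intro R_lincomb R_L2 e_L2)
  moreover have "L2_eq a b (R (R (e j))) (\<lambda>x. q j * e j x)"
  proof (rule L2_eq_trans)
    show "L2_eq a b (R (R (e j))) (Q (e j))" using sqrtR e_L2 by (simp add: L2_sqrt_operator_def)
    show "L2_eq a b (Q (e j)) (\<lambda>x. q j * e j x)" using cov by (simp add: covariance_operator_def)
  qed
  ultimately have "L2_eq a b (R w) (\<lambda>x. (- s) * w x)"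
    unfolding L2_eq_def
  proof eventually_elim
    case (elim x)
    then show ?case using s(2) by (simp add: w_def algebra_simps)
  qed
  then have "inn (R w) w = - s * inn w w"
    using L2_inner_cong[OF _ L2_eq_refl R_L2[OF w] L2_cmult[OF w, of "- s"] w w] by (simp add: L2_inner_cmult_left[of a b "- s" w w, simplified])
  moreover have "inn (R w) w \<ge> 0" using sqrtR w by (simp add: L2_sqrt_operator_def)
  ultimately have "s * inn w w \<le> 0" by simp
  then have "inn w w \<le> 0" using s(1) by (simp add: mult_le_0_iff)
  then have "L2_eq a b w (\<lambda>x. 0)"
    using L2_inner_self_nonneg[of a b w] L2_inner_self_eq_0[OF w] by simp
  then show ?thesis unfolding L2_eq_def by (rule eventually_mono) (simp add: w_def s_def)
qed

lemma R_H0: "u \<in> L2 a b \<Longrightarrow> R u \<in> H0 a b R"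
  unfolding H0_def using R_L2 by (auto intro: bexI[of _ u])

lemma bas_H0: "bas j \<in> H0 a b R"
  unfolding H0_def using L2_eq_sym[OF R_e] e_L2 bas_L2 by blast

context
  fixes u assumes u: "u \<in> L2 a b"
begin

lemma gu: "g u \<in> L20 a b R q e"
  using g_lip u by (simp add: lipschitz_diffusion_def)

lemma g_L2: "v \<in> H0 a b R \<Longrightarrow> g u v \<in> L2 a b"
  using gu by (simp add: L20_def)

lemma g_lincomb: "v \<in> H0 a b R \<Longrightarrow> w \<in> H0 a b R \<Longrightarrow>
    L2_eq a b (g u (\<lambda>x. c * v x + d * w x)) (\<lambda>x. c * g u v x + d * g u w x)"
  using gu by (simp add: L20_def)

lemma g_bounded: "\<exists>C. \<forall>v\<in>L2 a b. \<forall>w\<in>L2 a b. L2_eq a b v (R w) \<longrightarrow> nrm (g u v) \<le> C * nrm w"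
  using gu by (simp add: L20_def)

lemma H0_L2: "v \<in> H0 a b R \<Longrightarrow> v \<in> L2 a b"
  by (simp add: H0_def)

text \<open>The boundedness clause of \<open>L20\<close> speaks of all representatives. The
  difference \<open>v - w\<close> represents \<open>R 0\<close>, so its image has norm at most a
  constant times 0.\<close>

lemma g_cong:
  assumes v: "v \<in> H0 a b R" and w: "w \<in> H0 a b R" and eq: "L2_eq a b v w"
  shows "L2_eq a b (g u v) (g u w)"
proof -
  let ?d = "\<lambda>x. 1 * v x + (-1) * w x"
  obtain C where C: "\<And>v w. v \<in> L2 a b \<Longrightarrow> w \<in> L2 a b \<Longrightarrow> L2_eq a b v (R w) \<Longrightarrow> nrm (g u v) \<le> C * nrm w"
    using g_bounded by blast
  have dL: "?d \<in> L2 a b" by (intro L2_lincomb H0_L2 v w)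
  have R0: "L2_eq a b (R (\<lambda>x. 0)) (\<lambda>x. 0)"
    using R_lincomb[of "\<lambda>x. 0" "\<lambda>x. 0" 0 0] by simp
  have d0: "L2_eq a b ?d (\<lambda>x. 0)"
    using eq unfolding L2_eq_def by (rule eventually_mono) simp
  have dR: "L2_eq a b ?d (R (\<lambda>x. 0))" by (rule L2_eq_trans[OF d0 L2_eq_sym[OF R0]])
  have dH: "?d \<in> H0 a b R" using dL dR L2_const[of 0 a b] unfolding H0_def by blast
  have "nrm (g u ?d) \<le> 0" using C[OF dL L2_const dR] by simp
  then have "nrm (g u ?d) = 0" using L2_norm_nonneg[of a b "g u ?d"] by linarith
  then have "L2_eq a b (g u ?d) (\<lambda>x. 0)" using L2_norm_eq_0[OF g_L2[OF dH]] by blast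
  with g_lincomb[OF v w, of 1 "-1"] show ?thesis unfolding L2_eq_def by eventually_elim simp
qed

text \<open>This gives the adjoint in the trace its meaning. \<open>R\<close> is linear only up to
  null sets, so linearity has to pass through the congruences of \<open>g u\<close> and
  \<open>P_h\<close>.\<close>

lemma diffusion_bounded_linear: "L2_bounded_linear a b (\<lambda>v. P_h a b M k (g u (R v)))"
  unfolding L2_bounded_linear_def
proof (intro conjI ballI allI)
  fix v assume v: "v \<in> L2 a b"
  show "P_h a b M k (g u (R v)) \<in> L2 a b" by (intro V_h_L2 P_h g_L2 R_H0 v)
next
  fix v w c d assume v: "v \<in> L2 a b" and w: "w \<in> L2 a b"
  have lH: "(\<lambda>x. c * R v x + d * R w x) \<in> H0 a b R"
    unfolding H0_def using L2_eq_sym[OF R_lincomb[OF v w, of c d]] L2_lincomb[OF v w, of c d]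
      L2_lincomb[OF R_L2[OF v] R_L2[OF w], of c d] by blast
  note vw = g_L2[OF R_H0[OF v]] g_L2[OF R_H0[OF w]]
  have "L2_eq a b (g u (R (\<lambda>x. c * v x + d * w x))) (g u (\<lambda>x. c * R v x + d * R w x))"
    by (rule g_cong[OF R_H0[OF L2_lincomb[OF v w]] lH R_lincomb[OF v w]])
  from L2_eq_trans[OF this g_lincomb[OF R_H0[OF v] R_H0[OF w]]]
  have "L2_eq a b (P_h a b M k (g u (R (\<lambda>x. c * v x + d * w x)))) (P_h a b M k (\<lambda>x. c * g u (R v) x + d * g u (R w) x))"
    by (rule P_h_cong[OF g_L2[OF R_H0[OF L2_lincomb[OF v w]]] L2_lincomb[OF vw]])
  from L2_eq_trans[OF this P_h_lincomb[OF vw]]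
  show "L2_eq a b (P_h a b M k (g u (R (\<lambda>x. c * v x + d * w x)))) (\<lambda>x. c * P_h a b M k (g u (R v)) x + d * P_h a b M k (g u (R w)) x)" .
next
  obtain C where C: "\<And>v w. v \<in> L2 a b \<Longrightarrow> w \<in> L2 a b \<Longrightarrow> L2_eq a b v (R w) \<Longrightarrow> nrm (g u v) \<le> C * nrm w"
    using g_bounded by blast
  show "\<exists>C. \<forall>v\<in>L2 a b. nrm (P_h a b M k (g u (R v))) \<le> C * nrm v"
    using C[OF R_L2 _ L2_eq_refl] order_trans[OF P_h_norm_le[OF g_L2[OF R_H0]]] by blast
qed

text \<open>Since \<open>R\<close> sends \<open>e j\<close> to \<open>bas j\<close>, the trace of an
  operator times its adjoint is the squared Hilbert-Schmidt norm of the projected diffusion on the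
  basis of \<open>H0\<close>; it is finite because \<open>P_h\<close> does not increase
  norms.\<close>

lemma diffusion_trace:
  "summable (\<lambda>j. (nrm (P_h a b M k (g u (bas j))))\<^sup>2)"
  "L2_trace a b e (\<lambda>v. P_h a b M k (g u (R (L2_adjoint a b (\<lambda>v. P_h a b M k (g u (R v))) v))))
    = (\<Sum>j. (nrm (P_h a b M k (g u (bas j))))\<^sup>2)"
proof -
  have "(\<Sum>j. ennreal ((nrm (P_h a b M k (g u (bas j))))\<^sup>2)) \<le> (\<Sum>j. ennreal ((nrm (g u (bas j)))\<^sup>2))"
    by (intro suminf_le ennreal_leI power_mono P_h_norm_le g_L2 bas_H0) auto
  also have "\<dots> < \<infinity>" using gu by (simp add: L20_def HS0_norm_sq_def)
  finally show sm: "summable (\<lambda>j. (nrm (P_h a b M k (g u (bas j))))\<^sup>2)"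
    by (intro summable_suminf_not_top) auto
  have eq: "nrm (P_h a b M k (g u (R (e j)))) = nrm (P_h a b M k (g u (bas j)))" for j
    by (intro L2_norm_cong P_h_cong g_cong R_H0 bas_H0 R_e g_L2 e_L2 V_h_L2 P_h)
  show "L2_trace a b e (\<lambda>v. P_h a b M k (g u (R (L2_adjoint a b (\<lambda>v. P_h a b M k (g u (R v))) v))))
    = (\<Sum>j. (nrm (P_h a b M k (g u (bas j))))\<^sup>2)"
    using L2_trace_adjoint[OF e_basis diffusion_bounded_linear] sm by (simp add: eq)
qed

end

definition trace_density :: "real \<Rightarrow> 'w \<Rightarrow> real" where
  "trace_density s \<omega> = L2_trace a b e (\<lambda>v. P_h a b M k (g (U s \<omega>)
     (R (L2_adjoint a b (\<lambda>v. P_h a b M k (g (U s \<omega>) (R v))) v))))"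

text \<open>\<open>trace_density\<close> involves chosen adjoints and an infinite real sum. On
  [0, t] it equals this double series of measurable nonnegative terms, from which its measurability
  and integral are read off; its integral is the sum of \<open>mass i t\<close> over the
  coordinates.\<close>

definition trace_sum :: "real \<Rightarrow> real \<times> 'w \<Rightarrow> ennreal" where
  "trace_sum t z = (\<Sum>i<N. \<Sum>l. ennreal ((indicator {0..t} (fst z) *
      inn (P_h a b M k (g (U (fst z) (snd z)) (bas l))) (\<phi> i))\<^sup>2))"

lemma trace_density_nonneg:
  assumes "s \<in> {0..T}" "\<omega> \<in> space P" shows "0 \<le> trace_density s \<omega>"
  unfolding trace_density_def diffusion_trace(2)[OF V_h_L2[OF U_V_h[OF assms]]]
  by (intro suminf_nonneg diffusion_trace(1)[OF V_h_L2[OF U_V_h[OF assms]]]) simp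

lemma trace_density_eq:
  assumes s: "s \<in> {0..t}" and t: "t \<in> {0..T}" and \<omega>: "\<omega> \<in> space P"
  shows "ennreal (trace_density s \<omega>) = trace_sum t (s, \<omega>)"
proof -
  have u: "U s \<omega> \<in> L2 a b" using s t by (intro V_h_L2 U_V_h \<omega>) auto
  let ?p = "\<lambda>l. P_h a b M k (g (U s \<omega>) (bas l))"
  have p: "?p l \<in> Vh" for l by (intro P_h g_L2 u bas_H0)
  have "ennreal (trace_density s \<omega>) = (\<Sum>l. ennreal ((nrm (?p l))\<^sup>2))"
    unfolding trace_density_def diffusion_trace(2)[OF u]
    by (intro suminf_ennreal2[symmetric] diffusion_trace(1)[OF u]) simp
  also have "\<dots> = (\<Sum>l. \<Sum>i<N. ennreal ((inn (?p l) (\<phi> i))\<^sup>2))"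
    \<comment> \<open>The projection lies in \<open>V_h\<close>, so its norm is a finite sum over
      the coordinates; this links the trace to the coordinatewise isometry.\<close>
    by (simp add: V_h_norm_sq[OF p])
  also have "\<dots> = (\<Sum>i<N. \<Sum>l. ennreal ((inn (?p l) (\<phi> i))\<^sup>2))" by (intro suminf_sum) simp
  finally show ?thesis using s by (simp add: trace_sum_def)
qed

lemma trace_sum_integral:
  assumes t: "t \<in> {0..T}"
  shows "trace_sum t \<in> borel_measurable (lborel \<Otimes>\<^sub>M P)"
    "(\<integral>\<^sup>+z. trace_sum t z \<partial>(lborel \<Otimes>\<^sub>M P)) = ennreal (\<Sum>i<N. expectation (\<lambda>\<omega>. (Jc i t \<omega>)\<^sup>2))"
proof -
  let ?f = "\<lambda>i l z. indicator {0..t} (fst z) * inn (P_h a b M k (g (U (fst z) (snd z)) (bas l))) (\<phi> i)"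
  have m: "?f i l \<in> borel_measurable (lborel \<Otimes>\<^sub>M P)" if i: "i < N" for i l
  proof -
    interpret SI: stoch_integral P F T a b q e \<beta> W R "\<lambda>s \<omega> v. P_h a b M k (g (U s \<omega>) v)" I "\<phi> i"
      by (rule SI[OF i])
    show ?thesis using SI.\<psi>_measurable[of t l] t by (simp add: SI.\<psi>_def case_prod_unfold)
  qed
  have m': "(\<lambda>z. ennreal ((?f i l z)\<^sup>2)) \<in> borel_measurable (lborel \<Otimes>\<^sub>M P)" if "i < N" for i l
    using m[OF that] by measurable
  have ms: "(\<lambda>z. \<Sum>l. ennreal ((?f i l z)\<^sup>2)) \<in> borel_measurable (lborel \<Otimes>\<^sub>M P)" if "i < N" for i
    using m'[OF that] by measurable
  show "trace_sum t \<in> borel_measurable (lborel \<Otimes>\<^sub>M P)"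
    unfolding trace_sum_def[abs_def] using ms by (intro borel_measurable_sum) simp
  have "(\<integral>\<^sup>+z. trace_sum t z \<partial>(lborel \<Otimes>\<^sub>M P)) = (\<Sum>i<N. \<integral>\<^sup>+z. (\<Sum>l. ennreal ((?f i l z)\<^sup>2)) \<partial>(lborel \<Otimes>\<^sub>M P))"
    unfolding trace_sum_def using ms by (intro nn_integral_sum) simp
  also have "\<dots> = (\<Sum>i<N. mass i t)"
    unfolding mass_def using m' by (intro sum.cong refl nn_integral_suminf) simp
  also have "\<dots> = (\<Sum>i<N. ennreal (expectation (\<lambda>\<omega>. (Jc i t \<omega>)\<^sup>2)))"
    using Jc_moments(2)[OF _ t] by (intro sum.cong) simp_all
  finally show "(\<integral>\<^sup>+z. trace_sum t z \<partial>(lborel \<Otimes>\<^sub>M P)) = ennreal (\<Sum>i<N. expectation (\<lambda>\<omega>. (Jc i t \<omega>)\<^sup>2))"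
    by simp
qed

lemma trace_density_joint:
  assumes t: "t \<in> {0..T}"
  shows "integrable (lborel \<Otimes>\<^sub>M P) (\<lambda>z. indicator {0..t} (fst z) * trace_density (fst z) (snd z))"
    "(\<integral>z. indicator {0..t} (fst z) * trace_density (fst z) (snd z) \<partial>(lborel \<Otimes>\<^sub>M P))
      = (\<Sum>i<N. expectation (\<lambda>\<omega>. (Jc i t \<omega>)\<^sup>2))"
proof -
  let ?L = "lborel \<Otimes>\<^sub>M P" and ?h = "\<lambda>z. indicator {0..t} (fst z) * trace_density (fst z) (snd z)"
  have nn: "0 \<le> ?h z" if "z \<in> space ?L" for z
    using that t trace_density_nonneg[of "fst z" "snd z"] by (auto simp: space_pair_measure indicator_def)
  have eq: "ennreal (?h z) = trace_sum t z" if z: "z \<in> space ?L" for z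
  proof (cases "fst z \<in> {0..t}")
    case True
    then show ?thesis using trace_density_eq[OF True t, of "snd z"] z by (auto simp: space_pair_measure)
  qed (simp add: trace_sum_def)
  have hm: "?h \<in> borel_measurable ?L"
  proof -
    have "(\<lambda>z. enn2real (trace_sum t z)) \<in> borel_measurable ?L"
      using trace_sum_integral(1)[OF t] by measurable
    moreover have "enn2real (trace_sum t z) = ?h z" if "z \<in> space ?L" for z
      using eq[OF that] nn[OF that] by (metis enn2real_ennreal)
    ultimately show ?thesis by (subst measurable_cong[symmetric])
  qed
  have ae: "AE z in ?L. 0 \<le> ?h z" using nn by (rule AE_I2)
  have S0: "0 \<le> (\<Sum>i<N. expectation (\<lambda>\<omega>. (Jc i t \<omega>)\<^sup>2))" by (intro sum_nonneg) simp
  have val: "(\<integral>\<^sup>+z. ennreal (?h z) \<partial>?L) = ennreal (\<Sum>i<N. expectation (\<lambda>\<omega>. (Jc i t \<omega>)\<^sup>2))"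
    unfolding trace_sum_integral(2)[OF t, symmetric] by (rule nn_integral_cong) (rule eq)
  show "integrable ?L ?h" by (rule integrableI_nonneg[OF hm ae]) (simp add: val)
  show "(\<integral>z. ?h z \<partial>?L) = (\<Sum>i<N. expectation (\<lambda>\<omega>. (Jc i t \<omega>)\<^sup>2))"
    using integral_eq_nn_integral[OF hm ae] S0 by (simp add: val)
qed

text \<open>The product with the restricted measure is compared with the full product: the inclusion
  map transports measurability, and dropping the restriction only increases the nonnegative
  integral.\<close>

lemma trace_density_integrable:
  assumes t: "t \<in> {0..T}"
  shows "integrable (restrict_space lborel {0..t} \<Otimes>\<^sub>M P) (\<lambda>(s, \<omega>). trace_density s \<omega>)"
proof (rule integrableI_nonneg)
  let ?L = "lborel \<Otimes>\<^sub>M P" and ?N = "restrict_space lborel {0..t} \<Otimes>\<^sub>M P"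
  have id: "(\<lambda>z. z) \<in> ?N \<rightarrow>\<^sub>M ?L"
  proof -
    have "(\<lambda>s. s) \<in> restrict_space lborel {0..t} \<rightarrow>\<^sub>M lborel"
      by (rule measurable_restrict_space1) simp
    from measurable_compose[OF measurable_fst this] have "(\<lambda>z. fst z) \<in> ?N \<rightarrow>\<^sub>M lborel" .
    then have "(\<lambda>z. (fst z, snd z)) \<in> ?N \<rightarrow>\<^sub>M ?L" by (intro measurable_Pair measurable_snd)
    then show ?thesis by simp
  qed
  have sp: "fst z \<in> {0..t}" "snd z \<in> space P" if "z \<in> space ?N" for z
    using that by (auto simp: space_pair_measure space_restrict_space)
  have "(\<lambda>z. indicator {0..t} (fst z) * trace_density (fst z) (snd z)) \<in> borel_measurable ?N"
    using measurable_compose[OF id borel_measurable_integrable[OF trace_density_joint(1)[OF t]]] .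
  then show m: "(\<lambda>(s, \<omega>). trace_density s \<omega>) \<in> borel_measurable ?N"
    using sp(1) by (subst measurable_cong[where g="\<lambda>z. indicator {0..t} (fst z) * trace_density (fst z) (snd z)"]) (auto simp: case_prod_unfold)
  show "AE z in ?N. 0 \<le> (case z of (s, \<omega>) \<Rightarrow> trace_density s \<omega>)"
  proof (rule AE_I2)
    fix z assume z: "z \<in> space ?N"
    then have "fst z \<in> {0..T}" using sp(1)[OF z] t by simp
    from trace_density_nonneg[OF this sp(2)[OF z]] show "0 \<le> (case z of (s, \<omega>) \<Rightarrow> trace_density s \<omega>)"
      by (simp add: case_prod_unfold)
  qed
  have "(\<integral>\<^sup>+z. ennreal (case z of (s, \<omega>) \<Rightarrow> trace_density s \<omega>) \<partial>?N) = (\<integral>\<^sup>+z. trace_sum t z \<partial>?N)"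
  proof (rule nn_integral_cong)
    fix z assume "z \<in> space ?N"
    from trace_density_eq[OF sp(1)[OF this] t sp(2)[OF this]]
    show "ennreal (case z of (s, \<omega>) \<Rightarrow> trace_density s \<omega>) = trace_sum t z" by (simp add: case_prod_unfold)
  qed
  also have "\<dots> = (\<integral>\<^sup>+s. \<integral>\<^sup>+\<omega>. trace_sum t (s, \<omega>) \<partial>P \<partial>restrict_space lborel {0..t})"
    by (rule nn_integral_fst[symmetric]) (rule measurable_compose[OF id trace_sum_integral(1)[OF t]])
  also have "\<dots> \<le> (\<integral>\<^sup>+s. \<integral>\<^sup>+\<omega>. trace_sum t (s, \<omega>) \<partial>P \<partial>lborel)"
    by (subst nn_integral_restrict_space) (auto intro!: nn_integral_mono simp: indicator_def)
  also have "\<dots> = (\<integral>\<^sup>+z. trace_sum t z \<partial>?L)" by (rule nn_integral_fst) (rule trace_sum_integral(1)[OF t])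
  also have "\<dots> < \<infinity>" by (simp add: trace_sum_integral(2)[OF t])
  finally show "(\<integral>\<^sup>+z. ennreal (case z of (s, \<omega>) \<Rightarrow> trace_density s \<omega>) \<partial>?N) < \<infinity>" .
qed

lemma trace_density_expectation:
  assumes t: "t \<in> {0..T}"
  shows "expectation (\<lambda>\<omega>. LINT s:{0..t}|lborel. trace_density s \<omega>) = (\<Sum>i<N. expectation (\<lambda>\<omega>. (Jc i t \<omega>)\<^sup>2))"
proof -
  have int: "integrable (lborel \<Otimes>\<^sub>M P) (\<lambda>(s, \<omega>). indicator {0..t} s * trace_density s \<omega>)"
    using trace_density_joint(1)[OF t] by (simp add: case_prod_unfold)
  have "expectation (\<lambda>\<omega>. LINT s:{0..t}|lborel. trace_density s \<omega>)
    = (\<integral>\<omega>. \<integral>s. indicator {0..t} s * trace_density s \<omega> \<partial>lborel \<partial>P)"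
    by (simp add: set_lebesgue_integral_def)
  also have "\<dots> = (\<integral>z. indicator {0..t} (fst z) * trace_density (fst z) (snd z) \<partial>(lborel \<Otimes>\<^sub>M P))"
    using lborel_P.integral_snd[OF int] by (simp add: case_prod_unfold)
  finally show ?thesis by (simp add: trace_density_joint(2)[OF t])
qed

lemma energy_evolution:
  assumes t: "t \<in> {0..T}"
  shows "expectation (energy t) = expectation (energy 0)
    + 1/2 * expectation (\<lambda>\<omega>. LINT s:{0..t}|lborel. trace_density s \<omega>)"
  unfolding energy_expectation(2)[OF t] trace_density_expectation[OF t] ..

end

theorem theorem2p3:
  fixes P :: "'w measure" and F :: "real \<Rightarrow> 'w measure"
    and a b T \<sigma> :: real and M k :: nat
    and Q R :: "(real \<Rightarrow> real) \<Rightarrow> (real \<Rightarrow> real)"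
    and q :: "nat \<Rightarrow> real" and e :: "nat \<Rightarrow> real \<Rightarrow> real"
    and \<beta> :: "nat \<Rightarrow> real \<Rightarrow> 'w \<Rightarrow> real" and W :: "real \<Rightarrow> 'w \<Rightarrow> real \<Rightarrow> real"
    and f ft :: "real \<Rightarrow> real" and g :: "(real \<Rightarrow> real) \<Rightarrow> (real \<Rightarrow> real) \<Rightarrow> (real \<Rightarrow> real)"
    and u0 v0 :: "real \<Rightarrow> real" and U V :: "real \<Rightarrow> 'w \<Rightarrow> real \<Rightarrow> real"
  assumes "a < b" and "T > 0" and "M \<ge> 1" and "k \<ge> 1"
    and "prob_space P" and "normal_filtration P F T"
    and "covariance_operator a b Q q e" and "L2_sqrt_operator a b Q R"
    and "Q_wiener_process P F T a b q e \<beta> W"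
    and "lipschitz_nemytskii a b f" and "\<And>x. (ft has_real_derivative f x) (at x)"
    and "lipschitz_diffusion a b R q e g"
    and "\<sigma> > 0" and "B_h_coercive a b M k \<sigma>"
    and "u0 \<in> V_h a b M k" and "v0 \<in> V_h a b M k"
    and "ipdg_solution P F T a b M k \<sigma> R q e W f g u0 v0 U V"
  defines "A \<equiv> \<lambda>s \<omega> v. P_h a b M k (g (U s \<omega>) (R v))"
  defines "Tr \<equiv> \<lambda>s \<omega>. L2_trace a b e (\<lambda>v. A s \<omega> (L2_adjoint a b (A s \<omega>) v))"
  shows "\<forall>t\<in>{0..T}.
     integrable P (\<lambda>\<omega>. discrete_energy a b M k \<sigma> ft (U t \<omega>) (V t \<omega>)) \<and>
     integrable (restrict_space lborel {0..t} \<Otimes>\<^sub>M P) (\<lambda>(s, \<omega>). Tr s \<omega>) \<and>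
     prob_space.expectation P (\<lambda>\<omega>. discrete_energy a b M k \<sigma> ft (U t \<omega>) (V t \<omega>)) =
       prob_space.expectation P (\<lambda>\<omega>. discrete_energy a b M k \<sigma> ft (U 0 \<omega>) (V 0 \<omega>))
       + 1/2 * prob_space.expectation P (\<lambda>\<omega>. LINT s:{0..t}|lborel. Tr s \<omega>)"
proof -
  interpret mesh: dg_mesh a b M k using assms(1,3) by unfold_locales
  from mesh.V_h_orthonormal_basis obtain N \<phi> where N\<phi>: "L2_orthonormal a b {..<N} \<phi>"
    "\<And>i. i < N \<Longrightarrow> \<phi> i \<in> V_h a b M k"
    "\<And>w. w \<in> V_h a b M k \<Longrightarrow> L2_eq a b w (\<lambda>x. \<Sum>i<N. L2_inner a b w (\<phi> i) * \<phi> i x)" by blast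
  interpret basis: dg_basis a b M k N \<phi> by unfold_locales (fact N\<phi>)+
  interpret prob: prob_space P by fact
  have on: "L2_orthonormal a b UNIV e"
    using assms(7) by (intro orthonormal_basis_imp_orthonormal) (simp add: covariance_operator_def)
  interpret noise: Q_wiener P F T a b q e \<beta> W
    using assms(2,6,9) on by unfold_locales
  from assms(17) obtain I where I: "is_stochastic_integral P F T a b R q e W (\<lambda>s \<omega> v. P_h a b M k (g (U s \<omega>) v)) I"
    "\<forall>t\<in>{0..T}. AE \<omega> in P.
          L2_has_integral a b t
             (\<lambda>s x. Delta_h a b M k \<sigma> (U s \<omega>) x - P_h a b M k (\<lambda>y. f (U s \<omega> y)) x)
             (\<lambda>x. V t \<omega> x - V 0 \<omega> x - I t \<omega> x)"
    unfolding ipdg_solution_def by blast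
  interpret ipdg a b M k N \<phi> P F T q e \<beta> W \<sigma> Q R f ft g u0 v0 U V I
    using assms(7,8,10-12,15-17) I unfolding ipdg_solution_def by unfold_locales auto
  \<comment> \<open>The operator and trace of the statement unfold to the density already
    analysed.\<close>
  have Tr: "Tr = trace_density" by (intro ext) (simp add: Tr_def A_def trace_density_def)
  show ?thesis unfolding Tr
    using energy_expectation(1) trace_density_integrable energy_evolution by blast
qed

end
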